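(* Let $N$ be a Poisson random measure on $\mathcal{W}=\mathcal{J}\times\mathcal{Y}$, $\mathcal{J}=(0,\infty)$, with mean intensity $\nu(ds,dy)=\rho(ds|y)\,\eta(dy)$, let $\mu(dy)=\int_{\mathcal{J}}s\,N(ds,dy)$, and let $P_\mu(dy)=q(y,\mu)\,\mu(dy)$, where $q$ is a strictly positive measurable function such that $P_\mu$ is almost surely a probability measure on $\mathcal{Y}$. Let $\mathbf{Y}=(Y_1,\ldots,Y_n)$ be random elements of $\mathcal{Y}$ such that, given $P_\mu$ (that is, given $N$), $Y_1,\ldots,Y_n$ are i.i.d. with distribution $P_\mu$. Then the following hold. (i) The posterior distribution of $N|\mathbf{Y}$ is the conditional law, given $\mathbf{Y}$, of the random measure $N_n^*=N+\sum_{j=1}^{n(\mathbf{p})}\delta_{J_{j,n},Y_j^*}$, where in this representation the conditional law of $N$ given $(\mathbf{J},\mathbf{Y})$ is $$\pi^*(dN|\mathbf{J},\mathbf{Y})=[\phi_n(\mathbf{J},\mathbf{Y})]^{-1}\left[\prod_{j=1}^{n(\mathbf{p})}[q(Y_j^*,\mu_n^* )]^{e_j}\right]\mathcal{P}(dN|\nu),$$ and the distribution of $\mathbf{J}|\mathbf{Y}$ is $$\mathbb{P}(d\mathbf{J}|\mathbf{Y},\nu)\propto\phi_n(\mathbf{J},\mathbf{Y})\prod_{j=1}^{n(\mathbf{p})}J_{j,n}^{e_j}\,\rho(dJ_{j,n}|Y_j^* ).$$ The law of $\mu_n^*(dy)=\int_0^\infty s\,N_n^*(ds,dy)$ given $\mathbf{Y}$,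 determined by the law of $N_n^*|\mathbf{Y}$, is the posterior distribution of $\mu|\mathbf{Y}$. (ii) The posterior distribution of $P_\mu|\mathbf{Y}$ is the conditional distribution, given $\mathbf{Y}$, of the random probability measure $P_{\mu_n^*}(dy)=q(y,\mu_n^* )\,\mu_n^*(dy)$. (iii) The exchangeable marginal distribution of $\mathbf{Y}$ is $$\mathbb{P}(d\mathbf{Y}|\nu)=\left[\int_{\mathcal{J}^{n(\mathbf{p})}}\phi_n(\mathbf{s},\mathbf{Y})\prod_{j=1}^{n(\mathbf{p})}s_{j,n}^{e_j}\,\rho(ds_{j,n}|Y_j^* )\right]\prod_{j=1}^{n(\mathbf{p})}\eta(dY_j^* ).$$ The exchangeable partition probability function (EPPF) derived from the marginal distribution of $\mathbf{Y}$ is $$p(e_1,\ldots,e_{n(\mathbf{p})})=\int_{\mathcal{J}^{n(\mathbf{p})}\times\mathcal{Y}^{n(\mathbf{p})}}\phi_n(\mathbf{s},\mathbf{y})\prod_{j=1}^{n(\mathbf{p})}s_{j,n}^{e_j}\,\rho(ds_{j,n}|y_j^* )\,\eta(dy_j^* ).$$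
   Context: $\mathcal{Y}$ is a Polish space (with a fixed complete separable metric, which determines the bounded sets); $\eta$ is a sigma-finite nonatomic measure on $\mathcal{Y}$ and $\rho(ds|y)$ a (measurable in $y$) family of measures on $\mathcal{J}=(0,\infty)$ such that for each bounded Borel $B\subset\mathcal{Y}$, $\int_B\int_{\mathcal{J}}\min(s,1)\,\rho(ds|y)\,\eta(dy)<\infty$. $\mathcal{J}\times\mathcal{Y}$ carries a complete separable metric for which $\nu$ is finite on bounded sets, $\mathcal{M}$ is the space of boundedly finite measures on it, and $\mathcal{P}(dN|\nu)$ is the law on $\mathcal{M}$ of the Poisson random measure $N$ with mean intensity $\nu$. The random measure $\mu$ is boundedly finite on $\mathcal{Y}$, and $q=q(y,\mu)$ is a function of a point of $\mathcal{Y}$ and a boundedly finite measure on $\mathcal{Y}$. Partition notation: $\mathbf{Y}$ is identified with its distinct values $Y_1^*,\ldots,Y_{n(\mathbf{p})}^*$ and the partition $\mathbf{p}=\{C_1,\ldots,C_{n(\mathbf{p})}\}$ of $\{1,\ldots,n\}$ with cells $C_j=\{i:Y_i=Y_j^*\}$; $e_j=|C_j|$. The latent vector $\mathbf{J}=(J_1,\ldots,J_n)$ is defined by the augmentation: given $N$, the pairs $W_i=(J_i,Y_i)$, $i=1,\ldots,n$, are i.i.d. with distribution $\tilde P_\mu(ds,dy)=q(y,\mu)\,s\,N(ds,dy)$ on $\mathcal{J}\times\mathcal{Y}$. The distinct values of $(W_1,\ldots,W_n)$ are $W_j^*=(J_{j,n},Y_j^* )$, $j=1,\ldots,n(\mathbf{p})$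 (so $J_i=J_{j,n}$ for $i\in C_j$); $\mathbf{s}=(s_1,\ldots,s_n)$ and $(s_{1,n},\ldots,s_{n(\mathbf{p}),n})$ denote arguments for $\mathbf{J}$ and $(J_{j,n})$ respectively. Define $$\mu_n^*(dy)=\int_0^\infty s\,N_n^*(ds,dy)=\mu(dy)+\sum_{j=1}^{n(\mathbf{p})}J_{j,n}\,\delta_{Y_j^*}(dy),\qquad \phi_n(\mathbf{J},\mathbf{Y})=\int_{\mathcal{M}}\left[\prod_{j=1}^{n(\mathbf{p})}[q(Y_j^*,\mu_n^* )]^{e_j}\right]\mathcal{P}(dN|\nu).$$ A formula of the form $F(\mathbf{Y})\prod_{j=1}^{n(\mathbf{p})}\eta(dY_j^* )$ denotes the measure on $\mathcal{Y}^n$ whose integral of a nonnegative measurable $g$ is $\sum_{\mathbf{p}}\int_{\mathcal{Y}^{n(\mathbf{p})}}g(\mathbf{y})F(\mathbf{y})\prod_{j=1}^{n(\mathbf{p})}\eta(dy_j^* )$, the sum being over all partitions of $\{1,\ldots,n\}$ and $y_i=y_j^*$ for $i\in C_j$ in the term for $\mathbf{p}$. The EPPF is the probability that the partition of $\{1,\ldots,n\}$ induced by the ties among $Y_1,\ldots,Y_n$ equals $\mathbf{p}$. *)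

theory Defs
  imports "HOL-Probability.Probability" "HOL-Library.Disjoint_Sets"
begin

section \<open>Spaces of measures\<close>

text \<open>All measures on \<open>K\<close>, with the \<open>\<sigma>\<close>-algebra generated by the evaluations
  (as for \<^const>\<open>subprob_algebra\<close>). The laws of \<open>\<mu>\<close> and \<open>P\<^sub>\<mu>\<close> are laws on this space:
  they are boundedly finite, respectively probability measures, only almost surely.\<close>

definition measure_algebra :: "'a measure \<Rightarrow> 'a measure measure" where
  "measure_algebra K =
    (SUP A \<in> sets K. vimage_algebra {M. sets M = sets K} (\<lambda>M. emeasure M A) borel)"

definition boundedly_finite :: "'a measure \<Rightarrow> ('a set \<Rightarrow> bool) \<Rightarrow> 'a measure \<Rightarrow> bool" where
  "boundedly_finite K bdd M \<longleftrightarrow>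
     sets M = sets K \<and> (\<forall>B \<in> sets K. bdd B \<longrightarrow> emeasure M B < \<infinity>)"

definition boundedly_finite_measures ::
  "'a measure \<Rightarrow> ('a set \<Rightarrow> bool) \<Rightarrow> 'a measure measure" where
  "boundedly_finite_measures K bdd =
     restrict_space (measure_algebra K) {M. boundedly_finite K bdd M}"

definition nonatomic :: "'a measure \<Rightarrow> bool" where
  "nonatomic M \<longleftrightarrow>
     (\<forall>A \<in> sets M. 0 < emeasure M A \<longrightarrow>
        (\<exists>B \<in> sets M. B \<subseteq> A \<and> 0 < emeasure M B \<and> emeasure M B < emeasure M A))"

definition normalized :: "'a measure \<Rightarrow> 'a measure" where
  "normalized M = density M (\<lambda>_. 1 / emeasure M (space M))"


section \<open>Conditional distributions\<close>

definition regular_conditional_law ::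
  "'o measure \<Rightarrow> ('o \<Rightarrow> 'x) \<Rightarrow> 'x measure \<Rightarrow> ('o \<Rightarrow> 'z) \<Rightarrow> 'z measure \<Rightarrow> ('z \<Rightarrow> 'x measure) \<Rightarrow> bool"
where
  "regular_conditional_law \<Omega> X MX Z MZ \<kappa> \<longleftrightarrow>
     prob_space \<Omega> \<and> X \<in> measurable \<Omega> MX \<and> Z \<in> measurable \<Omega> MZ \<and>
     \<kappa> \<in> measurable MZ (prob_algebra MX) \<and>
     (\<forall>A \<in> sets MZ. \<forall>B \<in> sets MX.
        emeasure \<Omega> {\<omega> \<in> space \<Omega>. Z \<omega> \<in> A \<and> X \<omega> \<in> B} =
        (\<integral>\<^sup>+ z. emeasure (\<kappa> z) B * indicator A z \<partial>distr \<Omega> MZ Z))"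

text \<open>A conditional law is determined only up to null sets of the conditioning variable.
  A formula \<open>\<kappa>\<close> for it may therefore fail to define a probability measure (a normalising
  constant may be \<open>0\<close> or \<open>\<infinity>\<close>, or some \<open>\<rho>(ds|y)\<close> may not be \<open>\<sigma>\<close>-finite) on such a null set.\<close>

definition conditional_law ::
  "'o measure \<Rightarrow> ('o \<Rightarrow> 'x) \<Rightarrow> 'x measure \<Rightarrow> ('o \<Rightarrow> 'z) \<Rightarrow> 'z measure \<Rightarrow> ('z \<Rightarrow> 'x measure) \<Rightarrow> bool"
where
  "conditional_law \<Omega> X MX Z MZ \<kappa> \<longleftrightarrow>
     (\<exists>\<kappa>'. regular_conditional_law \<Omega> X MX Z MZ \<kappa>' \<and> (AE z in distr \<Omega> MZ Z. \<kappa> z = \<kappa>' z))"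


section \<open>The Poisson random measure\<close>

abbreviation Jumps :: "real measure" where
  "Jumps \<equiv> restrict_space borel {0<..}"

abbreviation Marked :: "(real \<times> 'y::polish_space) measure" where
  "Marked \<equiv> Jumps \<Otimes>\<^sub>M borel"

definition bounded_in :: "'a metric \<Rightarrow> 'a set \<Rightarrow> bool" where
  "bounded_in d = Metric_space.mbounded (mspace d) (mdist d)"

abbreviation RM :: "(real \<times> 'y::polish_space) metric \<Rightarrow> (real \<times> 'y) measure measure" where
  "RM d \<equiv> boundedly_finite_measures Marked (bounded_in d)"

text \<open>The measure \<open>\<nu>(ds,dy) = \<rho>(ds|y) \<eta>(dy)\<close>.\<close>

definition intensity ::
  "('y::polish_space \<Rightarrow> real measure) \<Rightarrow> 'y measure \<Rightarrow> (real \<times> 'y) measure" where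
  "intensity \<rho> \<eta> = measure_of (space Marked) (sets Marked)
     (\<lambda>C. \<integral>\<^sup>+ y. (\<integral>\<^sup>+ s. indicator C (s, y) \<partial>\<rho> y) \<partial>\<eta>)"

definition poisson_random_measure ::
  "'o measure \<Rightarrow> 'a measure \<Rightarrow> ('a set \<Rightarrow> bool) \<Rightarrow> 'a measure \<Rightarrow> ('o \<Rightarrow> 'a measure) \<Rightarrow> bool" where
  "poisson_random_measure \<Omega> K bdd \<nu> N \<longleftrightarrow>
     prob_space \<Omega> \<and> N \<in> measurable \<Omega> (boundedly_finite_measures K bdd) \<and>
     (\<forall>C \<in> sets K. emeasure \<nu> C < \<infinity> \<longrightarrow>
        (\<forall>k::nat. measure \<Omega> {\<omega> \<in> space \<Omega>. emeasure (N \<omega>) C = of_nat k} =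
           exp (- measure \<nu> C) * measure \<nu> C ^ k / fact k)) \<and>
     (\<forall>C \<in> sets K. emeasure \<nu> C = \<infinity> \<longrightarrow> (AE \<omega> in \<Omega>. emeasure (N \<omega>) C = \<infinity>)) \<and>
     (\<forall>(I::nat set) C. finite I \<and> C ` I \<subseteq> sets K \<and> disjoint_family_on C I \<longrightarrow>
        prob_space.indep_vars \<Omega> (\<lambda>_. borel) (\<lambda>i \<omega>. emeasure (N \<omega>) (C i)) I)"

text \<open>The random measure \<open>\<mu>(dy) = \<integral> s N(ds,dy)\<close>; applied to \<open>N\<^sub>n\<^sup>*\<close> it gives \<open>\<mu>\<^sub>n\<^sup>*\<close>.\<close>

definition mean_rm :: "(real \<times> 'y::polish_space) measure \<Rightarrow> 'y measure" where
  "mean_rm N = distr (density N (\<lambda>(s, y). ennreal s)) borel snd"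

text \<open>The function \<open>q\<close> is given only on boundedly finite measures. The value \<open>0\<close> used
  elsewhere is immaterial: \<open>\<mu>\<close> is almost surely boundedly finite.\<close>

definition q_at ::
  "('y::polish_space \<Rightarrow> 'y measure \<Rightarrow> real) \<Rightarrow> 'y \<Rightarrow> 'y measure \<Rightarrow> ennreal" where
  "q_at q y m = (if boundedly_finite borel bounded m then ennreal (q y m) else 0)"

text \<open>\<open>P\<^sub>\<mu>(dy) = q(y,\<mu>) \<mu>(dy)\<close> and its augmentation \<open>q(y,\<mu>) s N(ds,dy)\<close>.\<close>

definition P_of ::
  "('y::polish_space \<Rightarrow> 'y measure \<Rightarrow> real) \<Rightarrow> 'y measure \<Rightarrow> 'y measure" where
  "P_of q m = density m (\<lambda>y. q_at q y m)"

definition P_aug ::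
  "('y::polish_space \<Rightarrow> 'y measure \<Rightarrow> real) \<Rightarrow> (real \<times> 'y) measure \<Rightarrow> (real \<times> 'y) measure" where
  "P_aug q N = density N (\<lambda>(s, y). q_at q y (mean_rm N) * ennreal s)"


section \<open>Quantities indexed by the cells of a partition\<close>

text \<open>The finite set \<open>I\<close> indexes the cells: \<open>e j\<close> is the size of cell \<open>j\<close>, and \<open>s j\<close>,
  \<open>y j\<close> are the values of \<open>J\<^sub>j\<^sub>,\<^sub>n\<close> and \<open>Y\<^sub>j\<^sup>*\<close>. The law of \<open>N\<close> is \<open>L\<close>.\<close>

definition add_atoms ::
  "'i set \<Rightarrow> ('i \<Rightarrow> real) \<Rightarrow> ('i \<Rightarrow> 'y::polish_space) \<Rightarrow> (real \<times> 'y) measure \<Rightarrow> (real \<times> 'y) measure"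
where
  "add_atoms I s y N = measure_of (space N) (sets N)
     (\<lambda>A. emeasure N A + (\<Sum>j\<in>I. indicator A (s j, y j)))"

definition q_product ::
  "('y::polish_space \<Rightarrow> 'y measure \<Rightarrow> real) \<Rightarrow> 'i set \<Rightarrow> ('i \<Rightarrow> nat) \<Rightarrow>
   ('i \<Rightarrow> real) \<Rightarrow> ('i \<Rightarrow> 'y) \<Rightarrow> (real \<times> 'y) measure \<Rightarrow> ennreal" where
  "q_product q I e s y N = (\<Prod>j\<in>I. q_at q (y j) (mean_rm (add_atoms I s y N)) ^ e j)"

definition phi ::
  "('y::polish_space \<Rightarrow> 'y measure \<Rightarrow> real) \<Rightarrow> (real \<times> 'y) measure measure \<Rightarrow>
   'i set \<Rightarrow> ('i \<Rightarrow> nat) \<Rightarrow> ('i \<Rightarrow> real) \<Rightarrow> ('i \<Rightarrow> 'y) \<Rightarrow> ennreal" where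
  "phi q L I e s y = (\<integral>\<^sup>+ N. q_product q I e s y N \<partial>L)"

text \<open>\<open>\<integral> \<phi>\<^sub>n(s,y) \<Prod>\<^sub>j s\<^sub>j\<^sup>e \<rho>(ds\<^sub>j|y\<^sub>j)\<close>, the density of the marginal law.\<close>

definition marginal_density ::
  "('y::polish_space \<Rightarrow> 'y measure \<Rightarrow> real) \<Rightarrow> (real \<times> 'y) measure measure \<Rightarrow>
   ('y \<Rightarrow> real measure) \<Rightarrow> 'i set \<Rightarrow> ('i \<Rightarrow> nat) \<Rightarrow> ('i \<Rightarrow> 'y) \<Rightarrow> ennreal" where
  "marginal_density q L \<rho> I e y =
     (\<integral>\<^sup>+ s. phi q L I e s y * (\<Prod>j\<in>I. ennreal (s j) ^ e j) \<partial>(\<Pi>\<^sub>M j\<in>I. \<rho> (y j)))"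

definition eppf ::
  "('y::polish_space \<Rightarrow> 'y measure \<Rightarrow> real) \<Rightarrow> (real \<times> 'y) measure measure \<Rightarrow>
   ('y \<Rightarrow> real measure) \<Rightarrow> 'y measure \<Rightarrow> 'i set \<Rightarrow> ('i \<Rightarrow> nat) \<Rightarrow> ennreal" where
  "eppf q L \<rho> \<eta> I e = (\<integral>\<^sup>+ y. marginal_density q L \<rho> I e y \<partial>(\<Pi>\<^sub>M j\<in>I. \<eta>))"


section \<open>Vectors and their ties\<close>

definition rvec :: "nat \<Rightarrow> (nat \<Rightarrow> 'o \<Rightarrow> 'a) \<Rightarrow> 'o \<Rightarrow> nat \<Rightarrow> 'a" where
  "rvec n X \<omega> = (\<lambda>i\<in>{1..n}. X i \<omega>)"

definition ties :: "nat \<Rightarrow> (nat \<Rightarrow> 'a) \<Rightarrow> nat set set" where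
  "ties n y = (\<lambda>i. {k \<in> {1..n}. y k = y i}) ` {1..n}"

text \<open>The distinct values of a vector that is constant on cells are indexed by the cells
  themselves; \<open>of_cells\<close> is the converse passage from cell values to the vector.\<close>

definition on_cells :: "(nat \<Rightarrow> 'a) \<Rightarrow> nat set \<Rightarrow> 'a" where
  "on_cells x C = x (Min C)"

definition of_cells :: "nat \<Rightarrow> nat set set \<Rightarrow> (nat set \<Rightarrow> 'a) \<Rightarrow> nat \<Rightarrow> 'a" where
  "of_cells n p x = (\<lambda>i\<in>{1..n}. x (THE C. C \<in> p \<and> i \<in> C))"

text \<open>\<open>N\<^sub>n\<^sup>* = N + \<Sum>\<^sub>j \<delta>\<close>, with atoms at the points \<open>(J\<^sub>j\<^sub>,\<^sub>n, Y\<^sub>j\<^sup>*)\<close>.\<close>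

definition N_star ::
  "nat \<Rightarrow> (nat \<Rightarrow> real) \<Rightarrow> (nat \<Rightarrow> 'y::polish_space) \<Rightarrow> (real \<times> 'y) measure \<Rightarrow> (real \<times> 'y) measure"
where
  "N_star n J Y N = add_atoms (ties n Y) (on_cells J) (on_cells Y) N"

text \<open>\<open>\<pi>\<^sup>*(dN|J,Y)\<close>\<close>

definition pi_star ::
  "nat \<Rightarrow> ('y::polish_space \<Rightarrow> 'y measure \<Rightarrow> real) \<Rightarrow> (real \<times> 'y) measure measure \<Rightarrow>
   (nat \<Rightarrow> real) \<Rightarrow> (nat \<Rightarrow> 'y) \<Rightarrow> (real \<times> 'y) measure measure" where
  "pi_star n q L J Y = density L
     (\<lambda>N. q_product q (ties n Y) card (on_cells J) (on_cells Y) N /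
          phi q L (ties n Y) card (on_cells J) (on_cells Y))"

text \<open>The \<open>N\<close> in \<open>N\<^sub>n\<^sup>*\<close> has law \<open>\<pi>\<^sup>*\<close>, so this is the law given \<open>(J,Y)\<close> of the original Poisson
  random measure.\<close>

definition N_star_law ::
  "nat \<Rightarrow> (real \<times> 'y::polish_space) metric \<Rightarrow> ('y \<Rightarrow> 'y measure \<Rightarrow> real) \<Rightarrow>
   (real \<times> 'y) measure measure \<Rightarrow> (nat \<Rightarrow> real) \<Rightarrow> (nat \<Rightarrow> 'y) \<Rightarrow> (real \<times> 'y) measure measure" where
  "N_star_law n d q L J Y = distr (pi_star n q L J Y) (RM d) (N_star n J Y)"

text \<open>The law of the vector \<open>J\<close> given \<open>Y\<close>: the distinct values \<open>J\<^sub>j\<^sub>,\<^sub>n\<close> have law proportional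
  to \<open>\<phi>\<^sub>n(J,Y) \<Prod>\<^sub>j J\<^sub>j\<^sub>,\<^sub>n\<^sup>e \<rho>(dJ\<^sub>j\<^sub>,\<^sub>n|Y\<^sub>j\<^sup>*)\<close>, where \<open>e = e\<^sub>j\<close>.\<close>

definition J_law ::
  "nat \<Rightarrow> ('y::polish_space \<Rightarrow> 'y measure \<Rightarrow> real) \<Rightarrow> (real \<times> 'y) measure measure \<Rightarrow>
   ('y \<Rightarrow> real measure) \<Rightarrow> (nat \<Rightarrow> 'y) \<Rightarrow> (nat \<Rightarrow> real) measure" where
  "J_law n q L \<rho> Y = distr
     (normalized (density (\<Pi>\<^sub>M C\<in>ties n Y. \<rho> (on_cells Y C))
        (\<lambda>s. phi q L (ties n Y) card s (on_cells Y) * (\<Prod>C\<in>ties n Y. ennreal (s C) ^ card C))))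
     (\<Pi>\<^sub>M i\<in>{1..n}. Jumps) (of_cells n (ties n Y))"

definition N_star_posterior ::
  "nat \<Rightarrow> (real \<times> 'y::polish_space) metric \<Rightarrow> ('y \<Rightarrow> 'y measure \<Rightarrow> real) \<Rightarrow>
   (real \<times> 'y) measure measure \<Rightarrow> ('y \<Rightarrow> real measure) \<Rightarrow> (nat \<Rightarrow> 'y) \<Rightarrow> (real \<times> 'y) measure measure"
where
  "N_star_posterior n d q L \<rho> Y = bind (J_law n q L \<rho> Y) (\<lambda>J. N_star_law n d q L J Y)"

end

(* The Mecke formula  E \<integral> f(w, N) N(dw) = \<integral> E f(w, N + \<delta>_w) \<nu>(dw),  iterated n times, turns
   the integral against the n-fold product of N into a sum over the partitions of {1..n}: each cell
   carries one point of intensity \<nu>, which is added to N as an atom.  Applied to the product of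
   the densities s q(y, \<mu>) this expresses the joint law of (J, Y, N) as a sum over partitions.
   Since \<eta> has no atoms, the points attached to distinct cells are almost everywhere distinct,
   so the partition is the one given by the ties of Y.  Integrating out J and N gives the marginal law
   of Y and the EPPF; disintegrating with respect to Y or (J, Y) and normalising gives the
   conditional laws, by Bayes' rule. *)

theory Submission
  imports Defs
begin

section \<open>Measurability of integrals against random measures\<close>

text \<open>Four obstacles shape the proof. The jump measures \<rho>(ds|y) are \<sigma>-finite for
  almost every y only; they are replaced by \<open>regular_jumps\<close>, and the formulas with
  \<rho> return almost everywhere. The kernels that occur (realisations of N, jump measures) are
  \<sigma>-finite without a bound on their mass, so measurability and Tonelli for kernels are
  established in that generality. The latent J lives on \<Omega> only under the augmentation
  hypothesis; the joint law of (Y, N) rests instead on the fact that P_\<mu> is the location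
  marginal of \<open>P_aug\<close>. The number of coordinates varies with the partition, so
  coordinates are indexed by the cells themselves, and \<open>of_cells\<close> repeats a cell value
  at each of its indices.

  Partitions arise because N, once shifted, already carries the atoms of a partition of {1..n}:
  integrating index n+1 against it either draws a fresh point of N, which opens the cell {n+1}, or
  hits an atom, which puts n+1 into an old cell.\<close>

lemma space_measure_algebra: "space (measure_algebra K) = {M. sets M = sets K}"
  by (auto simp: measure_algebra_def space_Sup_eq_UN)

lemma measurable_emeasure_measure_algebra[measurable]:
  "A \<in> sets K \<Longrightarrow> (\<lambda>M. emeasure M A) \<in> borel_measurable (measure_algebra K)"
  by (auto intro!: measurable_Sup1 measurable_vimage_algebra1 simp: measure_algebra_def)

lemma measurable_measure_algebra:
  "(\<And>a. a \<in> space M \<Longrightarrow> sets (\<kappa> a) = sets K) \<Longrightarrow>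
  (\<And>A. A \<in> sets K \<Longrightarrow> (\<lambda>a. emeasure (\<kappa> a) A) \<in> borel_measurable M) \<Longrightarrow>
  \<kappa> \<in> measurable M (measure_algebra K)"
  by (auto intro!: measurable_Sup2 measurable_vimage_algebra2 simp: measure_algebra_def)

lemma measure_algebra_sets:
  "\<kappa> \<in> measurable M (measure_algebra K) \<Longrightarrow> a \<in> space M \<Longrightarrow> sets (\<kappa> a) = sets K"
  using measurable_space[of \<kappa> M "measure_algebra K" a] by (simp add: space_measure_algebra)

lemma nn_integral_measurable_measure_algebra[measurable]:
  assumes f: "f \<in> borel_measurable K"
  shows "(\<lambda>M. integral\<^sup>N M f) \<in> borel_measurable (measure_algebra K)" (is "_ \<in> ?B")
  using f
proof induct
  case (cong f g)
  moreover have "(\<lambda>M'. \<integral>\<^sup>+M''. f M'' \<partial>M') \<in> ?B \<longleftrightarrow> (\<lambda>M'. \<integral>\<^sup>+M''. g M'' \<partial>M') \<in> ?B"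
    by (intro measurable_cong nn_integral_cong cong)
       (auto simp: space_measure_algebra dest!: sets_eq_imp_space_eq)
  ultimately show ?case by simp
next
  case (set B)
  then have "(\<lambda>M'. \<integral>\<^sup>+M''. indicator B M'' \<partial>M') \<in> ?B \<longleftrightarrow> (\<lambda>M'. emeasure M' B) \<in> ?B"
    by (intro measurable_cong nn_integral_indicator) (simp add: space_measure_algebra)
  with set show ?case
    by (simp add: measurable_emeasure_measure_algebra)
next
  case (mult f c)
  then have "(\<lambda>M'. \<integral>\<^sup>+M''. c * f M'' \<partial>M') \<in> ?B \<longleftrightarrow> (\<lambda>M'. c * \<integral>\<^sup>+M''. f M'' \<partial>M') \<in> ?B"
    by (intro measurable_cong nn_integral_cmult) (auto simp add: space_measure_algebra)
  with mult show ?case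
    by simp
next
  case (add f g)
  then have "(\<lambda>M'. \<integral>\<^sup>+M''. f M'' + g M'' \<partial>M') \<in> ?B \<longleftrightarrow>
      (\<lambda>M'. (\<integral>\<^sup>+M''. f M'' \<partial>M') + (\<integral>\<^sup>+M''. g M'' \<partial>M')) \<in> ?B"
    by (intro measurable_cong nn_integral_add) (auto simp add: space_measure_algebra)
  with add show ?case
    by (simp add: ac_simps)
next
  case (seq F)
  then have "(\<lambda>M'. \<integral>\<^sup>+M''. (SUP i. F i) M'' \<partial>M') \<in> ?B \<longleftrightarrow>
      (\<lambda>M'. SUP i. (\<integral>\<^sup>+M''. F i M'' \<partial>M')) \<in> ?B"
    unfolding SUP_apply
    by (intro measurable_cong nn_integral_monotone_convergence_SUP) (auto simp add: space_measure_algebra)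
  with seq show ?case
    by (simp add: ac_simps)
qed

text \<open>The exhausting sets \<open>B k\<close> are the same for all \<open>z\<close>. With one
  countable decomposition of \<open>K\<close> for the whole kernel, cutting and normalising stay
  measurable in \<open>z\<close>; \<sigma>-finiteness of each single \<open>\<kappa> z\<close> would
  not provide it.\<close>

definition sigma_kernel :: "'z measure \<Rightarrow> 'a measure \<Rightarrow> ('z \<Rightarrow> 'a measure) \<Rightarrow> bool" where
  "sigma_kernel Z K \<kappa> \<longleftrightarrow> \<kappa> \<in> measurable Z (measure_algebra K) \<and>
     (\<exists>B::nat \<Rightarrow> 'a set. range B \<subseteq> sets K \<and> (\<Union>k. B k) = space K \<and>
        (\<forall>z\<in>space Z. \<forall>k. emeasure (\<kappa> z) (B k) < \<infinity>))"

lemma sigma_kernel_sets: "sigma_kernel Z K \<kappa> \<Longrightarrow> z \<in> space Z \<Longrightarrow> sets (\<kappa> z) = sets K"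
  unfolding sigma_kernel_def by (blast dest: measure_algebra_sets)

lemma sigma_kernel_space: "sigma_kernel Z K \<kappa> \<Longrightarrow> z \<in> space Z \<Longrightarrow> space (\<kappa> z) = space K"
  using sigma_kernel_sets by (rule sets_eq_imp_space_eq)

lemma sigma_kernel_sigma_finite:
  assumes "sigma_kernel Z K \<kappa>" "z \<in> space Z"
  shows "sigma_finite_measure (\<kappa> z)"
proof -
  obtain B :: "nat \<Rightarrow> 'b set" where "range B \<subseteq> sets K" "(\<Union>k. B k) = space K"
      "\<forall>z\<in>space Z. \<forall>k. emeasure (\<kappa> z) (B k) < \<infinity>"
    using assms(1) by (auto simp: sigma_kernel_def)
  then show ?thesis
    using assms by (intro sigma_finite_measure.intro exI[of _ "range B"])
      (auto simp: sigma_kernel_sets sigma_kernel_space less_top)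
qed

lemma sigma_kernel_compose:
  assumes "f \<in> measurable Z' Z" "sigma_kernel Z K \<kappa>"
  shows "sigma_kernel Z' K (\<lambda>z. \<kappa> (f z))"
proof -
  obtain B :: "nat \<Rightarrow> 'c set" where "range B \<subseteq> sets K" "(\<Union>k. B k) = space K"
      "\<forall>z\<in>space Z. \<forall>k. emeasure (\<kappa> z) (B k) < \<infinity>"
    using assms(2) by (auto simp: sigma_kernel_def)
  moreover have "(\<lambda>z. \<kappa> (f z)) \<in> measurable Z' (measure_algebra K)"
    using assms by (auto simp: sigma_kernel_def)
  ultimately show ?thesis
    using measurable_space[OF assms(1)] unfolding sigma_kernel_def by blast
qed

text \<open>Cutting \<open>K\<close> into countably many pieces of finite mass and normalising on each piece
  reduces the claim to sub-probability kernels.\<close>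

lemma measurable_nn_integral_sigma_kernel:
  assumes \<kappa>: "sigma_kernel Z K \<kappa>" and F: "(\<lambda>(z, x). F z x) \<in> borel_measurable (Z \<Otimes>\<^sub>M K)"
  shows "(\<lambda>z. \<integral>\<^sup>+ x. F z x \<partial>\<kappa> z) \<in> borel_measurable Z"
proof (cases "space K = {}")
  case True
  then have "(\<integral>\<^sup>+ x. F z x \<partial>\<kappa> z) = 0" if "z \<in> space Z" for z
    using sigma_kernel_space[OF \<kappa> that] by (simp add: nn_integral_empty)
  then show ?thesis by (subst measurable_cong[of Z _ "\<lambda>_. 0"]) auto
next
  case False
  obtain B :: "nat \<Rightarrow> 'b set" where B: "range B \<subseteq> sets K" "(\<Union>k. B k) = space K"
      "\<And>z k. z\<in>space Z \<Longrightarrow> emeasure (\<kappa> z) (B k) < \<infinity>"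
    and \<kappa>_meas[measurable]: "\<kappa> \<in> measurable Z (measure_algebra K)"
    using \<kappa> by (auto simp: sigma_kernel_def)
  note [measurable] = F
  define D where "D = disjointed B"
  have D[measurable]: "D k \<in> sets K" for k
    using sets.range_disjointed_sets[OF B(1)] by (auto simp: D_def)
  have D_un: "(\<Union>k. D k) = space K" and D_disj: "disjoint_family D"
    by (simp_all add: D_def UN_disjointed_eq B(2) disjoint_family_disjointed)
  have D_fin: "emeasure (\<kappa> z) (D k) < \<infinity>" if "z \<in> space Z" for z k
  proof -
    have "emeasure (\<kappa> z) (D k) \<le> emeasure (\<kappa> z) (B k)"
      using B(1) that by (intro emeasure_mono) (auto simp: D_def disjointed_def sigma_kernel_sets[OF \<kappa>])
    with B(3)[OF that, of k] show ?thesis by simp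
  qed
  \<comment> \<open>The summand 1 keeps the divisor away from 0, so that \<open>S k z\<close> is a
    sub-probability measure also where the piece \<open>D k\<close> is null.\<close>
  define c where "c k z = 1 + emeasure (\<kappa> z) (D k)" for k z
  have c[measurable]: "c k \<in> borel_measurable Z" for k
    unfolding c_def by measurable
  have c0: "c k z \<noteq> 0" "c k z \<noteq> \<infinity>" if "z \<in> space Z" for k z
    using D_fin[OF that, of k] by (auto simp: c_def)
  define S where "S k z = density (\<kappa> z) (\<lambda>x. indicator (D k) x / c k z)" for k z
  have sets_S: "z \<in> space Z \<Longrightarrow> sets (S k z) = sets K" for z k
    by (simp add: S_def sigma_kernel_sets[OF \<kappa>])
  have S_eq: "emeasure (S k z) A = emeasure (\<kappa> z) (D k \<inter> A) / c k z"
    if [measurable]: "A \<in> sets K" and z: "z \<in> space Z" for A k z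
  proof -
    note [measurable_cong] = sigma_kernel_sets[OF \<kappa> z]
    have "emeasure (S k z) A = (\<integral>\<^sup>+x. indicator (D k) x / c k z * indicator A x \<partial>\<kappa> z)"
      unfolding S_def by (rule emeasure_density) measurable
    also have "\<dots> = (\<integral>\<^sup>+x. indicator (D k \<inter> A) x / c k z \<partial>\<kappa> z)"
      by (intro nn_integral_cong) (auto split: split_indicator)
    also have "\<dots> = emeasure (\<kappa> z) (D k \<inter> A) / c k z"
      by (simp add: nn_integral_divide)
    finally show ?thesis .
  qed
  have S: "S k \<in> measurable Z (subprob_algebra K)" for k
  proof (rule measurable_subprob_algebra)
    fix z assume z: "z \<in> space Z"
    show "sets (S k z) = sets K" by (rule sets_S[OF z])
    then have sp: "space (S k z) = space K" by (rule sets_eq_imp_space_eq)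
    show "subprob_space (S k z)"
    proof
      show "space (S k z) \<noteq> {}" using sp False by simp
      have "emeasure (\<kappa> z) (D k \<inter> space K) \<le> c k z"
        using sets.sets_into_space[OF D[of k]] by (simp add: c_def Int_absorb2)
      then have "emeasure (\<kappa> z) (D k \<inter> space K) / c k z \<le> 1"
        using c0[OF z, of k] by (simp add: divide_le_posI_ennreal zero_less_iff_neq_zero)
      then show "emeasure (S k z) (space (S k z)) \<le> 1"
        using S_eq[OF sets.top z] by (simp add: sp)
    qed
  next
    fix A assume [measurable]: "A \<in> sets K"
    have "(\<lambda>z. emeasure (\<kappa> z) (D k \<inter> A) / c k z) \<in> borel_measurable Z" by measurable
    then show "(\<lambda>z. emeasure (S k z) A) \<in> borel_measurable Z"
      by (subst measurable_cong[OF S_eq]) auto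
  qed
  \<comment> \<open>Multiplying by \<open>c k z\<close> undoes the normalisation, and summation over
    the disjoint pieces \<open>D k\<close> recovers the integral against
    \<open>\<kappa> z\<close>.\<close>
  have eq: "(\<integral>\<^sup>+ x. F z x \<partial>\<kappa> z) = (\<Sum>k. c k z * (\<integral>\<^sup>+ x. F z x \<partial>S k z))" if z: "z \<in> space Z" for z
  proof -
    note [measurable_cong] = sigma_kernel_sets[OF \<kappa> z]
    have Fz[measurable]: "F z \<in> borel_measurable K"
      using measurable_Pair2[OF F z] by simp
    have "c k z * (\<integral>\<^sup>+ x. F z x \<partial>S k z) = (\<integral>\<^sup>+ x. F z x * indicator (D k) x \<partial>\<kappa> z)" for k
    proof -
      have "(\<integral>\<^sup>+ x. F z x \<partial>S k z) = (\<integral>\<^sup>+ x. indicator (D k) x / c k z * F z x \<partial>\<kappa> z)"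
        unfolding S_def by (rule nn_integral_density) measurable
      also have "\<dots> = (\<integral>\<^sup>+ x. (F z x * indicator (D k) x) / c k z \<partial>\<kappa> z)"
        by (intro nn_integral_cong) (simp add: divide_ennreal_def mult_ac)
      also have "\<dots> = (\<integral>\<^sup>+ x. F z x * indicator (D k) x \<partial>\<kappa> z) / c k z"
        by (rule nn_integral_divide) measurable
      finally show ?thesis using c0[OF z, of k]
        by (simp add: ennreal_times_divide mult.commute[of "c k z"] ennreal_mult_divide_eq)
    qed
    then have "(\<Sum>k. c k z * (\<integral>\<^sup>+ x. F z x \<partial>S k z)) = (\<integral>\<^sup>+ x. (\<Sum>k. F z x * indicator (D k) x) \<partial>\<kappa> z)"
      by (subst nn_integral_suminf) (auto simp del: ennreal_suminf_cmult)
    also have "\<dots> = (\<integral>\<^sup>+ x. F z x \<partial>\<kappa> z)"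
    proof (intro nn_integral_cong)
      fix x assume "x \<in> space (\<kappa> z)"
      then have "x \<in> (\<Union>k. D k)" using D_un sigma_kernel_space[OF \<kappa> z] by simp
      then have "(\<Sum>k. indicator (D k) x :: ennreal) = 1"
        using suminf_indicator[OF D_disj, of x] by simp
      then show "(\<Sum>k. F z x * indicator (D k) x) = F z x" by simp
    qed
    finally show ?thesis by simp
  qed
  have "(\<lambda>z. \<integral>\<^sup>+ x. F z x \<partial>S k z) \<in> borel_measurable Z" for k
    using F S by (rule nn_integral_measurable_subprob_algebra2)
  then have "(\<lambda>z. \<Sum>k. c k z * (\<integral>\<^sup>+ x. F z x \<partial>S k z)) \<in> borel_measurable Z"
    by measurable
  then show ?thesis by (subst measurable_cong[OF eq]) auto
qed

text \<open>Induction on \<open>I\<close>: the integral over the new coordinate is measurable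
  jointly in \<open>z\<close> and the remaining coordinates, which thus serve as parameters, and the
  result is the integrand for the induction hypothesis.\<close>

lemma measurable_nn_integral_PiM_sigma_kernel:
  assumes "finite I" and \<kappa>: "\<And>i. i \<in> I \<Longrightarrow> sigma_kernel Z K (\<kappa> i)"
    and F: "(\<lambda>(z, x). F z x) \<in> borel_measurable (Z \<Otimes>\<^sub>M PiM I (\<lambda>_. K))"
  shows "(\<lambda>z. \<integral>\<^sup>+ x. F z x \<partial>PiM I (\<lambda>i. \<kappa> i z)) \<in> borel_measurable Z"
  using assms
proof (induction I arbitrary: F rule: finite_induct)
  case empty
  have "(\<lambda>z. (z, \<lambda>_. undefined)) \<in> measurable Z (Z \<Otimes>\<^sub>M PiM {} (\<lambda>_. K))"
    by (intro measurable_Pair measurable_const) (auto simp: space_PiM)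
  from measurable_compose[OF this empty.prems(2)]
  have "(\<lambda>z. F z (\<lambda>_. undefined)) \<in> borel_measurable Z" by simp
  then show ?case by (simp add: PiM_empty nn_integral_count_space_finite)
next
  case (insert i I)
  note [measurable] = insert.prems(2)
  have "(\<lambda>((z, x), t). (z, x(i := t))) \<in>
      measurable ((Z \<Otimes>\<^sub>M PiM I (\<lambda>_. K)) \<Otimes>\<^sub>M K) (Z \<Otimes>\<^sub>M PiM (insert i I) (\<lambda>_. K))"
    unfolding split_beta'
    by (intro measurable_Pair measurable_fun_upd[where J=I]) auto
  from measurable_compose[OF this insert.prems(2)]
  have 1: "(\<lambda>(w, t). F (fst w) ((snd w)(i := t))) \<in> borel_measurable ((Z \<Otimes>\<^sub>M PiM I (\<lambda>_. K)) \<Otimes>\<^sub>M K)"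
    by (simp add: split_beta')
  have 2: "sigma_kernel (Z \<Otimes>\<^sub>M PiM I (\<lambda>_. K)) K (\<lambda>zx. \<kappa> i (fst zx))"
    using insert.prems(1) by (intro sigma_kernel_compose[of fst _ Z]) auto
  have 3: "(\<lambda>zx. \<integral>\<^sup>+ t. F (fst zx) ((snd zx)(i := t)) \<partial>\<kappa> i (fst zx))
      \<in> borel_measurable (Z \<Otimes>\<^sub>M PiM I (\<lambda>_. K))"
    by (rule measurable_nn_integral_sigma_kernel[OF 2 1])
  have "(\<lambda>z. \<integral>\<^sup>+ x. (\<integral>\<^sup>+ t. F z (x(i := t)) \<partial>\<kappa> i z) \<partial>PiM I (\<lambda>i. \<kappa> i z)) \<in> borel_measurable Z"
    using insert.prems(1) 3 by (intro insert.IH) (simp_all only: split_beta' insert_iff simp_thms)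
  moreover have "(\<integral>\<^sup>+ x. F z x \<partial>PiM (insert i I) (\<lambda>i. \<kappa> i z)) =
      (\<integral>\<^sup>+ x. (\<integral>\<^sup>+ t. F z (x(i := t)) \<partial>\<kappa> i z) \<partial>PiM I (\<lambda>i. \<kappa> i z))" if z: "z \<in> space Z" for z
  proof -
    \<comment> \<open>\<open>product_sigma_finite\<close> asks for \<sigma>-finiteness at every
      index of the type; the null measure outside \<open>insert i I\<close> supplies it without
      changing the products over \<open>I\<close> and \<open>insert i I\<close>.\<close>
    define \<kappa>' where "\<kappa>' j = (if j \<in> insert i I then \<kappa> j z else null_measure K)" for j
    have "sigma_finite_measure (null_measure K)"
      by (intro finite_measure.sigma_finite_measure finite_measureI) simp
    then interpret product_sigma_finite \<kappa>'
      using insert.prems(1) z sigma_kernel_sigma_finite unfolding product_sigma_finite_def \<kappa>'_def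
      by metis
    have 2: "sets (\<kappa>' j) = sets K" if "j \<in> insert i I" for j
      using sigma_kernel_sets[OF insert.prems(1)[OF that] z] that by (simp add: \<kappa>'_def)
    have 1: "PiM (insert i I) (\<lambda>i. \<kappa> i z) = PiM (insert i I) \<kappa>'" "PiM I (\<lambda>i. \<kappa> i z) = PiM I \<kappa>'"
      by (auto intro!: PiM_cong simp: \<kappa>'_def)
    have "F z \<in> borel_measurable (PiM (insert i I) (\<lambda>_. K))"
      using measurable_Pair2[OF insert.prems(2) z] by simp
    then have "F z \<in> borel_measurable (PiM (insert i I) \<kappa>')"
      by (subst measurable_cong_sets[OF sets_PiM_cong[OF refl 2] refl])
    then show ?thesis
      unfolding 1 using insert.hyps by (subst product_nn_integral_insert) (auto simp: \<kappa>'_def)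
  qed
  ultimately show ?case by (subst measurable_cong) auto
qed

section \<open>Composition of a measure with a kernel\<close>

definition semidirect :: "'z measure \<Rightarrow> 'a measure \<Rightarrow> ('z \<Rightarrow> 'a measure) \<Rightarrow> ('z \<times> 'a) measure" where
  "semidirect P K \<kappa> = measure_of (space (P \<Otimes>\<^sub>M K)) (sets (P \<Otimes>\<^sub>M K))
     (\<lambda>E. \<integral>\<^sup>+ z. (\<integral>\<^sup>+ x. indicator E (z, x) \<partial>\<kappa> z) \<partial>P)"

lemma sets_semidirect[simp, measurable_cong]: "sets (semidirect P K \<kappa>) = sets (P \<Otimes>\<^sub>M K)"
  by (simp add: semidirect_def)

text \<open>Tonelli's theorem with a kernel in place of a second factor. Two exchanges of sum and
  integral make the defining set function countably additive, so it is the value of the measure on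
  measurable sets; from indicators the formula extends to all integrands.\<close>

lemma nn_integral_semidirect:
  assumes \<kappa>: "sigma_kernel P K \<kappa>" and F: "F \<in> borel_measurable (P \<Otimes>\<^sub>M K)"
  shows "(\<integral>\<^sup>+ w. F w \<partial>semidirect P K \<kappa>) = (\<integral>\<^sup>+ z. (\<integral>\<^sup>+ x. F (z, x) \<partial>\<kappa> z) \<partial>P)"
proof -
  have m1: "(\<lambda>x. f (z, x)) \<in> borel_measurable (\<kappa> z)"
    if "f \<in> borel_measurable (P \<Otimes>\<^sub>M K)" "z \<in> space P" for f :: "_ \<Rightarrow> ennreal" and z
    using measurable_Pair2[OF that] by (simp only: measurable_cong_sets[OF sigma_kernel_sets[OF \<kappa> that(2)] refl])
  have m2: "(\<lambda>z. \<integral>\<^sup>+ x. f (z, x) \<partial>\<kappa> z) \<in> borel_measurable P"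
    if "f \<in> borel_measurable (P \<Otimes>\<^sub>M K)" for f :: "_ \<Rightarrow> ennreal"
    using that by (intro measurable_nn_integral_sigma_kernel[OF \<kappa>]) simp
  have em: "emeasure (semidirect P K \<kappa>) E = (\<integral>\<^sup>+ z. (\<integral>\<^sup>+ x. indicator E (z, x) \<partial>\<kappa> z) \<partial>P)"
    if E: "E \<in> sets (P \<Otimes>\<^sub>M K)" for E
    unfolding semidirect_def
  proof (rule emeasure_measure_of_sigma)
    show "countably_additive (sets (P \<Otimes>\<^sub>M K)) (\<lambda>E. \<integral>\<^sup>+ z. (\<integral>\<^sup>+ x. indicator E (z, x) \<partial>\<kappa> z) \<partial>P)"
      unfolding countably_additive_def
    proof safe
      fix E :: "nat \<Rightarrow> _" assume E: "range E \<subseteq> sets (P \<Otimes>\<^sub>M K)" "disjoint_family E"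
      have Ei: "(indicator (E i) :: _ \<Rightarrow> ennreal) \<in> borel_measurable (P \<Otimes>\<^sub>M K)" for i
        using E by (intro borel_measurable_indicator) auto
      have "(\<Sum>i. \<integral>\<^sup>+ z. (\<integral>\<^sup>+ x. indicator (E i) (z, x) \<partial>\<kappa> z) \<partial>P) = (\<integral>\<^sup>+ z. (\<Sum>i. \<integral>\<^sup>+ x. indicator (E i) (z, x) \<partial>\<kappa> z) \<partial>P)"
        using m2[OF Ei] by (intro nn_integral_suminf[symmetric])
      also have "\<dots> = (\<integral>\<^sup>+ z. (\<integral>\<^sup>+ x. (\<Sum>i. indicator (E i) (z, x)) \<partial>\<kappa> z) \<partial>P)"
        using m1[OF Ei] by (intro nn_integral_cong nn_integral_suminf[symmetric])
      finally show "(\<Sum>i. \<integral>\<^sup>+ z. (\<integral>\<^sup>+ x. indicator (E i) (z, x) \<partial>\<kappa> z) \<partial>P) =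
          (\<integral>\<^sup>+ z. (\<integral>\<^sup>+ x. indicator (\<Union>i. E i) (z, x) \<partial>\<kappa> z) \<partial>P)"
        using E(2) by (simp add: suminf_indicator)
    qed
  qed (auto simp: sets.sigma_algebra_axioms positive_def E)
  show ?thesis
    using F
  proof induct
    case (cong f g)
    have "(\<integral>\<^sup>+ w. f w \<partial>semidirect P K \<kappa>) = (\<integral>\<^sup>+ w. g w \<partial>semidirect P K \<kappa>)"
      using cong(3) by (intro nn_integral_cong) (simp add: sets_eq_imp_space_eq[OF sets_semidirect])
    moreover have "(\<integral>\<^sup>+ z. (\<integral>\<^sup>+ x. f (z, x) \<partial>\<kappa> z) \<partial>P) = (\<integral>\<^sup>+ z. (\<integral>\<^sup>+ x. g (z, x) \<partial>\<kappa> z) \<partial>P)"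
      using cong(3) sigma_kernel_space[OF \<kappa>] by (intro nn_integral_cong) (auto simp: space_pair_measure)
    ultimately show ?case using cong(4) by simp
  next
    case (set E)
    then show ?case by (simp add: em)
  next
    case (mult f c)
    have "(\<integral>\<^sup>+ z. (\<integral>\<^sup>+ x. c * f (z, x) \<partial>\<kappa> z) \<partial>P) = (\<integral>\<^sup>+ z. c * (\<integral>\<^sup>+ x. f (z, x) \<partial>\<kappa> z) \<partial>P)"
      using m1[OF mult(2)] by (intro nn_integral_cong nn_integral_cmult)
    then show ?case
      using mult m2[OF mult(2)] by (simp add: nn_integral_cmult cong: measurable_cong_sets)
  next
    case (add f g)
    have "(\<integral>\<^sup>+ z. (\<integral>\<^sup>+ x. g (z, x) + f (z, x) \<partial>\<kappa> z) \<partial>P) =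
        (\<integral>\<^sup>+ z. (\<integral>\<^sup>+ x. g (z, x) \<partial>\<kappa> z) + (\<integral>\<^sup>+ x. f (z, x) \<partial>\<kappa> z) \<partial>P)"
      using m1[OF add(1)] m1[OF add(4)] by (intro nn_integral_cong nn_integral_add)
    then show ?case
      using add m2[OF add(1)] m2[OF add(4)] by (simp add: nn_integral_add cong: measurable_cong_sets)
  next
    case (seq U)
    have inc: "U i x \<le> U (Suc i) x" for i x
      using \<open>incseq U\<close> by (cases x) (simp add: incseq_Suc_iff le_fun_def)
    have "(\<integral>\<^sup>+ w. (SUP i. U i w) \<partial>semidirect P K \<kappa>) = (SUP i. \<integral>\<^sup>+ w. U i w \<partial>semidirect P K \<kappa>)"
      using seq \<open>incseq U\<close> by (intro nn_integral_monotone_convergence_SUP) (auto cong: measurable_cong_sets)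
    also have "\<dots> = (\<integral>\<^sup>+ z. (SUP i. \<integral>\<^sup>+ x. U i (z, x) \<partial>\<kappa> z) \<partial>P)"
      using seq m2[OF seq(1)] inc
      by (subst nn_integral_monotone_convergence_SUP)
         (auto simp: incseq_Suc_iff le_fun_def intro!: nn_integral_mono)
    also have "\<dots> = (\<integral>\<^sup>+ z. (\<integral>\<^sup>+ x. (SUP i. U i (z, x)) \<partial>\<kappa> z) \<partial>P)"
      using m1[OF seq(1)] inc
      by (intro nn_integral_cong nn_integral_monotone_convergence_SUP[symmetric])
         (auto simp: incseq_Suc_iff le_fun_def)
    finally show ?case unfolding SUP_apply .
  qed
qed

section \<open>Finite products of \<open>\<sigma>\<close>-finite measures\<close>

text \<open>Equality of the two product measures is checked on rectangles, where it is the
  reindexing of a finite product of numbers. The lemma serves three bijections: a cell that gains an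
  index, a numbering of the cells in the EPPF, and a permutation of the sample.\<close>

lemma nn_integral_PiM_reindex:
  assumes M: "\<And>j. sigma_finite_measure (M j)" and h: "bij_betw h I J" and fin: "finite I"
    and f: "f \<in> borel_measurable (PiM I (\<lambda>i. M (h i)))"
  shows "(\<integral>\<^sup>+ w. f w \<partial>PiM I (\<lambda>i. M (h i))) = (\<integral>\<^sup>+ w. f (\<lambda>i\<in>I. w (h i)) \<partial>PiM J M)"
proof -
  interpret J: product_sigma_finite M using M by (simp add: product_sigma_finite_def)
  interpret I: product_sigma_finite "\<lambda>i. M (h i)" using M by (simp add: product_sigma_finite_def)
  have finJ: "finite J" using h fin bij_betw_finite by blast
  have hJ: "i \<in> I \<Longrightarrow> h i \<in> J" for i using h by (auto simp: bij_betw_def)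
  have meas: "(\<lambda>w. \<lambda>i\<in>I. w (h i)) \<in> measurable (PiM J M) (PiM I (\<lambda>i. M (h i)))"
    using hJ by (intro measurable_restrict measurable_component_singleton)
  have "distr (PiM J M) (PiM I (\<lambda>i. M (h i))) (\<lambda>w. \<lambda>i\<in>I. w (h i)) = PiM I (\<lambda>i. M (h i))"
  proof (rule I.PiM_eqI)
    fix A assume A: "\<And>i. i \<in> I \<Longrightarrow> A i \<in> sets (M (h i))"
    let ?g = "the_inv_into I h"
    have g: "h (?g j) = j" "?g j \<in> I" if "j \<in> J" for j
      using h that by (auto simp: bij_betw_def f_the_inv_into_f intro: the_inv_into_into)
    have gh: "i \<in> I \<Longrightarrow> ?g (h i) = i" for i
      using h by (auto simp: bij_betw_def the_inv_into_f_f)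
    have A': "A (?g j) \<in> sets (M j)" if "j \<in> J" for j
      using A[OF g(2)[OF that]] g(1)[OF that] by simp
    have "(\<lambda>w. \<lambda>i\<in>I. w (h i)) -` Pi\<^sub>E I A \<inter> space (PiM J M) = Pi\<^sub>E J (\<lambda>j. A (?g j))"
    proof (intro set_eqI iffI)
      fix w assume "w \<in> (\<lambda>w. \<lambda>i\<in>I. w (h i)) -` Pi\<^sub>E I A \<inter> space (PiM J M)"
      then have w: "\<And>i. i \<in> I \<Longrightarrow> w (h i) \<in> A i" "w \<in> extensional J"
        by (auto simp: space_PiM PiE_iff)
      have "w j \<in> A (?g j)" if "j \<in> J" for j
        using w(1)[OF g(2)[OF that]] g(1)[OF that] by simp
      then show "w \<in> Pi\<^sub>E J (\<lambda>j. A (?g j))" using w(2) by (simp add: PiE_iff)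
    next
      fix w assume w: "w \<in> Pi\<^sub>E J (\<lambda>j. A (?g j))"
      then have "w (h i) \<in> A i" if "i \<in> I" for i
        using hJ[OF that] gh[OF that] by (metis PiE_mem)
      moreover have "w j \<in> space (M j)" if "j \<in> J" for j
        using sets.sets_into_space[OF A'[OF that]] w that by (auto simp: PiE_iff)
      ultimately show "w \<in> (\<lambda>w. \<lambda>i\<in>I. w (h i)) -` Pi\<^sub>E I A \<inter> space (PiM J M)"
        using w by (simp add: space_PiM PiE_iff)
    qed
    then show "emeasure (distr (PiM J M) (PiM I (\<lambda>i. M (h i))) (\<lambda>w. \<lambda>i\<in>I. w (h i))) (Pi\<^sub>E I A) =
        (\<Prod>i\<in>I. emeasure (M (h i)) (A i))"
      using A A' fin finJ meas
      by (subst emeasure_distr)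
         (auto simp: J.emeasure_PiM gh intro!: prod.reindex_bij_betw[OF h, symmetric, THEN trans] prod.cong)
  qed (use fin in simp_all)
  then have "(\<integral>\<^sup>+ w. f w \<partial>PiM I (\<lambda>i. M (h i))) =
      (\<integral>\<^sup>+ w. f w \<partial>distr (PiM J M) (PiM I (\<lambda>i. M (h i))) (\<lambda>w. \<lambda>i\<in>I. w (h i)))" by simp
  also have "\<dots> = (\<integral>\<^sup>+ w. f (\<lambda>i\<in>I. w (h i)) \<partial>PiM J M)"
    using meas f by (simp add: nn_integral_distr)
  finally show ?thesis .
qed

text \<open>\<sigma>-finiteness of the images is assumed in addition to that of the
  \<open>M i\<close>, because a map can pile up infinite mass. The application projects powers of
  \<open>P_aug q M\<close>, almost surely a probability measure, to the locations.\<close>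

lemma PiM_distr:
  assumes M: "\<And>i. sigma_finite_measure (M i)" "\<And>i. sigma_finite_measure (distr (M i) B (f i))"
    and fin: "finite I" and f[measurable]: "\<And>i. f i \<in> measurable (M i) B"
  shows "PiM I (\<lambda>i. distr (M i) B (f i)) = distr (PiM I M) (PiM I (\<lambda>_. B)) (\<lambda>w. \<lambda>i\<in>I. f i (w i))"
proof -
  interpret M: product_sigma_finite M using M by (simp add: product_sigma_finite_def)
  interpret D: product_sigma_finite "\<lambda>i. distr (M i) B (f i)" using M by (simp add: product_sigma_finite_def)
  show ?thesis
  proof (rule D.PiM_eqI[symmetric])
    fix A assume "\<And>i. i \<in> I \<Longrightarrow> A i \<in> sets (distr (M i) B (f i))"
    then have A[measurable]: "\<And>i. i \<in> I \<Longrightarrow> A i \<in> sets B" by simp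
    have meas: "(\<lambda>w. \<lambda>i\<in>I. f i (w i)) \<in> measurable (PiM I M) (PiM I (\<lambda>_. B))"
      by (intro measurable_restrict measurable_compose[OF measurable_component_singleton, where g="f i" for i] f)
    have "(\<lambda>w. \<lambda>i\<in>I. f i (w i)) -` Pi\<^sub>E I A \<inter> space (PiM I M) =
        Pi\<^sub>E I (\<lambda>i. f i -` A i \<inter> space (M i))"
      by (auto simp: space_PiM PiE_iff)
    then show "emeasure (distr (PiM I M) (PiM I (\<lambda>_. B)) (\<lambda>w. \<lambda>i\<in>I. f i (w i))) (Pi\<^sub>E I A) =
        (\<Prod>i\<in>I. emeasure (distr (M i) B (f i)) (A i))"
      using fin meas
      by (subst emeasure_distr)
         (auto simp: M.emeasure_PiM emeasure_distr measurable_sets[OF f] intro!: sets_PiM_I_finite prod.cong)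
  qed (use fin in \<open>simp_all cong: sets_PiM_cong\<close>)
qed

text \<open>A density may take the value \<infinity>, so \<sigma>-finiteness of the reweighted
  measures is a separate assumption. The application has a realisation of the random measure as base
  and \<open>P_aug\<close> as reweighted measure.\<close>

lemma PiM_density:
  assumes M: "\<And>i. sigma_finite_measure (M i)" "\<And>i. sigma_finite_measure (density (M i) (f i))"
    and fin: "finite I" and f[measurable]: "\<And>i. f i \<in> borel_measurable (M i)"
  shows "PiM I (\<lambda>i. density (M i) (f i)) = density (PiM I M) (\<lambda>w. \<Prod>i\<in>I. f i (w i))"
proof -
  interpret M: product_sigma_finite M using M by (simp add: product_sigma_finite_def)
  interpret D: product_sigma_finite "\<lambda>i. density (M i) (f i)" using M by (simp add: product_sigma_finite_def)
  show ?thesis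
  proof (rule D.PiM_eqI[symmetric])
    fix A assume "\<And>i. i \<in> I \<Longrightarrow> A i \<in> sets (density (M i) (f i))"
    then have A[measurable]: "\<And>i. i \<in> I \<Longrightarrow> A i \<in> sets (M i)" by simp
    have m: "(\<lambda>w. \<Prod>i\<in>I. f i (w i)) \<in> borel_measurable (PiM I M)"
      by (intro borel_measurable_prod_ennreal measurable_compose[OF measurable_component_singleton, where g="f i" for i] f)
    have "emeasure (density (PiM I M) (\<lambda>w. \<Prod>i\<in>I. f i (w i))) (Pi\<^sub>E I A) =
        (\<integral>\<^sup>+ w. (\<Prod>i\<in>I. f i (w i)) * indicator (Pi\<^sub>E I A) w \<partial>PiM I M)"
      using fin m by (subst emeasure_density) (auto intro!: sets_PiM_I_finite)
    also have "\<dots> = (\<integral>\<^sup>+ w. (\<Prod>i\<in>I. f i (w i) * indicator (A i) (w i)) \<partial>PiM I M)"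
    proof (intro nn_integral_cong)
      fix w assume w: "w \<in> space (PiM I M)"
      have "indicator (Pi\<^sub>E I A) w = (\<Prod>i\<in>I. indicator (A i) (w i) :: ennreal)"
        using w fin by (auto simp: indicator_def space_PiM PiE_iff prod_zero_iff)
      then show "(\<Prod>i\<in>I. f i (w i)) * indicator (Pi\<^sub>E I A) w = (\<Prod>i\<in>I. f i (w i) * indicator (A i) (w i))"
        by (simp add: prod.distrib)
    qed
    also have "\<dots> = (\<Prod>i\<in>I. (\<integral>\<^sup>+ x. f i x * indicator (A i) x \<partial>M i))"
      using fin by (intro M.product_nn_integral_prod) auto
    also have "\<dots> = (\<Prod>i\<in>I. emeasure (density (M i) (f i)) (A i))"
      by (intro prod.cong refl) (simp add: emeasure_density)
    finally show "emeasure (density (PiM I M) (\<lambda>w. \<Prod>i\<in>I. f i (w i))) (Pi\<^sub>E I A) =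
        (\<Prod>i\<in>I. emeasure (density (M i) (f i)) (A i))" .
  qed (use fin in \<open>simp_all cong: sets_PiM_cong\<close>)
qed

section \<open>The Mecke formula\<close>

definition add_dirac :: "'a measure \<Rightarrow> 'a \<Rightarrow> 'a measure" where
  "add_dirac M x = measure_of (space M) (sets M) (\<lambda>A. emeasure M A + indicator A x)"

lemma sets_add_dirac[simp, measurable_cong]: "sets (add_dirac M x) = sets M"
  by (simp add: add_dirac_def)

lemma space_add_dirac[simp]: "space (add_dirac M x) = space M"
  by (simp add: add_dirac_def)

lemma countably_additive_indicator:
  "countably_additive \<A> (\<lambda>A. indicator A x :: ennreal)"
  by (auto simp: countably_additive_def suminf_indicator)

lemma emeasure_add_dirac:
  assumes "A \<in> sets M"
  shows "emeasure (add_dirac M x) A = emeasure M A + indicator A x"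
  unfolding add_dirac_def
proof (rule emeasure_measure_of_sigma)
  show "countably_additive (sets M) (\<lambda>A. emeasure M A + indicator A x)"
    using emeasure_countably_additive[of M] countably_additive_indicator[of "sets M" x]
    by (auto simp: countably_additive_def suminf_add[symmetric])
qed (auto simp: sets.sigma_algebra_axioms positive_def assms)

lemma nn_integral_add_dirac:
  assumes f: "f \<in> borel_measurable M" and x: "x \<in> space M"
  shows "(\<integral>\<^sup>+ y. f y \<partial>add_dirac M x) = (\<integral>\<^sup>+ y. f y \<partial>M) + f x"
  using f
proof induct
  case (cong f g)
  then show ?case using x by (metis nn_integral_cong space_add_dirac)
next
  case (set B)
  then show ?case by (simp add: emeasure_add_dirac)
next
  case (mult f c)
  then show ?case by (simp add: nn_integral_cmult distrib_left)
next
  case (add f g)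
  then show ?case by (simp add: nn_integral_add ac_simps)
next
  case (seq F)
  have inc: "incseq (\<lambda>i. \<integral>\<^sup>+ y. F i y \<partial>M)" "incseq (\<lambda>i. F i x)"
    using \<open>incseq F\<close> by (auto simp: incseq_def le_fun_def intro!: nn_integral_mono)
  have "(\<integral>\<^sup>+ y. (SUP i. F i y) \<partial>add_dirac M x) = (SUP i. \<integral>\<^sup>+ y. F i y \<partial>add_dirac M x)"
    using seq by (intro nn_integral_monotone_convergence_SUP) auto
  also have "\<dots> = (SUP i. (\<integral>\<^sup>+ y. F i y \<partial>M) + F i x)"
    using seq by simp
  also have "\<dots> = (SUP i. \<integral>\<^sup>+ y. F i y \<partial>M) + (SUP i. F i x)"
    using inc by (simp add: ennreal_SUP_add)
  also have "(SUP i. \<integral>\<^sup>+ y. F i y \<partial>M) = (\<integral>\<^sup>+ y. (SUP i. F i y) \<partial>M)"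
    using seq by (intro nn_integral_monotone_convergence_SUP[symmetric]) auto
  finally show ?case unfolding SUP_apply .
qed

lemma space_boundedly_finite_measures:
  "space (boundedly_finite_measures K bdd) = {M. boundedly_finite K bdd M}"
  by (auto simp: boundedly_finite_measures_def space_restrict_space space_measure_algebra boundedly_finite_def)

lemma measurable_ident_boundedly_finite_measures:
  "(\<lambda>M. M) \<in> measurable (boundedly_finite_measures K bdd) (measure_algebra K)"
  by (simp add: boundedly_finite_measures_def measurable_restrict_space1)

lemma measurable_boundedly_finite_measures:
  assumes "\<And>a. a \<in> space M \<Longrightarrow> boundedly_finite K bdd (\<kappa> a)"
    and "\<And>A. A \<in> sets K \<Longrightarrow> (\<lambda>a. emeasure (\<kappa> a) A) \<in> borel_measurable M"
  shows "\<kappa> \<in> measurable M (boundedly_finite_measures K bdd)"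
  unfolding boundedly_finite_measures_def
  using assms by (intro measurable_restrict_space2 measurable_measure_algebra)
    (auto simp: boundedly_finite_def)

lemma sigma_kernel_boundedly_finite_measures:
  fixes B :: "nat \<Rightarrow> 'a set"
  assumes "range B \<subseteq> sets K" "(\<Union>k. B k) = space K" "\<And>k. bdd (B k)"
  shows "sigma_kernel (boundedly_finite_measures K bdd) K (\<lambda>M. M)"
  unfolding sigma_kernel_def
  using assms measurable_ident_boundedly_finite_measures
  by (auto simp: space_boundedly_finite_measures boundedly_finite_def intro!: exI[of _ B])

lemma boundedly_finite_add_dirac:
  "boundedly_finite K bdd M \<Longrightarrow> boundedly_finite K bdd (add_dirac M x)"
  by (auto simp: boundedly_finite_def emeasure_add_dirac split: split_indicator)

text \<open>One sequence \<open>B\<close> serves two ends: boundedness makes all realisations of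
  \<open>N\<close> finite on the same sets, so that they form a \<open>sigma_kernel\<close>, and
  finite intensity allows the Mecke formula to be localised.\<close>

locale poisson_process =
  fixes \<Omega> :: "'o measure" and K :: "'a measure" and bdd :: "'a set \<Rightarrow> bool"
    and \<nu> :: "'a measure" and N :: "'o \<Rightarrow> 'a measure" and B :: "nat \<Rightarrow> 'a set"
  assumes prm: "poisson_random_measure \<Omega> K bdd \<nu> N"
    and sets_\<nu>[measurable_cong]: "sets \<nu> = sets K"
    and B: "range B \<subseteq> sets K" "(\<Union>k. B k) = space K" "\<And>k. bdd (B k)" "\<And>k. emeasure \<nu> (B k) < \<infinity>"

sublocale poisson_process \<subseteq> prob_space \<Omega>
  using prm by (simp add: poisson_random_measure_def)

section \<open>Size biasing of Poisson counts and the Mecke formula on cylinders\<close>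

context poisson_process begin

abbreviation "R \<equiv> boundedly_finite_measures K bdd"
abbreviation "L \<equiv> distr \<Omega> R N"

lemma N[measurable]: "N \<in> measurable \<Omega> R"
  using prm by (simp add: poisson_random_measure_def)

lemma sigma_finite_\<nu>: "sigma_finite_measure \<nu>"
  using B sets_\<nu> sets_eq_imp_space_eq[OF sets_\<nu>]
  by (intro sigma_finite_measure.intro exI[of _ "range B"]) (auto simp: less_top)

lemma sigma_kernel_R: "sigma_kernel R K (\<lambda>M. M)"
  using B by (intro sigma_kernel_boundedly_finite_measures) auto

lemma prob_space_L: "prob_space L"
  by (rule prob_space_distr) measurable

lemma measurable_emeasure_R[measurable]:
  "A \<in> sets K \<Longrightarrow> (\<lambda>M. emeasure M A) \<in> borel_measurable R"
  using measurable_compose[OF measurable_ident_boundedly_finite_measures measurable_emeasure_measure_algebra] .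

lemma sets_N: "\<omega> \<in> space \<Omega> \<Longrightarrow> sets (N \<omega>) = sets K"
  using measurable_space[OF N, of \<omega>] by (simp add: space_boundedly_finite_measures boundedly_finite_def)

text \<open>The Stein-Chen identity of the Poisson law, which is the Mecke formula for a single set
  and a function of its count. With p k = exp (- l) l^k / k!, it is the relation (k + 1) p (k + 1) =
  l p k summed over k.\<close>

lemma poisson_size_bias:
  assumes D[measurable]: "D \<in> sets K" and fin: "emeasure \<nu> D < \<infinity>"
    and g[measurable]: "g \<in> borel_measurable borel"
  shows "(\<integral>\<^sup>+ x. x * g x \<partial>distr \<Omega> borel (\<lambda>\<omega>. emeasure (N \<omega>) D)) =
    emeasure \<nu> D * (\<integral>\<^sup>+ x. g (x + 1) \<partial>distr \<Omega> borel (\<lambda>\<omega>. emeasure (N \<omega>) D))"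
proof -
  define P where "P = distr \<Omega> borel (\<lambda>\<omega>. emeasure (N \<omega>) D)"
  interpret P: prob_space P unfolding P_def by (rule prob_space_distr) measurable
  have [measurable_cong]: "sets P = sets borel" by (simp add: P_def)
  define l where "l = measure \<nu> D"
  have l: "0 \<le> l" "emeasure \<nu> D = ennreal l"
    using fin by (auto simp: l_def emeasure_eq_ennreal_measure less_top)
  define p where "p k = exp (- l) * l ^ k / fact k" for k :: nat
  have p0: "0 \<le> p k" for k using l by (simp add: p_def)
  have P_k: "emeasure P {of_nat k} = ennreal (p k)" for k :: nat
  proof -
    have "emeasure P {of_nat k} = emeasure \<Omega> {\<omega> \<in> space \<Omega>. emeasure (N \<omega>) D = of_nat k}"
      unfolding P_def by (subst emeasure_distr) (auto intro!: arg_cong[where f="emeasure \<Omega>"])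
    also have "\<dots> = ennreal (p k)"
      using prm D fin by (simp add: emeasure_eq_measure poisson_random_measure_def p_def l_def)
    finally show ?thesis .
  qed
  have sum_indicator: "(\<Sum>k. c k * indicator {of_nat k} x) =
      (if x \<in> range of_nat then c (the_inv of_nat x) else 0)" for c :: "nat \<Rightarrow> ennreal" and x :: ennreal
  proof (cases "x \<in> range of_nat")
    case True
    then obtain j where x: "x = of_nat j" by auto
    have "(\<Sum>k. c k * indicator {of_nat k} x) = (\<Sum>k\<in>{j}. c k * indicator {of_nat k} x)"
      by (rule suminf_finite) (auto simp: x indicator_def)
    then show ?thesis using x by (simp add: the_inv_f_f inj_of_nat)
  next
    case False
    then have "(\<lambda>k. c k * indicator {of_nat k} x) = (\<lambda>_. 0)" by (auto simp: indicator_def fun_eq_iff)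
    with False show ?thesis by (simp only: suminf_zero if_False)
  qed
  have int_P: "(\<integral>\<^sup>+ x. f x \<partial>P) = (\<Sum>k. f (of_nat k) * ennreal (p k))"
    if [measurable]: "f \<in> borel_measurable borel" for f
  proof -
    have "(\<lambda>k. l ^ k /\<^sub>R fact k) sums exp l" by (rule exp_converges)
    then have "(\<lambda>k. exp (- l) * (l ^ k /\<^sub>R fact k)) sums (exp (- l) * exp l)"
      by (rule sums_mult)
    then have "p sums 1"
      by (simp add: p_def[abs_def] exp_minus divide_inverse mult_ac)
    then have sum_p: "(\<Sum>k. ennreal (p k)) = 1"
      using suminf_ennreal_eq[OF p0] by fastforce
    have "emeasure P (range of_nat) = (\<Sum>k. emeasure P {of_nat k})"
      by (subst suminf_emeasure)
         (auto simp: disjoint_family_on_def intro!: arg_cong[where f="emeasure P"])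
    then have "emeasure P (range of_nat) = 1" by (simp add: P_k sum_p)
    \<comment> \<open>\<open>poisson_random_measure\<close> prescribes only the probabilities of the
      integer values of the count. Since these already sum to 1, the count is almost surely an
      integer.\<close>
    then have ae: "AE x in P. x \<in> range of_nat"
      by (intro P.AE_prob_1[OF measure_eq_emeasure_eq_ennreal[where x=1]]) simp_all
    have "(\<integral>\<^sup>+ x. f x \<partial>P) = (\<integral>\<^sup>+ x. (\<Sum>k. f (of_nat k) * indicator {of_nat k} x) \<partial>P)"
      using ae by (intro nn_integral_cong_AE) (auto simp: sum_indicator the_inv_f_f inj_of_nat elim!: eventually_mono)
    also have "\<dots> = (\<Sum>k. \<integral>\<^sup>+ x. f (of_nat k) * indicator {of_nat k} x \<partial>P)"
      by (rule nn_integral_suminf) measurable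
    also have "\<dots> = (\<Sum>k. f (of_nat k) * ennreal (p k))"
      by (simp add: nn_integral_cmult_indicator P_k)
    finally show ?thesis .
  qed
  define F where "F k = of_nat k * g (of_nat k) * ennreal (p k)" for k
  have F_Suc: "F (Suc k) = ennreal l * (g (of_nat k + 1) * ennreal (p k))" for k
  proof -
    have "real (Suc k) * p (Suc k) = l * p k"
      by (simp add: p_def field_simps del: of_nat_Suc)
    then have "ennreal (real (Suc k)) * ennreal (p (Suc k)) = ennreal l * ennreal (p k)"
      using l p0 by (simp add: ennreal_mult[symmetric] del: of_nat_Suc)
    then have "of_nat (Suc k) * ennreal (p (Suc k)) = ennreal l * ennreal (p k)"
      by (simp add: ennreal_of_nat_eq_real_of_nat del: of_nat_Suc)
    then have "F (Suc k) = g (of_nat (Suc k)) * (ennreal l * ennreal (p k))"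
      unfolding F_def by (metis mult.assoc mult.commute)
    then show ?thesis by (simp add: ac_simps)
  qed
  \<comment> \<open>The factor \<open>of_nat k\<close> makes \<open>F 0\<close> vanish, so the
    series may start at 1 and be shifted by one.\<close>
  have "(\<lambda>k. F (Suc k)) sums (\<Sum>k. F (Suc k))" by (rule summable_sums) simp
  then have "F sums ((\<Sum>k. F (Suc k)) + F 0)" by (rule sums_Suc)
  then have "F sums (\<Sum>k. F (Suc k))" by (simp add: F_def[of 0])
  then have "(\<Sum>k. F k) = (\<Sum>k. F (Suc k))" by (rule sums_unique[symmetric])
  then show ?thesis
    by (simp add: P_def[symmetric] int_P F_def[symmetric] F_Suc l)
qed

text \<open>Counts of disjoint sets are independent, so the law of \<open>X\<close> is a product
  measure. With the other coordinates held fixed, the claim is \<open>poisson_size_bias\<close> in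
  coordinate \<open>j\<close>.\<close>

lemma poisson_size_bias_family:
  fixes D :: "nat \<Rightarrow> 'a set"
  assumes I: "finite I" "j \<in> I" and D: "D ` I \<subseteq> sets K" "disjoint_family_on D I"
    and fin: "emeasure \<nu> (D j) < \<infinity>" and H[measurable]: "H \<in> borel_measurable (PiM I (\<lambda>_. borel))"
  defines "X \<equiv> \<lambda>\<omega>. \<lambda>i\<in>I. emeasure (N \<omega>) (D i)"
  shows "(\<integral>\<^sup>+ \<omega>. emeasure (N \<omega>) (D j) * H (X \<omega>) \<partial>\<Omega>) =
    emeasure \<nu> (D j) * (\<integral>\<^sup>+ \<omega>. H ((X \<omega>)(j := emeasure (N \<omega>) (D j) + 1)) \<partial>\<Omega>)"
proof -
  have Dj[measurable]: "D j \<in> sets K" using D I by auto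
  have D'[measurable]: "i \<in> I \<Longrightarrow> D i \<in> sets K" for i using D by auto
  have X[measurable]: "X \<in> measurable \<Omega> (PiM I (\<lambda>_. borel))"
    unfolding X_def by (intro measurable_restrict) measurable
  \<comment> \<open>Outside \<open>I\<close> any probability measure does; it makes \<open>P\<close>
    \<sigma>-finite at every index, as \<open>product_sigma_finite\<close> demands.\<close>
  define P where "P i = (if i \<in> I then distr \<Omega> borel (\<lambda>\<omega>. emeasure (N \<omega>) (D i)) else return borel 0)" for i
  have prob_P: "prob_space (P i)" for i
    by (auto simp: P_def intro!: prob_space_distr prob_space_return)
  then interpret P: product_sigma_finite P
    by (auto simp: product_sigma_finite_def intro!: prob_space_imp_sigma_finite)
  have sets_P[simp, measurable_cong]: "sets (P i) = sets borel" for i by (simp add: P_def)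
  have sets_PiM_P: "sets (PiM J P) = sets (PiM J (\<lambda>_. borel))" for J
    by (intro sets_PiM_cong) auto
  note [measurable_cong] = sets_PiM_P
  have "indep_vars (\<lambda>_. borel) (\<lambda>i \<omega>. emeasure (N \<omega>) (D i)) I"
    using prm I D by (simp add: poisson_random_measure_def)
  then have "distr \<Omega> (PiM I (\<lambda>_. borel)) X = PiM I (\<lambda>i. distr \<Omega> borel (\<lambda>\<omega>. emeasure (N \<omega>) (D i)))"
    using I unfolding X_def by (subst (asm) indep_vars_iff_distr_eq_PiM') auto
  also have "\<dots> = PiM I P" by (intro PiM_cong) (auto simp: P_def)
  finally have law: "distr \<Omega> (PiM I (\<lambda>_. borel)) X = PiM I P" .
  define I' where "I' = I - {j}"
  have I': "I = insert j I'" "j \<notin> I'" "finite I'" using I by (auto simp: I'_def)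
  have upd[measurable]: "(\<lambda>x. x(j := x j + 1)) \<in> measurable (PiM I (\<lambda>_. borel)) (PiM I (\<lambda>_. borel :: ennreal measure))"
  proof (rule measurable_PiM_single')
    fix i assume "i \<in> I"
    then show "(\<lambda>x. (x(j := x j + 1)) i) \<in> borel_measurable (PiM I (\<lambda>_. borel :: ennreal measure))"
      using I by (cases "i = j") simp_all
  qed (use I in \<open>auto simp: space_PiM PiE_iff extensional_def\<close>)
  have "(\<integral>\<^sup>+ \<omega>. emeasure (N \<omega>) (D j) * H (X \<omega>) \<partial>\<Omega>) = (\<integral>\<^sup>+ \<omega>. (X \<omega> j) * H (X \<omega>) \<partial>\<Omega>)"
    using I by (simp add: X_def)
  also have "\<dots> = (\<integral>\<^sup>+ x. x j * H x \<partial>PiM I P)"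
    using I by (subst law[symmetric], subst nn_integral_distr) measurable
  also have "\<dots> = (\<integral>\<^sup>+ x. (\<integral>\<^sup>+ t. t * H (x(j := t)) \<partial>P j) \<partial>PiM I' P)"
    using I' H unfolding I'(1)
    by (subst P.product_nn_integral_insert) (auto cong: measurable_cong_sets sets_PiM_cong)
  also have "\<dots> = (\<integral>\<^sup>+ x. emeasure \<nu> (D j) * (\<integral>\<^sup>+ t. H (x(j := t + 1)) \<partial>P j) \<partial>PiM I' P)"
  proof (intro nn_integral_cong)
    fix x assume "x \<in> space (PiM I' P)"
    then have x: "x \<in> space (PiM I' (\<lambda>_. borel))" by (simp add: sets_eq_imp_space_eq[OF sets_PiM_P])
    have "(\<lambda>t. x(j := t)) \<in> measurable borel (PiM I (\<lambda>_. borel))"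
      using x I' by (intro measurable_fun_upd[where J=I']) auto
    from measurable_compose[OF this H] have [measurable]: "(\<lambda>t. H (x(j := t))) \<in> borel_measurable borel" .
    show "(\<integral>\<^sup>+ t. t * H (x(j := t)) \<partial>P j) = emeasure \<nu> (D j) * (\<integral>\<^sup>+ t. H (x(j := t + 1)) \<partial>P j)"
      using poisson_size_bias[OF Dj fin, of "\<lambda>t. H (x(j := t))"] I by (simp add: P_def)
  qed
  also have "\<dots> = emeasure \<nu> (D j) * (\<integral>\<^sup>+ x. (\<integral>\<^sup>+ t. H (x(j := t + 1)) \<partial>P j) \<partial>PiM I' P)"
  proof (rule nn_integral_cmult)
    have "(\<lambda>(x, t). x(j := t + 1)) \<in> measurable (PiM I' (\<lambda>_. borel) \<Otimes>\<^sub>M borel) (PiM I (\<lambda>_. borel :: ennreal measure))"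
      using I' unfolding split_beta' by (intro measurable_fun_upd[where J=I']) auto
    from measurable_compose[OF this H]
    have "(\<lambda>(x, t). H (x(j := t + 1))) \<in> borel_measurable (PiM I' P \<Otimes>\<^sub>M P j)"
      by (simp add: split_beta' cong: measurable_cong_sets sets_pair_measure_cong sets_PiM_cong)
    then show "(\<lambda>x. \<integral>\<^sup>+ t. H (x(j := t + 1)) \<partial>P j) \<in> borel_measurable (PiM I' P)"
      by (rule P.M.borel_measurable_nn_integral)
  qed
  also have "(\<integral>\<^sup>+ x. (\<integral>\<^sup>+ t. H (x(j := t + 1)) \<partial>P j) \<partial>PiM I' P) = (\<integral>\<^sup>+ x. H (x(j := x j + 1)) \<partial>PiM I P)"
    using I' H upd unfolding I'(1)
    by (subst P.product_nn_integral_insert) (auto cong: measurable_cong_sets sets_PiM_cong)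
  also have "\<dots> = (\<integral>\<^sup>+ \<omega>. H ((X \<omega>)(j := X \<omega> j + 1)) \<partial>\<Omega>)"
    using I by (subst law[symmetric], subst nn_integral_distr) measurable
  finally have "(\<integral>\<^sup>+ \<omega>. emeasure (N \<omega>) (D j) * H (X \<omega>) \<partial>\<Omega>) =
      emeasure \<nu> (D j) * (\<integral>\<^sup>+ \<omega>. H ((X \<omega>)(j := X \<omega> j + 1)) \<partial>\<Omega>)" .
  moreover have "X \<omega> j = emeasure (N \<omega>) (D j)" for \<omega> using I by (simp add: X_def)
  ultimately show ?thesis by simp
qed


text \<open>The family \<open>C\<close> is refined to the atoms of the algebra it generates, which are indexed
  by (codes of) subsets of \<open>{..<m}\<close>; on disjoint sets the Poisson counts are independent.\<close>

lemma mecke_cylinder: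
  fixes C :: "nat \<Rightarrow> 'a set" and S :: "nat \<Rightarrow> ennreal set"
  assumes m: "0 < m" and C: "\<And>i. i < m \<Longrightarrow> C i \<in> sets K" and fin: "emeasure \<nu> (C 0) < \<infinity>"
    and S: "\<And>i. i < m \<Longrightarrow> S i \<in> sets borel"
  shows "(\<integral>\<^sup>+ \<omega>. emeasure (N \<omega>) (C 0) * (\<Prod>i<m. indicator (S i) (emeasure (N \<omega>) (C i))) \<partial>\<Omega>) =
    (\<integral>\<^sup>+ w. indicator (C 0) w *
      (\<integral>\<^sup>+ \<omega>. (\<Prod>i<m. indicator (S i) (emeasure (N \<omega>) (C i) + indicator (C i) w)) \<partial>\<Omega>) \<partial>\<nu>)"
proof -
  \<comment> \<open>Independence in \<open>poisson_random_measure\<close> is stated for families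
    indexed by natural numbers, whence the coding by \<open>set_encode\<close>. On the atom
    \<open>D k\<close> membership in the sets \<open>C i\<close> is decided by
    \<open>set_decode k\<close>, and \<open>I' i\<close> collects the atoms that make up
    \<open>C i\<close>.\<close>
  define I where "I = set_encode ` Pow {..<m}"
  define D where "D k = {w \<in> space K. \<forall>i<m. w \<in> C i \<longleftrightarrow> i \<in> set_decode k}" for k
  define I' where "I' i = {k \<in> I. i \<in> set_decode k}" for i
  have finI: "finite I" by (simp add: I_def)
  then have finI': "finite (I' i)" for i by (simp add: I'_def)
  have decode: "set_decode k \<subseteq> {..<m}" if "k \<in> I" for k
    using that finite_subset[OF _ finite_lessThan[of m]] by (auto simp: I_def set_encode_inverse)
  have D_sets[measurable]: "D k \<in> sets K" for k
  proof -
    define E where "E i = (if i \<in> set_decode k then C i else space K - C i)" for i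
    have E: "E i \<in> sets K" if "i < m" for i using C[OF that] by (simp add: E_def)
    have "w \<in> E i \<longleftrightarrow> (w \<in> C i \<longleftrightarrow> i \<in> set_decode k)" if "w \<in> space K" for w i
      using that by (simp add: E_def)
    then have "D k = space K \<inter> (\<Inter>i\<in>{..<m}. E i)"
      unfolding D_def by blast
    also have "\<dots> \<in> sets K"
      using E m by (intro sets.Int sets.finite_INT) auto
    finally show ?thesis .
  qed
  have disj: "disjoint_family_on D I"
    unfolding disjoint_family_on_def
  proof (intro ballI impI)
    fix k k' assume k: "k \<in> I" "k' \<in> I" "k \<noteq> k'"
    have False if "w \<in> D k" "w \<in> D k'" for w
    proof -
      have "set_decode k = set_decode k'"
        using that decode[OF k(1)] decode[OF k(2)] by (auto simp: D_def subset_eq)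
      then show False using k(3) by (metis set_decode_inverse)
    qed
    then show "D k \<inter> D k' = {}" by auto
  qed
  have C_eq: "C i = (\<Union>k\<in>I' i. D k)" if i: "i < m" for i
  proof (intro equalityI subsetI)
    fix w assume w: "w \<in> C i"
    define k where "k = set_encode {i. i < m \<and> w \<in> C i}"
    have k: "set_decode k = {i. i < m \<and> w \<in> C i}"
      unfolding k_def by (rule set_encode_inverse) simp
    have "k \<in> I" unfolding I_def k_def by auto
    moreover have "w \<in> D k" using w sets.sets_into_space[OF C[OF i]] by (auto simp: D_def k)
    ultimately show "w \<in> (\<Union>k\<in>I' i. D k)" using w i by (auto simp: I'_def k)
  qed (use i in \<open>auto simp: I'_def D_def\<close>)
  have sum_C: "emeasure M (C i) = (\<Sum>k\<in>I' i. emeasure M (D k))" if i: "i < m" and M: "sets M = sets K" for M i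
    unfolding C_eq[OF i] using disj M
    by (intro sum_emeasure[symmetric] finI') (auto simp: I'_def disjoint_family_on_def)
  define X where "X \<omega> = (\<lambda>k\<in>I. emeasure (N \<omega>) (D k))" for \<omega>
  define H :: "(nat \<Rightarrow> ennreal) \<Rightarrow> ennreal" where "H x = (\<Prod>i<m. indicator (S i) (\<Sum>k\<in>I' i. x k))" for x
  have H[measurable]: "H \<in> borel_measurable (PiM I (\<lambda>_. borel))"
  proof -
    have "(\<lambda>x. \<Sum>k\<in>I' i. x k) \<in> borel_measurable (PiM I (\<lambda>_. borel :: ennreal measure))" for i
      by (intro borel_measurable_sum measurable_component_singleton) (auto simp: I'_def)
    then show ?thesis unfolding H_def
      using S by (intro borel_measurable_prod_ennreal measurable_compose[OF _ borel_measurable_indicator[where M=borel]]) auto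
  qed
  have X[measurable]: "X \<in> measurable \<Omega> (PiM I (\<lambda>_. borel))"
    unfolding X_def by (intro measurable_restrict) measurable
  have X_sum: "(\<Sum>k\<in>I' i. X \<omega> k) = emeasure (N \<omega>) (C i)" if "i < m" "\<omega> \<in> space \<Omega>" for i \<omega>
    using sum_C[OF that(1) sets_N[OF that(2)]] by (simp add: X_def I'_def)
  have fin_D: "emeasure \<nu> (D j) < \<infinity>" if "j \<in> I' 0" for j
  proof -
    have "emeasure \<nu> (D j) \<le> emeasure \<nu> (C 0)"
      using that m C[of 0] sets_\<nu> by (intro emeasure_mono) (auto simp: I'_def D_def)
    with fin show ?thesis by simp
  qed
  \<comment> \<open>A point \<open>w\<close> of the atom \<open>D j\<close> lies in
    \<open>C i\<close> exactly if \<open>j\<close> is among the atoms of \<open>C i\<close>. Raising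
    the count of \<open>D j\<close> by 1 therefore changes all the sums as adding the point
    \<open>w\<close> would.\<close>
  have shift: "H ((X \<omega>)(j := X \<omega> j + 1)) =
      (\<Prod>i<m. indicator (S i) (emeasure (N \<omega>) (C i) + indicator (C i) w))"
    if j: "j \<in> I" and w: "w \<in> D j" and \<omega>: "\<omega> \<in> space \<Omega>" for j w \<omega>
  proof -
    have "(\<Sum>k\<in>I' i. ((X \<omega>)(j := X \<omega> j + 1)) k) = emeasure (N \<omega>) (C i) + indicator (C i) w" if i: "i < m" for i
    proof -
      have "(\<Sum>k\<in>I' i. ((X \<omega>)(j := X \<omega> j + 1)) k) = (\<Sum>k\<in>I' i. X \<omega> k + (if j = k then 1 else 0))"
        by (intro sum.cong) auto
      also have "\<dots> = (\<Sum>k\<in>I' i. X \<omega> k) + (if j \<in> I' i then 1 else 0)"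
        using finI'[of i] by (simp add: sum.distrib)
      also have "(if j \<in> I' i then 1 else 0) = (indicator (C i) w :: ennreal)"
        using w i j by (auto simp: D_def I'_def)
      finally show ?thesis using X_sum[OF i \<omega>] by simp
    qed
    then show ?thesis by (simp add: H_def)
  qed
  have "(\<integral>\<^sup>+ \<omega>. emeasure (N \<omega>) (C 0) * (\<Prod>i<m. indicator (S i) (emeasure (N \<omega>) (C i))) \<partial>\<Omega>) =
      (\<integral>\<^sup>+ \<omega>. (\<Sum>j\<in>I' 0. emeasure (N \<omega>) (D j) * H (X \<omega>)) \<partial>\<Omega>)"
  proof (intro nn_integral_cong)
    fix \<omega> assume \<omega>: "\<omega> \<in> space \<Omega>"
    have "(\<Prod>i<m. indicator (S i) (emeasure (N \<omega>) (C i))) = H (X \<omega>)"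
      using X_sum[OF _ \<omega>] by (simp add: H_def)
    then show "emeasure (N \<omega>) (C 0) * (\<Prod>i<m. indicator (S i) (emeasure (N \<omega>) (C i))) =
        (\<Sum>j\<in>I' 0. emeasure (N \<omega>) (D j) * H (X \<omega>))"
      by (simp add: sum_C[OF m sets_N[OF \<omega>]] sum_distrib_right)
  qed
  also have "\<dots> = (\<Sum>j\<in>I' 0. \<integral>\<^sup>+ \<omega>. emeasure (N \<omega>) (D j) * H (X \<omega>) \<partial>\<Omega>)"
    by (rule nn_integral_sum) measurable
  also have "\<dots> = (\<Sum>j\<in>I' 0. \<integral>\<^sup>+ w. indicator (D j) w * (indicator (C 0) w *
      (\<integral>\<^sup>+ \<omega>. (\<Prod>i<m. indicator (S i) (emeasure (N \<omega>) (C i) + indicator (C i) w)) \<partial>\<Omega>)) \<partial>\<nu>)"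
  proof (intro sum.cong refl)
    fix j assume j: "j \<in> I' 0"
    then have jI: "j \<in> I" by (simp add: I'_def)
    \<comment> \<open>The shifted expectation is the same for every \<open>w\<close> in
      \<open>D j\<close>, so \<open>emeasure \<nu> (D j) * c\<close> can be written as its integral
      over \<open>D j\<close>.\<close>
    define c where "c = (\<integral>\<^sup>+ \<omega>. H ((X \<omega>)(j := X \<omega> j + 1)) \<partial>\<Omega>)"
    have "(\<integral>\<^sup>+ \<omega>. emeasure (N \<omega>) (D j) * H (X \<omega>) \<partial>\<Omega>) = emeasure \<nu> (D j) * c"
    proof -
      have Xj: "X \<omega> j = emeasure (N \<omega>) (D j)" for \<omega> using jI by (simp add: X_def)
      have DI: "D ` I \<subseteq> sets K" using D_sets by auto
      show ?thesis unfolding c_def Xj unfolding X_def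
        by (rule poisson_size_bias_family[OF finI jI DI disj fin_D[OF j] H])
    qed
    also have "\<dots> = (\<integral>\<^sup>+ w. c * indicator (D j) w \<partial>\<nu>)"
      by (subst nn_integral_cmult_indicator) (auto simp: sets_\<nu> mult.commute)
    also have "\<dots> = (\<integral>\<^sup>+ w. indicator (D j) w * (indicator (C 0) w *
      (\<integral>\<^sup>+ \<omega>. (\<Prod>i<m. indicator (S i) (emeasure (N \<omega>) (C i) + indicator (C i) w)) \<partial>\<Omega>)) \<partial>\<nu>)"
    proof (intro nn_integral_cong)
      fix w
      show "c * indicator (D j) w = indicator (D j) w * (indicator (C 0) w *
        (\<integral>\<^sup>+ \<omega>. (\<Prod>i<m. indicator (S i) (emeasure (N \<omega>) (C i) + indicator (C i) w)) \<partial>\<Omega>))"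
      proof (cases "w \<in> D j")
        case True
        then have "w \<in> C 0" using m j by (auto simp: D_def I'_def)
        moreover have "c = (\<integral>\<^sup>+ \<omega>. (\<Prod>i<m. indicator (S i) (emeasure (N \<omega>) (C i) + indicator (C i) w)) \<partial>\<Omega>)"
          unfolding c_def using shift[OF jI True] by (intro nn_integral_cong) simp
        ultimately show ?thesis using True by simp
      qed simp
    qed
    finally show "(\<integral>\<^sup>+ \<omega>. emeasure (N \<omega>) (D j) * H (X \<omega>) \<partial>\<Omega>) = \<dots>" .
  qed
  also have "\<dots> = (\<integral>\<^sup>+ w. (\<Sum>j\<in>I' 0. indicator (D j) w * (indicator (C 0) w *
      (\<integral>\<^sup>+ \<omega>. (\<Prod>i<m. indicator (S i) (emeasure (N \<omega>) (C i) + indicator (C i) w)) \<partial>\<Omega>))) \<partial>\<nu>)"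
  proof (rule nn_integral_sum[symmetric])
    fix j
    have [measurable]: "i < m \<Longrightarrow> (\<lambda>(w, \<omega>). emeasure (N \<omega>) (C i) + indicator (C i) w)
        \<in> borel_measurable (\<nu> \<Otimes>\<^sub>M \<Omega>)" for i
      using C[of i] by measurable
    have "(\<lambda>(w, \<omega>). \<Prod>i<m. indicator (S i) (emeasure (N \<omega>) (C i) + indicator (C i) w) :: ennreal)
        \<in> borel_measurable (\<nu> \<Otimes>\<^sub>M \<Omega>)"
      using S unfolding split_beta'
      by (intro borel_measurable_prod_ennreal measurable_compose[OF _ borel_measurable_indicator[where M=borel]]) auto
    then show "(\<lambda>w. indicator (D j) w * (indicator (C 0) w *
      (\<integral>\<^sup>+ \<omega>. (\<Prod>i<m. indicator (S i) (emeasure (N \<omega>) (C i) + indicator (C i) w)) \<partial>\<Omega>)))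
        \<in> borel_measurable \<nu>"
      using C[OF m] D_sets sets_\<nu>
      by (intro borel_measurable_times_ennreal borel_measurable_indicator borel_measurable_nn_integral) auto
  qed
  also have "\<dots> = (\<integral>\<^sup>+ w. indicator (C 0) w *
      (\<integral>\<^sup>+ \<omega>. (\<Prod>i<m. indicator (S i) (emeasure (N \<omega>) (C i) + indicator (C i) w)) \<partial>\<Omega>) \<partial>\<nu>)"
  proof (intro nn_integral_cong)
    fix w
    have "(\<Sum>j\<in>I' 0. indicator (D j) w) = (indicator (\<Union>j\<in>I' 0. D j) w :: ennreal)"
      using disj by (intro indicator_UN_disjoint[symmetric] finI') (auto simp: disjoint_family_on_def I'_def)
    also have "\<dots> = indicator (C 0) w" by (simp add: C_eq[OF m])
    finally show "(\<Sum>j\<in>I' 0. indicator (D j) w * (indicator (C 0) w *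
      (\<integral>\<^sup>+ \<omega>. (\<Prod>i<m. indicator (S i) (emeasure (N \<omega>) (C i) + indicator (C i) w)) \<partial>\<Omega>))) =
      indicator (C 0) w *
      (\<integral>\<^sup>+ \<omega>. (\<Prod>i<m. indicator (S i) (emeasure (N \<omega>) (C i) + indicator (C i) w)) \<partial>\<Omega>)"
      by (simp add: sum_distrib_right[symmetric] indicator_def)
  qed
  finally show ?thesis .
qed

end

section \<open>From cylinders to all measurable integrands\<close>

context poisson_process begin

lemma measurable_add_dirac[measurable (raw)]:
  assumes f: "f \<in> measurable Z K" and g: "g \<in> measurable Z R"
  shows "(\<lambda>z. add_dirac (g z) (f z)) \<in> measurable Z R"
proof (rule measurable_boundedly_finite_measures)
  fix z assume "z \<in> space Z"
  then show "boundedly_finite K bdd (add_dirac (g z) (f z))"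
    using measurable_space[OF g]
    by (auto simp: space_boundedly_finite_measures intro!: boundedly_finite_add_dirac)
next
  fix A assume A[measurable]: "A \<in> sets K"
  have "(\<lambda>z. emeasure (g z) A + indicator A (f z)) \<in> borel_measurable Z"
    using f g by measurable
  moreover have "sets (g z) = sets K" if "z \<in> space Z" for z
    using measurable_space[OF g that]
    by (simp add: space_boundedly_finite_measures boundedly_finite_def)
  ultimately show "(\<lambda>z. emeasure (add_dirac (g z) (f z)) A) \<in> borel_measurable Z"
    using A by (subst measurable_cong[where g="\<lambda>z. emeasure (g z) A + indicator A (f z)"])
      (auto simp: emeasure_add_dirac)
qed

lemma measurable_nn_integral_R:
  "(\<lambda>(z, w). F z w) \<in> borel_measurable (Z \<Otimes>\<^sub>M K) \<Longrightarrow> g \<in> measurable Z R \<Longrightarrow>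
    (\<lambda>z. \<integral>\<^sup>+ w. F z w \<partial>g z) \<in> borel_measurable Z"
  using sigma_kernel_compose[OF _ sigma_kernel_R] by (rule measurable_nn_integral_sigma_kernel)

text \<open>Only marks in sets of finite intensity are used, so that both sides of the Mecke formula are
  finite on the generator.\<close>

definition cylinders :: "('a measure \<times> 'a) set set" where
  "cylinders = {{M \<in> space R. \<forall>i<m. emeasure M (C i) \<in> S i} \<times> A | A m (C :: nat \<Rightarrow> 'a set) S.
     A \<in> sets K \<and> emeasure \<nu> A < \<infinity> \<and> (\<forall>i<m. C i \<in> sets K \<and> S i \<in> sets borel)}"

lemma cylindersI:
  fixes m :: nat
  shows "A \<in> sets K \<Longrightarrow> emeasure \<nu> A < \<infinity> \<Longrightarrow> (\<And>i. i < m \<Longrightarrow> C i \<in> sets K \<and> S i \<in> sets borel) \<Longrightarrow>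
    {M \<in> space R. \<forall>i<m. emeasure M (C i) \<in> S i} \<times> A \<in> cylinders"
  unfolding cylinders_def
  by (intro CollectI exI[of _ A] exI[of _ m] exI[of _ C] exI[of _ S] conjI refl) auto

lemma cylindersE:
  assumes "E \<in> cylinders"
  obtains A m and C :: "nat \<Rightarrow> 'a set" and S
  where "E = {M \<in> space R. \<forall>i<m. emeasure M (C i) \<in> S i} \<times> A" "A \<in> sets K" "emeasure \<nu> A < \<infinity>"
    "\<forall>i<m. C i \<in> sets K \<and> S i \<in> sets borel"
  using assms unfolding cylinders_def mem_Collect_eq by (elim exE conjE) (rule that)

lemma Int_stable_cylinders: "Int_stable cylinders"
proof (rule Int_stableI)
  fix E E' assume "E \<in> cylinders" "E' \<in> cylinders"
  obtain A m and C :: "nat \<Rightarrow> 'a set" and S where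
    E: "E = {M \<in> space R. \<forall>i<m. emeasure M (C i) \<in> S i} \<times> A" "A \<in> sets K" "emeasure \<nu> A < \<infinity>"
      "\<forall>i<m. C i \<in> sets K \<and> S i \<in> sets borel"
    using cylindersE[OF \<open>E \<in> cylinders\<close>] .
  obtain A' m' and C' :: "nat \<Rightarrow> 'a set" and S' where
    E': "E' = {M \<in> space R. \<forall>i<m'. emeasure M (C' i) \<in> S' i} \<times> A'" "A' \<in> sets K" "emeasure \<nu> A' < \<infinity>"
      "\<forall>i<m'. C' i \<in> sets K \<and> S' i \<in> sets borel"
    using cylindersE[OF \<open>E' \<in> cylinders\<close>] .
  define C2 where "C2 i = (if i < m then C i else C' (i - m))" for i
  define S2 where "S2 i = (if i < m then S i else S' (i - m))" for i
  have "(\<forall>i<m + m'. emeasure M (C2 i) \<in> S2 i) \<longleftrightarrow>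
      (\<forall>i<m. emeasure M (C i) \<in> S i) \<and> (\<forall>i<m'. emeasure M (C' i) \<in> S' i)" for M
  proof safe
    fix i assume *: "\<forall>i<m + m'. emeasure M (C2 i) \<in> S2 i"
    show "emeasure M (C i) \<in> S i" if "i < m"
      using *[rule_format, of i] that by (simp add: C2_def S2_def)
    show "emeasure M (C' i) \<in> S' i" if "i < m'"
      using *[rule_format, of "m + i"] that by (simp add: C2_def S2_def)
  next
    fix i assume "\<forall>i<m. emeasure M (C i) \<in> S i" "\<forall>i<m'. emeasure M (C' i) \<in> S' i" "i < m + m'"
    then show "emeasure M (C2 i) \<in> S2 i" by (auto simp: C2_def S2_def)
  qed
  then have "E \<inter> E' = {M \<in> space R. \<forall>i<m + m'. emeasure M (C2 i) \<in> S2 i} \<times> (A \<inter> A')"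
    unfolding E(1) E'(1) by auto
  also have "emeasure \<nu> (A \<inter> A') < \<infinity>"
    using E(2,3) emeasure_mono[of "A \<inter> A'" A \<nu>] by (auto simp: sets_\<nu> intro: le_less_trans)
  then have "{M \<in> space R. \<forall>i<m + m'. emeasure M (C2 i) \<in> S2 i} \<times> (A \<inter> A') \<in> cylinders"
    using E E' by (intro cylindersI) (auto simp: C2_def S2_def)
  finally show "E \<inter> E' \<in> cylinders" .
qed

lemma cylinders_sets: "cylinders \<subseteq> sets (R \<Otimes>\<^sub>M K)"
proof
  fix E assume "E \<in> cylinders"
  then obtain A m and C :: "nat \<Rightarrow> 'a set" and S where
    E: "E = {M \<in> space R. \<forall>i<m. emeasure M (C i) \<in> S i} \<times> A" "A \<in> sets K"
      "\<forall>i<m. C i \<in> sets K \<and> S i \<in> sets borel"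
    by (rule cylindersE)
  have "{M \<in> space R. emeasure M (C i) \<in> S i} \<in> sets R" if "i < m" for i
  proof -
    have "(\<lambda>M. emeasure M (C i)) -` S i \<inter> space R \<in> sets R"
      using E(3) that by (intro measurable_sets[OF measurable_emeasure_R]) auto
    then show ?thesis by (simp add: vimage_def Int_def conj_commute)
  qed
  then have "{M \<in> space R. \<forall>i\<in>{..<m}. emeasure M (C i) \<in> S i} \<in> sets R"
    by (intro sets.sets_Collect_finite_All) auto
  then show "E \<in> sets (R \<Otimes>\<^sub>M K)"
    unfolding E(1) Ball_def lessThan_iff by (intro pair_measureI E(2))
qed

text \<open>Restricting the marks to finite intensity loses nothing, as a rectangle with an
  arbitrary \<open>A\<close> is the union of its pieces over \<open>A \<inter> B k\<close>.
  Cylinders without constraints (\<open>m = 0\<close>) then make the mark measurable; those with one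
  constraint and \<open>A = space K\<close> do the same for every evaluation, hence for the random
  measure.\<close>

lemma sets_pair_R: "sets (R \<Otimes>\<^sub>M K) = sigma_sets (space R \<times> space K) cylinders"
proof
  have sub: "cylinders \<subseteq> Pow (space R \<times> space K)"
    using cylinders_sets sets.space_closed[of "R \<Otimes>\<^sub>M K"] by (auto simp: space_pair_measure)
  let ?S = "sigma (space R \<times> space K) cylinders"
  have rect: "{M \<in> space R. \<forall>i<m. emeasure M (C i) \<in> S i} \<times> A \<in> sets ?S"
    if A: "A \<in> sets K" and CS: "\<And>i. i < m \<Longrightarrow> C i \<in> sets K \<and> S i \<in> sets borel"
    for A and m :: nat and C :: "nat \<Rightarrow> 'a set" and S
  proof -
    have "{M \<in> space R. \<forall>i<m. emeasure M (C i) \<in> S i} \<times> (A \<inter> B k) \<in> sets ?S" for k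
    proof -
      have "emeasure \<nu> (A \<inter> B k) < \<infinity>"
        using B(1,4) emeasure_mono[of "A \<inter> B k" "B k" \<nu>] by (auto simp: sets_\<nu> intro: le_less_trans)
      then have "{M \<in> space R. \<forall>i<m. emeasure M (C i) \<in> S i} \<times> (A \<inter> B k) \<in> cylinders"
        using A B(1) CS by (intro cylindersI) auto
      then show ?thesis using sub by auto
    qed
    then have "(\<Union>k. {M \<in> space R. \<forall>i<m. emeasure M (C i) \<in> S i} \<times> (A \<inter> B k)) \<in> sets ?S"
      by (intro sets.countable_UN) auto
    also have "(\<Union>k. {M \<in> space R. \<forall>i<m. emeasure M (C i) \<in> S i} \<times> (A \<inter> B k)) =
        {M \<in> space R. \<forall>i<m. emeasure M (C i) \<in> S i} \<times> A"
      using B(2) sets.sets_into_space[OF A] by blast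
    finally show ?thesis .
  qed
  have "snd \<in> measurable ?S K"
  proof (rule measurableI)
    fix A assume A: "A \<in> sets K"
    have "snd -` A \<inter> space ?S = {M \<in> space R. \<forall>i<0::nat. emeasure M (undefined i) \<in> undefined i} \<times> A"
      using sub sets.sets_into_space[OF A] by (auto simp: space_measure_of)
    then show "snd -` A \<inter> space ?S \<in> sets ?S" using rect[OF A, of 0] by simp
  qed (use sub in \<open>auto simp: space_measure_of\<close>)
  moreover have "fst \<in> measurable ?S R"
  proof (rule measurable_boundedly_finite_measures)
    fix A assume A: "A \<in> sets K"
    show "(\<lambda>x. emeasure (fst x) A) \<in> borel_measurable ?S"
    proof (rule measurableI)
      fix U :: "ennreal set" assume U: "U \<in> sets borel"
      have "(\<lambda>x. emeasure (fst x) A) -` U \<inter> space ?S =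
          {M \<in> space R. \<forall>i<Suc 0. emeasure M ((\<lambda>_. A) i) \<in> (\<lambda>_. U) i} \<times> space K"
        using sub by (auto simp: space_measure_of)
      then show "(\<lambda>x. emeasure (fst x) A) -` U \<inter> space ?S \<in> sets ?S"
        using rect[OF sets.top, of "Suc 0" "\<lambda>_. A" "\<lambda>_. U"] A U by simp
    qed simp
  qed (use sub in \<open>auto simp: space_measure_of space_boundedly_finite_measures\<close>)
  ultimately have id: "(\<lambda>x. (fst x, snd x)) \<in> measurable ?S (R \<Otimes>\<^sub>M K)"
    by (intro measurable_Pair)
  show "sets (R \<Otimes>\<^sub>M K) \<subseteq> sigma_sets (space R \<times> space K) cylinders"
  proof
    fix E assume E: "E \<in> sets (R \<Otimes>\<^sub>M K)"
    then have "E \<subseteq> space R \<times> space K" using sets.sets_into_space by (fastforce simp: space_pair_measure)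
    then show "E \<in> sigma_sets (space R \<times> space K) cylinders"
      using measurable_sets[OF id E] sub by (simp add: space_measure_of Int_absorb2)
  qed
  show "sigma_sets (space R \<times> space K) cylinders \<subseteq> sets (R \<Otimes>\<^sub>M K)"
    unfolding space_pair_measure[symmetric] by (intro sets.sigma_sets_subset cylinders_sets)
qed

lemma space_\<nu>: "space \<nu> = space K"
  by (rule sets_eq_imp_space_eq[OF sets_\<nu>])

lemma space_R_D: "M \<in> space R \<Longrightarrow> sets M = sets K" "M \<in> space R \<Longrightarrow> space M = space K"
  by (auto simp: space_boundedly_finite_measures boundedly_finite_def dest: sets_eq_imp_space_eq)

text \<open>\<open>?P\<close> is the Campbell measure of the process, and \<open>?Q\<close> is the
  image of \<open>\<nu> \<Otimes>\<^sub>M L\<close> under adding the point to the configuration.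
  They agree on the intersection-stable \<open>cylinders\<close> by \<open>mecke_cylinder\<close>,
  hence everywhere.\<close>

theorem mecke:
  assumes F: "F \<in> borel_measurable (K \<Otimes>\<^sub>M R)"
  shows "(\<integral>\<^sup>+ M. (\<integral>\<^sup>+ w. F (w, M) \<partial>M) \<partial>L) = (\<integral>\<^sup>+ w. (\<integral>\<^sup>+ M. F (w, add_dirac M w) \<partial>L) \<partial>\<nu>)"
proof -
  interpret L: prob_space L by (rule prob_space_L)
  have sets1: "sets (L \<Otimes>\<^sub>M K) = sets (R \<Otimes>\<^sub>M K)" and sets2: "sets (\<nu> \<Otimes>\<^sub>M L) = sets (K \<Otimes>\<^sub>M R)"
    by (intro sets_pair_measure_cong; simp add: sets_\<nu>)+
  have K1: "sigma_kernel L K (\<lambda>M. M)"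
    by (rule sigma_kernel_compose[OF _ sigma_kernel_R]) (simp add: measurable_ident_sets)
  let ?P = "semidirect L K (\<lambda>M. M)" and ?f = "\<lambda>(w, M). (add_dirac M w, w)"
  let ?Q = "distr (\<nu> \<Otimes>\<^sub>M L) (R \<Otimes>\<^sub>M K) ?f"
  have f: "?f \<in> measurable (\<nu> \<Otimes>\<^sub>M L) (R \<Otimes>\<^sub>M K)"
    unfolding measurable_cong_sets[OF sets2 refl] split_beta'
    by (intro measurable_Pair measurable_add_dirac measurable_fst measurable_snd)
  have intP: "(\<integral>\<^sup>+ x. G x \<partial>?P) = (\<integral>\<^sup>+ M. (\<integral>\<^sup>+ w. G (M, w) \<partial>M) \<partial>L)" if "G \<in> borel_measurable (R \<Otimes>\<^sub>M K)" for G
    by (rule nn_integral_semidirect[OF K1]) (simp only: measurable_cong_sets[OF sets1 refl] that)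
  have intQ: "(\<integral>\<^sup>+ x. G x \<partial>?Q) = (\<integral>\<^sup>+ w. (\<integral>\<^sup>+ M. G (add_dirac M w, w) \<partial>L) \<partial>\<nu>)" if G: "G \<in> borel_measurable (R \<Otimes>\<^sub>M K)" for G
  proof -
    have "(\<integral>\<^sup>+ x. G x \<partial>?Q) = (\<integral>\<^sup>+ x. G (?f x) \<partial>(\<nu> \<Otimes>\<^sub>M L))"
      using f G by (simp add: nn_integral_distr)
    also have "\<dots> = (\<integral>\<^sup>+ w. (\<integral>\<^sup>+ M. G (?f (w, M)) \<partial>L) \<partial>\<nu>)"
      by (rule L.nn_integral_fst[symmetric]) (rule measurable_compose[OF f G])
    finally show ?thesis by simp
  qed
  have "?Q = ?P"
  proof (rule measure_eqI_generator_eq[OF Int_stable_cylinders, where \<Omega>="space R \<times> space K" and A="\<lambda>k. space R \<times> B k"])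
    show "cylinders \<subseteq> Pow (space R \<times> space K)"
      using cylinders_sets sets.space_closed[of "R \<Otimes>\<^sub>M K"] by (auto simp: space_pair_measure)
    show "sets ?P = sigma_sets (space R \<times> space K) cylinders" "sets ?Q = sigma_sets (space R \<times> space K) cylinders"
      using sets1 by (simp_all add: sets_pair_R[symmetric])
    show "range (\<lambda>k. space R \<times> B k) \<subseteq> cylinders"
      using cylindersI[of _ 0] B(1,4) by auto
    show "(\<Union>k. space R \<times> B k) = space R \<times> space K" using B(2) by blast
    fix E assume cyl: "E \<in> cylinders"
    then obtain A m and C :: "nat \<Rightarrow> 'a set" and S where
      E: "E = {M \<in> space R. \<forall>i<m. emeasure M (C i) \<in> S i} \<times> A" "A \<in> sets K" "emeasure \<nu> A < \<infinity>"
        "\<forall>i<m. C i \<in> sets K \<and> S i \<in> sets borel"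
      by (rule cylindersE)
    have E_meas: "E \<in> sets (R \<Otimes>\<^sub>M K)" using cyl cylinders_sets by blast
    \<comment> \<open>\<open>mecke_cylinder\<close> takes its marked set as member 0 of the family,
      so \<open>A\<close> is put in front with the void constraint \<open>UNIV\<close>.\<close>
    define C' where "C' i = (case i of 0 \<Rightarrow> A | Suc i \<Rightarrow> C i)" for i
    define S' where "S' i = (case i of 0 \<Rightarrow> UNIV | Suc i \<Rightarrow> S i)" for i
    define H where "H f = (\<Prod>i<Suc m. indicator (S' i) (f (C' i)) :: ennreal)" for f
    have C': "C' i \<in> sets K" "S' i \<in> sets borel" if "i < Suc m" for i
      using that E by (auto simp: C'_def S'_def split: nat.splits)
    have C0: "C' 0 = A" by (simp add: C'_def)
    have ind: "indicator E (M, w) = indicator A w * H (emeasure M)" if "M \<in> space R" for w M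
    proof -
      have "H (emeasure M) = (\<Prod>i<m. indicator (S i) (emeasure M (C i)))"
        unfolding H_def prod.lessThan_Suc_shift by (simp add: C'_def S'_def)
      also have "\<dots> = indicator {M \<in> space R. \<forall>i<m. emeasure M (C i) \<in> S i} M"
        using that by (auto simp: indicator_def prod_zero_iff)
      finally show ?thesis by (auto simp: E(1) indicator_def)
    qed
    have H_meas: "(\<lambda>z. H (g z)) \<in> borel_measurable Z" if "\<And>i. i < Suc m \<Longrightarrow> (\<lambda>z. g z (C' i)) \<in> borel_measurable Z" for g and Z :: "'z measure"
      unfolding H_def using C' that
      by (intro borel_measurable_prod_ennreal measurable_compose[OF _ borel_measurable_indicator[where M=borel]]) auto
    have "emeasure ?P E = (\<integral>\<^sup>+ M. (\<integral>\<^sup>+ w. indicator E (M, w) \<partial>M) \<partial>L)"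
      using intP[of "indicator E"] E_meas sets1 by simp
    also have "\<dots> = (\<integral>\<^sup>+ M. emeasure M A * H (emeasure M) \<partial>L)"
    proof (intro nn_integral_cong)
      fix M assume "M \<in> space L"
      then have M: "M \<in> space R" by simp
      show "(\<integral>\<^sup>+ w. indicator E (M, w) \<partial>M) = emeasure M A * H (emeasure M)"
        unfolding ind[OF M] using space_R_D[OF M] E(2) by (subst nn_integral_multc) auto
    qed
    also have "\<dots> = (\<integral>\<^sup>+ \<omega>. emeasure (N \<omega>) A * H (emeasure (N \<omega>)) \<partial>\<Omega>)"
    proof (intro nn_integral_distr N)
      have "(\<lambda>M. emeasure M A * H (emeasure M)) \<in> borel_measurable R"
        by (intro borel_measurable_times_ennreal measurable_emeasure_R[OF E(2)]
            H_meas measurable_emeasure_R[OF C'(1)])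
      then show "(\<lambda>M. emeasure M A * H (emeasure M)) \<in> borel_measurable (distr \<Omega> R N)"
        by simp
    qed
    also have "\<dots> = (\<integral>\<^sup>+ w. indicator A w * (\<integral>\<^sup>+ \<omega>. H (\<lambda>D. emeasure (N \<omega>) D + indicator D w) \<partial>\<Omega>) \<partial>\<nu>)"
      unfolding H_def C0[symmetric] using C' E(3) by (intro mecke_cylinder) (auto simp: C0)
    also have "\<dots> = (\<integral>\<^sup>+ w. (\<integral>\<^sup>+ M. indicator E (add_dirac M w, w) \<partial>L) \<partial>\<nu>)"
    proof (intro nn_integral_cong)
      fix w assume "w \<in> space \<nu>"
      then have w: "w \<in> space K" using space_\<nu> by simp
      have "(\<integral>\<^sup>+ M. indicator E (add_dirac M w, w) \<partial>L) = (\<integral>\<^sup>+ M. indicator A w * H (emeasure (add_dirac M w)) \<partial>L)"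
        by (intro nn_integral_cong ind) (simp add: space_boundedly_finite_measures boundedly_finite_add_dirac)
      also have "\<dots> = (\<integral>\<^sup>+ \<omega>. indicator A w * H (emeasure (add_dirac (N \<omega>) w)) \<partial>\<Omega>)"
      proof (intro nn_integral_distr N)
        have "(\<lambda>M. add_dirac M w) \<in> measurable R R"
          using w by (intro measurable_add_dirac measurable_const measurable_ident_sets refl)
        from measurable_compose[OF this measurable_emeasure_R]
        show "(\<lambda>M. indicator A w * H (emeasure (add_dirac M w))) \<in> borel_measurable (distr \<Omega> R N)"
          using C' by (intro borel_measurable_times_ennreal borel_measurable_const H_meas) simp_all
      qed
      also have "\<dots> = (\<integral>\<^sup>+ \<omega>. indicator A w * H (\<lambda>D. emeasure (N \<omega>) D + indicator D w) \<partial>\<Omega>)"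
        unfolding H_def using C'(1) sets_N
        by (intro nn_integral_cong arg_cong2[where f="(*)"] refl prod.cong) (simp add: emeasure_add_dirac)
      also have "\<dots> = indicator A w * (\<integral>\<^sup>+ \<omega>. H (\<lambda>D. emeasure (N \<omega>) D + indicator D w) \<partial>\<Omega>)"
        using C' by (intro nn_integral_cmult H_meas) simp
      finally show "indicator A w * (\<integral>\<^sup>+ \<omega>. H (\<lambda>D. emeasure (N \<omega>) D + indicator D w) \<partial>\<Omega>) =
        (\<integral>\<^sup>+ M. indicator E (add_dirac M w, w) \<partial>L)" by simp
    qed
    also have "\<dots> = emeasure ?Q E" using intQ[of "indicator E"] E_meas by simp
    finally show "emeasure ?Q E = emeasure ?P E" by simp
  next
    fix k
    have Bk: "B k \<in> sets K" using B(1) by auto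
    \<comment> \<open>Uniqueness of measures requires finite mass along the exhausting cylinders;
      under \<open>?Q\<close> this mass is \<open>emeasure \<nu> (B k)\<close>.\<close>
    have "emeasure ?Q (space R \<times> B k) = (\<integral>\<^sup>+ w. (\<integral>\<^sup>+ M. indicator (space R \<times> B k) (add_dirac M w, w) \<partial>L) \<partial>\<nu>)"
      using intQ[of "indicator (space R \<times> B k)"] Bk by simp
    also have "\<dots> = (\<integral>\<^sup>+ w. indicator (B k) w \<partial>\<nu>)"
    proof (intro nn_integral_cong)
      fix w
      have "(\<integral>\<^sup>+ M. indicator (space R \<times> B k) (add_dirac M w, w) \<partial>L) = (\<integral>\<^sup>+ M. indicator (B k) w \<partial>L)"
        by (intro nn_integral_cong) (auto simp: indicator_def space_boundedly_finite_measures boundedly_finite_add_dirac)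
      then show "(\<integral>\<^sup>+ M. indicator (space R \<times> B k) (add_dirac M w, w) \<partial>L) = indicator (B k) w"
        using L.emeasure_space_1 by simp
    qed
    finally show "emeasure ?Q (space R \<times> B k) \<noteq> \<infinity>" using Bk sets_\<nu> B(4)[of k] by simp
  qed
  then show ?thesis
    using intP[of "\<lambda>(M, w). F (w, M)"] intQ[of "\<lambda>(M, w). F (w, M)"] measurable_compose[OF measurable_pair_swap' F]
    by (simp add: split_beta')
qed

end

section \<open>Adding finitely many atoms\<close>

lemma sets_add_atoms[simp, measurable_cong]: "sets (add_atoms I s y M) = sets M"
  by (simp add: add_atoms_def)

lemma space_add_atoms[simp]: "space (add_atoms I s y M) = space M"
  by (simp add: add_atoms_def)

lemma emeasure_add_atoms:
  assumes "A \<in> sets M"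
  shows "emeasure (add_atoms I s y M) A = emeasure M A + (\<Sum>j\<in>I. indicator A (s j, y j))"
  unfolding add_atoms_def
proof (rule emeasure_measure_of_sigma)
  show "countably_additive (sets M) (\<lambda>A. emeasure M A + (\<Sum>j\<in>I. indicator A (s j, y j)))"
    unfolding countably_additive_def
  proof safe
    fix A :: "nat \<Rightarrow> _" assume A: "range A \<subseteq> sets M" "disjoint_family A"
    have "(\<Sum>i. emeasure M (A i) + (\<Sum>j\<in>I. indicator (A i) (s j, y j))) =
        (\<Sum>i. emeasure M (A i)) + (\<Sum>j\<in>I. \<Sum>i. indicator (A i) (s j, y j))"
      by (simp add: suminf_add[symmetric] suminf_sum)
    then show "(\<Sum>i. emeasure M (A i) + (\<Sum>j\<in>I. indicator (A i) (s j, y j))) =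
        emeasure M (\<Union>i. A i) + (\<Sum>j\<in>I. indicator (\<Union>i. A i) (s j, y j))"
      using A by (simp add: suminf_emeasure suminf_indicator)
  qed
qed (auto simp: sets.sigma_algebra_axioms positive_def assms)

lemma add_atoms_empty: "add_atoms {} s y M = M"
  by (rule measure_eqI) (simp_all add: emeasure_add_atoms)

lemma add_atoms_insert:
  "finite I \<Longrightarrow> j \<notin> I \<Longrightarrow> add_atoms (insert j I) s y M = add_dirac (add_atoms I s y M) (s j, y j)"
  by (rule measure_eqI) (simp_all add: emeasure_add_atoms emeasure_add_dirac ac_simps)

lemma add_atoms_add_dirac: "add_atoms I s y (add_dirac M x) = add_dirac (add_atoms I s y M) x"
  by (rule measure_eqI) (simp_all add: emeasure_add_atoms emeasure_add_dirac ac_simps)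

lemma add_atoms_cong:
  "(\<And>j. j \<in> I \<Longrightarrow> s j = s' j) \<Longrightarrow> (\<And>j. j \<in> I \<Longrightarrow> y j = y' j) \<Longrightarrow>
    add_atoms I s y M = add_atoms I s' y' M"
  by (rule measure_eqI) (simp_all add: emeasure_add_atoms)

lemma add_atoms_reindex:
  "bij_betw h I I' \<Longrightarrow> add_atoms I (\<lambda>j. s (h j)) (\<lambda>j. y (h j)) M = add_atoms I' s y M"
  by (rule measure_eqI) (auto simp: emeasure_add_atoms sum.reindex_bij_betw[of h I I' "\<lambda>j. indicator _ (s j, y j)"])

lemma boundedly_finite_add_atoms:
  assumes "boundedly_finite K bdd M"
  shows "boundedly_finite K bdd (add_atoms I s y M)"
proof -
  \<comment> \<open>For infinite \<open>I\<close> the sum is 0 by convention, for finite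
    \<open>I\<close> it is at most \<open>card I\<close>.\<close>
  have "(\<Sum>j\<in>I. indicator A (s j, y j)) < (\<infinity> :: ennreal)" for A
    by (cases "finite I") (auto simp: indicator_def of_nat_less_top)
  then show ?thesis
    using assms by (simp add: boundedly_finite_def emeasure_add_atoms)
qed

lemma nn_integral_add_atoms:
  assumes "finite I" and f: "f \<in> borel_measurable M" and "\<And>j. j \<in> I \<Longrightarrow> (s j, y j) \<in> space M"
  shows "(\<integral>\<^sup>+ x. f x \<partial>add_atoms I s y M) = (\<integral>\<^sup>+ x. f x \<partial>M) + (\<Sum>j\<in>I. f (s j, y j))"
  using assms
proof (induction I rule: finite_induct)
  case empty
  then show ?case by (simp add: add_atoms_empty)
next
  case (insert j I)
  have "f \<in> borel_measurable (add_atoms I s y M)"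
    using f by (simp cong: measurable_cong_sets)
  with insert show ?case
    by (simp add: add_atoms_insert nn_integral_add_dirac ac_simps)
qed

lemma measurable_add_atoms:
  assumes g: "g \<in> measurable Z (boundedly_finite_measures K bdd)"
    and f: "\<And>j. j \<in> I \<Longrightarrow> (\<lambda>z. (s j z, y j z)) \<in> measurable Z K"
  shows "(\<lambda>z. add_atoms I (\<lambda>j. s j z) (\<lambda>j. y j z) (g z)) \<in> measurable Z (boundedly_finite_measures K bdd)"
proof (rule measurable_boundedly_finite_measures)
  fix z assume "z \<in> space Z"
  then show "boundedly_finite K bdd (add_atoms I (\<lambda>j. s j z) (\<lambda>j. y j z) (g z))"
    using measurable_space[OF g]
    by (auto simp: space_boundedly_finite_measures intro!: boundedly_finite_add_atoms)
next
  fix A assume A[measurable]: "A \<in> sets K"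
  have [measurable]: "(\<lambda>z. emeasure (g z) A) \<in> borel_measurable Z"
    using measurable_compose[OF measurable_compose[OF g measurable_ident_boundedly_finite_measures]
      measurable_emeasure_measure_algebra[OF A]] .
  have "(\<lambda>z. \<Sum>j\<in>I. indicator A (s j z, y j z) :: ennreal) \<in> borel_measurable Z"
    by (intro borel_measurable_sum measurable_compose[OF f borel_measurable_indicator[OF A]])
  then have "(\<lambda>z. emeasure (g z) A + (\<Sum>j\<in>I. indicator A (s j z, y j z))) \<in> borel_measurable Z"
    by measurable
  moreover have "sets (g z) = sets K" if "z \<in> space Z" for z
    using measurable_space[OF g that]
    by (simp add: space_boundedly_finite_measures boundedly_finite_def)
  ultimately show "(\<lambda>z. emeasure (add_atoms I (\<lambda>j. s j z) (\<lambda>j. y j z) (g z)) A) \<in> borel_measurable Z"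
    using A by (subst measurable_cong[where g="\<lambda>z. emeasure (g z) A + (\<Sum>j\<in>I. indicator A (s j z, y j z))"])
      (auto simp: emeasure_add_atoms)
qed

section \<open>Partitions of \<open>{1..n}\<close>\<close>

lemma partition_on_disjnt: "partition_on A p \<Longrightarrow> C \<in> p \<Longrightarrow> disjnt C (\<Union>(p - {C}))"
  by (fastforce simp: partition_on_def disjoint_def disjnt_def)

lemma partition_on_finite: "finite A \<Longrightarrow> partition_on A p \<Longrightarrow> finite p"
  by (metis finite_UnionD partition_onD1)

lemma partition_on_add_cell:
  assumes "a \<notin> A" "partition_on A p"
  shows "partition_on (insert a A) (insert {a} p)"
proof -
  have "disjnt {a} (\<Union>p)" using assms by (auto simp: partition_on_def disjnt_def)
  then show ?thesis using assms by (simp add: partition_on_insert)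
qed

lemma partition_on_enlarge_cell:
  assumes a: "a \<notin> A" and p: "partition_on A p" and C: "C \<in> p"
  shows "partition_on (insert a A) (insert (insert a C) (p - {C}))"
proof -
  have d: "disjnt C (\<Union>(p - {C}))" by (rule partition_on_disjnt[OF p C])
  moreover have "insert C (p - {C}) = p" using C by auto
  ultimately have 1: "partition_on (A - C) (p - {C})" "C \<subseteq> A"
    using partition_on_insert[OF d, of A] p by simp_all
  have "disjnt (insert a C) (\<Union>(p - {C}))"
    using d a p by (auto simp: partition_on_def disjnt_def)
  moreover have "insert a A - insert a C = A - C" using a by auto
  ultimately show ?thesis using 1 by (auto simp: partition_on_insert)
qed

text \<open>Deleting \<open>a\<close> from a partition of \<open>insert a A\<close> leaves a
  partition of \<open>A\<close>. Either \<open>a\<close> was a cell by itself or it had joined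
  exactly one cell \<open>C\<close>, which gives the two kinds of summand. The iterated Mecke
  formula obeys the same recursion.\<close>

lemma sum_partition_on_insert:
  fixes f :: "'a set set \<Rightarrow> 'b::comm_monoid_add"
  assumes A: "finite A" "a \<notin> A"
  shows "(\<Sum>p | partition_on (insert a A) p. f p) =
    (\<Sum>p | partition_on A p. f (insert {a} p) + (\<Sum>C\<in>p. f (insert (insert a C) (p - {C}))))"
proof -
  define P where "P = {p. partition_on A p}"
  have finP: "finite P" unfolding P_def using A(1) by (rule finitely_many_partition_on)
  have fin_p: "finite p" if "p \<in> P" for p using that A(1) by (auto simp: P_def intro: partition_on_finite)
  have notin: "a \<notin> C" if "C \<in> p" "p \<in> P" for C p
    using that A(2) by (auto simp: P_def partition_on_def)
  have ne: "{} \<notin> p" if "p \<in> P" for p using that by (auto simp: P_def partition_on_def)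
  let ?g = "\<lambda>(p, C). insert (insert a C) (p - {C})"
  \<comment> \<open>\<open>r\<close> removes \<open>a\<close> from every cell and drops a cell that
    becomes empty. It undoes both constructions, which gives their injectivity; the choice of
    \<open>C\<close> is recovered from the cell that contains \<open>a\<close>.\<close>
  define r where "r p = (\<lambda>C. C - {a}) ` p - {{}}" for p
  have id: "(\<lambda>C. C - {a}) ` p = p" if "p \<in> P" for p
    using notin[OF _ that] by (force simp: image_iff)
  have r1: "r (insert {a} p) = p" if "p \<in> P" for p
    using id[OF that] ne[OF that] by (auto simp: r_def)
  have r2: "r (insert (insert a C) (p - {C})) = p" if "p \<in> P" "C \<in> p" for p C
  proof -
    have "(\<lambda>C. C - {a}) ` (p - {C}) = p - {C}" using notin[OF _ that(1)] by (force simp: image_iff)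
    then show ?thesis using ne[OF that(1)] notin[OF that(2,1)] that(2) by (auto simp: r_def)
  qed
  have inj1: "inj_on (insert {a}) P" by (rule inj_on_inverseI[of _ r]) (rule r1)
  have inj2: "inj_on ?g (SIGMA p:P. p)"
  proof (rule inj_onI, clarify)
    fix p C p' C' assume *: "p \<in> P" "C \<in> p" "p' \<in> P" "C' \<in> p'"
      "insert (insert a C) (p - {C}) = insert (insert a C') (p' - {C'})"
    then have "p = p'" using r2 by metis
    moreover have "insert a C = insert a C'"
    proof -
      have "insert a C \<in> insert (insert a C') (p' - {C'})" using *(5) by auto
      then show ?thesis using notin *(3) by auto
    qed
    then have "C = C'" using notin * by (metis insert_ident)
    ultimately show "p = p' \<and> C = C'" by simp
  qed
  have "{p. partition_on (insert a A) p} = insert {a} ` P \<union> ?g ` (SIGMA p:P. p)"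
  proof (intro equalityI subsetI)
    fix q assume "q \<in> {p. partition_on (insert a A) p}"
    then have q: "partition_on (insert a A) q" by simp
    then obtain D where D: "D \<in> q" "a \<in> D" by (auto simp: partition_on_def)
    have d: "disjnt D (\<Union>(q - {D}))" by (rule partition_on_disjnt[OF q D(1)])
    have "insert D (q - {D}) = q" using D by auto
    then have q': "partition_on (insert a A - D) (q - {D})" "D \<subseteq> insert a A"
      using partition_on_insert[OF d, of "insert a A"] q by simp_all
    show "q \<in> insert {a} ` P \<union> ?g ` (SIGMA p:P. p)"
    proof (cases "D = {a}")
      case True
      then have "q - {D} \<in> P" using q'(1) A(2) by (simp add: P_def)
      moreover have "q = insert {a} (q - {D})" unfolding True[symmetric] by (rule \<open>insert D (q - {D}) = q\<close>[symmetric])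
      ultimately have "q \<in> insert {a} ` P" by (rule rev_image_eqI)
      then show ?thesis ..
    next
      case False
      define C where "C = D - {a}"
      have DC: "D = insert a C" "a \<notin> C" using D by (auto simp: C_def)
      have C: "C \<noteq> {}" "C \<subseteq> A" using False q'(2) DC by auto
      have dC: "disjnt C (\<Union>(q - {D}))" using d DC by (auto simp: disjnt_def)
      have "insert a A - D = A - C" using A(2) DC by auto
      then have "insert C (q - {D}) \<in> P"
        using q'(1) C dC by (simp add: P_def partition_on_insert)
      then have mem: "(insert C (q - {D}), C) \<in> (SIGMA p:P. p)" by simp
      have "C \<notin> q - {D}" using dC C by (auto simp: disjnt_def)
      then have "insert C (q - {D}) - {C} = q - {D}" by simp
      then have "q = ?g (insert C (q - {D}), C)"
        unfolding prod.case using \<open>insert D (q - {D}) = q\<close> DC(1) by metis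
      with mem have "q \<in> ?g ` (SIGMA p:P. p)" by (rule rev_image_eqI)
      then show ?thesis ..
    qed
  next
    fix q assume "q \<in> insert {a} ` P \<union> ?g ` (SIGMA p:P. p)"
    then show "q \<in> {p. partition_on (insert a A) p}"
      using A(2) by (auto simp: P_def intro: partition_on_add_cell partition_on_enlarge_cell)
  qed
  moreover have "insert {a} ` P \<inter> ?g ` (SIGMA p:P. p) = {}"
  proof -
    have "insert {a} p \<noteq> insert (insert a C) (p' - {C})" if "p' \<in> P" "C \<in> p'" for p p' C
    proof
      assume "insert {a} p = insert (insert a C) (p' - {C})"
      then have "{a} \<in> insert (insert a C) (p' - {C})" by auto
      then have "{a} = insert a C" using notin[OF _ that(1)] by auto
      then have "C = {}" using notin[OF that(2,1)] by auto
      then show False using ne that by auto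
    qed
    then show ?thesis by auto
  qed
  ultimately have "(\<Sum>p | partition_on (insert a A) p. f p) =
      (\<Sum>p\<in>insert {a} ` P. f p) + (\<Sum>p\<in>?g ` (SIGMA p:P. p). f p)"
    using finP fin_p by (simp add: sum.union_disjoint)
  also have "\<dots> = (\<Sum>p\<in>P. f (insert {a} p)) + (\<Sum>p\<in>P. \<Sum>C\<in>p. f (insert (insert a C) (p - {C})))"
  proof -
    have "(\<Sum>p\<in>?g ` (SIGMA p:P. p). f p) = (\<Sum>(p, C)\<in>(SIGMA p:P. p). f (insert (insert a C) (p - {C})))"
      unfolding sum.reindex[OF inj2] by (rule sum.cong) auto
    also have "\<dots> = (\<Sum>p\<in>P. \<Sum>C\<in>p. f (insert (insert a C) (p - {C})))"
      using finP fin_p by (intro sum.Sigma[symmetric]) auto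
    finally show ?thesis by (simp add: sum.reindex[OF inj1])
  qed
  finally show ?thesis by (simp add: sum.distrib P_def)
qed

lemma of_cells_eq:
  assumes "partition_on {1..n} p" "C \<in> p" "i \<in> C"
  shows "of_cells n p x i = x C"
proof -
  have "(THE D. D \<in> p \<and> i \<in> D) = C"
    using assms by (intro the_equality) (auto simp: partition_on_def disjoint_def)
  then show ?thesis using assms by (auto simp: of_cells_def partition_on_def)
qed

lemma of_cells_outside: "i \<notin> {1..n} \<Longrightarrow> of_cells n p x i = undefined"
  unfolding of_cells_def by (simp only: restrict_apply if_False)

lemma partition_on_cell:
  assumes "partition_on A p" "i \<in> A"
  obtains C where "C \<in> p" "i \<in> C"
  using assms by (auto simp: partition_on_def)

lemma measurable_of_cells:
  assumes p: "partition_on {1..n} p"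
  shows "of_cells n p \<in> measurable (PiM p (\<lambda>_. K)) (PiM {1..n} (\<lambda>_. K))"
proof -
  have "(THE C. C \<in> p \<and> i \<in> C) \<in> p" if i: "i \<in> {1..n}" for i
  proof -
    obtain C where C: "C \<in> p" "i \<in> C" using partition_on_cell[OF p i] .
    then have "(THE D. D \<in> p \<and> i \<in> D) = C"
      using p by (intro the_equality) (auto simp: partition_on_def disjoint_def)
    with C show ?thesis by simp
  qed
  then show ?thesis
    unfolding of_cells_def[abs_def] by (intro measurable_restrict measurable_component_singleton)
qed

lemma of_cells_add_cell:
  assumes p: "partition_on {1..n} p"
  shows "of_cells (Suc n) (insert {Suc n} p) (v({Suc n} := x)) = (of_cells n p v)(Suc n := x)"
proof
  fix i
  have p': "partition_on {1..Suc n} (insert {Suc n} p)"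
    using partition_on_add_cell[OF _ p, of "Suc n"] by (simp add: atLeastAtMostSuc_conv)
  have "Suc n \<notin> \<Union>p" using partition_onD1[OF p, symmetric] by simp
  then have notin: "{Suc n} \<notin> p" by blast
  consider "i = Suc n" | "i \<in> {1..n}" | "i \<notin> {1..Suc n}" by force
  then show "of_cells (Suc n) (insert {Suc n} p) (v({Suc n} := x)) i = ((of_cells n p v)(Suc n := x)) i"
  proof cases
    case 1
    then show ?thesis using of_cells_eq[OF p', of "{Suc n}" i "v({Suc n} := x)"] by simp
  next
    case 2
    obtain C where C: "C \<in> p" "i \<in> C" using partition_on_cell[OF p 2] .
    then show ?thesis using of_cells_eq[OF p', of C i "v({Suc n} := x)"] of_cells_eq[OF p C, of v] 2 C notin by auto
  next
    case 3
    then have "i \<notin> {1..n}" "i \<noteq> Suc n" by auto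
    with 3 show ?thesis by (simp add: of_cells_outside del: atLeastAtMost_iff)
  qed
qed

lemma bij_betw_enlarge_cell:
  assumes p: "partition_on {1..n} p" and C: "C \<in> p"
  shows "bij_betw (\<lambda>D. if D = C then insert (Suc n) C else D) p (insert (insert (Suc n) C) (p - {C}))"
proof -
  have "Suc n \<notin> \<Union>p" using partition_onD1[OF p, symmetric] by simp
  then have notin: "Suc n \<notin> D" if "D \<in> p" for D using that by blast
  then show ?thesis using C by (intro bij_betwI') auto
qed

text \<open>The new partition has as many cells as \<open>p\<close>, but one of them has a new name.
  The cell values are therefore transported along \<open>bij_betw_enlarge_cell\<close>, and the new
  index repeats the value of the cell that it joins.\<close>

lemma of_cells_enlarge_cell:
  assumes p: "partition_on {1..n} p" and C: "C \<in> p"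
  shows "of_cells (Suc n) (insert (insert (Suc n) C) (p - {C})) v =
    (of_cells n p (\<lambda>D\<in>p. v (if D = C then insert (Suc n) C else D)))(Suc n := v (insert (Suc n) C))"
proof
  fix i
  let ?p = "insert (insert (Suc n) C) (p - {C})"
  have p': "partition_on {1..Suc n} ?p"
    using partition_on_enlarge_cell[OF _ p C, of "Suc n"] by (simp add: atLeastAtMostSuc_conv)
  consider "i = Suc n" | "i \<in> {1..n}" | "i \<notin> {1..Suc n}" by force
  then show "of_cells (Suc n) ?p v i =
    ((of_cells n p (\<lambda>D\<in>p. v (if D = C then insert (Suc n) C else D)))(Suc n := v (insert (Suc n) C))) i"
  proof cases
    case 1
    then show ?thesis using of_cells_eq[OF p', of "insert (Suc n) C" i v] by simp
  next
    case 2
    obtain D where D: "D \<in> p" "i \<in> D" using partition_on_cell[OF p 2] .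
    then show ?thesis
      using of_cells_eq[OF p', of "if D = C then insert (Suc n) C else D" i v]
        of_cells_eq[OF p D, of "\<lambda>D\<in>p. v (if D = C then insert (Suc n) C else D)"] 2 D
      by (cases "D = C") auto
  next
    case 3
    then have "i \<notin> {1..n}" "i \<noteq> Suc n" by auto
    with 3 show ?thesis by (simp add: of_cells_outside del: atLeastAtMost_iff)
  qed
qed

section \<open>The iterated Mecke formula as a sum over set partitions\<close>

locale marked_poisson_process = poisson_process \<Omega> K bdd \<nu> N B
  for \<Omega> :: "'o measure" and K :: "(real \<times> 'y::polish_space) measure" and bdd \<nu> N B
begin

abbreviation add_cells :: "'i set \<Rightarrow> ('i \<Rightarrow> real \<times> 'y) \<Rightarrow> (real \<times> 'y) measure \<Rightarrow> (real \<times> 'y) measure" where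
  "add_cells p v M \<equiv> add_atoms p (\<lambda>C. fst (v C)) (\<lambda>C. snd (v C)) M"

lemma measurable_add_cells:
  "(\<lambda>(v, M). add_cells p v M) \<in> measurable (PiM p (\<lambda>_. K) \<Otimes>\<^sub>M R) R"
  unfolding split_beta'
  by (intro measurable_add_atoms) (auto intro: measurable_compose[OF measurable_fst measurable_component_singleton])

lemma measurable_cells_integrand:
  assumes p: "partition_on {1..n} p" and F: "F \<in> borel_measurable (PiM {1..n} (\<lambda>_. K) \<Otimes>\<^sub>M R)"
  shows "(\<lambda>(v, M). F (of_cells n p v, add_cells p v M)) \<in> borel_measurable (PiM p (\<lambda>_. K) \<Otimes>\<^sub>M R)"
proof -
  have "(\<lambda>x. (of_cells n p (fst x), case x of (v, M) \<Rightarrow> add_cells p v M))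
      \<in> measurable (PiM p (\<lambda>_. K) \<Otimes>\<^sub>M R) (PiM {1..n} (\<lambda>_. K) \<Otimes>\<^sub>M R)"
    by (intro measurable_Pair measurable_add_cells measurable_compose[OF measurable_fst measurable_of_cells[OF p]])
  from measurable_compose[OF this F] show ?thesis by (simp add: split_beta')
qed

definition mecke_term :: "nat \<Rightarrow> ((nat \<Rightarrow> real \<times> 'y) \<times> (real \<times> 'y) measure \<Rightarrow> ennreal) \<Rightarrow> nat set set \<Rightarrow> ennreal" where
  "mecke_term n F p = (\<integral>\<^sup>+ v. (\<integral>\<^sup>+ M. F (of_cells n p v, add_cells p v M) \<partial>L) \<partial>PiM p (\<lambda>_. \<nu>))"

lemma sets_PiM_\<nu>: "sets (PiM I (\<lambda>_. \<nu>)) = sets (PiM I (\<lambda>_. K))"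
  by (intro sets_PiM_cong) (simp_all add: sets_\<nu>)

text \<open>For fixed \<open>v\<close> the integral over the point of the new cell is the right side
  of \<open>mecke\<close>, because the atom of that cell is added to \<open>M\<close>. The left side
  integrates the point against \<open>M\<close> itself, while the integrand sees \<open>M\<close>
  together with the atoms of the old cells.\<close>

lemma mecke_term_add_cell:
  assumes p: "partition_on {1..n} p" and F: "F \<in> borel_measurable (PiM {1..Suc n} (\<lambda>_. K) \<Otimes>\<^sub>M R)"
  shows "mecke_term (Suc n) F (insert {Suc n} p) =
    (\<integral>\<^sup>+ v. (\<integral>\<^sup>+ M. (\<integral>\<^sup>+ x. F ((of_cells n p v)(Suc n := x), add_cells p v M) \<partial>M) \<partial>L) \<partial>PiM p (\<lambda>_. \<nu>))"
proof -
  interpret L: prob_space L by (rule prob_space_L)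
  interpret product_sigma_finite "\<lambda>_ :: nat set. \<nu>"
    using sigma_finite_\<nu> by (simp add: product_sigma_finite_def)
  have fin: "finite p" using partition_on_finite[OF _ p] by simp
  have "Suc n \<notin> \<Union>p" using partition_onD1[OF p, symmetric] by simp
  then have notin: "{Suc n} \<notin> p" by blast
  let ?p = "insert {Suc n} p"
  have p': "partition_on {1..Suc n} ?p"
    using partition_on_add_cell[OF _ p, of "Suc n"] by (simp add: atLeastAtMostSuc_conv)
  have "(\<lambda>(v, M). F (of_cells (Suc n) ?p v, add_cells ?p v M)) \<in> borel_measurable (PiM ?p (\<lambda>_. \<nu>) \<Otimes>\<^sub>M L)"
    using measurable_cells_integrand[OF p' F]
    by (subst measurable_cong_sets[OF sets_pair_measure_cong[OF sets_PiM_\<nu>] refl]) auto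
  then have m: "(\<lambda>v. \<integral>\<^sup>+ M. F (of_cells (Suc n) ?p v, add_cells ?p v M) \<partial>L) \<in> borel_measurable (PiM ?p (\<lambda>_. \<nu>))"
    by (rule L.borel_measurable_nn_integral)
  have "mecke_term (Suc n) F ?p = (\<integral>\<^sup>+ v. (\<integral>\<^sup>+ x. (\<integral>\<^sup>+ M. F (of_cells (Suc n) ?p (v({Suc n} := x)),
      add_cells ?p (v({Suc n} := x)) M) \<partial>L) \<partial>\<nu>) \<partial>PiM p (\<lambda>_. \<nu>))"
    unfolding mecke_term_def by (rule product_nn_integral_insert[OF fin notin m])
  also have "\<dots> = (\<integral>\<^sup>+ v. (\<integral>\<^sup>+ M. (\<integral>\<^sup>+ x. F ((of_cells n p v)(Suc n := x), add_cells p v M) \<partial>M) \<partial>L) \<partial>PiM p (\<lambda>_. \<nu>))"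
  proof (intro nn_integral_cong)
    fix v assume "v \<in> space (PiM p (\<lambda>_. \<nu>))"
    then have v: "v \<in> space (PiM p (\<lambda>_. K))" by (simp add: sets_eq_imp_space_eq[OF sets_PiM_\<nu>])
    have "(\<integral>\<^sup>+ x. (\<integral>\<^sup>+ M. F (of_cells (Suc n) ?p (v({Suc n} := x)), add_cells ?p (v({Suc n} := x)) M) \<partial>L) \<partial>\<nu>) =
        (\<integral>\<^sup>+ x. (\<integral>\<^sup>+ M. F ((of_cells n p v)(Suc n := x), add_cells p v (add_dirac M x)) \<partial>L) \<partial>\<nu>)"
    proof -
      have "add_cells ?p (v({Suc n} := x)) M = add_cells p v (add_dirac M x)" for x M
      proof -
        have "add_cells ?p (v({Suc n} := x)) M = add_dirac (add_cells p (v({Suc n} := x)) M) x"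
          using fin notin by (simp add: add_atoms_insert)
        also have "add_cells p (v({Suc n} := x)) M = add_cells p v M"
          using notin by (intro add_atoms_cong) auto
        finally show ?thesis by (simp add: add_atoms_add_dirac)
      qed
      then show ?thesis by (simp add: of_cells_add_cell[OF p])
    qed
    also have "\<dots> = (\<integral>\<^sup>+ M. (\<integral>\<^sup>+ x. F ((of_cells n p v)(Suc n := x), add_cells p v M) \<partial>M) \<partial>L)"
    proof -
      have "of_cells n p v \<in> space (PiM {1..n} (\<lambda>_. K))"
        using measurable_space[OF measurable_of_cells[OF p] v] .
      then have "(\<lambda>x. (of_cells n p v)(Suc n := fst x)) \<in> measurable (K \<Otimes>\<^sub>M R) (PiM {1..Suc n} (\<lambda>_. K))"
        by (intro measurable_fun_upd[where J="{1..n}"]) (auto simp: atLeastAtMostSuc_conv)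
      moreover have "(\<lambda>x. add_cells p v (snd x)) \<in> measurable (K \<Otimes>\<^sub>M R) R"
        using measurable_compose[OF _ measurable_add_cells, of "\<lambda>x. (v, snd x)" "K \<Otimes>\<^sub>M R"] v by simp
      ultimately have "(\<lambda>x. ((of_cells n p v)(Suc n := fst x), add_cells p v (snd x))) \<in>
          measurable (K \<Otimes>\<^sub>M R) (PiM {1..Suc n} (\<lambda>_. K) \<Otimes>\<^sub>M R)"
        by (rule measurable_Pair)
      from mecke[OF measurable_compose[OF this F]] show ?thesis by simp
    qed
    finally show "(\<integral>\<^sup>+ x. (\<integral>\<^sup>+ M. F (of_cells (Suc n) ?p (v({Suc n} := x)), add_cells ?p (v({Suc n} := x)) M) \<partial>L) \<partial>\<nu>) =
        (\<integral>\<^sup>+ M. (\<integral>\<^sup>+ x. F ((of_cells n p v)(Suc n := x), add_cells p v M) \<partial>M) \<partial>L)" .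
  qed
  finally show ?thesis .
qed

lemma measurable_update_cells:
  assumes p: "partition_on {1..n} p" and C: "C \<in> p" and F: "F \<in> borel_measurable (PiM {1..Suc n} (\<lambda>_. K) \<Otimes>\<^sub>M R)"
  shows "(\<lambda>(v, M). F ((of_cells n p v)(Suc n := v C), add_cells p v M)) \<in> borel_measurable (PiM p (\<lambda>_. K) \<Otimes>\<^sub>M R)"
proof -
  have "(\<lambda>x. ((of_cells n p (fst x))(Suc n := fst x C), case x of (v, M) \<Rightarrow> add_cells p v M))
      \<in> measurable (PiM p (\<lambda>_. K) \<Otimes>\<^sub>M R) (PiM {1..Suc n} (\<lambda>_. K) \<Otimes>\<^sub>M R)"
    using measurable_compose[OF measurable_fst measurable_of_cells[OF p]]
      measurable_compose[OF measurable_fst measurable_component_singleton[OF C]]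
    by (intro measurable_Pair measurable_add_cells measurable_fun_upd[where J="{1..n}"])
       (auto simp: atLeastAtMostSuc_conv)
  from measurable_compose[OF this F] show ?thesis by (simp add: split_beta')
qed

text \<open>The new index repeats the point of \<open>C\<close>, so no further integral arises: the
  two sides differ by the renaming of \<open>C\<close> to \<open>insert (Suc n) C\<close>, a
  reindexing of the product of copies of \<nu>.\<close>

lemma mecke_term_enlarge_cell:
  assumes p: "partition_on {1..n} p" and C: "C \<in> p" and F: "F \<in> borel_measurable (PiM {1..Suc n} (\<lambda>_. K) \<Otimes>\<^sub>M R)"
  shows "mecke_term (Suc n) F (insert (insert (Suc n) C) (p - {C})) =
    (\<integral>\<^sup>+ v. (\<integral>\<^sup>+ M. F ((of_cells n p v)(Suc n := v C), add_cells p v M) \<partial>L) \<partial>PiM p (\<lambda>_. \<nu>))"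
proof -
  interpret L: prob_space L by (rule prob_space_L)
  have fin: "finite p" using partition_on_finite[OF _ p] by simp
  let ?p = "insert (insert (Suc n) C) (p - {C})"
  let ?h = "\<lambda>D. if D = C then insert (Suc n) C else D"
  have h: "bij_betw ?h p ?p" by (rule bij_betw_enlarge_cell[OF p C])
  have "(\<lambda>(v, M). F ((of_cells n p v)(Suc n := v C), add_cells p v M)) \<in> borel_measurable (PiM p (\<lambda>_. \<nu>) \<Otimes>\<^sub>M L)"
    using measurable_update_cells[OF p C F]
    by (subst measurable_cong_sets[OF sets_pair_measure_cong[OF sets_PiM_\<nu>] refl]) auto
  then have m: "(\<lambda>v. \<integral>\<^sup>+ M. F ((of_cells n p v)(Suc n := v C), add_cells p v M) \<partial>L) \<in> borel_measurable (PiM p (\<lambda>_. \<nu>))"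
    by (rule L.borel_measurable_nn_integral)
  have "(\<integral>\<^sup>+ v. (\<integral>\<^sup>+ M. F ((of_cells n p v)(Suc n := v C), add_cells p v M) \<partial>L) \<partial>PiM p (\<lambda>_. \<nu>)) =
      (\<integral>\<^sup>+ v. (\<integral>\<^sup>+ M. F ((of_cells n p (\<lambda>D\<in>p. v (?h D)))(Suc n := (\<lambda>D\<in>p. v (?h D)) C),
        add_cells p (\<lambda>D\<in>p. v (?h D)) M) \<partial>L) \<partial>PiM ?p (\<lambda>_. \<nu>))"
    using nn_integral_PiM_reindex[where M="\<lambda>_. \<nu>", OF sigma_finite_\<nu> h fin m] .
  also have "\<dots> = mecke_term (Suc n) F ?p"
  proof -
    have "add_cells p (\<lambda>D\<in>p. v (?h D)) M = add_cells ?p v M" for v M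
    proof -
      have "add_cells p (\<lambda>D\<in>p. v (?h D)) M = add_atoms p (\<lambda>D. fst (v (?h D))) (\<lambda>D. snd (v (?h D))) M"
        by (intro add_atoms_cong) auto
      also have "\<dots> = add_cells ?p v M"
        by (rule add_atoms_reindex[OF h, where s="\<lambda>D. fst (v D)" and y="\<lambda>D. snd (v D)"])
      finally show ?thesis .
    qed
    then show ?thesis
      unfolding mecke_term_def using C by (simp add: of_cells_enlarge_cell[OF p C])
  qed
  finally show ?thesis by simp
qed

text \<open>Induction on \<open>n\<close>. The last coordinate is integrated first, which gives an
  integrand \<open>F'\<close> of the other ones. The induction hypothesis evaluates it at
  \<open>add_cells p v M\<close>, and integration against this measure is integration against
  \<open>M\<close> plus a sum of values at the atoms. The former is the term in which
  \<open>Suc n\<close> opens a cell; the latter are the terms in which it joins one.\<close>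

theorem mecke_partition:
  assumes F: "F \<in> borel_measurable (PiM {1..n} (\<lambda>_. K) \<Otimes>\<^sub>M R)"
  shows "(\<integral>\<^sup>+ M. (\<integral>\<^sup>+ w. F (w, M) \<partial>PiM {1..n} (\<lambda>_. M)) \<partial>L) = (\<Sum>p | partition_on {1..n} p. mecke_term n F p)"
  using F
proof (induction n arbitrary: F)
  case 0
  have *: "{p. partition_on ({} :: nat set) p} = {{}}" by (auto simp: partition_on_empty)
  show ?case
    by (simp add: * mecke_term_def PiM_empty nn_integral_count_space_finite add_atoms_empty)
       (simp add: of_cells_def)
next
  case (Suc n)
  interpret L: prob_space L by (rule prob_space_L)
  note F = Suc.prems
  have Suc_eq: "{1..Suc n} = insert (Suc n) {1..n}" by (simp add: atLeastAtMostSuc_conv)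
  define F' where "F' = (\<lambda>(w, M). \<integral>\<^sup>+ x. F (w(Suc n := x), M) \<partial>M)"
  have upd: "(\<lambda>((w, M), x). F (w(Suc n := x), M)) \<in> borel_measurable ((PiM {1..n} (\<lambda>_. K) \<Otimes>\<^sub>M R) \<Otimes>\<^sub>M K)"
  proof -
    have "(\<lambda>z. ((fst (fst z))(Suc n := snd z), snd (fst z))) \<in>
        measurable ((PiM {1..n} (\<lambda>_. K) \<Otimes>\<^sub>M R) \<Otimes>\<^sub>M K) (PiM {1..Suc n} (\<lambda>_. K) \<Otimes>\<^sub>M R)"
      by (intro measurable_Pair measurable_fun_upd[where J="{1..n}"]) (auto simp: atLeastAtMostSuc_conv)
    from measurable_compose[OF this F] show ?thesis by (simp add: split_beta')
  qed
  have F': "F' \<in> borel_measurable (PiM {1..n} (\<lambda>_. K) \<Otimes>\<^sub>M R)"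
    using measurable_nn_integral_R[of "\<lambda>z x. F ((fst z)(Suc n := x), snd z)" "PiM {1..n} (\<lambda>_. K) \<Otimes>\<^sub>M R" snd] upd
    by (simp add: F'_def split_beta')
  have "(\<integral>\<^sup>+ M. (\<integral>\<^sup>+ w. F (w, M) \<partial>PiM {1..Suc n} (\<lambda>_. M)) \<partial>L) =
      (\<integral>\<^sup>+ M. (\<integral>\<^sup>+ w. F' (w, M) \<partial>PiM {1..n} (\<lambda>_. M)) \<partial>L)"
  proof (intro nn_integral_cong)
    fix M assume "M \<in> space L"
    then have M: "M \<in> space R" by simp
    interpret product_sigma_finite "\<lambda>_ :: nat. M"
      using sigma_kernel_sigma_finite[OF sigma_kernel_R M] by (simp add: product_sigma_finite_def)
    have "(\<lambda>w. F (w, M)) \<in> borel_measurable (PiM {1..Suc n} (\<lambda>_. K))"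
      using measurable_Pair1[OF F M] .
    then have "(\<lambda>w. F (w, M)) \<in> borel_measurable (PiM {1..Suc n} (\<lambda>_. M))"
      by (subst measurable_cong_sets[OF sets_PiM_cong[OF refl] refl]) (auto simp: space_R_D[OF M])
    then show "(\<integral>\<^sup>+ w. F (w, M) \<partial>PiM {1..Suc n} (\<lambda>_. M)) = (\<integral>\<^sup>+ w. F' (w, M) \<partial>PiM {1..n} (\<lambda>_. M))"
      unfolding Suc_eq F'_def prod.case by (intro product_nn_integral_insert) auto
  qed
  also have "\<dots> = (\<Sum>p | partition_on {1..n} p. mecke_term n F' p)"
    by (rule Suc.IH[OF F'])
  also have "\<dots> = (\<Sum>p | partition_on {1..n} p. mecke_term (Suc n) F (insert {Suc n} p) +
      (\<Sum>C\<in>p. mecke_term (Suc n) F (insert (insert (Suc n) C) (p - {C}))))"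
  proof (intro sum.cong refl)
    fix p assume "p \<in> {p. partition_on {1..n} p}"
    then have p: "partition_on {1..n} p" by simp
    have fin: "finite p" using partition_on_finite[OF _ p] by simp
    have spaceP: "space (PiM p (\<lambda>_. \<nu>)) = space (PiM p (\<lambda>_. K))"
      by (rule sets_eq_imp_space_eq[OF sets_PiM_\<nu>])
    have cong: "f \<in> borel_measurable (PiM p (\<lambda>_. \<nu>) \<Otimes>\<^sub>M L)" if "f \<in> borel_measurable (PiM p (\<lambda>_. K) \<Otimes>\<^sub>M R)" for f :: "_ \<Rightarrow> ennreal"
      using that by (subst measurable_cong_sets[OF sets_pair_measure_cong[OF sets_PiM_\<nu>] refl]) auto
    define G where "G v M = (\<integral>\<^sup>+ x. F ((of_cells n p v)(Suc n := x), add_cells p v M) \<partial>M)" for v M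
    have G: "(\<lambda>(v, M). G v M) \<in> borel_measurable (PiM p (\<lambda>_. K) \<Otimes>\<^sub>M R)"
    proof -
      have "(\<lambda>z. ((of_cells n p (fst (fst z)))(Suc n := snd z), add_cells p (fst (fst z)) (snd (fst z)))) \<in>
        measurable ((PiM p (\<lambda>_. K) \<Otimes>\<^sub>M R) \<Otimes>\<^sub>M K) (PiM {1..Suc n} (\<lambda>_. K) \<Otimes>\<^sub>M R)"
      proof (intro measurable_Pair)
        show "(\<lambda>z. (of_cells n p (fst (fst z)))(Suc n := snd z)) \<in>
            measurable ((PiM p (\<lambda>_. K) \<Otimes>\<^sub>M R) \<Otimes>\<^sub>M K) (PiM {1..Suc n} (\<lambda>_. K))"
          using measurable_compose[OF measurable_compose[OF measurable_fst measurable_fst] measurable_of_cells[OF p]]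
          by (intro measurable_fun_upd[where J="{1..n}"]) (auto simp: atLeastAtMostSuc_conv)
        have "(\<lambda>z. case fst z of (v, M) \<Rightarrow> add_cells p v M) \<in> measurable ((PiM p (\<lambda>_. K) \<Otimes>\<^sub>M R) \<Otimes>\<^sub>M K) R"
          by (rule measurable_compose[OF measurable_fst measurable_add_cells])
        then show "(\<lambda>z. add_cells p (fst (fst z)) (snd (fst z))) \<in> measurable ((PiM p (\<lambda>_. K) \<Otimes>\<^sub>M R) \<Otimes>\<^sub>M K) R"
          by (simp add: split_beta')
      qed
      from measurable_compose[OF this F]
      show ?thesis
        using measurable_nn_integral_R[of "\<lambda>z x. F ((of_cells n p (fst z))(Suc n := x), add_cells p (fst z) (snd z))"
            "PiM p (\<lambda>_. K) \<Otimes>\<^sub>M R" snd]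
        by (simp add: G_def split_beta')
    qed
    have H: "(\<lambda>(v, M). F ((of_cells n p v)(Suc n := v C), add_cells p v M)) \<in> borel_measurable (PiM p (\<lambda>_. K) \<Otimes>\<^sub>M R)"
      if "C \<in> p" for C by (rule measurable_update_cells[OF p that F])
    have G': "(\<lambda>M. G v M) \<in> borel_measurable L" if "v \<in> space (PiM p (\<lambda>_. \<nu>))" for v
      using measurable_Pair2[OF cong[OF G] that] by simp
    have H': "(\<lambda>M. F ((of_cells n p v)(Suc n := v C), add_cells p v M)) \<in> borel_measurable L"
      if "C \<in> p" "v \<in> space (PiM p (\<lambda>_. \<nu>))" for v C
      using measurable_Pair2[OF cong[OF H[OF that(1)]] that(2)] by simp
    have "mecke_term n F' p = (\<integral>\<^sup>+ v. (\<integral>\<^sup>+ M. G v M +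
        (\<Sum>C\<in>p. F ((of_cells n p v)(Suc n := v C), add_cells p v M)) \<partial>L) \<partial>PiM p (\<lambda>_. \<nu>))"
      unfolding mecke_term_def
    proof (intro nn_integral_cong)
      fix v M assume v: "v \<in> space (PiM p (\<lambda>_. \<nu>))" and "M \<in> space L"
      then have M: "M \<in> space R" by simp
      have v': "v \<in> space (PiM p (\<lambda>_. K))" using v spaceP by simp
      have "add_cells p v M \<in> space R"
        using M by (auto simp: space_boundedly_finite_measures intro!: boundedly_finite_add_atoms)
      moreover have "of_cells n p v \<in> space (PiM {1..n} (\<lambda>_. K))"
        using measurable_space[OF measurable_of_cells[OF p] v'] .
      ultimately have "(\<lambda>x. F ((of_cells n p v)(Suc n := x), add_cells p v M)) \<in> borel_measurable K"
        using measurable_Pair2[OF upd, of "(of_cells n p v, add_cells p v M)"] by (simp add: space_pair_measure)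
      then have "(\<lambda>x. F ((of_cells n p v)(Suc n := x), add_cells p v M)) \<in> borel_measurable M"
        by (simp add: space_R_D[OF M] cong: measurable_cong_sets)
      moreover have "(fst (v C), snd (v C)) \<in> space M" if "C \<in> p" for C
        using v' that by (auto simp: space_PiM space_R_D[OF M])
      ultimately show "F' (of_cells n p v, add_cells p v M) =
          G v M + (\<Sum>C\<in>p. F ((of_cells n p v)(Suc n := v C), add_cells p v M))"
        using fin by (simp add: F'_def G_def nn_integral_add_atoms)
    qed
    also have "\<dots> = (\<integral>\<^sup>+ v. (\<integral>\<^sup>+ M. G v M \<partial>L) +
        (\<Sum>C\<in>p. \<integral>\<^sup>+ M. F ((of_cells n p v)(Suc n := v C), add_cells p v M) \<partial>L) \<partial>PiM p (\<lambda>_. \<nu>))"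
      using G' H' by (intro nn_integral_cong) (simp add: nn_integral_add nn_integral_sum)
    also have "\<dots> = (\<integral>\<^sup>+ v. (\<integral>\<^sup>+ M. G v M \<partial>L) \<partial>PiM p (\<lambda>_. \<nu>)) +
        (\<Sum>C\<in>p. \<integral>\<^sup>+ v. (\<integral>\<^sup>+ M. F ((of_cells n p v)(Suc n := v C), add_cells p v M) \<partial>L) \<partial>PiM p (\<lambda>_. \<nu>))"
      using L.borel_measurable_nn_integral[OF cong[OF G]] L.borel_measurable_nn_integral[OF cong[OF H]]
      by (simp add: nn_integral_add nn_integral_sum)
    also have "(\<integral>\<^sup>+ v. (\<integral>\<^sup>+ M. G v M \<partial>L) \<partial>PiM p (\<lambda>_. \<nu>)) = mecke_term (Suc n) F (insert {Suc n} p)"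
      by (simp add: G_def mecke_term_add_cell[OF p F])
    also have "(\<Sum>C\<in>p. \<integral>\<^sup>+ v. (\<integral>\<^sup>+ M. F ((of_cells n p v)(Suc n := v C), add_cells p v M) \<partial>L) \<partial>PiM p (\<lambda>_. \<nu>)) =
        (\<Sum>C\<in>p. mecke_term (Suc n) F (insert (insert (Suc n) C) (p - {C})))"
      by (intro sum.cong refl mecke_term_enlarge_cell[OF p _ F, symmetric])
    finally show "mecke_term n F' p = mecke_term (Suc n) F (insert {Suc n} p) +
      (\<Sum>C\<in>p. mecke_term (Suc n) F (insert (insert (Suc n) C) (p - {C})))" .
  qed
  also have "\<dots> = (\<Sum>p | partition_on {1..Suc n} p. mecke_term (Suc n) F p)"
    unfolding Suc_eq by (rule sum_partition_on_insert[symmetric]) auto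
  finally show ?case .
qed

end

section \<open>Conditional laws\<close>

text \<open>The definition speaks of rectangles only. These are stable under intersection and
  generate the product \<sigma>-algebra, so the joint law of \<open>(Z, X)\<close> is the
  composition of the law of \<open>Z\<close> with the kernel.\<close>

lemma regular_conditional_law_nn_integral:
  assumes r: "regular_conditional_law \<Omega> X MX Z MZ \<kappa>" and F: "F \<in> borel_measurable (MZ \<Otimes>\<^sub>M MX)"
  shows "(\<integral>\<^sup>+ \<omega>. F (Z \<omega>, X \<omega>) \<partial>\<Omega>) = (\<integral>\<^sup>+ z. (\<integral>\<^sup>+ x. F (z, x) \<partial>\<kappa> z) \<partial>distr \<Omega> MZ Z)"
proof -
  have X[measurable]: "X \<in> measurable \<Omega> MX" and Z[measurable]: "Z \<in> measurable \<Omega> MZ"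
    and \<kappa>: "\<kappa> \<in> measurable MZ (prob_algebra MX)" and prob: "prob_space \<Omega>"
    and eq: "\<And>A B. A \<in> sets MZ \<Longrightarrow> B \<in> sets MX \<Longrightarrow> emeasure \<Omega> {\<omega> \<in> space \<Omega>. Z \<omega> \<in> A \<and> X \<omega> \<in> B} =
        (\<integral>\<^sup>+ z. emeasure (\<kappa> z) B * indicator A z \<partial>distr \<Omega> MZ Z)"
    using r by (auto simp: regular_conditional_law_def)
  interpret prob_space \<Omega> by fact
  have \<kappa>_sub[measurable]: "\<kappa> \<in> measurable MZ (subprob_algebra MX)"
    using \<kappa> by (rule measurable_prob_algebraD)
  have sets_\<kappa>: "sets (\<kappa> z) = sets MX" if "z \<in> space MZ" for z
    using sets_kernel[OF \<kappa>_sub that] .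
  have K: "sigma_kernel (distr \<Omega> MZ Z) MX \<kappa>"
    unfolding sigma_kernel_def
  proof (intro conjI exI[of _ "\<lambda>_. space MX"])
    show "\<kappa> \<in> measurable (distr \<Omega> MZ Z) (measure_algebra MX)"
      using measurable_emeasure_kernel[OF \<kappa>_sub] by (intro measurable_measure_algebra) (simp_all add: sets_\<kappa>)
    show "\<forall>z\<in>space (distr \<Omega> MZ Z). \<forall>k::nat. emeasure (\<kappa> z) (space MX) < \<infinity>"
      using subprob_space.subprob_emeasure_le_1[OF subprob_space_kernel[OF \<kappa>_sub]]
      by (auto intro!: le_less_trans[OF _ ennreal_one_less_top])
  qed auto
  let ?P = "semidirect (distr \<Omega> MZ Z) MX \<kappa>"
  have sets_P: "sets ?P = sets (MZ \<Otimes>\<^sub>M MX)"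
    by (rule trans[OF sets_semidirect sets_pair_measure_cong[OF sets_distr refl]])
  have "distr \<Omega> (MZ \<Otimes>\<^sub>M MX) (\<lambda>\<omega>. (Z \<omega>, X \<omega>)) = ?P"
  proof (rule measure_eqI_generator_eq[OF Int_stable_pair_measure_generator[of MZ MX], where \<Omega>="space MZ \<times> space MX" and A="\<lambda>_. space MZ \<times> space MX"])
    fix E assume "E \<in> {a \<times> b |a b. a \<in> sets MZ \<and> b \<in> sets MX}"
    then obtain A B where E: "E = A \<times> B" and [measurable]: "A \<in> sets MZ" "B \<in> sets MX" by auto
    have "emeasure (distr \<Omega> (MZ \<Otimes>\<^sub>M MX) (\<lambda>\<omega>. (Z \<omega>, X \<omega>))) E = emeasure \<Omega> {\<omega> \<in> space \<Omega>. Z \<omega> \<in> A \<and> X \<omega> \<in> B}"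
      unfolding E by (subst emeasure_distr) (auto intro!: arg_cong[where f="emeasure \<Omega>"])
    also have "\<dots> = (\<integral>\<^sup>+ z. emeasure (\<kappa> z) B * indicator A z \<partial>distr \<Omega> MZ Z)" by (rule eq) measurable
    also have "\<dots> = (\<integral>\<^sup>+ z. (\<integral>\<^sup>+ x. indicator (A \<times> B) (z, x) \<partial>\<kappa> z) \<partial>distr \<Omega> MZ Z)"
    proof (intro nn_integral_cong)
      fix z assume "z \<in> space (distr \<Omega> MZ Z)"
      then have "B \<in> sets (\<kappa> z)" by (simp add: sets_\<kappa>)
      then show "emeasure (\<kappa> z) B * indicator A z = (\<integral>\<^sup>+ x. indicator (A \<times> B) (z, x) \<partial>\<kappa> z)"
        by (simp add: indicator_times nn_integral_cmult mult.commute[of "emeasure _ _"])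
    qed
    also have "\<dots> = (\<integral>\<^sup>+ w. indicator (A \<times> B) w \<partial>?P)"
      by (rule nn_integral_semidirect[OF K, symmetric]) simp
    also have "\<dots> = emeasure ?P E" unfolding E by (rule nn_integral_indicator) simp
    finally show "emeasure (distr \<Omega> (MZ \<Otimes>\<^sub>M MX) (\<lambda>\<omega>. (Z \<omega>, X \<omega>))) E = emeasure ?P E" .
  next
    interpret Q: prob_space "distr \<Omega> (MZ \<Otimes>\<^sub>M MX) (\<lambda>\<omega>. (Z \<omega>, X \<omega>))" by (rule prob_space_distr) simp
    show "emeasure (distr \<Omega> (MZ \<Otimes>\<^sub>M MX) (\<lambda>\<omega>. (Z \<omega>, X \<omega>))) (space MZ \<times> space MX) \<noteq> \<infinity>"
      by simp
  qed (auto simp: sets_pair_measure sets_P dest: sets.sets_into_space)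
  then have "(\<integral>\<^sup>+ x. F x \<partial>?P) = (\<integral>\<^sup>+ x. F x \<partial>distr \<Omega> (MZ \<Otimes>\<^sub>M MX) (\<lambda>\<omega>. (Z \<omega>, X \<omega>)))" by simp
  also have "\<dots> = (\<integral>\<^sup>+ \<omega>. F (Z \<omega>, X \<omega>) \<partial>\<Omega>)"
    using F by (subst nn_integral_distr) auto
  finally show ?thesis
    using nn_integral_semidirect[OF K, of F] F measurable_cong_sets[OF sets_P refl, of borel]
      measurable_cong_sets[OF sets_semidirect refl, of _ _ _ borel] by simp
qed

lemma conditional_law_nn_integral:
  assumes c: "conditional_law \<Omega> X MX Z MZ \<kappa>" and F: "F \<in> borel_measurable (MZ \<Otimes>\<^sub>M MX)"
  shows "(\<integral>\<^sup>+ \<omega>. F (Z \<omega>, X \<omega>) \<partial>\<Omega>) = (\<integral>\<^sup>+ z. (\<integral>\<^sup>+ x. F (z, x) \<partial>\<kappa> z) \<partial>distr \<Omega> MZ Z)"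
proof -
  obtain \<kappa>' where r: "regular_conditional_law \<Omega> X MX Z MZ \<kappa>'" and ae: "AE z in distr \<Omega> MZ Z. \<kappa> z = \<kappa>' z"
    using c by (auto simp: conditional_law_def)
  have "(\<integral>\<^sup>+ z. (\<integral>\<^sup>+ x. F (z, x) \<partial>\<kappa>' z) \<partial>distr \<Omega> MZ Z) = (\<integral>\<^sup>+ z. (\<integral>\<^sup>+ x. F (z, x) \<partial>\<kappa> z) \<partial>distr \<Omega> MZ Z)"
    using ae by (intro nn_integral_cong_AE) auto
  then show ?thesis using regular_conditional_law_nn_integral[OF r F] by simp
qed

text \<open>\<mu> and P_\<mu> are measurable functions of N, so their posterior laws are images of
  that of N. The exceptional null set of the conditioning variable stays the same.\<close>

lemma conditional_law_distr:
  assumes c: "conditional_law \<Omega> X MX Z MZ \<kappa>" and f[measurable]: "f \<in> measurable MX MX'"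
  shows "conditional_law \<Omega> (\<lambda>\<omega>. f (X \<omega>)) MX' Z MZ (\<lambda>z. distr (\<kappa> z) MX' f)"
proof -
  obtain \<kappa>' where r: "regular_conditional_law \<Omega> X MX Z MZ \<kappa>'" and ae: "AE z in distr \<Omega> MZ Z. \<kappa> z = \<kappa>' z"
    using c by (auto simp: conditional_law_def)
  have X[measurable]: "X \<in> measurable \<Omega> MX" and Z[measurable]: "Z \<in> measurable \<Omega> MZ"
    and \<kappa>: "\<kappa>' \<in> measurable MZ (prob_algebra MX)" and prob: "prob_space \<Omega>"
    and eq: "\<And>A B. A \<in> sets MZ \<Longrightarrow> B \<in> sets MX \<Longrightarrow> emeasure \<Omega> {\<omega> \<in> space \<Omega>. Z \<omega> \<in> A \<and> X \<omega> \<in> B} =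
        (\<integral>\<^sup>+ z. emeasure (\<kappa>' z) B * indicator A z \<partial>distr \<Omega> MZ Z)"
    using r by (auto simp: regular_conditional_law_def)
  have sets_\<kappa>: "sets (\<kappa>' z) = sets MX" if "z \<in> space MZ" for z
    using sets_kernel[OF measurable_prob_algebraD[OF \<kappa>] that] .
  have "regular_conditional_law \<Omega> (\<lambda>\<omega>. f (X \<omega>)) MX' Z MZ (\<lambda>z. distr (\<kappa>' z) MX' f)"
    unfolding regular_conditional_law_def
  proof (intro conjI ballI)
    show "(\<lambda>z. distr (\<kappa>' z) MX' f) \<in> measurable MZ (prob_algebra MX')"
      by (rule measurable_compose[OF \<kappa> measurable_distr_prob_space[OF f]])
  next
    fix A B assume [measurable]: "A \<in> sets MZ" "B \<in> sets MX'"
    have "{\<omega> \<in> space \<Omega>. Z \<omega> \<in> A \<and> f (X \<omega>) \<in> B} = {\<omega> \<in> space \<Omega>. Z \<omega> \<in> A \<and> X \<omega> \<in> f -` B \<inter> space MX}"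
      using measurable_space[OF X] by auto
    also have "emeasure \<Omega> \<dots> = (\<integral>\<^sup>+ z. emeasure (\<kappa>' z) (f -` B \<inter> space MX) * indicator A z \<partial>distr \<Omega> MZ Z)"
      by (rule eq) measurable
    also have "\<dots> = (\<integral>\<^sup>+ z. emeasure (distr (\<kappa>' z) MX' f) B * indicator A z \<partial>distr \<Omega> MZ Z)"
    proof (intro nn_integral_cong arg_cong2[where f="(*)"] refl)
      fix z assume "z \<in> space (distr \<Omega> MZ Z)"
      then have z: "z \<in> space MZ" by simp
      have "f \<in> measurable (\<kappa>' z) MX'" using f sets_\<kappa>[OF z] by (simp cong: measurable_cong_sets)
      then show "emeasure (\<kappa>' z) (f -` B \<inter> space MX) = emeasure (distr (\<kappa>' z) MX' f) B"
        using sets_eq_imp_space_eq[OF sets_\<kappa>[OF z]] by (simp add: emeasure_distr)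
    qed
    finally show "emeasure \<Omega> {\<omega> \<in> space \<Omega>. Z \<omega> \<in> A \<and> f (X \<omega>) \<in> B} = \<dots>" .
  qed (use prob in measurable)
  moreover have "AE z in distr \<Omega> MZ Z. distr (\<kappa> z) MX' f = distr (\<kappa>' z) MX' f"
    using ae by eventually_elim simp
  ultimately show ?thesis unfolding conditional_law_def by blast
qed

text \<open>Bayes' rule. If the joint law disintegrates as \<open>I(dz) T(z, dx)\<close>, then the law of \<open>X\<close> given
  \<open>Z = z\<close> is \<open>T(z, \<cdot>)\<close> normalised. The set where \<open>T(z, \<cdot>)\<close> has mass \<open>0\<close> or \<open>\<infinity>\<close> is null for \<open>Z\<close>,
  since doubling an integrand supported on that set does not change its integral.\<close>

lemma conditional_law_bayes:
  fixes I :: "('z \<Rightarrow> ennreal) \<Rightarrow> ennreal"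
  assumes prob: "prob_space \<Omega>" and X[measurable]: "X \<in> measurable \<Omega> MX" and Z[measurable]: "Z \<in> measurable \<Omega> MZ"
    and T_sets: "\<And>z. z \<in> space MZ \<Longrightarrow> sets (T z) = sets MX"
    and T_meas: "\<And>B. B \<in> sets MX \<Longrightarrow> (\<lambda>z. emeasure (T z) B) \<in> borel_measurable MZ"
    and I_cong: "\<And>f g. (\<And>z. z \<in> space MZ \<Longrightarrow> f z = g z) \<Longrightarrow> I f = I g"
    and joint: "\<And>F. F \<in> borel_measurable (MZ \<Otimes>\<^sub>M MX) \<Longrightarrow>
        (\<integral>\<^sup>+ \<omega>. F (Z \<omega>, X \<omega>) \<partial>\<Omega>) = I (\<lambda>z. \<integral>\<^sup>+ x. F (z, x) \<partial>T z)"
    and G[measurable]: "G \<in> sets MZ" and Z_G: "AE \<omega> in \<Omega>. Z \<omega> \<in> G"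
    and \<kappa>_sets: "\<And>z. z \<in> G \<Longrightarrow> 0 < emeasure (T z) (space MX) \<Longrightarrow> emeasure (T z) (space MX) < \<infinity> \<Longrightarrow> sets (\<kappa> z) = sets MX"
    and \<kappa>: "\<And>z B. z \<in> G \<Longrightarrow> 0 < emeasure (T z) (space MX) \<Longrightarrow> emeasure (T z) (space MX) < \<infinity> \<Longrightarrow> B \<in> sets MX \<Longrightarrow>
        emeasure (\<kappa> z) B = emeasure (T z) B / emeasure (T z) (space MX)"
  shows "conditional_law \<Omega> X MX Z MZ \<kappa>"
proof -
  interpret prob_space \<Omega> by fact
  define t where "t z = emeasure (T z) (space MX)" for z
  have t[measurable]: "t \<in> borel_measurable MZ" unfolding t_def by (rule T_meas) simp
  have T_int: "(\<integral>\<^sup>+ x. c * indicator B x \<partial>T z) = c * emeasure (T z) B" if "z \<in> space MZ" "B \<in> sets MX" for c z B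
    using that T_sets by (intro nn_integral_cmult_indicator) simp
  have T_const: "(\<integral>\<^sup>+ x. c \<partial>T z) = c * t z" if "z \<in> space MZ" for c z
    using sets_eq_imp_space_eq[OF T_sets[OF that]] by (simp add: t_def)
  define bad where "bad = {z \<in> space MZ. t z = 0 \<or> t z = \<infinity>}"
  have bad[measurable]: "bad \<in> sets MZ" unfolding bad_def by measurable
  have "(\<integral>\<^sup>+ \<omega>. indicator bad (Z \<omega>) \<partial>\<Omega>) = 0"
  proof -
    define b :: ennreal where "b = (\<integral>\<^sup>+ \<omega>. indicator bad (Z \<omega>) \<partial>\<Omega>)"
    have "b = I (\<lambda>z. \<integral>\<^sup>+ x. indicator bad z \<partial>T z)"
      unfolding b_def using joint[of "\<lambda>x. indicator bad (fst x)"] by simp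
    also have "\<dots> = I (\<lambda>z. \<integral>\<^sup>+ x. 2 * indicator bad z \<partial>T z)"
      by (rule I_cong) (simp only: T_const, auto simp: bad_def indicator_def)
    also have "\<dots> = (\<integral>\<^sup>+ \<omega>. 2 * indicator bad (Z \<omega>) \<partial>\<Omega>)"
      using joint[of "\<lambda>x. 2 * indicator bad (fst x)"] by simp
    also have "\<dots> = b + b" unfolding b_def by (subst nn_integral_cmult) (auto simp: mult_2)
    finally have "b + 0 = b + b" by simp
    moreover have "b \<le> (\<integral>\<^sup>+ \<omega>. 1 \<partial>\<Omega>)" unfolding b_def by (intro nn_integral_mono) (auto simp: indicator_def)
    then have "b \<noteq> \<infinity>" using emeasure_space_1 by (auto simp: top_unique)
    ultimately have "0 = b" by (simp only: ennreal_add_left_cancel) simp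
    then show ?thesis by (simp add: b_def)
  qed
  then have Z_bad: "AE \<omega> in \<Omega>. Z \<omega> \<notin> bad"
    by (subst (asm) nn_integral_0_iff_AE) (auto simp: indicator_def split: if_splits)
  define H where "H = G - bad"
  have H[measurable]: "H \<in> sets MZ" by (simp add: H_def)
  have Z_H: "AE \<omega> in \<Omega>. Z \<omega> \<in> H" using Z_G Z_bad by eventually_elim (simp add: H_def)
  have H_space: "z \<in> H \<Longrightarrow> z \<in> space MZ" for z using sets.sets_into_space[OF G] by (auto simp: H_def)
  have tH: "0 < t z" "t z < \<infinity>" if "z \<in> H" for z
    using that H_space[OF that] by (auto simp: H_def bad_def zero_less_iff_neq_zero less_top)
  have \<kappa>H: "sets (\<kappa> z) = sets MX" "\<And>B. B \<in> sets MX \<Longrightarrow> emeasure (\<kappa> z) B = emeasure (T z) B / t z" if "z \<in> H" for z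
    using \<kappa>_sets[of z] \<kappa>[of z] tH[OF that] that by (auto simp: t_def H_def)
  \<comment> \<open>Off \<open>H\<close> any fixed probability measure turns the formula into a
    kernel defined everywhere; the law of \<open>X\<close> is at hand.\<close>
  define \<kappa>' where "\<kappa>' z = (if z \<in> H then \<kappa> z else distr \<Omega> MX X)" for z
  have \<kappa>': "\<kappa>' \<in> measurable MZ (prob_algebra MX)"
  proof (rule measurable_prob_algebraI)
    show prob_\<kappa>': "prob_space (\<kappa>' z)" if "z \<in> space MZ" for z
    proof (cases "z \<in> H")
      case True
      have "emeasure (\<kappa> z) (space (\<kappa> z)) = t z / t z"
        using \<kappa>H[OF True] sets_eq_imp_space_eq[OF \<kappa>H(1)[OF True]] by (simp add: t_def)
      also have "\<dots> = 1" using tH[OF True] by (simp add: ennreal_divide_self)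
      finally show ?thesis using True by (auto simp: \<kappa>'_def intro: prob_spaceI)
    qed (simp add: \<kappa>'_def prob_space_distr)
    show "\<kappa>' \<in> measurable MZ (subprob_algebra MX)"
    proof (rule measurable_subprob_algebra)
      show "subprob_space (\<kappa>' z)" if "z \<in> space MZ" for z
        using prob_\<kappa>'[OF that] by (rule prob_space_imp_subprob_space)
      show "sets (\<kappa>' z) = sets MX" for z
        using \<kappa>H(1) by (simp add: \<kappa>'_def)
      fix B assume B: "B \<in> sets MX"
      note [measurable] = T_meas[OF B]
      have "(\<lambda>z. if z \<in> H then emeasure (T z) B / t z else emeasure (distr \<Omega> MX X) B) \<in> borel_measurable MZ"
        by measurable
      also have "(\<lambda>z. if z \<in> H then emeasure (T z) B / t z else emeasure (distr \<Omega> MX X) B) = (\<lambda>z. emeasure (\<kappa>' z) B)"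
        using \<kappa>H(2)[OF _ B] by (auto simp: \<kappa>'_def fun_eq_iff)
      finally show "(\<lambda>z. emeasure (\<kappa>' z) B) \<in> borel_measurable MZ" .
    qed
  qed
  have "regular_conditional_law \<Omega> X MX Z MZ \<kappa>'"
    unfolding regular_conditional_law_def
  proof (intro conjI ballI prob X Z \<kappa>')
    fix A B assume A[measurable]: "A \<in> sets MZ" and B[measurable]: "B \<in> sets MX"
    have \<kappa>'B[measurable]: "(\<lambda>z. emeasure (\<kappa>' z) B) \<in> borel_measurable MZ"
      by (rule measurable_emeasure_kernel[OF measurable_prob_algebraD[OF \<kappa>'] B])
    have "emeasure \<Omega> {\<omega> \<in> space \<Omega>. Z \<omega> \<in> A \<and> X \<omega> \<in> B} = (\<integral>\<^sup>+ \<omega>. indicator {\<omega> \<in> space \<Omega>. Z \<omega> \<in> A \<and> X \<omega> \<in> B} \<omega> \<partial>\<Omega>)"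
      by (rule nn_integral_indicator[symmetric]) measurable
    also have "\<dots> = (\<integral>\<^sup>+ \<omega>. indicator (A \<inter> H) (Z \<omega>) * indicator B (X \<omega>) \<partial>\<Omega>)"
      using Z_H by (intro nn_integral_cong_AE) (auto elim!: eventually_mono simp: indicator_def)
    also have "\<dots> = I (\<lambda>z. \<integral>\<^sup>+ x. indicator (A \<inter> H) z * indicator B x \<partial>T z)"
      using joint[of "\<lambda>x. indicator (A \<inter> H) (fst x) * indicator B (snd x)"] by simp
    \<comment> \<open>On \<open>H\<close> the mass \<open>emeasure (T z) B\<close> is
      \<open>emeasure (\<kappa>' z) B\<close> times the total mass of \<open>T z\<close>, that is,
      the integral of a constant against \<open>T z\<close>. In this form the identity
      \<open>joint\<close> can be read backwards.\<close>
    also have "\<dots> = I (\<lambda>z. \<integral>\<^sup>+ x. emeasure (\<kappa>' z) B * indicator (A \<inter> H) z \<partial>T z)"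
    proof (rule I_cong)
      fix z assume z: "z \<in> space MZ"
      show "(\<integral>\<^sup>+ x. indicator (A \<inter> H) z * indicator B x \<partial>T z) = (\<integral>\<^sup>+ x. emeasure (\<kappa>' z) B * indicator (A \<inter> H) z \<partial>T z)"
      proof (cases "z \<in> H")
        case True
        have "emeasure (T z) B / t z * t z = emeasure (T z) B"
          using tH[OF True]
          by (subst mult.commute, subst ennreal_times_divide, subst mult.commute, intro ennreal_mult_divide_eq) auto
        then have "emeasure (\<kappa>' z) B * t z = emeasure (T z) B"
          using True \<kappa>H(2)[OF True B] by (simp add: \<kappa>'_def)
        then show ?thesis unfolding T_int[OF z B] T_const[OF z] by (metis mult.assoc mult.commute)
      qed (simp add: indicator_def)
    qed
    also have "\<dots> = (\<integral>\<^sup>+ \<omega>. emeasure (\<kappa>' (Z \<omega>)) B * indicator (A \<inter> H) (Z \<omega>) \<partial>\<Omega>)"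
      using joint[of "\<lambda>x. emeasure (\<kappa>' (fst x)) B * indicator (A \<inter> H) (fst x)"] by simp
    also have "\<dots> = (\<integral>\<^sup>+ \<omega>. emeasure (\<kappa>' (Z \<omega>)) B * indicator A (Z \<omega>) \<partial>\<Omega>)"
      using Z_H by (intro nn_integral_cong_AE) (auto elim!: eventually_mono simp: indicator_def)
    also have "\<dots> = (\<integral>\<^sup>+ z. emeasure (\<kappa>' z) B * indicator A z \<partial>distr \<Omega> MZ Z)"
      by (subst nn_integral_distr) measurable
    finally show "emeasure \<Omega> {\<omega> \<in> space \<Omega>. Z \<omega> \<in> A \<and> X \<omega> \<in> B} = \<dots>" .
  qed
  moreover have "AE z in distr \<Omega> MZ Z. \<kappa> z = \<kappa>' z"
  proof -
    have "AE z in distr \<Omega> MZ Z. z \<in> H"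
      using Z_H by (subst AE_distr_iff) (auto simp: H_space intro: sets.sets_Collect)
    then show ?thesis by eventually_elim (simp add: \<kappa>'_def)
  qed
  ultimately show ?thesis unfolding conditional_law_def by blast
qed

section \<open>The intensity measure\<close>

text \<open>\<open>\<rho>(ds|y)\<close> is \<open>\<sigma>\<close>-finite for \<open>\<eta>\<close>-almost every \<open>y\<close> only; the exceptional values are replaced
  by the null measure.\<close>

definition regular_jumps :: "('y::polish_space \<Rightarrow> real measure) \<Rightarrow> 'y \<Rightarrow> real measure" where
  "regular_jumps \<rho> y = (if (\<integral>\<^sup>+ s. ennreal (min s 1) \<partial>\<rho> y) < \<infinity> then \<rho> y else null_measure Jumps)"

lemma measurable_jump_mass:
  "\<rho> \<in> measurable borel (measure_algebra Jumps) \<Longrightarrow>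
    (\<lambda>y. \<integral>\<^sup>+ s. ennreal (min s 1) \<partial>\<rho> y) \<in> borel_measurable borel"
  by (rule measurable_compose[OF _ nn_integral_measurable_measure_algebra])
     (auto intro!: measurable_restrict_space1)

text \<open>Markov's inequality: on jumps larger than 1 / (k + 1) the function min s 1 is at least 1
  / (k + 1), so a finite integral of it bounds their mass. These sets exhaust the positive half-line
  and are the same for all locations.\<close>

lemma sigma_kernel_regular_jumps:
  assumes \<rho>: "\<rho> \<in> measurable borel (measure_algebra Jumps)"
  shows "sigma_kernel borel Jumps (regular_jumps \<rho>)"
  unfolding sigma_kernel_def
proof (intro conjI exI[of _ "\<lambda>k::nat. {1 / Suc k<..}"])
  have sets_\<rho>: "sets (\<rho> y) = sets Jumps" for y
    using measure_algebra_sets[OF \<rho>, of y] by simp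
  note [measurable] = measurable_jump_mass[OF \<rho>]
  show "regular_jumps \<rho> \<in> measurable borel (measure_algebra Jumps)"
  proof (rule measurable_measure_algebra)
    fix A assume A: "A \<in> sets Jumps"
    have [measurable]: "(\<lambda>y. emeasure (\<rho> y) A) \<in> borel_measurable borel"
      by (rule measurable_compose[OF \<rho> measurable_emeasure_measure_algebra[OF A]])
    have "(\<lambda>y. if (\<integral>\<^sup>+ s. ennreal (min s 1) \<partial>\<rho> y) < \<infinity> then emeasure (\<rho> y) A else 0) \<in> borel_measurable borel"
      by measurable
    then show "(\<lambda>y. emeasure (regular_jumps \<rho> y) A) \<in> borel_measurable borel"
      by (rule measurable_cong[THEN iffD1, rotated]) (simp add: regular_jumps_def)
  qed (simp add: regular_jumps_def sets_\<rho>)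
  have pos: "0 < x" if "1 / real (Suc k) < x" for k x
  proof -
    have "0 < 1 / real (Suc k)" by simp
    then show ?thesis using that by (rule less_trans)
  qed
  have in_Jumps: "{1 / real (Suc k)<..} \<in> sets Jumps" for k
    by (auto simp: sets_restrict_space_iff simp del: of_nat_Suc intro: pos)
  then show "range (\<lambda>k. {1 / real (Suc k)<..}) \<subseteq> sets Jumps" by blast
  show "(\<Union>k. {1 / real (Suc k)<..}) = space Jumps"
  proof
    show "(\<Union>k. {1 / real (Suc k)<..}) \<subseteq> space Jumps"
      by (auto simp: space_restrict_space simp del: of_nat_Suc intro: pos)
    show "space Jumps \<subseteq> (\<Union>k. {1 / real (Suc k)<..})"
    proof
      fix x :: real assume "x \<in> space Jumps"
      then have "0 < x" by (simp add: space_restrict_space)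
      then obtain k where "inverse (real (Suc k)) < x" using reals_Archimedean by blast
      then show "x \<in> (\<Union>k. {1 / real (Suc k)<..})" by (auto simp: inverse_eq_divide)
    qed
  qed
  show "\<forall>y\<in>space borel. \<forall>k. emeasure (regular_jumps \<rho> y) {1 / real (Suc k)<..} < \<infinity>"
  proof (intro ballI allI)
    fix y k
    show "emeasure (regular_jumps \<rho> y) {1 / real (Suc k)<..} < \<infinity>"
    proof (cases "(\<integral>\<^sup>+ s. ennreal (min s 1) \<partial>\<rho> y) < \<infinity>")
      case True
      have m: "{1 / real (Suc k)<..} \<in> sets (\<rho> y)"
        using in_Jumps by (simp only: sets_\<rho>)
      have "emeasure (\<rho> y) {1 / real (Suc k)<..} = (\<integral>\<^sup>+ s. indicator {1 / real (Suc k)<..} s \<partial>\<rho> y)"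
        using m by simp
      also have "\<dots> \<le> (\<integral>\<^sup>+ s. ennreal (real (Suc k)) * ennreal (min s 1) \<partial>\<rho> y)"
      proof (intro nn_integral_mono)
        fix s :: real
        have "1 \<le> real (Suc k) * min s 1" if "1 / real (Suc k) < s"
        proof -
          have "1 / real (Suc k) \<le> 1" by simp
          then have "1 / real (Suc k) \<le> min s 1" using that by (auto simp del: of_nat_Suc)
          then have "real (Suc k) * (1 / real (Suc k)) \<le> real (Suc k) * min s 1"
            by (intro mult_left_mono) auto
          then show ?thesis by (simp del: of_nat_Suc)
        qed
        then show "indicator {1 / real (Suc k)<..} s \<le> ennreal (real (Suc k)) * ennreal (min s 1)"
          by (auto simp: indicator_def ennreal_mult'[symmetric] simp del: of_nat_Suc)
      qed
      also have "\<dots> = ennreal (real (Suc k)) * (\<integral>\<^sup>+ s. ennreal (min s 1) \<partial>\<rho> y)"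
        by (rule nn_integral_cmult)
           (auto simp: measurable_cong_sets[OF sets_\<rho> refl] intro!: measurable_restrict_space1)
      also have "\<dots> < \<infinity>" using True by (simp add: ennreal_mult_less_top del: of_nat_Suc)
      finally show ?thesis using True by (simp add: regular_jumps_def)
    qed (simp add: regular_jumps_def)
  qed
qed

text \<open>The balls of integer radius about the arbitrary centre \<open>undefined\<close> are
  bounded and cover the space. Integrability over each of them makes the integral of min s 1 finite
  almost everywhere on it, and countably many null sets are discarded.\<close>

lemma AE_regular_jumps:
  fixes \<eta> :: "'y::polish_space measure"
  assumes \<eta>: "sets \<eta> = sets borel" and \<rho>: "\<rho> \<in> measurable borel (measure_algebra Jumps)"
    and fin: "\<And>B. B \<in> sets borel \<Longrightarrow> bounded B \<Longrightarrow>
        (\<integral>\<^sup>+ y. (\<integral>\<^sup>+ s. ennreal (min s 1) \<partial>\<rho> y) * indicator B y \<partial>\<eta>) < \<infinity>"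
  shows "AE y in \<eta>. regular_jumps \<rho> y = \<rho> y"
proof -
  note [measurable_cong] = \<eta>
  note [measurable] = measurable_jump_mass[OF \<rho>]
  have "AE y in \<eta>. \<forall>k::nat. (\<integral>\<^sup>+ s. ennreal (min s 1) \<partial>\<rho> y) * indicator (ball undefined (real k)) y \<noteq> \<infinity>"
    unfolding AE_all_countable
  proof
    fix k :: nat
    show "AE y in \<eta>. (\<integral>\<^sup>+ s. ennreal (min s 1) \<partial>\<rho> y) * indicator (ball undefined (real k)) y \<noteq> \<infinity>"
    proof (rule nn_integral_PInf_AE)
      have "(\<lambda>y. (\<integral>\<^sup>+ s. ennreal (min s 1) \<partial>\<rho> y) * indicator (ball undefined (real k)) y) \<in> borel_measurable borel"
        by (intro borel_measurable_times_ennreal measurable_jump_mass[OF \<rho>] borel_measurable_indicator) auto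
      then show "(\<lambda>y. (\<integral>\<^sup>+ s. ennreal (min s 1) \<partial>\<rho> y) * indicator (ball undefined (real k)) y) \<in> borel_measurable \<eta>"
        by (simp only: measurable_cong_sets[OF \<eta> refl])
      show "(\<integral>\<^sup>+ y. (\<integral>\<^sup>+ s. ennreal (min s 1) \<partial>\<rho> y) * indicator (ball undefined (real k)) y \<partial>\<eta>) \<noteq> \<infinity>"
        using fin[of "ball undefined (real k)"] by auto
    qed
  qed
  then show ?thesis
  proof eventually_elim
    fix y
    assume *: "\<forall>k::nat. (\<integral>\<^sup>+ s. ennreal (min s 1) \<partial>\<rho> y) * indicator (ball undefined (real k)) y \<noteq> \<infinity>"
    obtain k :: nat where "dist undefined y < real k" using reals_Archimedean2 by blast
    with *[rule_format, of k] show "regular_jumps \<rho> y = \<rho> y"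
      by (simp add: regular_jumps_def less_top)
  qed
qed

lemma intensity_cong_AE: "AE y in \<eta>. \<rho> y = \<rho>' y \<Longrightarrow> intensity \<rho> \<eta> = intensity \<rho>' \<eta>"
  unfolding intensity_def
  by (intro arg_cong[where f="measure_of _ _"] ext nn_integral_cong_AE) auto

lemma sets_intensity[simp, measurable_cong]: "sets (intensity \<rho> \<eta>) = sets Marked"
  by (simp add: intensity_def)

lemma nn_integral_intensity:
  fixes r :: "'y::polish_space \<Rightarrow> real measure"
  assumes \<eta>: "sets \<eta> = sets borel" and r: "sigma_kernel borel Jumps r"
    and f: "f \<in> borel_measurable Marked"
  shows "(\<integral>\<^sup>+ w. f w \<partial>intensity r \<eta>) = (\<integral>\<^sup>+ y. (\<integral>\<^sup>+ s. f (s, y) \<partial>r y) \<partial>\<eta>)"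
proof -
  have r': "sigma_kernel \<eta> Jumps r"
    using \<eta> by (intro sigma_kernel_compose[OF _ r, of "\<lambda>y. y"]) (simp add: measurable_ident_sets)
  \<comment> \<open>The kernel leads from locations to jumps, whereas points are written with the
    jump first, so the intensity is a \<open>semidirect\<close> measure with exchanged coordinates.
    \<open>measure_of\<close> depends only on the values on measurable sets, where both
    agree.\<close>
  define S where "S = distr (semidirect \<eta> Jumps r) Marked (\<lambda>(y, s). (s, y))"
  have swap: "(\<lambda>(y, s). (s, y)) \<in> measurable (semidirect \<eta> Jumps r) Marked"
    unfolding measurable_cong_sets[OF trans[OF sets_semidirect sets_pair_measure_cong[OF \<eta> refl]] refl]
    by (rule measurable_pair_swap')
  have int_S: "(\<integral>\<^sup>+ w. g w \<partial>S) = (\<integral>\<^sup>+ y. (\<integral>\<^sup>+ s. g (s, y) \<partial>r y) \<partial>\<eta>)" if "g \<in> borel_measurable Marked" for g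
    unfolding S_def using that swap measurable_compose[OF swap that]
    by (simp add: nn_integral_distr nn_integral_semidirect[OF r'] cong: measurable_cong_sets)
  have "(\<integral>\<^sup>+ y. (\<integral>\<^sup>+ s. indicator C (s, y) \<partial>r y) \<partial>\<eta>) = emeasure S C" if "C \<in> sets Marked" for C
    using int_S[of "indicator C"] that by (simp add: S_def)
  then have "intensity r \<eta> = measure_of (space Marked) (sets Marked) (emeasure S)"
    unfolding intensity_def by (intro measure_of_eq sets.space_closed) (simp only: sets.sigma_sets_eq)
  also have "\<dots> = S" using measure_of_of_measure[of S] by (simp add: S_def)
  finally show ?thesis using int_S[OF f] by simp
qed

text \<open>A point of \<nu> is a location together with a jump whose measure depends on the
  location. For finitely many points all locations are integrated outside and all jumps inside, the
  order needed to disintegrate with respect to the sample.\<close>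

lemma nn_integral_PiM_intensity:
  fixes r :: "'y::polish_space \<Rightarrow> real measure" and I :: "'i set"
  assumes \<eta>: "sets \<eta> = sets borel" "sigma_finite_measure \<eta>" and r: "sigma_kernel borel Jumps r"
    and sf: "sigma_finite_measure (intensity r \<eta>)" and I: "finite I"
    and F: "F \<in> borel_measurable (PiM I (\<lambda>_. Marked))"
  shows "(\<integral>\<^sup>+ v. F v \<partial>PiM I (\<lambda>_. intensity r \<eta>)) =
    (\<integral>\<^sup>+ y. (\<integral>\<^sup>+ s. F (\<lambda>i\<in>I. (s i, y i)) \<partial>PiM I (\<lambda>i. r (y i))) \<partial>PiM I (\<lambda>_. \<eta>))"
proof -
  interpret \<eta>: sigma_finite_measure \<eta> by fact
  interpret P: product_sigma_finite "\<lambda>_ :: 'i. intensity r \<eta>" using sf by (simp add: product_sigma_finite_def)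
  interpret E: product_sigma_finite "\<lambda>_ :: 'i. \<eta>" using \<eta> by (simp add: product_sigma_finite_def)
  have r_sf: "sigma_finite_measure (r y)" for y using sigma_kernel_sigma_finite[OF r] by simp
  have sets_r: "sets (r y) = sets Jumps" for y using sigma_kernel_sets[OF r, of y] by simp
  have sets_PiM_r: "sets (PiM J (\<lambda>i. r (y i))) = sets (PiM J (\<lambda>_. Jumps))" for J :: "'i set" and y
    by (intro sets_PiM_cong) (auto simp: sets_r)
  have sets_PiM_\<eta>: "sets (PiM J (\<lambda>i. \<eta>)) = sets (PiM J (\<lambda>_. borel))" for J :: "'i set"
    by (intro sets_PiM_cong) (auto simp: \<eta>)
  have sets_PiM_\<nu>: "sets (PiM J (\<lambda>i. intensity r \<eta>)) = sets (PiM J (\<lambda>_. Marked))" for J :: "'i set"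
    by (intro sets_PiM_cong) auto
  show ?thesis
    using I F
  proof (induction I arbitrary: F rule: finite_induct)
    case empty
    show ?case by (simp add: PiM_empty nn_integral_count_space_finite)
  next
    case (insert j I)
    note F = insert.prems
    have zip: "(\<lambda>z. \<lambda>i\<in>J. (fst z i, snd z i)) \<in> measurable (PiM J (\<lambda>_. Jumps) \<Otimes>\<^sub>M PiM J (\<lambda>_. borel)) (PiM J (\<lambda>_. Marked))"
      for J :: "'i set"
      by (intro measurable_restrict measurable_Pair measurable_compose[OF measurable_fst measurable_component_singleton]
          measurable_compose[OF measurable_snd measurable_component_singleton])
    have upd: "(\<lambda>(v, w). F (v(j := w))) \<in> borel_measurable (PiM I (\<lambda>_. Marked) \<Otimes>\<^sub>M Marked)"
    proof -
      have "(\<lambda>z. (fst z)(j := snd z)) \<in> measurable (PiM I (\<lambda>_. Marked) \<Otimes>\<^sub>M Marked) (PiM (insert j I) (\<lambda>_. Marked))"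
        by (rule measurable_fun_upd[where J=I]) auto
      from measurable_compose[OF this F] show ?thesis unfolding split_beta' .
    qed
    define F0 where "F0 v = (\<integral>\<^sup>+ w. F (v(j := w)) \<partial>intensity r \<eta>)" for v
    have F0: "F0 \<in> borel_measurable (PiM I (\<lambda>_. Marked))"
      unfolding F0_def
      using upd by (intro sigma_finite_measure.borel_measurable_nn_integral[OF sf]) (simp cong: measurable_cong_sets sets_pair_measure_cong)
    \<comment> \<open>Here the new location \<open>t\<close> and jump \<open>u\<close> are
      integrated inside the old jumps \<open>s\<close>. Fubini then moves the integral over
      \<open>t\<close> outside that over \<open>s\<close>, so that the locations remain outside all
      jumps.\<close>
    define H where "H s y = (\<integral>\<^sup>+ t. (\<integral>\<^sup>+ u. F ((\<lambda>i\<in>I. (s i, y i))(j := (u, t))) \<partial>r t) \<partial>\<eta>)" for s y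
    have "(\<integral>\<^sup>+ v. F v \<partial>PiM (insert j I) (\<lambda>_. intensity r \<eta>)) = (\<integral>\<^sup>+ v. F0 v \<partial>PiM I (\<lambda>_. intensity r \<eta>))"
      unfolding F0_def using insert.hyps F
      by (intro P.product_nn_integral_insert) (simp_all add: measurable_cong_sets[OF sets_PiM_\<nu> refl])
    also have "\<dots> = (\<integral>\<^sup>+ y. (\<integral>\<^sup>+ s. F0 (\<lambda>i\<in>I. (s i, y i)) \<partial>PiM I (\<lambda>i. r (y i))) \<partial>PiM I (\<lambda>_. \<eta>))"
      by (rule insert.IH[OF F0])
    also have "\<dots> = (\<integral>\<^sup>+ y. (\<integral>\<^sup>+ s. H s y \<partial>PiM I (\<lambda>i. r (y i))) \<partial>PiM I (\<lambda>_. \<eta>))"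
    proof (intro nn_integral_cong)
      fix y s assume y: "y \<in> space (PiM I (\<lambda>_. \<eta>))" and s: "s \<in> space (PiM I (\<lambda>i. r (y i)))"
      have "(s, y) \<in> space (PiM I (\<lambda>_. Jumps) \<Otimes>\<^sub>M PiM I (\<lambda>_. borel))"
        using y s sets_eq_imp_space_eq[OF sets_PiM_\<eta>] sets_eq_imp_space_eq[OF sets_PiM_r]
        by (auto simp: space_pair_measure)
      then have v: "(\<lambda>i\<in>I. (s i, y i)) \<in> space (PiM I (\<lambda>_. Marked))"
        using measurable_space[OF zip] by fastforce
      show "F0 (\<lambda>i\<in>I. (s i, y i)) = H s y"
        unfolding F0_def H_def using measurable_Pair2[OF upd v]
        by (intro nn_integral_intensity[OF \<eta>(1) r]) simp
    qed
    also have "\<dots> = (\<integral>\<^sup>+ y. (\<integral>\<^sup>+ t. (\<integral>\<^sup>+ s. F (\<lambda>i\<in>insert j I. (s i, (y(j := t)) i))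
        \<partial>PiM (insert j I) (\<lambda>i. r ((y(j := t)) i))) \<partial>\<eta>) \<partial>PiM I (\<lambda>_. \<eta>))"
    proof (intro nn_integral_cong)
      fix y assume "y \<in> space (PiM I (\<lambda>_. \<eta>))"
      then have y: "y \<in> space (PiM I (\<lambda>_. borel))" by (simp add: sets_eq_imp_space_eq[OF sets_PiM_\<eta>])
      interpret R: product_sigma_finite "\<lambda>i. r (y i)" using r_sf by (simp add: product_sigma_finite_def)
      have eq: "(\<lambda>i\<in>insert j I. ((s(j := u)) i, (y(j := t)) i)) = (\<lambda>i\<in>I. (s i, y i))(j := (u, t))" for s u t
        using insert.hyps by (auto simp: fun_eq_iff restrict_def)
      have m: "(\<lambda>((s, t), u). F ((\<lambda>i\<in>I. (s i, y i))(j := (u, t)))) \<in>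
          borel_measurable ((PiM I (\<lambda>_. Jumps) \<Otimes>\<^sub>M borel) \<Otimes>\<^sub>M Jumps)"
      proof -
        have "(\<lambda>z. (fst (fst z), y)) \<in> measurable ((PiM I (\<lambda>_. Jumps) \<Otimes>\<^sub>M (borel :: 'y measure)) \<Otimes>\<^sub>M Jumps) (PiM I (\<lambda>_. Jumps) \<Otimes>\<^sub>M PiM I (\<lambda>_. borel))"
          using y by (intro measurable_Pair measurable_const measurable_compose[OF measurable_fst measurable_fst])
        from measurable_compose[OF this zip]
        have 1: "(\<lambda>z. \<lambda>i\<in>I. (fst (fst z) i, y i)) \<in> measurable ((PiM I (\<lambda>_. Jumps) \<Otimes>\<^sub>M (borel :: 'y measure)) \<Otimes>\<^sub>M Jumps) (PiM I (\<lambda>_. Marked))"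
          by simp
        have 2: "(\<lambda>z. (snd z, snd (fst z))) \<in> measurable ((PiM I (\<lambda>_. Jumps) \<Otimes>\<^sub>M (borel :: 'y measure)) \<Otimes>\<^sub>M Jumps) Marked"
          by (intro measurable_Pair measurable_snd measurable_compose[OF measurable_fst measurable_snd])
        from measurable_compose[OF measurable_Pair[OF 1 2] upd] show ?thesis by (simp add: split_beta')
      qed
      have "(\<lambda>(s, t). \<integral>\<^sup>+ u. F ((\<lambda>i\<in>I. (s i, y i))(j := (u, t))) \<partial>r t) \<in> borel_measurable (PiM I (\<lambda>_. Jumps) \<Otimes>\<^sub>M borel)"
        using measurable_nn_integral_sigma_kernel[OF sigma_kernel_compose[OF measurable_snd r] , of "\<lambda>z u. F ((\<lambda>i\<in>I. (fst z i, y i))(j := (u, snd z)))"] m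
        by (simp add: split_beta')
      then have m2: "(\<lambda>(s, t). \<integral>\<^sup>+ u. F ((\<lambda>i\<in>I. (s i, y i))(j := (u, t))) \<partial>r t) \<in> borel_measurable (PiM I (\<lambda>i. r (y i)) \<Otimes>\<^sub>M \<eta>)"
        by (simp add: measurable_cong_sets[OF sets_pair_measure_cong[OF sets_PiM_r \<eta>(1)] refl])
      have "(\<integral>\<^sup>+ s. H s y \<partial>PiM I (\<lambda>i. r (y i))) =
          (\<integral>\<^sup>+ t. (\<integral>\<^sup>+ s. (\<integral>\<^sup>+ u. F ((\<lambda>i\<in>I. (s i, y i))(j := (u, t))) \<partial>r t) \<partial>PiM I (\<lambda>i. r (y i))) \<partial>\<eta>)"
        unfolding H_def
        using pair_sigma_finite.Fubini'[OF pair_sigma_finite.intro[OF R.sigma_finite[OF insert.hyps(1)] \<eta>(2)] m2]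
        by (simp add: split_beta')
      also have "\<dots> = (\<integral>\<^sup>+ t. (\<integral>\<^sup>+ s. F (\<lambda>i\<in>insert j I. (s i, (y(j := t)) i)) \<partial>PiM (insert j I) (\<lambda>i. r ((y(j := t)) i))) \<partial>\<eta>)"
      proof (intro nn_integral_cong)
        fix t assume "t \<in> space \<eta>"
        interpret R': product_sigma_finite "\<lambda>i. r ((y(j := t)) i)" using r_sf by (simp add: product_sigma_finite_def)
        have yt: "y(j := t) \<in> space (PiM (insert j I) (\<lambda>_. borel))"
          using y by (auto simp: space_PiM PiE_iff extensional_def)
        from measurable_compose[OF measurable_compose[OF measurable_Pair2'[OF yt] zip] F]
        have "(\<lambda>s. F (\<lambda>i\<in>insert j I. (s i, (y(j := t)) i))) \<in> borel_measurable (PiM (insert j I) (\<lambda>_. Jumps))"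
          by (simp only: fst_conv snd_conv)
        then have "(\<integral>\<^sup>+ s. F (\<lambda>i\<in>insert j I. (s i, (y(j := t)) i)) \<partial>PiM (insert j I) (\<lambda>i. r ((y(j := t)) i))) =
          (\<integral>\<^sup>+ s. (\<integral>\<^sup>+ u. F (\<lambda>i\<in>insert j I. ((s(j := u)) i, (y(j := t)) i)) \<partial>r ((y(j := t)) j)) \<partial>PiM I (\<lambda>i. r ((y(j := t)) i)))"
          using insert.hyps by (intro R'.product_nn_integral_insert) (simp_all add: measurable_cong_sets[OF sets_PiM_r refl])
        also have "PiM I (\<lambda>i. r ((y(j := t)) i)) = PiM I (\<lambda>i. r (y i))"
          using insert.hyps by (intro PiM_cong) auto
        finally have swap: "(\<integral>\<^sup>+ s. F (\<lambda>i\<in>insert j I. (s i, (y(j := t)) i)) \<partial>PiM (insert j I) (\<lambda>i. r ((y(j := t)) i))) =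
          (\<integral>\<^sup>+ s. (\<integral>\<^sup>+ u. F (\<lambda>i\<in>insert j I. ((s(j := u)) i, (y(j := t)) i)) \<partial>r ((y(j := t)) j)) \<partial>PiM I (\<lambda>i. r (y i)))" .
        show "(\<integral>\<^sup>+ s. (\<integral>\<^sup>+ u. F ((\<lambda>i\<in>I. (s i, y i))(j := (u, t))) \<partial>r t) \<partial>PiM I (\<lambda>i. r (y i))) =
            (\<integral>\<^sup>+ s. F (\<lambda>i\<in>insert j I. (s i, (y(j := t)) i)) \<partial>PiM (insert j I) (\<lambda>i. r ((y(j := t)) i)))"
          unfolding swap eq fun_upd_same ..
      qed
      finally show "(\<integral>\<^sup>+ s. H s y \<partial>PiM I (\<lambda>i. r (y i))) = \<dots>" .
    qed
    also have "\<dots> = (\<integral>\<^sup>+ y. (\<integral>\<^sup>+ s. F (\<lambda>i\<in>insert j I. (s i, y i)) \<partial>PiM (insert j I) (\<lambda>i. r (y i))) \<partial>PiM (insert j I) (\<lambda>_. \<eta>))"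
    proof (rule E.product_nn_integral_insert[symmetric])
      have "sigma_kernel (PiM (insert j I) (\<lambda>_. borel)) Jumps (\<lambda>y. r (y i))" if "i \<in> insert j I" for i
        using sigma_kernel_compose[OF measurable_component_singleton[OF that, of "\<lambda>_. borel"] r] .
      moreover have "(\<lambda>(y, s). F (\<lambda>i\<in>insert j I. (s i, y i))) \<in> borel_measurable (PiM (insert j I) (\<lambda>_. borel) \<Otimes>\<^sub>M PiM (insert j I) (\<lambda>_. Jumps))"
        using measurable_compose[OF measurable_compose[OF measurable_pair_swap' zip] F]
        by (simp only: split_beta' fst_conv snd_conv)
      ultimately have "(\<lambda>y. \<integral>\<^sup>+ s. F (\<lambda>i\<in>insert j I. (s i, y i)) \<partial>PiM (insert j I) (\<lambda>i. r (y i))) \<in> borel_measurable (PiM (insert j I) (\<lambda>_. borel))"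
        using insert.hyps by (intro measurable_nn_integral_PiM_sigma_kernel) auto
      then show "(\<lambda>y. \<integral>\<^sup>+ s. F (\<lambda>i\<in>insert j I. (s i, y i)) \<partial>PiM (insert j I) (\<lambda>i. r (y i))) \<in> borel_measurable (PiM (insert j I) (\<lambda>_. \<eta>))"
        by (simp add: measurable_cong_sets[OF sets_PiM_\<eta> refl])
    qed (use insert.hyps in auto)
    finally show ?case .
  qed
qed

section \<open>The mean measure and the function \<open>q\<close>\<close>

lemma emeasure_mean_rm:
  assumes M: "sets M = sets Marked" and A: "A \<in> sets borel"
  shows "emeasure (mean_rm M) A = (\<integral>\<^sup>+ w. ennreal (fst w) * indicator A (snd w) \<partial>M)"
proof -
  note [measurable_cong] = M
  have fst: "(\<lambda>w. ennreal (fst w)) \<in> borel_measurable M"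
    unfolding measurable_cong_sets[OF M refl]
    by (intro measurable_compose[OF measurable_fst] measurable_restrict_space1) auto
  have snd: "snd \<in> measurable M borel"
    unfolding measurable_cong_sets[OF M refl] by simp
  have d: "density M (\<lambda>(s, y). ennreal s) = density M (\<lambda>w. ennreal (fst w))"
    by (simp add: split_beta')
  have "emeasure (mean_rm M) A = emeasure (density M (\<lambda>w. ennreal (fst w))) (snd -` A \<inter> space M)"
    unfolding mean_rm_def d using snd A by (subst emeasure_distr) auto
  also have "\<dots> = (\<integral>\<^sup>+ w. ennreal (fst w) * indicator (snd -` A \<inter> space M) w \<partial>M)"
    using fst measurable_sets[OF snd A] by (rule emeasure_density)
  also have "\<dots> = (\<integral>\<^sup>+ w. ennreal (fst w) * indicator A (snd w) \<partial>M)"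
    by (intro nn_integral_cong) (auto simp: indicator_def)
  finally show ?thesis .
qed

lemma sets_mean_rm[simp, measurable_cong]: "sets (mean_rm M) = sets borel"
  by (simp add: mean_rm_def)

lemma measurable_mean_rm: "mean_rm \<in> measurable (measure_algebra Marked) (measure_algebra borel)"
proof (rule measurable_measure_algebra)
  fix A :: "'a set" assume A: "A \<in> sets borel"
  have "(\<lambda>w. ennreal (fst w) * indicator A (snd w)) \<in> borel_measurable Marked"
    using A by (intro borel_measurable_times_ennreal measurable_compose[OF measurable_fst]
        measurable_compose[OF measurable_snd] measurable_restrict_space1) auto
  from nn_integral_measurable_measure_algebra[OF this]
  show "(\<lambda>M. emeasure (mean_rm M) A) \<in> borel_measurable (measure_algebra Marked)"
    by (rule measurable_cong[THEN iffD1, rotated]) (simp add: emeasure_mean_rm space_measure_algebra A)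
qed simp

text \<open>Measurability of \<open>q\<close> is given on boundedly finite measures only. This
  retraction onto them allows \<open>q\<close>, and integrals against the measure, to be handled on
  all of \<open>measure_algebra borel\<close>, where \<mu> has its law.\<close>

definition restrict_bdd :: "'y::metric_space measure \<Rightarrow> 'y measure" where
  "restrict_bdd m = (if boundedly_finite borel bounded m then m else null_measure borel)"

lemma boundedly_finite_null_measure: "boundedly_finite borel bounded (null_measure borel)"
  by (simp add: boundedly_finite_def)

text \<open>Every bounded set lies in a ball of integer radius, so countably many evaluations decide
  bounded finiteness. This is what makes the boundedly finite measures a measurable set.\<close>

lemma boundedly_finite_borel_iff:
  fixes m :: "'y::metric_space measure"
  shows "boundedly_finite borel bounded m \<longleftrightarrow>
    sets m = sets borel \<and> (\<forall>k::nat. emeasure m (ball undefined (real k)) < \<infinity>)"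
proof
  assume r: "sets m = sets borel \<and> (\<forall>k::nat. emeasure m (ball undefined (real k)) < \<infinity>)"
  have "emeasure m B < \<infinity>" if B: "bounded B" for B
  proof -
    obtain e where "\<forall>x\<in>B. dist undefined x \<le> e" using B bounded_any_center by blast
    moreover obtain k :: nat where "e < real k" using reals_Archimedean2 by blast
    ultimately have "B \<subseteq> ball undefined (real k)" by fastforce
    then have "emeasure m B \<le> emeasure m (ball undefined (real k))"
      using r by (intro emeasure_mono) auto
    with r show ?thesis using le_less_trans by blast
  qed
  with r show "boundedly_finite borel bounded m" by (simp add: boundedly_finite_def)
qed (auto simp: boundedly_finite_def)

lemma sets_boundedly_finite_borel:
  "{m \<in> space (measure_algebra borel). boundedly_finite borel bounded (m :: 'y::metric_space measure)}
    \<in> sets (measure_algebra borel)"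
proof -
  have "{m \<in> space (measure_algebra borel). \<forall>k::nat. emeasure m (ball (undefined::'y) (real k)) < \<infinity>}
      \<in> sets (measure_algebra borel)"
    by measurable
  also have "{m \<in> space (measure_algebra borel). \<forall>k::nat. emeasure m (ball (undefined::'y) (real k)) < \<infinity>} =
      {m \<in> space (measure_algebra borel). boundedly_finite borel bounded m}"
    by (auto simp: boundedly_finite_borel_iff space_measure_algebra)
  finally show ?thesis .
qed

lemma measurable_restrict_bdd:
  "restrict_bdd \<in> measurable (measure_algebra borel) (boundedly_finite_measures borel bounded)"
proof (rule measurable_boundedly_finite_measures)
  fix m :: "'a measure"
  show "boundedly_finite borel bounded (restrict_bdd m)"
    by (simp add: restrict_bdd_def boundedly_finite_null_measure)
next
  fix A :: "'a set" assume A: "A \<in> sets borel"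
  have "(\<lambda>m. if boundedly_finite borel bounded m then emeasure m A else 0) \<in> borel_measurable (measure_algebra borel)"
    using A sets_boundedly_finite_borel by (intro measurable_If) auto
  also have "(\<lambda>m. if boundedly_finite borel bounded m then emeasure m A else 0) = (\<lambda>m. emeasure (restrict_bdd m) A)"
    by (auto simp: restrict_bdd_def)
  finally show "(\<lambda>m. emeasure (restrict_bdd m) A) \<in> borel_measurable (measure_algebra borel)" .
qed

lemma measurable_q_at:
  assumes q: "(\<lambda>(y, m). q y m) \<in> borel_measurable (borel \<Otimes>\<^sub>M boundedly_finite_measures borel bounded)"
  shows "(\<lambda>(y, m). q_at q y m) \<in> borel_measurable (borel \<Otimes>\<^sub>M measure_algebra borel)"
proof -
  have "(\<lambda>x. (fst x, restrict_bdd (snd x))) \<in>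
      measurable (borel \<Otimes>\<^sub>M measure_algebra borel) (borel \<Otimes>\<^sub>M boundedly_finite_measures borel bounded)"
    by (intro measurable_Pair measurable_fst measurable_compose[OF measurable_snd measurable_restrict_bdd])
  from measurable_compose[OF this q]
  have "(\<lambda>x. q (fst x) (restrict_bdd (snd x))) \<in> borel_measurable (borel \<Otimes>\<^sub>M measure_algebra borel)" by simp
  then have 1: "(\<lambda>x. ennreal (q (fst x) (restrict_bdd (snd x)))) \<in> borel_measurable (borel \<Otimes>\<^sub>M measure_algebra borel)"
    by simp
  have "(\<lambda>x. snd x) -` {m \<in> space (measure_algebra borel). boundedly_finite borel bounded m} \<inter>
      space (borel \<Otimes>\<^sub>M measure_algebra borel) \<in> sets (borel \<Otimes>\<^sub>M measure_algebra borel)"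
    by (rule measurable_sets[OF measurable_snd sets_boundedly_finite_borel])
  also have "(\<lambda>x. snd x) -` {m \<in> space (measure_algebra borel). boundedly_finite borel bounded m} \<inter>
      space (borel \<Otimes>\<^sub>M measure_algebra borel) =
      {x \<in> space (borel \<Otimes>\<^sub>M measure_algebra borel). boundedly_finite borel bounded (snd x)}"
    by (auto simp: space_pair_measure)
  finally have "(\<lambda>x. if boundedly_finite borel bounded (snd x) then ennreal (q (fst x) (restrict_bdd (snd x))) else 0)
      \<in> borel_measurable (borel \<Otimes>\<^sub>M measure_algebra borel)"
    using 1 by (intro measurable_If) auto
  then show ?thesis
    by (rule measurable_cong[THEN iffD1, rotated]) (auto simp: q_at_def restrict_bdd_def split_beta')
qed

lemma sets_P_of[simp, measurable_cong]: "sets (P_of q m) = sets m"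
  by (simp add: P_of_def)

text \<open>Integrals depend measurably on the measure along a \<open>sigma_kernel\<close>, and
  \<open>measure_algebra\<close> contains measures that are not \<sigma>-finite. As
  \<open>q_at\<close> vanishes off the boundedly finite measures, the integral may be taken against
  \<open>restrict_bdd m\<close>, which is such a kernel.\<close>

lemma measurable_P_of:
  fixes q :: "'y::polish_space \<Rightarrow> 'y measure \<Rightarrow> real"
  assumes q: "(\<lambda>(y, m). q y m) \<in> borel_measurable (borel \<Otimes>\<^sub>M boundedly_finite_measures borel bounded)"
  shows "P_of q \<in> measurable (measure_algebra borel) (measure_algebra borel)"
proof (rule measurable_measure_algebra)
  fix A :: "'y set" assume A: "A \<in> sets borel"
  have K: "sigma_kernel (measure_algebra borel) borel (restrict_bdd :: 'y measure \<Rightarrow> _)"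
  proof (rule sigma_kernel_compose[OF measurable_restrict_bdd, where \<kappa>="\<lambda>m. m"])
    have "(\<Union>k::nat. ball (undefined :: 'y) (real k)) = UNIV"
      using reals_Archimedean2 by (auto simp: ball_def)
    then show "sigma_kernel (boundedly_finite_measures borel bounded) borel (\<lambda>m::'y measure. m)"
      by (intro sigma_kernel_boundedly_finite_measures[of "\<lambda>k. ball undefined (real k)"]) auto
  qed
  have "(\<lambda>x. q_at q (snd x) (fst x) * indicator A (snd x)) \<in> borel_measurable (measure_algebra borel \<Otimes>\<^sub>M borel)"
    using measurable_compose[OF measurable_pair_swap' measurable_q_at[OF q]] A
    by (intro borel_measurable_times_ennreal measurable_compose[OF measurable_snd]) (auto simp: split_beta')
  then have "(\<lambda>m. \<integral>\<^sup>+ y. q_at q y m * indicator A y \<partial>restrict_bdd m) \<in> borel_measurable (measure_algebra borel)"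
    by (intro measurable_nn_integral_sigma_kernel[OF K]) (simp add: split_beta')
  then show "(\<lambda>m. emeasure (P_of q m) A) \<in> borel_measurable (measure_algebra borel)"
  proof (rule measurable_cong[THEN iffD1, rotated])
    fix m :: "'y measure" assume m: "m \<in> space (measure_algebra borel)"
    then have sets_m: "sets m = sets borel" by (simp add: space_measure_algebra)
    have "(\<lambda>y. q_at q y m) \<in> borel_measurable m"
      using measurable_Pair1[OF measurable_q_at[OF q] m] by (simp add: measurable_cong_sets[OF sets_m refl])
    then have "emeasure (P_of q m) A = (\<integral>\<^sup>+ y. q_at q y m * indicator A y \<partial>m)"
      unfolding P_of_def using A sets_m by (intro emeasure_density) auto
    also have "\<dots> = (\<integral>\<^sup>+ y. q_at q y m * indicator A y \<partial>restrict_bdd m)"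
      by (cases "boundedly_finite borel bounded m") (simp_all add: restrict_bdd_def q_at_def)
    finally show "(\<integral>\<^sup>+ y. q_at q y m * indicator A y \<partial>restrict_bdd m) = emeasure (P_of q m) A" by simp
  qed
qed (simp add: space_measure_algebra)

text \<open>Forgetting the jumps in the augmentation leaves P_\<mu>. A sample from P_\<mu> can thus
  be treated as the locations of a sample from \<open>P_aug\<close>, even if no latent jumps are
  given on \<Omega>.\<close>

lemma P_of_mean_rm:
  assumes q: "(\<lambda>(y, m). q y m) \<in> borel_measurable (borel \<Otimes>\<^sub>M boundedly_finite_measures borel bounded)"
    and M: "sets M = sets Marked"
  shows "P_of q (mean_rm M) = distr (P_aug q M) borel snd"
proof (rule measure_eqI)
  fix A assume "A \<in> sets (P_of q (mean_rm M))"
  then have A: "A \<in> sets borel" by simp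
  have fst: "(\<lambda>w. ennreal (fst w)) \<in> borel_measurable M"
    unfolding measurable_cong_sets[OF M refl]
    by (intro measurable_compose[OF measurable_fst] measurable_restrict_space1) auto
  have snd: "snd \<in> measurable M borel"
    unfolding measurable_cong_sets[OF M refl] by simp
  have mm: "mean_rm M \<in> space (measure_algebra borel)" by (simp add: space_measure_algebra)
  have qm: "(\<lambda>y. q_at q y (mean_rm M)) \<in> borel_measurable borel"
    using measurable_Pair1[OF measurable_q_at[OF q] mm] by simp
  have d: "density M (\<lambda>(s, y). ennreal s) = density M (\<lambda>w. ennreal (fst w))"
    by (simp add: split_beta')
  have "emeasure (P_of q (mean_rm M)) A = (\<integral>\<^sup>+ y. q_at q y (mean_rm M) * indicator A y \<partial>mean_rm M)"
    unfolding P_of_def using qm A by (intro emeasure_density) (auto simp: measurable_cong_sets[OF sets_mean_rm refl])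
  also have "\<dots> = (\<integral>\<^sup>+ y. q_at q y (mean_rm M) * indicator A y \<partial>distr (density M (\<lambda>w. ennreal (fst w))) borel snd)"
    unfolding d[symmetric] mean_rm_def[symmetric] ..
  also have "\<dots> = (\<integral>\<^sup>+ w. q_at q (snd w) (mean_rm M) * indicator A (snd w) \<partial>density M (\<lambda>w. ennreal (fst w)))"
    using qm A snd by (subst nn_integral_distr) auto
  also have "\<dots> = (\<integral>\<^sup>+ w. ennreal (fst w) * (q_at q (snd w) (mean_rm M) * indicator A (snd w)) \<partial>M)"
    by (intro nn_integral_density fst borel_measurable_times_ennreal measurable_compose[OF snd qm]
        measurable_compose[OF snd borel_measurable_indicator[OF A]])
  also have "\<dots> = (\<integral>\<^sup>+ w. (q_at q (snd w) (mean_rm M) * ennreal (fst w)) * indicator (snd -` A \<inter> space M) w \<partial>M)"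
    by (intro nn_integral_cong) (auto simp: indicator_def ac_simps)
  also have "\<dots> = emeasure (P_aug q M) (snd -` A \<inter> space M)"
    unfolding P_aug_def using fst measurable_compose[OF snd qm] measurable_sets[OF snd A]
    by (subst emeasure_density) (auto simp: split_beta')
  also have "\<dots> = emeasure (distr (P_aug q M) borel snd) A"
    using snd A by (subst emeasure_distr) (auto simp: P_aug_def)
  finally show "emeasure (P_of q (mean_rm M)) A = emeasure (distr (P_aug q M) borel snd) A" .
qed simp

text \<open>Sampling from the augmentation is rewritten as integration against the n-fold product of
  the random measure itself, the form in which the iterated Mecke formula applies.\<close>

lemma nn_integral_PiM_P_aug:
  fixes M :: "(real \<times> 'y::polish_space) measure"
  assumes q: "(\<lambda>(y, m). q y m) \<in> borel_measurable (borel \<Otimes>\<^sub>M boundedly_finite_measures borel bounded)"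
    and M: "sets M = sets Marked" "sigma_finite_measure M" and P: "sigma_finite_measure (P_aug q M)"
    and I: "finite I" and F: "F \<in> borel_measurable (PiM I (\<lambda>_. Marked))"
  shows "(\<integral>\<^sup>+ w. F w \<partial>PiM I (\<lambda>_. P_aug q M)) =
    (\<integral>\<^sup>+ w. (\<Prod>i\<in>I. q_at q (snd (w i)) (mean_rm M) * ennreal (fst (w i))) * F w \<partial>PiM I (\<lambda>_. M))"
proof -
  have mm: "mean_rm M \<in> space (measure_algebra borel)" by (simp add: space_measure_algebra)
  have "(\<lambda>y. q_at q y (mean_rm M)) \<in> borel_measurable borel"
    using measurable_Pair1[OF measurable_q_at[OF q] mm] by simp
  then have f: "(\<lambda>w. q_at q (snd w) (mean_rm M) * ennreal (fst w)) \<in> borel_measurable M"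
    unfolding measurable_cong_sets[OF M(1) refl]
    by (intro borel_measurable_times_ennreal measurable_compose[OF measurable_snd, of "\<lambda>y. q_at q y (mean_rm M)"]
        measurable_compose[OF measurable_fst] measurable_restrict_space1) auto
  have aug: "P_aug q M = density M (\<lambda>w. q_at q (snd w) (mean_rm M) * ennreal (fst w))"
    by (simp add: P_aug_def split_beta')
  have "(\<lambda>w. \<Prod>i\<in>I. q_at q (snd (w i)) (mean_rm M) * ennreal (fst (w i))) \<in> borel_measurable (PiM I (\<lambda>_. M))"
    by (intro borel_measurable_prod_ennreal f
        measurable_compose[OF measurable_component_singleton, where g="\<lambda>w. q_at q (snd w) (mean_rm M) * ennreal (fst w)"])
  moreover have "F \<in> borel_measurable (PiM I (\<lambda>_. M))"
    using F by (subst measurable_cong_sets[OF sets_PiM_cong[OF refl M(1)] refl])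
  ultimately show ?thesis
    using P unfolding aug
    by (subst PiM_density[OF M(2) _ I f]) (auto intro: nn_integral_density)
qed

section \<open>The joint law of the sample and the Poisson random measure\<close>

text \<open>Balls of the metric \<open>d\<close> are open for the subspace topology of the half-line
  times the space of locations. In second countable spaces the Borel sets of a product are generated
  by rectangles, so these balls belong to \<open>Marked\<close>.\<close>

lemma sets_Marked_open:
  fixes U :: "(real \<times> 'y::polish_space) set"
  assumes "open U"
  shows "({0<..} \<times> UNIV) \<inter> U \<in> sets Marked"
proof -
  have "(\<lambda>w. (fst w, snd w)) \<in> measurable (Marked :: (real \<times> 'y) measure) (borel \<Otimes>\<^sub>M borel)"
    by (intro measurable_Pair measurable_snd measurable_compose[OF measurable_fst] measurable_restrict_space1) auto
  then have "(\<lambda>w. (fst w, snd w)) -` U \<inter> space Marked \<in> sets (Marked :: (real \<times> 'y) measure)"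
  proof (rule measurable_sets)
    show "U \<in> sets (borel \<Otimes>\<^sub>M borel)" unfolding borel_prod using assms by (rule borel_open)
  qed
  also have "(\<lambda>w. (fst w, snd w)) -` U \<inter> space Marked = ({0<..} \<times> UNIV) \<inter> U"
    by (auto simp: space_pair_measure space_restrict_space)
  finally show ?thesis .
qed

text \<open>The source of the exponents e_j: the factors of the indices in a cell coincide, so
  together they give a power with exponent the size of the cell.\<close>

lemma prod_of_cells:
  fixes h :: "'b \<Rightarrow> 'c::comm_monoid_mult"
  assumes p: "partition_on {1..n} p"
  shows "(\<Prod>i\<in>{1..n}. h (of_cells n p v i)) = (\<Prod>C\<in>p. h (v C) ^ card C)"
proof -
  have fin: "finite C" if "C \<in> p" for C
    using that partition_onD1[OF p] by (metis Union_upper finite_atLeastAtMost finite_subset)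
  have "(\<Prod>i\<in>{1..n}. h (of_cells n p v i)) = (\<Prod>i\<in>\<Union>p. h (of_cells n p v i))"
    by (simp only: partition_onD1[OF p])
  also have "\<dots> = (\<Prod>C\<in>p. \<Prod>i\<in>C. h (of_cells n p v i))"
    using fin partition_onD2[OF p] by (subst prod.Union_disjoint) (auto simp: disjoint_def)
  also have "\<dots> = (\<Prod>C\<in>p. h (v C) ^ card C)"
    by (intro prod.cong refl) (simp add: of_cells_eq[OF p])
  finally show ?thesis .
qed

lemma q_product_cong:
  assumes "\<And>j. j \<in> I \<Longrightarrow> s j = s' j" "\<And>j. j \<in> I \<Longrightarrow> y j = y' j"
  shows "q_product q I e s y M = q_product q I e s' y' M"
  unfolding q_product_def using assms
  by (intro prod.cong refl arg_cong2[where f="(^)"]) (simp_all cong: add_atoms_cong)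

text \<open>The random measure and the function \<open>q\<close> are fixed here, but no sample: the
  results are applied both to a vector of locations alone and to a vector of jump-location
  pairs.\<close>

locale species_model =
  fixes \<Omega> :: "'o measure"
    and \<eta> :: "'y::polish_space measure"
    and \<rho> :: "'y \<Rightarrow> real measure"
    and d :: "(real \<times> 'y) metric"
    and \<nu> :: "(real \<times> 'y) measure"
    and N :: "'o \<Rightarrow> (real \<times> 'y) measure"
    and q :: "'y \<Rightarrow> 'y measure \<Rightarrow> real"
  assumes eta: "sets \<eta> = sets borel" "sigma_finite_measure \<eta>" "nonatomic \<eta>"
    and rho: "\<rho> \<in> measurable borel (measure_algebra Jumps)"
    and rho_eta: "\<And>B. B \<in> sets borel \<Longrightarrow> bounded B \<Longrightarrow>
        (\<integral>\<^sup>+ y. (\<integral>\<^sup>+ s. ennreal (min s 1) \<partial>\<rho> y) * indicator B y \<partial>\<eta>) < \<infinity>"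
    and nu: "\<nu> = intensity \<rho> \<eta>"
    and metric: "mspace d = {0<..} \<times> UNIV" "mtopology_of d = top_of_set ({0<..} \<times> UNIV)"
    and nu_bounded: "boundedly_finite Marked (bounded_in d) \<nu>"
    and N_prm: "poisson_random_measure \<Omega> Marked (bounded_in d) \<nu> N"
    and q_meas: "(\<lambda>(y, m). q y m)
        \<in> borel_measurable (borel \<Otimes>\<^sub>M boundedly_finite_measures borel bounded)"
    and P_prob: "AE \<omega> in \<Omega>. prob_space (P_of q (mean_rm (N \<omega>)))"

text \<open>The exhausting sets are the balls of \<open>d\<close> with integer radius about a point
  of the space; 1 is a positive jump and \<open>undefined\<close> an arbitrary location. They are
  bounded for \<open>d\<close>, hence of finite intensity, and cover the space.\<close>

sublocale species_model \<subseteq> marked_poisson_process \<Omega> Marked "bounded_in d" \<nu> N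
  "\<lambda>k. Metric_space.mball (mspace d) (mdist d) (1, undefined) (real k)"
proof -
  interpret D: Metric_space "mspace d" "mdist d" by (rule Metric_space_mspace_mdist)
  have ball: "D.mball (1, undefined) (real k) \<in> sets Marked" for k
  proof -
    have "openin (top_of_set ({0<..} \<times> UNIV)) (D.mball (1, undefined) (real k))"
      using D.openin_mball[of "(1, undefined)" "real k"] unfolding metric(2)[unfolded mtopology_of_def] .
    then obtain U where "open U" "D.mball (1, undefined) (real k) = ({0<..} \<times> UNIV) \<inter> U"
      by (auto simp: openin_open)
    then show ?thesis using sets_Marked_open by simp
  qed
  have bdd: "bounded_in d (D.mball (1, undefined) (real k))" for k
    by (simp add: bounded_in_def)
  have space: "(\<Union>k::nat. D.mball (1, undefined) (real k)) = space Marked"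
  proof
    show "(\<Union>k::nat. D.mball (1, undefined) (real k)) \<subseteq> space Marked"
      using sets.sets_into_space[OF ball] by auto
    show "space Marked \<subseteq> (\<Union>k::nat. D.mball (1, undefined) (real k))"
    proof
      fix w :: "real \<times> 'y" assume "w \<in> space Marked"
      then have w: "w \<in> mspace d" by (auto simp: metric space_pair_measure space_restrict_space)
      obtain k :: nat where k: "mdist d (1, undefined) w < real k" using reals_Archimedean2 by blast
      have "(1, undefined) \<in> mspace d" by (simp add: metric)
      with w k have "w \<in> D.mball (1, undefined) (real k)" unfolding D.in_mball by blast
      then show "w \<in> (\<Union>k::nat. D.mball (1, undefined) (real k))" by auto
    qed
  qed
  show "marked_poisson_process \<Omega> Marked (bounded_in d) \<nu> N (\<lambda>k. D.mball (1, undefined) (real k))"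
  proof (intro marked_poisson_process.intro poisson_process.intro)
    show "range (\<lambda>k. D.mball (1, undefined) (real k)) \<subseteq> sets Marked" using ball by auto
    show "emeasure \<nu> (D.mball (1, undefined) (real k)) < \<infinity>" for k
      using nu_bounded ball bdd by (simp add: boundedly_finite_def)
  qed (use N_prm space bdd in \<open>simp_all add: nu\<close>)
qed

context species_model begin

abbreviation "r \<equiv> regular_jumps \<rho>"

lemma r: "sigma_kernel borel Jumps r"
  by (rule sigma_kernel_regular_jumps[OF rho])

lemma r_eq: "AE y in \<eta>. r y = \<rho> y"
  by (rule AE_regular_jumps[OF eta(1) rho rho_eta])

lemma nu_r: "\<nu> = intensity r \<eta>"
  unfolding nu using r_eq by (intro intensity_cong_AE) (auto elim: eventually_mono)

lemma sets_r: "sets (r y) = sets Jumps"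
  using sigma_kernel_sets[OF r, of y] by simp

lemma r_sigma_finite: "sigma_finite_measure (r y)"
  using sigma_kernel_sigma_finite[OF r] by simp

lemma sets_PiM_r: "sets (PiM I (\<lambda>i. r (y i))) = sets (PiM I (\<lambda>_. Jumps))"
  by (intro sets_PiM_cong) (auto simp: sets_r)

lemma sets_PiM_\<eta>: "sets (PiM I (\<lambda>_. \<eta>)) = sets (PiM I (\<lambda>_. borel))"
  by (intro sets_PiM_cong) (auto simp: eta)

text \<open>The product of the n densities q(y,\<mu>) s of \<open>P_aug\<close>, taken at the random
  measure with its atoms added and grouped by cells. Only \<open>q_product\<close> involves
  \<open>M\<close>; integrating it out leaves \<open>phi\<close> times the jump powers.\<close>

definition weight :: "'i set \<Rightarrow> ('i \<Rightarrow> nat) \<Rightarrow> ('i \<Rightarrow> real) \<Rightarrow> ('i \<Rightarrow> 'y) \<Rightarrow> (real \<times> 'y) measure \<Rightarrow> ennreal" where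
  "weight I e s y M = q_product q I e s y M * (\<Prod>j\<in>I. ennreal (s j) ^ e j)"

lemma measurable_add_atoms_cells:
  assumes f: "f \<in> measurable Z (PiM I (\<lambda>_. Jumps))" and g: "g \<in> measurable Z (PiM I (\<lambda>_. borel))"
    and h: "h \<in> measurable Z R"
  shows "(\<lambda>z. add_atoms I (f z) (g z) (h z)) \<in> measurable Z R"
  using measurable_add_atoms[where s="\<lambda>j z. f z j" and y="\<lambda>j z. g z j" and I=I, OF h]
    measurable_compose[OF f measurable_component_singleton] measurable_compose[OF g measurable_component_singleton]
  by (simp add: measurable_Pair)

lemma measurable_q_product:
  assumes f: "f \<in> measurable Z (PiM I (\<lambda>_. Jumps))" and g: "g \<in> measurable Z (PiM I (\<lambda>_. borel))"
    and h: "h \<in> measurable Z R"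
  shows "(\<lambda>z. q_product q I e (f z) (g z) (h z)) \<in> borel_measurable Z"
  unfolding q_product_def
proof (intro borel_measurable_prod_ennreal borel_measurable_power_ennreal)
  fix j assume j: "j \<in> I"
  have 1: "(\<lambda>z. mean_rm (add_atoms I (f z) (g z) (h z))) \<in> measurable Z (measure_algebra borel)"
    using measurable_compose[OF measurable_compose[OF measurable_add_atoms_cells[OF f g h]
      measurable_ident_boundedly_finite_measures] measurable_mean_rm] .
  have 2: "(\<lambda>z. g z j) \<in> measurable Z borel"
    by (rule measurable_compose[OF g measurable_component_singleton[OF j]])
  show "(\<lambda>z. q_at q (g z j) (mean_rm (add_atoms I (f z) (g z) (h z)))) \<in> borel_measurable Z"
    using measurable_compose[OF measurable_Pair[OF 2 1] measurable_q_at[OF q_meas]] by simp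
qed

lemma measurable_jump_power:
  assumes f: "f \<in> measurable Z (PiM I (\<lambda>_. Jumps))"
  shows "(\<lambda>z. \<Prod>j\<in>I. ennreal (f z j) ^ e j) \<in> borel_measurable Z"
proof (intro borel_measurable_prod_ennreal borel_measurable_power_ennreal)
  fix j assume j: "j \<in> I"
  have "(\<lambda>s. ennreal s) \<in> borel_measurable Jumps" by (intro measurable_restrict_space1) auto
  from measurable_compose[OF measurable_compose[OF f measurable_component_singleton[OF j]] this]
  show "(\<lambda>z. ennreal (f z j)) \<in> borel_measurable Z" .
qed

lemma measurable_weight:
  assumes "f \<in> measurable Z (PiM I (\<lambda>_. Jumps))" "g \<in> measurable Z (PiM I (\<lambda>_. borel))" "h \<in> measurable Z R"
  shows "(\<lambda>z. weight I e (f z) (g z) (h z)) \<in> borel_measurable Z"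
  unfolding weight_def
  by (intro borel_measurable_times_ennreal measurable_q_product measurable_jump_power assms)

text \<open>Stands for the expectation of \<open>F\<close> at (J, Y, N). The random measure enters
  as \<open>add_atoms p s y M\<close> because the Mecke formula shifts it by the sampled points;
  this is where N_n^* comes from.\<close>

definition joint_integral :: "nat \<Rightarrow> ((nat \<Rightarrow> real) \<Rightarrow> (nat \<Rightarrow> 'y) \<Rightarrow> (real \<times> 'y) measure \<Rightarrow> ennreal) \<Rightarrow> ennreal" where
  "joint_integral n F = (\<Sum>p | partition_on {1..n} p.
     \<integral>\<^sup>+ y. (\<integral>\<^sup>+ s. (\<integral>\<^sup>+ M. F (of_cells n p s) (of_cells n p y) (add_atoms p s y M) * weight p card s y M \<partial>L)
       \<partial>PiM p (\<lambda>C. r (y C))) \<partial>PiM p (\<lambda>_. \<eta>))"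

text \<open>\<open>P_aug\<close> has the same total mass as its projection \<open>P_of\<close>. That
  this mass equals 1 is a measurable condition on \<open>M\<close>, so it passes from \<Omega> to
  the law of the random measure.\<close>

lemma AE_P_aug: "AE M in L. prob_space (P_aug q M)"
proof -
  have sets: "(\<lambda>M. emeasure (P_of q (mean_rm M)) UNIV) \<in> borel_measurable R"
    by (rule measurable_compose[OF measurable_compose[OF measurable_compose[OF
      measurable_ident_boundedly_finite_measures measurable_mean_rm] measurable_P_of[OF q_meas]]
      measurable_emeasure_measure_algebra]) simp
  have "AE \<omega> in \<Omega>. emeasure (P_of q (mean_rm (N \<omega>))) UNIV = 1"
    using P_prob
  proof eventually_elim
    fix \<omega> assume "prob_space (P_of q (mean_rm (N \<omega>)))"
    from prob_space.emeasure_space_1[OF this]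
    show "emeasure (P_of q (mean_rm (N \<omega>))) UNIV = 1"
      by (simp add: P_of_def mean_rm_def)
  qed
  then have "AE M in L. emeasure (P_of q (mean_rm M)) UNIV = 1"
  proof (subst AE_distr_iff[OF N])
    show "{M \<in> space R. emeasure (P_of q (mean_rm M)) UNIV = 1} \<in> sets R"
      using measurable_sets[OF sets, of "{1}"] by (simp add: vimage_def Int_def conj_commute)
  qed
  moreover have "AE M in L. M \<in> space R" by (rule AE_I2) simp
  ultimately show ?thesis
  proof eventually_elim
    fix M assume M: "emeasure (P_of q (mean_rm M)) UNIV = 1" "M \<in> space R"
    have snd: "snd \<in> measurable (P_aug q M) borel"
    proof -
      have "sets (P_aug q M) = sets Marked" by (simp add: P_aug_def space_R_D[OF M(2)])
      then show ?thesis unfolding measurable_cong_sets[OF \<open>sets (P_aug q M) = sets Marked\<close> refl] by (intro measurable_snd)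
    qed
    have "emeasure (P_of q (mean_rm M)) UNIV = emeasure (P_aug q M) (space (P_aug q M))"
      unfolding P_of_mean_rm[OF q_meas space_R_D(1)[OF M(2)]] using snd by (subst emeasure_distr) auto
    with M(1) show "prob_space (P_aug q M)" by (intro prob_spaceI) simp
  qed
qed

text \<open>The sampling densities become part of the integrand, \<open>mecke_partition\<close>
  splits it by cells, and the intensity is disintegrated into locations and jumps. No sample on
  \<Omega> is mentioned, so \<open>sample_joint\<close> and \<open>augmented_joint\<close> both
  follow from it.\<close>

lemma P_aug_joint:
  assumes F: "(\<lambda>(w, M). F w M) \<in> borel_measurable (PiM {1..n} (\<lambda>_. Marked) \<Otimes>\<^sub>M R)"
  shows "(\<integral>\<^sup>+ M. (\<integral>\<^sup>+ w. F w M \<partial>PiM {1..n} (\<lambda>_. P_aug q M)) \<partial>L) =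
    joint_integral n (\<lambda>s y M. F (\<lambda>i\<in>{1..n}. (s i, y i)) M)"
proof -
  interpret L: prob_space L by (rule prob_space_L)
  define h where "h M w = q_at q (snd w) (mean_rm M) * ennreal (fst w)" for M and w :: "real \<times> 'y"
  define F' where "F' = (\<lambda>(w, M). (\<Prod>i\<in>{1..n}. h M (w i)) * F w M)"
  have h: "(\<lambda>z. h (snd z) (fst z i)) \<in> borel_measurable (PiM {1..n} (\<lambda>_. Marked) \<Otimes>\<^sub>M R)" if i: "i \<in> {1..n}" for i
  proof -
    have c: "(\<lambda>z. fst z i) \<in> measurable (PiM {1..n} (\<lambda>_. Marked) \<Otimes>\<^sub>M R) Marked"
      by (rule measurable_compose[OF measurable_fst measurable_component_singleton[OF i]])
    have 1: "(\<lambda>z. snd (fst z i)) \<in> measurable (PiM {1..n} (\<lambda>_. Marked) \<Otimes>\<^sub>M R) borel"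
      by (rule measurable_compose[OF c measurable_snd])
    have "(\<lambda>s. ennreal s) \<in> borel_measurable Jumps" by (intro measurable_restrict_space1) auto
    from measurable_compose[OF measurable_compose[OF c measurable_fst] this]
    have 2: "(\<lambda>z. ennreal (fst (fst z i))) \<in> borel_measurable (PiM {1..n} (\<lambda>_. Marked) \<Otimes>\<^sub>M R)" .
    have 3: "(\<lambda>z. mean_rm (snd z)) \<in> measurable (PiM {1..n} (\<lambda>_. Marked) \<Otimes>\<^sub>M R) (measure_algebra borel)"
      using measurable_compose[OF measurable_compose[OF measurable_snd measurable_ident_boundedly_finite_measures] measurable_mean_rm] .
    show ?thesis
      unfolding h_def using measurable_compose[OF measurable_Pair[OF 1 3] measurable_q_at[OF q_meas]]
      by (intro borel_measurable_times_ennreal 2) simp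
  qed
  have F': "F' \<in> borel_measurable (PiM {1..n} (\<lambda>_. Marked) \<Otimes>\<^sub>M R)"
    unfolding F'_def split_beta' using F by (intro borel_measurable_times_ennreal borel_measurable_prod_ennreal h) (simp_all add: split_beta')
  have "(\<integral>\<^sup>+ M. (\<integral>\<^sup>+ w. F w M \<partial>PiM {1..n} (\<lambda>_. P_aug q M)) \<partial>L) =
      (\<integral>\<^sup>+ M. (\<integral>\<^sup>+ w. F' (w, M) \<partial>PiM {1..n} (\<lambda>_. M)) \<partial>L)"
  proof (intro nn_integral_cong_AE)
    have "AE M in L. M \<in> space R" by (rule AE_I2) simp
    with AE_P_aug show "AE M in L. (\<integral>\<^sup>+ w. F w M \<partial>PiM {1..n} (\<lambda>_. P_aug q M)) = (\<integral>\<^sup>+ w. F' (w, M) \<partial>PiM {1..n} (\<lambda>_. M))"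
    proof eventually_elim
      fix M assume P: "prob_space (P_aug q M)" and M: "M \<in> space R"
      have "(\<lambda>w. F w M) \<in> borel_measurable (PiM {1..n} (\<lambda>_. Marked))"
        using measurable_Pair1[OF F M] by simp
      from nn_integral_PiM_P_aug[OF q_meas space_R_D(1)[OF M] sigma_kernel_sigma_finite[OF sigma_kernel_R M]
        prob_space_imp_sigma_finite[OF P] _ this]
      show "(\<integral>\<^sup>+ w. F w M \<partial>PiM {1..n} (\<lambda>_. P_aug q M)) = (\<integral>\<^sup>+ w. F' (w, M) \<partial>PiM {1..n} (\<lambda>_. M))"
        by (simp add: F'_def h_def)
    qed
  qed
  also have "\<dots> = (\<Sum>p | partition_on {1..n} p. mecke_term n F' p)"
    by (rule mecke_partition[OF F'])
  also have "\<dots> = joint_integral n (\<lambda>s y M. F (\<lambda>i\<in>{1..n}. (s i, y i)) M)"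
    unfolding joint_integral_def
  proof (intro sum.cong refl)
    fix p assume "p \<in> {p. partition_on {1..n} p}"
    then have p: "partition_on {1..n} p" by simp
    have fin: "finite p" using partition_on_finite[OF _ p] by simp
    define G where "G v = (\<integral>\<^sup>+ M. F' (of_cells n p v, add_cells p v M) \<partial>L)" for v
    have "(\<lambda>(v, M). F' (of_cells n p v, add_cells p v M)) \<in> borel_measurable (PiM p (\<lambda>_. Marked) \<Otimes>\<^sub>M L)"
      using measurable_cells_integrand[OF p F'] by (subst measurable_cong_sets[OF sets_pair_measure_cong refl]) auto
    then have G: "G \<in> borel_measurable (PiM p (\<lambda>_. Marked))"
      unfolding G_def by (rule L.borel_measurable_nn_integral)
    have "mecke_term n F' p = (\<integral>\<^sup>+ v. G v \<partial>PiM p (\<lambda>_. intensity r \<eta>))"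
      unfolding mecke_term_def G_def nu_r[symmetric] ..
    also have "\<dots> = (\<integral>\<^sup>+ y. (\<integral>\<^sup>+ s. G (\<lambda>C\<in>p. (s C, y C)) \<partial>PiM p (\<lambda>C. r (y C))) \<partial>PiM p (\<lambda>_. \<eta>))"
      using sigma_finite_\<nu> unfolding nu_r
      by (rule nn_integral_PiM_intensity[OF eta(1,2) r _ fin G])
    also have "\<dots> = (\<integral>\<^sup>+ y. (\<integral>\<^sup>+ s. (\<integral>\<^sup>+ M. F (\<lambda>i\<in>{1..n}. (of_cells n p s i, of_cells n p y i)) (add_atoms p s y M) *
        weight p card s y M \<partial>L) \<partial>PiM p (\<lambda>C. r (y C))) \<partial>PiM p (\<lambda>_. \<eta>))"
    proof (intro nn_integral_cong)
      fix y :: "nat set \<Rightarrow> 'y" and s :: "nat set \<Rightarrow> real"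
      have cells: "of_cells n p (\<lambda>C\<in>p. (s C, y C)) = (\<lambda>i\<in>{1..n}. (of_cells n p s i, of_cells n p y i))"
      proof
        fix i
        show "of_cells n p (\<lambda>C\<in>p. (s C, y C)) i = (\<lambda>i\<in>{1..n}. (of_cells n p s i, of_cells n p y i)) i"
        proof (cases "i \<in> {1..n}")
          case True
          obtain C where C: "C \<in> p" "i \<in> C" using partition_on_cell[OF p True] .
          show ?thesis using True C
            by (simp add: of_cells_eq[OF p C] del: atLeastAtMost_iff)
        next
          case False
          then show ?thesis by (simp add: of_cells_outside del: atLeastAtMost_iff)
        qed
      qed
      have atoms: "add_cells p (\<lambda>C\<in>p. (s C, y C)) M = add_atoms p s y M" for M
        by (rule add_atoms_cong) auto
      have "(\<Prod>i\<in>{1..n}. h (add_atoms p s y M) (of_cells n p (\<lambda>C\<in>p. (s C, y C)) i)) = weight p card s y M" for M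
      proof -
        have "(\<Prod>i\<in>{1..n}. h (add_atoms p s y M) (of_cells n p (\<lambda>C\<in>p. (s C, y C)) i)) =
            (\<Prod>C\<in>p. h (add_atoms p s y M) ((\<lambda>C\<in>p. (s C, y C)) C) ^ card C)"
          by (rule prod_of_cells[OF p])
        also have "\<dots> = (\<Prod>C\<in>p. q_at q (y C) (mean_rm (add_atoms p s y M)) ^ card C * ennreal (s C) ^ card C)"
          by (intro prod.cong refl) (simp add: h_def power_mult_distrib)
        also have "\<dots> = weight p card s y M"
          by (simp add: weight_def q_product_def prod.distrib)
        finally show ?thesis .
      qed
      then show "G (\<lambda>C\<in>p. (s C, y C)) = (\<integral>\<^sup>+ M. F (\<lambda>i\<in>{1..n}. (of_cells n p s i, of_cells n p y i)) (add_atoms p s y M) *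
        weight p card s y M \<partial>L)"
        unfolding G_def F'_def prod.case atoms by (simp only: cells mult.commute)
    qed
    finally show "mecke_term n F' p = (\<integral>\<^sup>+ y. (\<integral>\<^sup>+ s. (\<integral>\<^sup>+ M. F (\<lambda>i\<in>{1..n}. (of_cells n p s i, of_cells n p y i)) (add_atoms p s y M) *
        weight p card s y M \<partial>L) \<partial>PiM p (\<lambda>C. r (y C))) \<partial>PiM p (\<lambda>_. \<eta>))" .
  qed
  finally show ?thesis .
qed

lemma restrict_of_cells: "(\<lambda>i\<in>{1..n}. of_cells n p y i) = of_cells n p y"
  by (auto simp: of_cells_def restrict_def fun_eq_iff)

text \<open>The sample alone is given on \<Omega>. Its conditional law is the projection of a power
  of \<open>P_aug\<close>, so the jumps enter only as integration variables.\<close>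

lemma sample_joint:
  assumes iid: "conditional_law \<Omega> Y (\<Pi>\<^sub>M i\<in>{1..n}. borel) N R (\<lambda>M. \<Pi>\<^sub>M i\<in>{1..n}. P_of q (mean_rm M))"
    and F: "(\<lambda>(y, M). F y M) \<in> borel_measurable ((\<Pi>\<^sub>M i\<in>{1..n}. borel) \<Otimes>\<^sub>M R)"
  shows "(\<integral>\<^sup>+ \<omega>. F (Y \<omega>) (N \<omega>) \<partial>\<Omega>) = joint_integral n (\<lambda>s y M. F y M)"
proof -
  have "(\<integral>\<^sup>+ \<omega>. F (Y \<omega>) (N \<omega>) \<partial>\<Omega>) = (\<integral>\<^sup>+ M. (\<integral>\<^sup>+ y. F y M \<partial>(\<Pi>\<^sub>M i\<in>{1..n}. P_of q (mean_rm M))) \<partial>L)"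
    using conditional_law_nn_integral[OF iid, of "\<lambda>(M, y). F y M"] measurable_compose[OF measurable_pair_swap' F]
    by (simp add: split_beta')
  also have "\<dots> = (\<integral>\<^sup>+ M. (\<integral>\<^sup>+ w. F (\<lambda>i\<in>{1..n}. snd (w i)) M \<partial>(\<Pi>\<^sub>M i\<in>{1..n}. P_aug q M)) \<partial>L)"
  proof (intro nn_integral_cong_AE)
    have "AE M in L. M \<in> space R" by (rule AE_I2) simp
    with AE_P_aug show "AE M in L. (\<integral>\<^sup>+ y. F y M \<partial>(\<Pi>\<^sub>M i\<in>{1..n}. P_of q (mean_rm M))) =
        (\<integral>\<^sup>+ w. F (\<lambda>i\<in>{1..n}. snd (w i)) M \<partial>(\<Pi>\<^sub>M i\<in>{1..n}. P_aug q M))"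
    proof eventually_elim
      fix M assume P: "prob_space (P_aug q M)" and M: "M \<in> space R"
      have snd: "snd \<in> measurable (P_aug q M) borel"
      proof -
        have "sets (P_aug q M) = sets Marked" by (simp add: P_aug_def space_R_D[OF M])
        then show ?thesis unfolding measurable_cong_sets[OF \<open>sets (P_aug q M) = sets Marked\<close> refl] by (intro measurable_snd)
      qed
      have FM: "(\<lambda>y. F y M) \<in> borel_measurable (\<Pi>\<^sub>M i\<in>{1..n}. borel)"
        using measurable_Pair1[OF F M] by simp
      have meas: "(\<lambda>w. \<lambda>i\<in>{1..n}. snd (w i)) \<in> measurable (\<Pi>\<^sub>M i\<in>{1..n}. P_aug q M) (\<Pi>\<^sub>M i\<in>{1..n}. borel)"
        by (intro measurable_restrict snd
            measurable_compose[OF measurable_component_singleton, where g=snd])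
      have "(\<Pi>\<^sub>M i\<in>{1..n}. distr (P_aug q M) borel snd) =
          distr (\<Pi>\<^sub>M i\<in>{1..n}. P_aug q M) (\<Pi>\<^sub>M i\<in>{1..n}. borel) (\<lambda>w. \<lambda>i\<in>{1..n}. snd (w i))"
        using P snd by (intro PiM_distr prob_space_imp_sigma_finite prob_space.prob_space_distr) auto
      then show "(\<integral>\<^sup>+ y. F y M \<partial>(\<Pi>\<^sub>M i\<in>{1..n}. P_of q (mean_rm M))) =
        (\<integral>\<^sup>+ w. F (\<lambda>i\<in>{1..n}. snd (w i)) M \<partial>(\<Pi>\<^sub>M i\<in>{1..n}. P_aug q M))"
        unfolding P_of_mean_rm[OF q_meas space_R_D(1)[OF M]] using meas FM by (simp add: nn_integral_distr)
    qed
  qed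
  also have "\<dots> = joint_integral n (\<lambda>s y M. F (\<lambda>i\<in>{1..n}. snd ((\<lambda>i\<in>{1..n}. (s i, y i)) i)) M)"
  proof (rule P_aug_joint)
    have "(\<lambda>w. \<lambda>i\<in>{1..n}. snd (w i)) \<in> measurable (\<Pi>\<^sub>M i\<in>{1..n}. Marked) (\<Pi>\<^sub>M i\<in>{1..n}. (borel :: 'y measure))"
      by (intro measurable_restrict measurable_snd
          measurable_compose[OF measurable_component_singleton, where g=snd])
    from measurable_compose[OF measurable_Pair[OF measurable_compose[OF measurable_fst this] measurable_snd] F]
    show "(\<lambda>(w, M). F (\<lambda>i\<in>{1..n}. snd (w i)) M) \<in> borel_measurable ((\<Pi>\<^sub>M i\<in>{1..n}. Marked) \<Otimes>\<^sub>M R)"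
      by (simp only: split_beta' fst_conv snd_conv)
  qed
  also have "\<dots> = joint_integral n (\<lambda>s y M. F y M)"
  proof -
    have "(\<lambda>i\<in>{1..n}. snd ((\<lambda>i\<in>{1..n}. (of_cells n p s i, of_cells n p y i)) i)) = of_cells n p y"
      for p and s :: "nat set \<Rightarrow> real" and y :: "nat set \<Rightarrow> 'y"
    proof -
      have "(\<lambda>i\<in>{1..n}. snd ((\<lambda>i\<in>{1..n}. (of_cells n p s i, of_cells n p y i)) i)) = (\<lambda>i\<in>{1..n}. of_cells n p y i)"
        by (rule restrict_ext) simp
      also have "\<dots> = of_cells n p y" by (rule restrict_of_cells)
      finally show ?thesis .
    qed
    then show ?thesis unfolding joint_integral_def by (simp only:)
  qed
  finally show ?thesis .
qed

lemma augmented_joint: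
  assumes aug: "conditional_law \<Omega> W (\<Pi>\<^sub>M i\<in>{1..n}. Marked) N R (\<lambda>M. \<Pi>\<^sub>M i\<in>{1..n}. P_aug q M)"
    and F: "(\<lambda>(w, M). F w M) \<in> borel_measurable ((\<Pi>\<^sub>M i\<in>{1..n}. Marked) \<Otimes>\<^sub>M R)"
  shows "(\<integral>\<^sup>+ \<omega>. F (W \<omega>) (N \<omega>) \<partial>\<Omega>) = joint_integral n (\<lambda>s y M. F (\<lambda>i\<in>{1..n}. (s i, y i)) M)"
proof -
  have "(\<integral>\<^sup>+ \<omega>. F (W \<omega>) (N \<omega>) \<partial>\<Omega>) = (\<integral>\<^sup>+ M. (\<integral>\<^sup>+ w. F w M \<partial>(\<Pi>\<^sub>M i\<in>{1..n}. P_aug q M)) \<partial>L)"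
    using conditional_law_nn_integral[OF aug, of "\<lambda>(M, w). F w M"] measurable_compose[OF measurable_pair_swap' F]
    by (simp add: split_beta')
  then show ?thesis using P_aug_joint[OF F] by simp
qed

end

section \<open>Ties\<close>

lemma ties_partition: "partition_on {1..n} (ties n y)"
proof (rule partition_onI)
  show "\<Union> (ties n y) = {1..n}" by (auto simp: ties_def)
  show "disjnt C D" if "C \<in> ties n y" "D \<in> ties n y" "C \<noteq> D" for C D
    using that by (auto simp: ties_def disjnt_def)
  show "{} \<notin> ties n y" by (auto simp: ties_def)
qed

text \<open>Turns an equation between sets of sets into finitely many comparisons of coordinates,
  from which measurability can be read off.\<close>

lemma ties_eq_iff:
  assumes p: "partition_on {1..n} p"
  shows "ties n y = p \<longleftrightarrow> (\<forall>i\<in>{1..n}. \<forall>k\<in>{1..n}. y k = y i \<longleftrightarrow> (\<exists>C\<in>p. i \<in> C \<and> k \<in> C))"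
proof
  assume t: "ties n y = p"
  show "\<forall>i\<in>{1..n}. \<forall>k\<in>{1..n}. y k = y i \<longleftrightarrow> (\<exists>C\<in>p. i \<in> C \<and> k \<in> C)"
  proof (intro ballI)
    fix i k assume i: "i \<in> {1..n}" and k: "k \<in> {1..n}"
    show "y k = y i \<longleftrightarrow> (\<exists>C\<in>p. i \<in> C \<and> k \<in> C)"
    proof
      assume "y k = y i"
      then have "i \<in> {k \<in> {1..n}. y k = y i}" "k \<in> {k \<in> {1..n}. y k = y i}" using i k by auto
      moreover have "{k \<in> {1..n}. y k = y i} \<in> p" using i unfolding t[symmetric] ties_def by blast
      ultimately show "\<exists>C\<in>p. i \<in> C \<and> k \<in> C"
        by (intro bexI[of _ "{k \<in> {1..n}. y k = y i}"] conjI)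
    next
      assume "\<exists>C\<in>p. i \<in> C \<and> k \<in> C"
      then obtain C where "C \<in> ties n y" "i \<in> C" "k \<in> C" unfolding t by blast
      then show "y k = y i" by (auto simp: ties_def)
    qed
  qed
next
  assume *: "\<forall>i\<in>{1..n}. \<forall>k\<in>{1..n}. y k = y i \<longleftrightarrow> (\<exists>C\<in>p. i \<in> C \<and> k \<in> C)"
  have cell: "{k \<in> {1..n}. y k = y i} = C" if "C \<in> p" "i \<in> C" for i C
  proof -
    have sub: "C \<subseteq> {1..n}" using partition_onD1[OF p] that by blast
    have "k \<in> C" if "D \<in> p" "i \<in> D" "k \<in> D" for k D
      using partition_onD2[OF p] \<open>C \<in> p\<close> \<open>i \<in> C\<close> that by (auto simp: disjoint_def)
    moreover have "k \<in> C \<longleftrightarrow> y k = y i" if "k \<in> {1..n}" for k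
      using *[rule_format, of i k] that sub calculation \<open>C \<in> p\<close> \<open>i \<in> C\<close> by blast
    ultimately show ?thesis using sub by blast
  qed
  show "ties n y = p"
  proof (intro equalityI subsetI)
    fix D assume "D \<in> ties n y"
    then obtain i where i: "i \<in> {1..n}" "D = {k \<in> {1..n}. y k = y i}" by (auto simp: ties_def)
    obtain C where "C \<in> p" "i \<in> C" using partition_on_cell[OF p i(1)] .
    with cell i(2) show "D \<in> p" by simp
  next
    fix C assume C: "C \<in> p"
    then obtain i where i: "i \<in> C" using partition_onD3[OF p] by fastforce
    then have "i \<in> {1..n}" using C partition_onD1[OF p] by blast
    then show "C \<in> ties n y" using cell[OF C i] unfolding ties_def by blast
  qed
qed

lemma measurable_ties:
  fixes p :: "nat set set"
  assumes p: "partition_on {1..n} p"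
  shows "{y \<in> space (PiM {1..n} (\<lambda>_. borel :: 'y::polish_space measure)). ties n y = p} \<in> sets (PiM {1..n} (\<lambda>_. borel))"
proof -
  have "{y \<in> space (PiM {1..n} (\<lambda>_. borel :: 'y measure)). y k = y i} \<in> sets (PiM {1..n} (\<lambda>_. borel))"
    if "i \<in> {1..n}" "k \<in> {1..n}" for i k
    by (intro measurable_equality_set measurable_component_singleton that)
  note eq = this
  have cell: "{y \<in> space (PiM {1..n} (\<lambda>_. borel :: 'y measure)). y k = y i \<longleftrightarrow> (\<exists>C\<in>p. i \<in> C \<and> k \<in> C)} \<in> sets (PiM {1..n} (\<lambda>_. borel))"
    if i: "i \<in> {1..n}" and k: "k \<in> {1..n}" for i k
  proof (cases "\<exists>C\<in>p. i \<in> C \<and> k \<in> C")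
    case True
    show ?thesis unfolding eqTrueI[OF True] simp_thms by (rule eq[OF i k])
  next
    case False
    then have "(y k = y i \<longleftrightarrow> (\<exists>C\<in>p. i \<in> C \<and> k \<in> C)) \<longleftrightarrow> \<not> y k = y i" for y :: "nat \<Rightarrow> 'y" by blast
    then show ?thesis using sets.sets_Collect_neg[OF eq[OF i k]] by (simp only:)
  qed
  show ?thesis
    unfolding ties_eq_iff[OF p] by (intro sets.sets_Collect_finite_All cell finite_atLeastAtMost)
qed

text \<open>The product space on which \<open>f p\<close> is built changes with the partition. As
  there are finitely many tie patterns, each with a measurable preimage, measurability can be
  checked pattern by pattern.\<close>

lemma measurable_case_ties:
  fixes f :: "nat set set \<Rightarrow> 'z \<Rightarrow> ennreal"
  assumes f: "\<And>p. partition_on {1..n} p \<Longrightarrow> f p \<in> borel_measurable Z"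
    and g: "g \<in> measurable Z (PiM {1..n} (\<lambda>_. borel :: 'y::polish_space measure))"
  shows "(\<lambda>z. f (ties n (g z)) z) \<in> borel_measurable Z"
proof -
  have "(\<lambda>z. \<Sum>p | partition_on {1..n} p. f p z * indicator {y \<in> space (PiM {1..n} (\<lambda>_. borel)). ties n y = p} (g z)) \<in> borel_measurable Z"
    using f measurable_ties
    by (intro borel_measurable_sum borel_measurable_times_ennreal measurable_compose[OF g borel_measurable_indicator]) auto
  then show ?thesis
  proof (rule measurable_cong[THEN iffD1, rotated])
    fix z assume z: "z \<in> space Z"
    have fin: "finite {p. partition_on {1..n} p}" by (rule finitely_many_partition_on) simp
    have "(\<Sum>p | partition_on {1..n} p. f p z * indicator {y \<in> space (PiM {1..n} (\<lambda>_. borel)). ties n y = p} (g z)) =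
        (\<Sum>p | partition_on {1..n} p. if ties n (g z) = p then f p z else 0)"
      using measurable_space[OF g z] by (intro sum.cong) (auto simp: indicator_def)
    also have "\<dots> = f (ties n (g z)) z"
      using fin ties_partition[of n "g z"] by simp
    finally show "(\<Sum>p | partition_on {1..n} p. f p z * indicator {y \<in> space (PiM {1..n} (\<lambda>_. borel)). ties n y = p} (g z)) =
        f (ties n (g z)) z" .
  qed
qed

lemma Min_cell:
  fixes n :: nat
  assumes p: "partition_on {1..n} p" and C: "C \<in> p"
  shows "Min C \<in> C" "Min C \<in> {1..n}"
proof -
  have sub: "C \<subseteq> {1..n}" using partition_onD1[OF p] C by blast
  have "C \<noteq> {}" using partition_onD3[OF p] C by auto
  then show "Min C \<in> C" by (intro Min_in finite_subset[OF sub]) simp_all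
  with sub show "Min C \<in> {1..n}" by blast
qed

lemma measurable_on_cells:
  assumes p: "partition_on {1..n} p"
  shows "(\<lambda>y. restrict (on_cells y) p) \<in> measurable (PiM {1..n} (\<lambda>_. K)) (PiM p (\<lambda>_. K))"
  unfolding on_cells_def using Min_cell[OF p]
  by (intro measurable_restrict measurable_component_singleton) auto

lemma on_cells_of_cells:
  assumes p: "partition_on {1..n} p" and C: "C \<in> p"
  shows "on_cells (of_cells n p y) C = y C"
  unfolding on_cells_def using Min_cell[OF p C] by (intro of_cells_eq[OF p C])

text \<open>Equal values on two cells would merge them, hence the injectivity;
  \<open>AE_inj_on\<close> provides it almost everywhere.\<close>

lemma ties_of_cells:
  assumes p: "partition_on {1..n} p" and inj: "inj_on y p"
  shows "ties n (of_cells n p y) = p"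
  unfolding ties_eq_iff[OF p]
proof (intro ballI)
  fix i k assume i: "i \<in> {1..n}" and k: "k \<in> {1..n}"
  obtain C where C: "C \<in> p" "i \<in> C" using partition_on_cell[OF p i] .
  obtain D where D: "D \<in> p" "k \<in> D" using partition_on_cell[OF p k] .
  have "of_cells n p y k = of_cells n p y i \<longleftrightarrow> C = D"
    unfolding of_cells_eq[OF p C] of_cells_eq[OF p D] using inj C D by (auto dest: inj_onD)
  also have "\<dots> \<longleftrightarrow> (\<exists>C\<in>p. i \<in> C \<and> k \<in> C)"
  proof -
    have "A = B" if "A \<in> p" "B \<in> p" "x \<in> A" "x \<in> B" for A B x
      using partition_onD2[OF p] that unfolding disjoint_def by blast
    then show ?thesis using C D by metis
  qed
  finally show "of_cells n p y k = of_cells n p y i \<longleftrightarrow> (\<exists>C\<in>p. i \<in> C \<and> k \<in> C)" .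
qed

lemma (in product_sigma_finite) AE_PiM_component_finite:
  assumes I: "finite I" "i \<in> I" and P: "AE x in M i. P x"
  shows "AE y in PiM I M. P (y i)"
proof -
  obtain X where X: "{x \<in> space (M i). \<not> P x} \<subseteq> X" "emeasure (M i) X = 0" "X \<in> sets (M i)"
    using P by (rule AE_E)
  define A where "A j = (if j = i then X else space (M j))" for j
  have A: "A j \<in> sets (M j)" for j using X by (simp add: A_def)
  \<comment> \<open>The other factors may be infinite, but in \<open>ennreal\<close> a product with
    a factor 0 is 0, so the null set \<open>X\<close> in coordinate \<open>i\<close> is
    enough.\<close>
  have "emeasure (PiM I M) (Pi\<^sub>E I A) = (\<Prod>j\<in>I. emeasure (M j) (A j))"
    using I A by (intro emeasure_PiM) auto
  also have "\<dots> = 0" using I X by (auto simp: A_def intro!: prod_zero bexI[of _ i])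
  finally have "Pi\<^sub>E I A \<in> null_sets (PiM I M)"
    using I A by (auto simp: null_sets_def intro!: sets_PiM_I_finite)
  then show ?thesis
  proof (rule AE_I')
    show "{y \<in> space (PiM I M). \<not> P (y i)} \<subseteq> Pi\<^sub>E I A"
      using X(1) I by (auto simp: space_PiM A_def PiE_iff extensional_def)
  qed
qed

lemma nonatomic_singleton:
  assumes "nonatomic M" "{x} \<in> sets M"
  shows "emeasure M {x} = 0"
proof (rule ccontr)
  assume "emeasure M {x} \<noteq> 0"
  then obtain B where "B \<subseteq> {x}" "0 < emeasure M B" "emeasure M B < emeasure M {x}"
    using assms unfolding nonatomic_def by (metis zero_less_iff_neq_zero)
  then show False by (metis emeasure_empty less_irrefl subset_singletonD)
qed

section \<open>The disintegrating kernels\<close>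

context species_model begin

lemma AE_inj_on:
  assumes I: "finite (I :: 'i set)"
  shows "AE y in PiM I (\<lambda>_. \<eta>). inj_on y I"
proof -
  interpret product_sigma_finite "\<lambda>_ :: 'i. \<eta>" using eta by (simp add: product_sigma_finite_def)
  have "AE y in PiM I (\<lambda>_. \<eta>). y i \<noteq> y j" if ij: "i \<in> I" "j \<in> I" "i \<noteq> j" for i j
  proof -
    define I' where "I' = I - {i}"
    have I': "I = insert i I'" "i \<notin> I'" "finite I'" "j \<in> I'" using I ij by (auto simp: I'_def)
    define D where "D = {y \<in> space (PiM I (\<lambda>_. borel :: 'y measure)). y i = y j}"
    have D: "D \<in> sets (PiM I (\<lambda>_. borel))"
      unfolding D_def by (intro measurable_equality_set measurable_component_singleton ij)
    have D': "D \<in> sets (PiM I (\<lambda>_. \<eta>))" using D by (simp only: sets_PiM_\<eta>)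
    \<comment> \<open>With coordinate \<open>i\<close> integrated innermost, the section of
      \<open>D\<close> lies in the singleton of \<open>y j\<close>, which is null because \<eta> is
      nonatomic.\<close>
    have "emeasure (PiM I (\<lambda>_. \<eta>)) D = (\<integral>\<^sup>+ y. indicator D y \<partial>PiM I (\<lambda>_. \<eta>))"
      using D' by simp
    also have "\<dots> = (\<integral>\<^sup>+ y. (\<integral>\<^sup>+ t. indicator D (y(i := t)) \<partial>\<eta>) \<partial>PiM I' (\<lambda>_. \<eta>))"
      using I' D' unfolding I'(1) by (intro product_nn_integral_insert) auto
    also have "\<dots> = (\<integral>\<^sup>+ y. 0 \<partial>PiM I' (\<lambda>_. \<eta>))"
    proof (intro nn_integral_cong)
      fix y
      have s: "{y j} \<in> sets \<eta>" by (simp add: eta)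
      have "(\<integral>\<^sup>+ t. indicator D (y(i := t)) \<partial>\<eta>) \<le> (\<integral>\<^sup>+ t. indicator {y j} t \<partial>\<eta>)"
        using ij by (intro nn_integral_mono) (auto simp: D_def indicator_def)
      also have "\<dots> = 0" using s nonatomic_singleton[OF eta(3) s] by simp
      finally show "(\<integral>\<^sup>+ t. indicator D (y(i := t)) \<partial>\<eta>) = 0" by simp
    qed
    finally have "D \<in> null_sets (PiM I (\<lambda>_. \<eta>))" using D' by (simp add: null_sets_def)
    then show ?thesis
    proof (rule AE_I')
      show "{y \<in> space (PiM I (\<lambda>_. \<eta>)). \<not> y i \<noteq> y j} \<subseteq> D"
        by (auto simp: D_def sets_eq_imp_space_eq[OF sets_PiM_\<eta>])
    qed
  qed
  then have "AE y in PiM I (\<lambda>_. \<eta>). \<forall>i\<in>I. \<forall>j\<in>I. i \<noteq> j \<longrightarrow> y i \<noteq> y j"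
    using I by (intro AE_finite_allI AE_impI) auto
  then show ?thesis by eventually_elim (auto simp: inj_on_def)
qed

text \<open>The unnormalised law of the cell jumps and of the Poisson random measure (before the
  atoms are added), given the locations \<open>y\<close> of the cells. Its total mass is the
  marginal density at \<open>y\<close>, with \<open>r\<close> in place of \<rho>.\<close>

definition cell_measure :: "'i set \<Rightarrow> ('i \<Rightarrow> nat) \<Rightarrow> ('i \<Rightarrow> 'y) \<Rightarrow> (('i \<Rightarrow> real) \<times> (real \<times> 'y) measure) measure" where
  "cell_measure I e y = density (PiM I (\<lambda>i. r (y i)) \<Otimes>\<^sub>M L) (\<lambda>(s, M). weight I e s y M)"

lemma sets_cell_measure[simp]: "sets (cell_measure I e y) = sets (PiM I (\<lambda>_. Jumps) \<Otimes>\<^sub>M R)"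
  unfolding cell_measure_def by (simp add: sets_pair_measure_cong[OF sets_PiM_r])

lemma nn_integral_cell_measure:
  assumes y: "y \<in> space (PiM I (\<lambda>_. borel))" and f: "(\<lambda>(s, M). f s M) \<in> borel_measurable (PiM I (\<lambda>_. Jumps) \<Otimes>\<^sub>M R)"
  shows "(\<integral>\<^sup>+ x. (case x of (s, M) \<Rightarrow> f s M) \<partial>cell_measure I e y) =
    (\<integral>\<^sup>+ s. (\<integral>\<^sup>+ M. f s M * weight I e s y M \<partial>L) \<partial>PiM I (\<lambda>i. r (y i)))"
proof -
  interpret L: prob_space L by (rule prob_space_L)
  have sets: "sets (PiM I (\<lambda>i. r (y i)) \<Otimes>\<^sub>M L) = sets (PiM I (\<lambda>_. Jumps) \<Otimes>\<^sub>M R)"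
    by (intro sets_pair_measure_cong sets_PiM_r) simp
  have w: "(\<lambda>(s, M). weight I e s y M) \<in> borel_measurable (PiM I (\<lambda>_. Jumps) \<Otimes>\<^sub>M R)"
    unfolding split_beta' using y by (intro measurable_weight) auto
  have fw: "(\<lambda>(s, M). weight I e s y M * f s M) \<in> borel_measurable (PiM I (\<lambda>i. r (y i)) \<Otimes>\<^sub>M L)"
    unfolding measurable_cong_sets[OF sets refl] using f w
    unfolding split_beta' by (intro borel_measurable_times_ennreal)
  have "(\<integral>\<^sup>+ x. (case x of (s, M) \<Rightarrow> f s M) \<partial>cell_measure I e y) =
      (\<integral>\<^sup>+ x. (case x of (s, M) \<Rightarrow> weight I e s y M) * (case x of (s, M) \<Rightarrow> f s M) \<partial>(PiM I (\<lambda>i. r (y i)) \<Otimes>\<^sub>M L))"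
    unfolding cell_measure_def using f w by (intro nn_integral_density) (simp_all only: measurable_cong_sets[OF sets refl])
  also have "\<dots> = (\<integral>\<^sup>+ x. (case x of (s, M) \<Rightarrow> weight I e s y M * f s M) \<partial>(PiM I (\<lambda>i. r (y i)) \<Otimes>\<^sub>M L))"
    by (simp only: split_beta')
  also have "\<dots> = (\<integral>\<^sup>+ s. (\<integral>\<^sup>+ M. weight I e s y M * f s M \<partial>L) \<partial>PiM I (\<lambda>i. r (y i)))"
    using L.nn_integral_fst[OF fw] by simp
  finally show ?thesis by (simp only: mult.commute)
qed

lemma measurable_cell_integral:
  assumes I: "finite I" and F: "(\<lambda>((y, s), M). F y s M) \<in> borel_measurable ((PiM I (\<lambda>_. borel) \<Otimes>\<^sub>M PiM I (\<lambda>_. Jumps)) \<Otimes>\<^sub>M R)"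
  shows "(\<lambda>y. \<integral>\<^sup>+ s. (\<integral>\<^sup>+ M. F y s M * weight I e s y M \<partial>L) \<partial>PiM I (\<lambda>i. r (y i))) \<in> borel_measurable (PiM I (\<lambda>_. borel))"
proof (rule measurable_nn_integral_PiM_sigma_kernel[OF I])
  interpret L: prob_space L by (rule prob_space_L)
  show "sigma_kernel (PiM I (\<lambda>_. borel)) Jumps (\<lambda>y. r (y i))" if "i \<in> I" for i
    using sigma_kernel_compose[OF measurable_component_singleton[OF that, of "\<lambda>_. borel"] r] .
  have "(\<lambda>z. weight I e (snd (fst z)) (fst (fst z)) (snd z)) \<in> borel_measurable ((PiM I (\<lambda>_. borel) \<Otimes>\<^sub>M PiM I (\<lambda>_. Jumps)) \<Otimes>\<^sub>M R)"
    by (rule measurable_weight[OF measurable_compose[OF measurable_fst measurable_snd]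
        measurable_compose[OF measurable_fst measurable_fst] measurable_snd])
  then have m: "(\<lambda>(x, M). F (fst x) (snd x) M * weight I e (snd x) (fst x) M)
      \<in> borel_measurable ((PiM I (\<lambda>_. borel) \<Otimes>\<^sub>M PiM I (\<lambda>_. Jumps)) \<Otimes>\<^sub>M L)"
    using F unfolding measurable_cong_sets[OF sets_pair_measure_cong[OF refl sets_distr] refl] split_beta'
    by (intro borel_measurable_times_ennreal)
  show "(\<lambda>(y, s). \<integral>\<^sup>+ M. F y s M * weight I e s y M \<partial>L) \<in> borel_measurable (PiM I (\<lambda>_. borel) \<Otimes>\<^sub>M PiM I (\<lambda>_. Jumps))"
    unfolding split_beta' by (rule L.borel_measurable_nn_integral[OF m])
qed

text \<open>The dominating measure of the marginal law: integration over all vectors whose ties are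
  described by a partition, with one factor \<eta> per cell. It is the outer functional
  \<open>I\<close> in \<open>conditional_law_bayes\<close>.\<close>

definition cells_integral :: "nat \<Rightarrow> ((nat \<Rightarrow> 'y) \<Rightarrow> ennreal) \<Rightarrow> ennreal" where
  "cells_integral n f = (\<Sum>p | partition_on {1..n} p. \<integral>\<^sup>+ y. f (of_cells n p y) \<partial>PiM p (\<lambda>_. \<eta>))"

text \<open>The unnormalised posterior given the sample: the cells are read off its ties, and
  \<open>h\<close> extracts the quantity of interest from cell values, jumps and random measure.
  \<open>restrict\<close> puts the cell values into the product space over the cells.\<close>

definition sample_kernel :: "nat \<Rightarrow> 'x measure \<Rightarrow>
    (nat set set \<Rightarrow> (nat set \<Rightarrow> 'y) \<Rightarrow> (nat set \<Rightarrow> real) \<Rightarrow> (real \<times> 'y) measure \<Rightarrow> 'x) \<Rightarrow> (nat \<Rightarrow> 'y) \<Rightarrow> 'x measure" where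
  "sample_kernel n X h y = distr (cell_measure (ties n y) card (restrict (on_cells y) (ties n y))) X
     (\<lambda>(s, M). h (ties n y) (restrict (on_cells y) (ties n y)) s M)"

lemma sets_sample_kernel: "sets (sample_kernel n X h y) = sets X"
  by (simp add: sample_kernel_def)

context
  fixes n :: nat and X :: "'x measure"
    and h :: "nat set set \<Rightarrow> (nat set \<Rightarrow> 'y) \<Rightarrow> (nat set \<Rightarrow> real) \<Rightarrow> (real \<times> 'y) measure \<Rightarrow> 'x"
  assumes h: "\<And>p. partition_on {1..n} p \<Longrightarrow>
    (\<lambda>((y, s), M). h p y s M) \<in> measurable ((PiM p (\<lambda>_. borel) \<Otimes>\<^sub>M PiM p (\<lambda>_. Jumps)) \<Otimes>\<^sub>M R) X"
begin

lemma nn_integral_sample_kernel: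
  assumes p: "partition_on {1..n} p" and y: "y \<in> space (PiM {1..n} (\<lambda>_. borel))" "ties n y = p"
    and f: "f \<in> borel_measurable X"
  shows "(\<integral>\<^sup>+ x. f x \<partial>sample_kernel n X h y) =
    (\<integral>\<^sup>+ s. (\<integral>\<^sup>+ M. f (h p (restrict (on_cells y) p) s M) * weight p card s (restrict (on_cells y) p) M \<partial>L)
      \<partial>PiM p (\<lambda>C. r (restrict (on_cells y) p C)))"
proof -
  let ?c = "restrict (on_cells y) p"
  have c: "?c \<in> space (PiM p (\<lambda>_. borel))"
    using measurable_space[OF measurable_on_cells[OF p] y(1)] .
  have "(\<lambda>x. ((?c, fst x), snd x)) \<in> measurable (PiM p (\<lambda>_. Jumps) \<Otimes>\<^sub>M R) ((PiM p (\<lambda>_. borel) \<Otimes>\<^sub>M PiM p (\<lambda>_. Jumps)) \<Otimes>\<^sub>M R)"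
    using c by (intro measurable_Pair measurable_const measurable_fst measurable_snd)
  from measurable_compose[OF this h[OF p]]
  have hc: "(\<lambda>(s, M). h p ?c s M) \<in> measurable (PiM p (\<lambda>_. Jumps) \<Otimes>\<^sub>M R) X"
    unfolding split_beta' by (simp only: fst_conv snd_conv)
  have "(\<integral>\<^sup>+ x. f x \<partial>sample_kernel n X h y) = (\<integral>\<^sup>+ x. f (case x of (s, M) \<Rightarrow> h p ?c s M) \<partial>cell_measure p card ?c)"
    unfolding sample_kernel_def y(2) using hc f by (intro nn_integral_distr) (simp_all only: measurable_cong_sets[OF sets_cell_measure refl] measurable_distr_eq1)
  also have "\<dots> = (\<integral>\<^sup>+ x. (case x of (s, M) \<Rightarrow> f (h p ?c s M)) \<partial>cell_measure p card ?c)"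
    by (simp only: split_beta')
  also have "\<dots> = (\<integral>\<^sup>+ s. (\<integral>\<^sup>+ M. f (h p ?c s M) * weight p card s ?c M \<partial>L) \<partial>PiM p (\<lambda>C. r (?c C)))"
    using measurable_compose[OF hc f] by (intro nn_integral_cell_measure c) (simp only: split_beta')
  finally show ?thesis .
qed

lemma measurable_emeasure_sample_kernel:
  assumes B: "B \<in> sets X"
  shows "(\<lambda>y. emeasure (sample_kernel n X h y) B) \<in> borel_measurable (PiM {1..n} (\<lambda>_. borel))"
proof -
  define f where "f p y = (\<integral>\<^sup>+ s. (\<integral>\<^sup>+ M. indicator B (h p y s M) * weight p card s y M \<partial>L) \<partial>PiM p (\<lambda>C. r (y C)))" for p y
  have f: "f p \<in> borel_measurable (PiM p (\<lambda>_. borel))" if p: "partition_on {1..n} p" for p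
    unfolding f_def using partition_on_finite[OF _ p] measurable_compose[OF h[OF p] borel_measurable_indicator[OF B]]
    by (intro measurable_cell_integral) (simp_all only: split_beta' finite_atLeastAtMost)
  have "(\<lambda>y. f (ties n y) (restrict (on_cells y) (ties n y))) \<in> borel_measurable (PiM {1..n} (\<lambda>_. borel))"
    using measurable_compose[OF measurable_on_cells f]
    by (intro measurable_case_ties[where f="\<lambda>p y. f p (restrict (on_cells y) p)" and g="\<lambda>y. y"]) simp_all
  then show ?thesis
  proof (rule measurable_cong[THEN iffD1, rotated])
    fix y :: "nat \<Rightarrow> 'y" assume y: "y \<in> space (PiM {1..n} (\<lambda>_. borel))"
    have "emeasure (sample_kernel n X h y) B = (\<integral>\<^sup>+ x. indicator B x \<partial>sample_kernel n X h y)"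
      using B by (simp add: sets_sample_kernel)
    also have "\<dots> = f (ties n y) (restrict (on_cells y) (ties n y))"
      unfolding f_def using B by (intro nn_integral_sample_kernel ties_partition y refl) simp
    finally show "f (ties n y) (restrict (on_cells y) (ties n y)) = emeasure (sample_kernel n X h y) B"
      by simp
  qed
qed

text \<open>In the term of \<open>p\<close> the cell values are almost everywhere distinct, so the
  kernel recovers \<open>p\<close> and the values \<open>y\<close> from
  \<open>of_cells n p y\<close>. This brings the sum over partitions into the form that Bayes' rule
  expects.\<close>

lemma sample_kernel_joint:
  assumes F: "(\<lambda>(y, x). F y x) \<in> borel_measurable (PiM {1..n} (\<lambda>_. borel) \<Otimes>\<^sub>M X)"
  shows "(\<Sum>p | partition_on {1..n} p. \<integral>\<^sup>+ y. (\<integral>\<^sup>+ s. (\<integral>\<^sup>+ M. F (of_cells n p y) (h p y s M) * weight p card s y M \<partial>L)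
       \<partial>PiM p (\<lambda>C. r (y C))) \<partial>PiM p (\<lambda>_. \<eta>)) =
    cells_integral n (\<lambda>y. \<integral>\<^sup>+ x. F y x \<partial>sample_kernel n X h y)"
  unfolding cells_integral_def
proof (intro sum.cong refl nn_integral_cong_AE)
  fix p assume "p \<in> {p. partition_on {1..n} p}"
  then have p: "partition_on {1..n} p" by simp
  have fin: "finite p" using partition_on_finite[OF _ p] by simp
  have "AE y in PiM p (\<lambda>_. \<eta>). y \<in> space (PiM p (\<lambda>_. borel))"
    by (rule AE_I2) (simp add: sets_eq_imp_space_eq[OF sets_PiM_\<eta>])
  with AE_inj_on[OF fin]
  show "AE y in PiM p (\<lambda>_. \<eta>). (\<integral>\<^sup>+ s. (\<integral>\<^sup>+ M. F (of_cells n p y) (h p y s M) * weight p card s y M \<partial>L)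
       \<partial>PiM p (\<lambda>C. r (y C))) = (\<integral>\<^sup>+ x. F (of_cells n p y) x \<partial>sample_kernel n X h (of_cells n p y))"
  proof eventually_elim
    fix y :: "nat set \<Rightarrow> 'y" assume inj: "inj_on y p" and y: "y \<in> space (PiM p (\<lambda>_. borel))"
    have y': "of_cells n p y \<in> space (PiM {1..n} (\<lambda>_. borel))"
      by (rule measurable_space[OF measurable_of_cells[OF p] y])
    have c: "restrict (on_cells (of_cells n p y)) p = y"
      using y by (auto simp: fun_eq_iff on_cells_of_cells[OF p] restrict_def space_PiM PiE_iff extensional_def)
    have "F (of_cells n p y) \<in> borel_measurable X" using measurable_Pair2[OF F y'] by simp
    from nn_integral_sample_kernel[OF p y' ties_of_cells[OF p inj] this]
    show "(\<integral>\<^sup>+ s. (\<integral>\<^sup>+ M. F (of_cells n p y) (h p y s M) * weight p card s y M \<partial>L)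
       \<partial>PiM p (\<lambda>C. r (y C))) = (\<integral>\<^sup>+ x. F (of_cells n p y) x \<partial>sample_kernel n X h (of_cells n p y))"
      unfolding c by simp
  qed
qed

end

end

section \<open>The posterior laws\<close>

context species_model begin

lemma measurable_q_integral:
  assumes f: "f \<in> measurable Z (PiM I (\<lambda>_. Jumps))" and g: "g \<in> measurable Z (PiM I (\<lambda>_. borel))"
    and F: "(\<lambda>(z, M). F z M) \<in> borel_measurable (Z \<Otimes>\<^sub>M R)"
  shows "(\<lambda>z. \<integral>\<^sup>+ M. F z M * q_product q I e (f z) (g z) M \<partial>L) \<in> borel_measurable Z"
proof -
  interpret L: prob_space L by (rule prob_space_L)
  have "(\<lambda>x. q_product q I e (f (fst x)) (g (fst x)) (snd x)) \<in> borel_measurable (Z \<Otimes>\<^sub>M R)"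
    by (rule measurable_q_product[OF measurable_compose[OF measurable_fst f] measurable_compose[OF measurable_fst g] measurable_snd])
  then have "(\<lambda>(z, M). F z M * q_product q I e (f z) (g z) M) \<in> borel_measurable (Z \<Otimes>\<^sub>M L)"
    using F unfolding measurable_cong_sets[OF sets_pair_measure_cong[OF refl sets_distr] refl] split_beta'
    by (intro borel_measurable_times_ennreal)
  then show ?thesis by (rule L.borel_measurable_nn_integral)
qed

lemma measurable_phi:
  assumes f: "f \<in> measurable Z (PiM I (\<lambda>_. Jumps))" and g: "g \<in> measurable Z (PiM I (\<lambda>_. borel))"
  shows "(\<lambda>z. phi q L I e (f z) (g z)) \<in> borel_measurable Z"
  using measurable_q_integral[OF f g, of "\<lambda>_ _. 1" e] by (simp add: phi_def)

lemma q_product_measurable_M: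
  assumes "s \<in> space (PiM I (\<lambda>_. Jumps))" "y \<in> space (PiM I (\<lambda>_. borel))"
  shows "(\<lambda>M. q_product q I e s y M) \<in> borel_measurable R"
  using assms by (intro measurable_q_product measurable_const measurable_ident_sets refl)

lemma add_atoms_measurable_M:
  assumes "s \<in> space (PiM I (\<lambda>_. Jumps))" "y \<in> space (PiM I (\<lambda>_. borel))"
  shows "(\<lambda>M. add_atoms I s y M) \<in> measurable R R"
  using assms by (intro measurable_add_atoms_cells measurable_const measurable_ident_sets refl)

lemma nn_integral_weight:
  assumes s: "s \<in> space (PiM I (\<lambda>_. Jumps))" and y: "y \<in> space (PiM I (\<lambda>_. borel))"
    and f: "f \<in> borel_measurable R"
  shows "(\<integral>\<^sup>+ M. f M * weight I e s y M \<partial>L) =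
    (\<integral>\<^sup>+ M. f M * q_product q I e s y M \<partial>L) * (\<Prod>j\<in>I. ennreal (s j) ^ e j)"
  unfolding weight_def mult.assoc[symmetric] using f q_product_measurable_M[OF s y]
  by (intro nn_integral_multc) simp

lemma phi_weight:
  assumes s: "s \<in> space (PiM I (\<lambda>_. Jumps))" and y: "y \<in> space (PiM I (\<lambda>_. borel))"
  shows "(\<integral>\<^sup>+ M. weight I e s y M \<partial>L) = phi q L I e s y * (\<Prod>j\<in>I. ennreal (s j) ^ e j)"
  using nn_integral_weight[OF s y, of "\<lambda>_. 1" e] by (simp add: phi_def)

lemma phi_cong:
  assumes "\<And>j. j \<in> I \<Longrightarrow> s j = s' j" "\<And>j. j \<in> I \<Longrightarrow> y j = y' j"
  shows "phi q L I e s y = phi q L I e s' y'"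
  unfolding phi_def by (intro nn_integral_cong q_product_cong assms)

lemma jump_power_neq_0:
  assumes "s \<in> space (PiM I (\<lambda>_. Jumps))" "finite I"
  shows "(\<Prod>j\<in>I. ennreal (s j) ^ e j) \<noteq> 0"
  using assms by (auto simp: prod_zero_iff space_PiM PiE_iff space_restrict_space)

text \<open>If the integral is infinite, the regular version is the null measure, whose integral is
  0, so the two measures differ. Equality of measures is thereby replaced by a measurable condition
  on \<open>y\<close>.\<close>

lemma r_eq_iff: "r y = \<rho> y \<longleftrightarrow> (\<integral>\<^sup>+ s. ennreal (min s 1) \<partial>\<rho> y) < \<infinity>"
proof
  assume "r y = \<rho> y"
  show "(\<integral>\<^sup>+ s. ennreal (min s 1) \<partial>\<rho> y) < \<infinity>"
  proof (rule ccontr)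
    assume *: "\<not> (\<integral>\<^sup>+ s. ennreal (min s 1) \<partial>\<rho> y) < \<infinity>"
    then have "\<rho> y = null_measure Jumps" using \<open>r y = \<rho> y\<close> by (simp add: regular_jumps_def)
    then have "(\<integral>\<^sup>+ s. ennreal (min s 1) \<partial>\<rho> y) = 0" by simp
    with * show False by simp
  qed
qed (simp add: regular_jumps_def)

text \<open>The good set \<open>G\<close> of Bayes' rule: on it the jump measures \<rho> in the
  stated formulas coincide with the \<sigma>-finite version used in the computations.\<close>

definition regular_sample :: "nat \<Rightarrow> (nat \<Rightarrow> 'y) set" where
  "regular_sample n = {y \<in> space (PiM {1..n} (\<lambda>_. borel)). \<forall>i\<in>{1..n}. r (y i) = \<rho> (y i)}"

lemma regular_sample_sets: "regular_sample n \<in> sets (PiM {1..n} (\<lambda>_. borel))"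
  unfolding regular_sample_def
proof (rule sets.sets_Collect_finite_All)
  fix i assume "i \<in> {1..n}"
  then have "(\<lambda>y. \<integral>\<^sup>+ s. ennreal (min s 1) \<partial>\<rho> (y i)) \<in> borel_measurable (PiM {1..n} (\<lambda>_. borel))"
    by (intro measurable_jump_mass[OF rho]
        measurable_compose[OF measurable_component_singleton, where g="\<lambda>y. \<integral>\<^sup>+ s. ennreal (min s 1) \<partial>\<rho> y"])
  then show "{y \<in> space (PiM {1..n} (\<lambda>_. borel)). r (y i) = \<rho> (y i)} \<in> sets (PiM {1..n} (\<lambda>_. borel))"
    unfolding r_eq_iff by measurable
qed simp

lemma AE_r_cells:
  assumes "finite (I :: 'i set)"
  shows "AE y in PiM I (\<lambda>_. \<eta>). \<forall>i\<in>I. r (y i) = \<rho> (y i)"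
proof -
  interpret product_sigma_finite "\<lambda>_ :: 'i. \<eta>" using eta by (simp add: product_sigma_finite_def)
  show ?thesis
    using assms r_eq by (intro AE_finite_allI AE_PiM_component_finite)
qed

lemma AE_regular_of_cells:
  assumes p: "partition_on {1..n} p"
  shows "AE y in PiM p (\<lambda>_. \<eta>). of_cells n p y \<in> regular_sample n"
proof -
  have fin: "finite p" using partition_on_finite[OF _ p] by simp
  have "AE y in PiM p (\<lambda>_. \<eta>). y \<in> space (PiM p (\<lambda>_. borel))"
    by (rule AE_I2) (simp add: sets_eq_imp_space_eq[OF sets_PiM_\<eta>])
  with AE_r_cells[OF fin] show ?thesis
  proof eventually_elim
    fix y :: "nat set \<Rightarrow> 'y" assume y: "\<forall>C\<in>p. r (y C) = \<rho> (y C)" "y \<in> space (PiM p (\<lambda>_. borel))"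
    have "r (of_cells n p y i) = \<rho> (of_cells n p y i)" if i: "i \<in> {1..n}" for i
    proof -
      obtain C where C: "C \<in> p" "i \<in> C" using partition_on_cell[OF p i] .
      with y show ?thesis by (simp add: of_cells_eq[OF p C])
    qed
    then show "of_cells n p y \<in> regular_sample n"
      using measurable_space[OF measurable_of_cells[OF p] y(2)] by (simp add: regular_sample_def)
  qed
qed

lemma cells_integral_cong:
  assumes "\<And>y. y \<in> space (PiM {1..n} (\<lambda>_. borel)) \<Longrightarrow> f y = g y"
  shows "cells_integral n f = cells_integral n g"
  unfolding cells_integral_def
proof (intro sum.cong refl nn_integral_cong)
  fix p y assume "p \<in> {p. partition_on {1..n} p}" and y: "y \<in> space (PiM p (\<lambda>_. \<eta>))"
  then have p: "partition_on {1..n} p" by simp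
  have "y \<in> space (PiM p (\<lambda>_. borel))" using y by (simp add: sets_eq_imp_space_eq[OF sets_PiM_\<eta>])
  from measurable_space[OF measurable_of_cells[OF p] this] assms
  show "f (of_cells n p y) = g (of_cells n p y)" by blast
qed

text \<open>Every term of the partition sum is an integral over products of \<eta>, for which
  irregular locations are null. The joint law is a premise, so that the lemma covers a sample given
  alone as well as one given with its jumps.\<close>

lemma AE_regular_sample:
  assumes Y: "Y \<in> measurable \<Omega> (PiM {1..n} (\<lambda>_. borel))"
    and joint: "\<And>B. B \<in> sets (PiM {1..n} (\<lambda>_. borel)) \<Longrightarrow>
      (\<integral>\<^sup>+ \<omega>. indicator B (Y \<omega>) \<partial>\<Omega>) = joint_integral n (\<lambda>s y M. indicator B y)"
  shows "AE \<omega> in \<Omega>. Y \<omega> \<in> regular_sample n"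
proof -
  let ?B = "space (PiM {1..n} (\<lambda>_. borel)) - regular_sample n"
  have B: "?B \<in> sets (PiM {1..n} (\<lambda>_. borel))" using regular_sample_sets by (rule sets.compl_sets)
  then have "(\<integral>\<^sup>+ \<omega>. indicator ?B (Y \<omega>) \<partial>\<Omega>) = joint_integral n (\<lambda>s y M. indicator ?B y)" by (rule joint)
  also have "\<dots> = (\<Sum>p | partition_on {1..n} p. \<integral>\<^sup>+ y. 0 \<partial>PiM p (\<lambda>_. \<eta>))"
    unfolding joint_integral_def
  proof (intro sum.cong refl nn_integral_cong_AE)
    fix p assume "p \<in> {p. partition_on {1..n} p}"
    then have p: "partition_on {1..n} p" by simp
    show "AE y in PiM p (\<lambda>_. \<eta>). (\<integral>\<^sup>+ s. (\<integral>\<^sup>+ M. indicator ?B (of_cells n p y) * weight p card s y M \<partial>L)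
        \<partial>PiM p (\<lambda>C. r (y C))) = 0"
      using AE_regular_of_cells[OF p] by eventually_elim (simp add: indicator_def)
  qed
  finally have "(\<integral>\<^sup>+ \<omega>. indicator ?B (Y \<omega>) \<partial>\<Omega>) = 0" by simp
  then have "AE \<omega> in \<Omega>. indicator ?B (Y \<omega>) = (0 :: ennreal)"
    using measurable_compose[OF Y borel_measurable_indicator[OF B]] by (subst (asm) nn_integral_0_iff_AE) auto
  moreover have "AE \<omega> in \<Omega>. Y \<omega> \<in> space (PiM {1..n} (\<lambda>_. borel))"
    by (rule AE_I2) (rule measurable_space[OF Y])
  ultimately show ?thesis by eventually_elim (auto simp: indicator_def split: if_splits)
qed

context
  fixes n :: nat and y :: "nat \<Rightarrow> 'y" and p :: "nat set set" and c :: "nat set \<Rightarrow> 'y"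
  assumes y: "y \<in> space (PiM {1..n} (\<lambda>_. borel))"
  defines "p \<equiv> ties n y" and "c \<equiv> restrict (on_cells y) p"
begin

lemma p_partition: "partition_on {1..n} p"
  unfolding p_def by (rule ties_partition)

lemma p_finite: "finite p"
  using partition_on_finite[OF _ p_partition] by simp

lemma c_space: "c \<in> space (PiM p (\<lambda>_. borel))"
  unfolding c_def using measurable_space[OF measurable_on_cells[OF p_partition] y] .

lemma N_star_law_cells:
  "N_star_law n d q L j y = distr (density L (\<lambda>M. q_product q p card (restrict (on_cells j) p) c M /
     phi q L p card (restrict (on_cells j) p) c)) R (add_atoms p (restrict (on_cells j) p) c)"
proof -
  have 1: "q_product q p card (on_cells j) (on_cells y) M = q_product q p card (restrict (on_cells j) p) c M" for M
    by (rule q_product_cong) (auto simp: c_def)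
  have 2: "phi q L p card (on_cells j) (on_cells y) = phi q L p card (restrict (on_cells j) p) c"
    by (rule phi_cong) (auto simp: c_def)
  have 3: "N_star n j y = add_atoms p (restrict (on_cells j) p) c"
    unfolding N_star_def p_def[symmetric] by (rule ext, rule add_atoms_cong) (auto simp: c_def)
  show ?thesis
    unfolding N_star_law_def pi_star_def p_def[symmetric] 1 2 3 ..
qed

lemma emeasure_N_star_law:
  assumes j: "j \<in> space (PiM {1..n} (\<lambda>_. Jumps))" and B: "B \<in> sets R"
  defines "s \<equiv> restrict (on_cells j) p"
  shows "emeasure (N_star_law n d q L j y) B =
    (\<integral>\<^sup>+ M. indicator B (add_atoms p s c M) * q_product q p card s c M \<partial>L) / phi q L p card s c"
proof -
  have s: "s \<in> space (PiM p (\<lambda>_. Jumps))"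
    unfolding s_def using measurable_space[OF measurable_on_cells[OF p_partition] j] .
  have qm: "(\<lambda>M. q_product q p card s c M) \<in> borel_measurable L"
    using q_product_measurable_M[OF s c_space] by simp
  have am: "add_atoms p s c \<in> measurable R R" by (rule add_atoms_measurable_M[OF s c_space])
  have im: "(\<lambda>M. indicator B (add_atoms p s c M) :: ennreal) \<in> borel_measurable L"
    using measurable_compose[OF am borel_measurable_indicator[OF B]] by simp
  let ?D = "density L (\<lambda>M. q_product q p card s c M / phi q L p card s c)"
  have "emeasure (N_star_law n d q L j y) B = (\<integral>\<^sup>+ M. indicator B M \<partial>distr ?D R (add_atoms p s c))"
    unfolding N_star_law_cells s_def[symmetric] using B by simp
  also have "\<dots> = (\<integral>\<^sup>+ M. indicator B (add_atoms p s c M) \<partial>?D)"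
    using am B by (intro nn_integral_distr) (simp_all cong: measurable_cong_sets)
  also have "\<dots> = (\<integral>\<^sup>+ M. q_product q p card s c M / phi q L p card s c * indicator B (add_atoms p s c M) \<partial>L)"
    using qm im by (intro nn_integral_density borel_measurable_divide_ennreal borel_measurable_const)
  also have "\<dots> = (\<integral>\<^sup>+ M. (indicator B (add_atoms p s c M) * q_product q p card s c M) / phi q L p card s c \<partial>L)"
    by (intro nn_integral_cong) (simp add: divide_ennreal_def ac_simps)
  also have "\<dots> = (\<integral>\<^sup>+ M. indicator B (add_atoms p s c M) * q_product q p card s c M \<partial>L) / phi q L p card s c"
    using qm im by (intro nn_integral_divide borel_measurable_times_ennreal)
  finally show ?thesis .
qed

text \<open>\<open>N_star_posterior\<close> is formed by \<open>bind\<close>, which asks for a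
  sub-probability kernel at all arguments, including those where \<open>phi\<close> is 0 or
  \<infinity>. There the quotient of \<open>phi\<close> by itself is 0 in \<open>ennreal\<close>;
  elsewhere it is 1.\<close>

lemma N_star_law_kernel:
  "(\<lambda>j. N_star_law n d q L j y) \<in> measurable (PiM {1..n} (\<lambda>_. Jumps)) (subprob_algebra R)"
proof (rule measurable_subprob_algebra)
  interpret L: prob_space L by (rule prob_space_L)
  fix j :: "nat \<Rightarrow> real" assume j: "j \<in> space (PiM {1..n} (\<lambda>_. Jumps))"
  show sets: "sets (N_star_law n d q L j y) = sets R" by (simp add: N_star_law_def)
  let ?s = "restrict (on_cells j) p"
  have s: "?s \<in> space (PiM p (\<lambda>_. Jumps))"
    using measurable_space[OF measurable_on_cells[OF p_partition] j] .
  show "subprob_space (N_star_law n d q L j y)"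
  proof
    show "space (N_star_law n d q L j y) \<noteq> {}"
      using L.not_empty sets_eq_imp_space_eq[OF sets] by simp
    have "emeasure (N_star_law n d q L j y) (space R) = phi q L p card ?s c / phi q L p card ?s c"
    proof -
      have "(\<integral>\<^sup>+ M. indicator (space R) (add_atoms p ?s c M) * q_product q p card ?s c M \<partial>L) = phi q L p card ?s c"
        unfolding phi_def using measurable_space[OF add_atoms_measurable_M[OF s c_space]]
        by (intro nn_integral_cong) simp
      then show ?thesis using emeasure_N_star_law[OF j, of "space R"] by simp
    qed
    also have "\<dots> \<le> 1"
    proof (cases "phi q L p card ?s c = 0 \<or> phi q L p card ?s c = \<infinity>")
      case True
      then show ?thesis by (auto simp: divide_ennreal_def)
    next
      case False
      then show ?thesis by (simp add: ennreal_divide_self less_top)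
    qed
    finally show "emeasure (N_star_law n d q L j y) (space (N_star_law n d q L j y)) \<le> 1"
      using sets_eq_imp_space_eq[OF sets] by simp
  qed
next
  fix B assume B: "B \<in> sets R"
  have f: "(\<lambda>j. restrict (on_cells j) p) \<in> measurable (PiM {1..n} (\<lambda>_. Jumps)) (PiM p (\<lambda>_. Jumps))"
    by (rule measurable_on_cells[OF p_partition])
  have g: "(\<lambda>j. c) \<in> measurable (PiM {1..n} (\<lambda>_. Jumps)) (PiM p (\<lambda>_. borel))"
    using c_space by (rule measurable_const)
  have "(\<lambda>x. add_atoms p (restrict (on_cells (fst x)) p) c (snd x)) \<in> measurable (PiM {1..n} (\<lambda>_. Jumps) \<Otimes>\<^sub>M R) R"
    by (rule measurable_add_atoms_cells[OF measurable_compose[OF measurable_fst f] measurable_const[OF c_space] measurable_snd])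
  from measurable_compose[OF this borel_measurable_indicator[OF B]]
  have F: "(\<lambda>(j, M). indicator B (add_atoms p (restrict (on_cells j) p) c M) :: ennreal) \<in> borel_measurable (PiM {1..n} (\<lambda>_. Jumps) \<Otimes>\<^sub>M R)"
    by (simp only: split_beta')
  have "(\<lambda>j. (\<integral>\<^sup>+ M. indicator B (add_atoms p (restrict (on_cells j) p) c M) * q_product q p card (restrict (on_cells j) p) c M \<partial>L) /
      phi q L p card (restrict (on_cells j) p) c) \<in> borel_measurable (PiM {1..n} (\<lambda>_. Jumps))"
    by (intro borel_measurable_divide_ennreal measurable_q_integral[OF f g F] measurable_phi[OF f g])
  then show "(\<lambda>j. emeasure (N_star_law n d q L j y) B) \<in> borel_measurable (PiM {1..n} (\<lambda>_. Jumps))"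
    by (rule measurable_cong[THEN iffD1, rotated]) (simp add: emeasure_N_star_law B)
qed

text \<open>The premise \<open>reg\<close> turns the product of the \<rho> in \<open>J_law\<close>
  into that of the \<sigma>-finite versions; the normalising constant is then the total mass of the
  density \<open>D\<close>.\<close>

lemma nn_integral_J_law:
  assumes reg: "y \<in> regular_sample n" and f: "f \<in> borel_measurable (PiM {1..n} (\<lambda>_. Jumps))"
  defines "D \<equiv> \<lambda>s. phi q L p card s c * (\<Prod>C\<in>p. ennreal (s C) ^ card C)"
  shows "(\<integral>\<^sup>+ j. f j \<partial>J_law n q L \<rho> y) =
    (\<integral>\<^sup>+ s. D s * (1 / (\<integral>\<^sup>+ s. D s \<partial>PiM p (\<lambda>C. r (c C))) * f (of_cells n p s)) \<partial>PiM p (\<lambda>C. r (c C)))"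
proof -
  have P: "PiM p (\<lambda>C. \<rho> (on_cells y C)) = PiM p (\<lambda>C. r (c C))"
    using reg Min_cell[OF p_partition] by (intro PiM_cong) (auto simp: c_def on_cells_def regular_sample_def)
  have D: "(\<lambda>s. phi q L p card s (on_cells y) * (\<Prod>C\<in>p. ennreal (s C) ^ card C)) = D"
    unfolding D_def by (intro ext arg_cong2[where f="(*)"] phi_cong refl) (simp add: c_def)
  have Dm: "D \<in> borel_measurable (PiM p (\<lambda>C. r (c C)))"
    unfolding measurable_cong_sets[OF sets_PiM_r refl] D_def
    using c_space by (intro borel_measurable_times_ennreal measurable_phi measurable_jump_power measurable_const measurable_ident_sets refl)
  have fm: "of_cells n p \<in> measurable (PiM p (\<lambda>C. r (c C))) (PiM {1..n} (\<lambda>_. Jumps))"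
    unfolding measurable_cong_sets[OF sets_PiM_r refl] by (rule measurable_of_cells[OF p_partition])
  have ff: "(\<lambda>s. f (of_cells n p s)) \<in> borel_measurable (PiM p (\<lambda>C. r (c C)))"
    by (rule measurable_compose[OF fm f])
  define Q where "Q = density (PiM p (\<lambda>C. r (c C))) D"
  have tot: "emeasure Q (space Q) = (\<integral>\<^sup>+ s. D s \<partial>PiM p (\<lambda>C. r (c C)))"
    unfolding Q_def using Dm by (subst emeasure_density) (auto intro!: nn_integral_cong)
  have J: "J_law n q L \<rho> y = distr (normalized Q) (PiM {1..n} (\<lambda>_. Jumps)) (of_cells n p)"
    unfolding J_law_def p_def[symmetric] P D Q_def ..
  have "(\<integral>\<^sup>+ j. f j \<partial>J_law n q L \<rho> y) = (\<integral>\<^sup>+ s. f (of_cells n p s) \<partial>normalized Q)"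
    unfolding J using fm f by (intro nn_integral_distr) (simp_all add: normalized_def Q_def cong: measurable_cong_sets)
  also have "\<dots> = (\<integral>\<^sup>+ s. 1 / emeasure Q (space Q) * f (of_cells n p s) \<partial>Q)"
    unfolding normalized_def using ff by (intro nn_integral_density) (simp_all add: Q_def)
  also have "\<dots> = (\<integral>\<^sup>+ s. D s * (1 / emeasure Q (space Q) * f (of_cells n p s)) \<partial>PiM p (\<lambda>C. r (c C)))"
    using Dm ff unfolding Q_def by (intro nn_integral_density) simp_all
  finally show ?thesis unfolding tot .
qed

lemma sets_J_law: "sets (J_law n q L \<rho> y) = sets (PiM {1..n} (\<lambda>_. Jumps))"
  by (simp add: J_law_def)

lemma restrict_on_cells_of_cells:
  "s \<in> space (PiM p (\<lambda>_. X)) \<Longrightarrow> restrict (on_cells (of_cells n p s)) p = s"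
  by (auto simp: fun_eq_iff on_cells_of_cells[OF p_partition] restrict_def space_PiM PiE_iff extensional_def)

text \<open>The factor \<open>phi\<close> in the density of \<open>J_law\<close> cancels the divisor
  in \<open>pi_star\<close>. What remains is the unnormalised posterior divided by the single
  constant \<open>t\<close>.\<close>

lemma emeasure_N_star_posterior:
  assumes reg: "y \<in> regular_sample n" and B: "B \<in> sets R"
  defines "t \<equiv> (\<integral>\<^sup>+ s. phi q L p card s c * (\<Prod>C\<in>p. ennreal (s C) ^ card C) \<partial>PiM p (\<lambda>C. r (c C)))"
  assumes t: "t < \<infinity>"
  shows "emeasure (N_star_posterior n d q L \<rho> y) B =
    (\<integral>\<^sup>+ s. (\<integral>\<^sup>+ M. indicator B (add_atoms p s c M) * weight p card s c M \<partial>L) \<partial>PiM p (\<lambda>C. r (c C))) / t"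
proof -
  define \<Psi> where "\<Psi> s = (\<integral>\<^sup>+ M. indicator B (add_atoms p s c M) * q_product q p card s c M \<partial>L)" for s
  define \<Phi> where "\<Phi> s = phi q L p card s c" for s
  define W where "W s = (\<Prod>C\<in>p. ennreal (s C) ^ card C)" for s :: "nat set \<Rightarrow> real"
  have space_r: "space (PiM p (\<lambda>C. r (c C))) = space (PiM p (\<lambda>_. Jumps))"
    by (rule sets_eq_imp_space_eq[OF sets_PiM_r])
  have idm: "(\<lambda>s. s) \<in> measurable (PiM p (\<lambda>_. Jumps)) (PiM p (\<lambda>_. Jumps))"
    and cm: "(\<lambda>s. c) \<in> measurable (PiM p (\<lambda>_. Jumps)) (PiM p (\<lambda>_. borel))"
    using c_space by (auto intro: measurable_const)
  have \<Phi>m: "\<Phi> \<in> borel_measurable (PiM p (\<lambda>C. r (c C)))"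
    unfolding measurable_cong_sets[OF sets_PiM_r refl] \<Phi>_def by (rule measurable_phi[OF idm cm])
  have Wm: "W \<in> borel_measurable (PiM p (\<lambda>C. r (c C)))"
    unfolding measurable_cong_sets[OF sets_PiM_r refl] W_def by (rule measurable_jump_power[OF idm])
  have \<Psi>m: "\<Psi> \<in> borel_measurable (PiM p (\<lambda>C. r (c C)))"
    unfolding measurable_cong_sets[OF sets_PiM_r refl] \<Psi>_def
  proof (rule measurable_q_integral[OF idm cm])
    have "(\<lambda>x. add_atoms p (fst x) c (snd x)) \<in> measurable (PiM p (\<lambda>_. Jumps) \<Otimes>\<^sub>M R) R"
      by (rule measurable_add_atoms_cells[OF measurable_fst measurable_const[OF c_space] measurable_snd])
    from measurable_compose[OF this borel_measurable_indicator[OF B]]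
    show "(\<lambda>(s, M). indicator B (add_atoms p s c M) :: ennreal) \<in> borel_measurable (PiM p (\<lambda>_. Jumps) \<Otimes>\<^sub>M R)"
      by (simp only: split_beta')
  qed
  have t_eq: "t = (\<integral>\<^sup>+ s. \<Phi> s * W s \<partial>PiM p (\<lambda>C. r (c C)))" by (simp add: t_def \<Phi>_def W_def)
  have sub: "(\<lambda>j. N_star_law n d q L j y) \<in> measurable (J_law n q L \<rho> y) (subprob_algebra R)"
    using N_star_law_kernel by (simp cong: measurable_cong_sets add: sets_J_law)
  have "(\<lambda>i\<in>{1..n}. 1) \<in> space (PiM {1..n} (\<lambda>_. Jumps))"
    by (auto simp: space_PiM space_restrict_space)
  then have ne: "space (J_law n q L \<rho> y) \<noteq> {}" using sets_eq_imp_space_eq[OF sets_J_law] by auto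
  have Nm: "(\<lambda>j. emeasure (N_star_law n d q L j y) B) \<in> borel_measurable (PiM {1..n} (\<lambda>_. Jumps))"
    by (rule measurable_emeasure_kernel[OF N_star_law_kernel B])
  have "emeasure (N_star_posterior n d q L \<rho> y) B = (\<integral>\<^sup>+ j. emeasure (N_star_law n d q L j y) B \<partial>J_law n q L \<rho> y)"
    unfolding N_star_posterior_def by (rule emeasure_bind[OF ne sub B])
  also have "\<dots> = (\<integral>\<^sup>+ s. \<Phi> s * W s * (1 / t * emeasure (N_star_law n d q L (of_cells n p s) y) B) \<partial>PiM p (\<lambda>C. r (c C)))"
    using nn_integral_J_law[OF reg Nm] by (simp add: t_def \<Phi>_def W_def)
  also have "\<dots> = (\<integral>\<^sup>+ s. \<Psi> s * W s / t \<partial>PiM p (\<lambda>C. r (c C)))"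
  proof (intro nn_integral_cong_AE)
    \<comment> \<open>Finiteness of \<open>t\<close> excludes the value \<infinity> almost
      everywhere. Since the jumps are positive, \<open>W s\<close> is not 0, so \<open>phi\<close>
      itself is finite, as the cancellation requires.\<close>
    have "AE s in PiM p (\<lambda>C. r (c C)). \<Phi> s * W s \<noteq> \<infinity>"
      using t \<Phi>m Wm unfolding t_eq by (intro nn_integral_PInf_AE borel_measurable_times_ennreal) auto
    moreover have "AE s in PiM p (\<lambda>C. r (c C)). s \<in> space (PiM p (\<lambda>_. Jumps))"
      by (rule AE_I2) (simp add: space_r)
    ultimately show "AE s in PiM p (\<lambda>C. r (c C)).
        \<Phi> s * W s * (1 / t * emeasure (N_star_law n d q L (of_cells n p s) y) B) = \<Psi> s * W s / t"
    proof eventually_elim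
      fix s assume fin: "\<Phi> s * W s \<noteq> \<infinity>" and s: "s \<in> space (PiM p (\<lambda>_. Jumps))"
      have "W s \<noteq> 0" unfolding W_def by (rule jump_power_neq_0[OF s p_finite])
      with fin have \<Phi>_fin: "\<Phi> s \<noteq> \<infinity>" by (auto simp: ennreal_mult_eq_top_iff)
      have "of_cells n p s \<in> space (PiM {1..n} (\<lambda>_. Jumps))"
        by (rule measurable_space[OF measurable_of_cells[OF p_partition] s])
      from emeasure_N_star_law[OF this B]
      have N: "emeasure (N_star_law n d q L (of_cells n p s) y) B = \<Psi> s / \<Phi> s"
        unfolding restrict_on_cells_of_cells[OF s] \<Psi>_def \<Phi>_def .
      have "\<Phi> s * (\<Psi> s / \<Phi> s) = \<Psi> s"
      proof (cases "\<Phi> s = 0")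
        case True
        \<comment> \<open>The indicator is at most 1, so the numerator vanishes together with the
          divisor, and the quotient 0 / 0 = 0 does no harm.\<close>
        have "\<Psi> s \<le> \<Phi> s" unfolding \<Psi>_def \<Phi>_def phi_def
          by (intro nn_integral_mono) (auto simp: indicator_def)
        then show ?thesis using True by simp
      next
        case False
        then show ?thesis using \<Phi>_fin
          by (simp add: ennreal_times_divide mult.commute[of "\<Phi> s"] ennreal_mult_divide_eq)
      qed
      then have "\<Phi> s * W s * (1 / t * (\<Psi> s / \<Phi> s)) = \<Psi> s * (W s * (1 / t))"
        by (metis mult.assoc mult.commute)
      then show "\<Phi> s * W s * (1 / t * emeasure (N_star_law n d q L (of_cells n p s) y) B) = \<Psi> s * W s / t"
        unfolding N by (simp add: divide_ennreal_def mult.assoc)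
    qed
  qed
  also have "\<dots> = (\<integral>\<^sup>+ s. \<Psi> s * W s \<partial>PiM p (\<lambda>C. r (c C))) / t"
    using \<Psi>m Wm by (intro nn_integral_divide borel_measurable_times_ennreal)
  also have "(\<integral>\<^sup>+ s. \<Psi> s * W s \<partial>PiM p (\<lambda>C. r (c C))) =
      (\<integral>\<^sup>+ s. (\<integral>\<^sup>+ M. indicator B (add_atoms p s c M) * weight p card s c M \<partial>L) \<partial>PiM p (\<lambda>C. r (c C)))"
  proof (intro nn_integral_cong)
    fix s assume "s \<in> space (PiM p (\<lambda>C. r (c C)))"
    then have s: "s \<in> space (PiM p (\<lambda>_. Jumps))" by (simp add: space_r)
    show "\<Psi> s * W s = (\<integral>\<^sup>+ M. indicator B (add_atoms p s c M) * weight p card s c M \<partial>L)"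
      unfolding \<Psi>_def W_def using measurable_compose[OF add_atoms_measurable_M[OF s c_space] borel_measurable_indicator[OF B]]
      by (intro nn_integral_weight[symmetric] s c_space)
  qed
  finally show ?thesis .
qed

end

end

section \<open>Bayes' rule for N given Y, J given Y, and N given (J, Y)\<close>

context species_model begin

lemma measurable_add_atoms_kernel:
  "(\<lambda>((y, s), M). add_atoms p s y M) \<in> measurable ((PiM p (\<lambda>_. borel) \<Otimes>\<^sub>M PiM p (\<lambda>_. Jumps)) \<Otimes>\<^sub>M R) R"
  unfolding split_beta'
  by (rule measurable_add_atoms_cells[OF measurable_compose[OF measurable_fst measurable_snd]
      measurable_compose[OF measurable_fst measurable_fst] measurable_snd])

lemma measurable_of_cells_kernel:
  "partition_on {1..n} p \<Longrightarrow> (\<lambda>((y, s), M). of_cells n p s) \<in>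
    measurable ((PiM p (\<lambda>_. borel) \<Otimes>\<^sub>M PiM p (\<lambda>_. Jumps)) \<Otimes>\<^sub>M R) (PiM {1..n} (\<lambda>_. Jumps))"
  unfolding split_beta'
  by (rule measurable_compose[OF measurable_compose[OF measurable_fst measurable_snd] measurable_of_cells])

lemma nn_integral_weight_phi:
  assumes y: "y \<in> space (PiM I (\<lambda>_. borel))"
  shows "(\<integral>\<^sup>+ s. (\<integral>\<^sup>+ M. g s * weight I e s y M \<partial>L) \<partial>PiM I (\<lambda>i. r (y i))) =
    (\<integral>\<^sup>+ s. g s * (phi q L I e s y * (\<Prod>j\<in>I. ennreal (s j) ^ e j)) \<partial>PiM I (\<lambda>i. r (y i)))"
proof (intro nn_integral_cong)
  fix s assume "s \<in> space (PiM I (\<lambda>i. r (y i)))"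
  then have s: "s \<in> space (PiM I (\<lambda>_. Jumps))" by (simp add: sets_eq_imp_space_eq[OF sets_PiM_r])
  have "(\<lambda>M. weight I e s y M) \<in> borel_measurable R"
    using s y by (intro measurable_weight measurable_const measurable_ident_sets refl)
  then show "(\<integral>\<^sup>+ M. g s * weight I e s y M \<partial>L) = g s * (phi q L I e s y * (\<Prod>j\<in>I. ennreal (s j) ^ e j))"
    by (subst nn_integral_cmult) (simp_all add: phi_weight[OF s y])
qed

text \<open>The joint law shows the random measure as \<open>add_atoms p s y M\<close>, so pushing
  \<open>cell_measure\<close> forward by this map gives the unnormalised law of N_n^*. Bayes' rule
  normalises it, and \<open>emeasure_N_star_posterior\<close> identifies the result with the mixture
  of \<open>N_star_law\<close> over \<open>J_law\<close> on \<open>regular_sample\<close>.\<close>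

theorem N_given_sample:
  assumes iid: "conditional_law \<Omega> Y (\<Pi>\<^sub>M i\<in>{1..n}. borel) N R (\<lambda>M. \<Pi>\<^sub>M i\<in>{1..n}. P_of q (mean_rm M))"
  shows "conditional_law \<Omega> N R Y (\<Pi>\<^sub>M i\<in>{1..n}. borel) (N_star_posterior n d q L \<rho>)"
proof -
  let ?T = "sample_kernel n R (\<lambda>p y s M. add_atoms p s y M)"
  have Y: "Y \<in> measurable \<Omega> (PiM {1..n} (\<lambda>_. borel))"
    using iid by (auto simp: conditional_law_def regular_conditional_law_def)
  have T: "emeasure (?T y) B = (\<integral>\<^sup>+ s. (\<integral>\<^sup>+ M. indicator B (add_atoms (ties n y) s (restrict (on_cells y) (ties n y)) M) *
      weight (ties n y) card s (restrict (on_cells y) (ties n y)) M \<partial>L) \<partial>PiM (ties n y) (\<lambda>C. r (restrict (on_cells y) (ties n y) C)))"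
    if y: "y \<in> space (PiM {1..n} (\<lambda>_. borel))" and B: "B \<in> sets R" for y B
  proof -
    have "emeasure (?T y) B = (\<integral>\<^sup>+ M. indicator B M \<partial>?T y)"
      using B by (simp add: sets_sample_kernel)
    then show ?thesis
      using nn_integral_sample_kernel[OF measurable_add_atoms_kernel ties_partition y refl borel_measurable_indicator[OF B]] by simp
  qed
  have T_top: "emeasure (?T y) (space R) = (\<integral>\<^sup>+ s. phi q L (ties n y) card s (restrict (on_cells y) (ties n y)) *
      (\<Prod>C\<in>ties n y. ennreal (s C) ^ card C) \<partial>PiM (ties n y) (\<lambda>C. r (restrict (on_cells y) (ties n y) C)))"
    if y: "y \<in> space (PiM {1..n} (\<lambda>_. borel))" for y
  proof -
    have "emeasure (?T y) (space R) = (\<integral>\<^sup>+ x. 1 \<partial>?T y)"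
      using sets_eq_imp_space_eq[OF sets_sample_kernel[where n=n and X=R and h="\<lambda>p y s M. add_atoms p s y M" and y=y]] by simp
    also have "\<dots> = (\<integral>\<^sup>+ s. (\<integral>\<^sup>+ M. 1 * weight (ties n y) card s (restrict (on_cells y) (ties n y)) M \<partial>L)
        \<partial>PiM (ties n y) (\<lambda>C. r (restrict (on_cells y) (ties n y) C)))"
      by (rule nn_integral_sample_kernel[OF measurable_add_atoms_kernel ties_partition y refl, of "\<lambda>_. 1"]) simp
    finally show ?thesis
      using nn_integral_weight_phi[OF measurable_space[OF measurable_on_cells[OF ties_partition] y], where g="\<lambda>_. 1" and e=card] by simp
  qed
  show ?thesis
  proof (rule conditional_law_bayes[where I="cells_integral n" and T="?T" and G="regular_sample n"])
    show "prob_space \<Omega>" by unfold_locales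
    show "N \<in> measurable \<Omega> R" by (rule N)
    show "Y \<in> measurable \<Omega> (PiM {1..n} (\<lambda>_. borel))" by (rule Y)
    show "sets (?T z) = sets R" for z by (rule sets_sample_kernel)
    show "(\<lambda>z. emeasure (?T z) B) \<in> borel_measurable (PiM {1..n} (\<lambda>_. borel))" if "B \<in> sets R" for B
      by (rule measurable_emeasure_sample_kernel[OF measurable_add_atoms_kernel that])
    show "cells_integral n f = cells_integral n g" if "\<And>z. z \<in> space (PiM {1..n} (\<lambda>_. borel)) \<Longrightarrow> f z = g z" for f g
      using that by (rule cells_integral_cong)
    show "(\<integral>\<^sup>+ \<omega>. F (Y \<omega>, N \<omega>) \<partial>\<Omega>) = cells_integral n (\<lambda>z. \<integral>\<^sup>+ x. F (z, x) \<partial>?T z)"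
      if F: "F \<in> borel_measurable (PiM {1..n} (\<lambda>_. borel) \<Otimes>\<^sub>M R)" for F
    proof -
      have F': "(\<lambda>(y, M). F (y, M)) \<in> borel_measurable (PiM {1..n} (\<lambda>_. borel) \<Otimes>\<^sub>M R)" using F by simp
      show ?thesis
        unfolding sample_joint[OF iid F'] joint_integral_def
        by (rule sample_kernel_joint[OF measurable_add_atoms_kernel F'])
    qed
    show "regular_sample n \<in> sets (PiM {1..n} (\<lambda>_. borel))" by (rule regular_sample_sets)
    show "AE \<omega> in \<Omega>. Y \<omega> \<in> regular_sample n"
    proof (rule AE_regular_sample[OF Y sample_joint[OF iid]])
      fix B :: "(nat \<Rightarrow> 'y) set" assume B: "B \<in> sets (PiM {1..n} (\<lambda>_. borel))"
      show "(\<lambda>(y, M). indicator B y :: ennreal) \<in> borel_measurable ((\<Pi>\<^sub>M i\<in>{1..n}. borel) \<Otimes>\<^sub>M R)"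
        unfolding split_beta' by (rule measurable_compose[OF measurable_fst borel_measurable_indicator[OF B]])
    qed
  next
    fix z assume z: "z \<in> regular_sample n"
    then have zs: "z \<in> space (PiM {1..n} (\<lambda>_. borel))" by (simp add: regular_sample_def)
    have sub: "(\<lambda>j. N_star_law n d q L j z) \<in> measurable (J_law n q L \<rho> z) (subprob_algebra R)"
      using N_star_law_kernel[OF zs] by (simp cong: measurable_cong_sets add: sets_J_law[OF zs])
    have "(\<lambda>i\<in>{1..n}. 1) \<in> space (PiM {1..n} (\<lambda>_. Jumps))"
      by (auto simp: space_PiM space_restrict_space)
    then have ne: "space (J_law n q L \<rho> z) \<noteq> {}" using sets_eq_imp_space_eq[OF sets_J_law[OF zs]] by auto
    show "sets (N_star_posterior n d q L \<rho> z) = sets R"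
      unfolding N_star_posterior_def by (rule sets_bind[OF sets_kernel[OF sub] ne])
    show "emeasure (N_star_posterior n d q L \<rho> z) B = emeasure (?T z) B / emeasure (?T z) (space R)"
      if "emeasure (?T z) (space R) < \<infinity>" "B \<in> sets R" for B
      using emeasure_N_star_posterior[OF zs z that(2)] that(1) unfolding T[OF zs that(2)] T_top[OF zs] by simp
  qed
qed

context
  fixes n :: nat and W :: "'o \<Rightarrow> nat \<Rightarrow> real \<times> 'y" and J :: "'o \<Rightarrow> nat \<Rightarrow> real" and Y :: "'o \<Rightarrow> nat \<Rightarrow> 'y"
  assumes aug: "conditional_law \<Omega> W (\<Pi>\<^sub>M i\<in>{1..n}. Marked) N R (\<lambda>M. \<Pi>\<^sub>M i\<in>{1..n}. P_aug q M)"
    and JW: "\<And>\<omega>. J \<omega> = (\<lambda>i\<in>{1..n}. fst (W \<omega> i))" and YW: "\<And>\<omega>. Y \<omega> = (\<lambda>i\<in>{1..n}. snd (W \<omega> i))"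
begin

lemma W_measurable: "W \<in> measurable \<Omega> (\<Pi>\<^sub>M i\<in>{1..n}. Marked)"
  using aug by (auto simp: conditional_law_def regular_conditional_law_def)

lemma measurable_fsts:
  "(\<lambda>w. \<lambda>i\<in>{1..n}. fst (w i)) \<in> measurable (\<Pi>\<^sub>M i\<in>{1..n}. (Marked :: (real \<times> 'y) measure)) (\<Pi>\<^sub>M i\<in>{1..n}. Jumps)"
  by (intro measurable_restrict measurable_fst measurable_compose[OF measurable_component_singleton, where g=fst])

lemma measurable_snds:
  "(\<lambda>w. \<lambda>i\<in>{1..n}. snd (w i)) \<in> measurable (\<Pi>\<^sub>M i\<in>{1..n}. (Marked :: (real \<times> 'y) measure)) (\<Pi>\<^sub>M i\<in>{1..n}. borel)"
  by (intro measurable_restrict measurable_snd measurable_compose[OF measurable_component_singleton, where g=snd])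

lemma J_measurable: "J \<in> measurable \<Omega> (\<Pi>\<^sub>M i\<in>{1..n}. Jumps)"
  using measurable_compose[OF W_measurable measurable_fsts] by (simp only: JW[symmetric])

lemma Y_measurable: "Y \<in> measurable \<Omega> (\<Pi>\<^sub>M i\<in>{1..n}. borel)"
  using measurable_compose[OF W_measurable measurable_snds] by (simp only: YW[symmetric])

lemma jump_sample_joint:
  assumes F: "(\<lambda>((j, y), M). F j y M) \<in> borel_measurable (((\<Pi>\<^sub>M i\<in>{1..n}. Jumps) \<Otimes>\<^sub>M (\<Pi>\<^sub>M i\<in>{1..n}. borel)) \<Otimes>\<^sub>M R)"
  shows "(\<integral>\<^sup>+ \<omega>. F (J \<omega>) (Y \<omega>) (N \<omega>) \<partial>\<Omega>) = joint_integral n F"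
proof -
  have F': "(\<lambda>(w, M). F (\<lambda>i\<in>{1..n}. fst (w i)) (\<lambda>i\<in>{1..n}. snd (w i)) M) \<in> borel_measurable ((\<Pi>\<^sub>M i\<in>{1..n}. Marked) \<Otimes>\<^sub>M R)"
    using measurable_compose[OF measurable_Pair[OF measurable_Pair[OF measurable_compose[OF measurable_fst measurable_fsts]
      measurable_compose[OF measurable_fst measurable_snds]] measurable_snd] F]
    by (simp only: split_beta' fst_conv snd_conv)
  have "(\<lambda>i\<in>{1..n}. fst ((\<lambda>i\<in>{1..n}. (of_cells n p s i, of_cells n p y i)) i)) = of_cells n p s"
    "(\<lambda>i\<in>{1..n}. snd ((\<lambda>i\<in>{1..n}. (of_cells n p s i, of_cells n p y i)) i)) = of_cells n p y"
    for p and s :: "nat set \<Rightarrow> real" and y :: "nat set \<Rightarrow> 'y"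
  proof -
    show "(\<lambda>i\<in>{1..n}. fst ((\<lambda>i\<in>{1..n}. (of_cells n p s i, of_cells n p y i)) i)) = of_cells n p s"
      by (subst (2) restrict_of_cells[symmetric], rule restrict_ext) simp
    show "(\<lambda>i\<in>{1..n}. snd ((\<lambda>i\<in>{1..n}. (of_cells n p s i, of_cells n p y i)) i)) = of_cells n p y"
      by (subst (2) restrict_of_cells[symmetric], rule restrict_ext) simp
  qed
  then show ?thesis
    unfolding JW YW augmented_joint[OF aug F'] joint_integral_def by (simp only:)
qed

lemma AE_latent_regular: "AE \<omega> in \<Omega>. Y \<omega> \<in> regular_sample n"
proof (rule AE_regular_sample[OF Y_measurable jump_sample_joint])
  fix B :: "(nat \<Rightarrow> 'y) set" assume B: "B \<in> sets (PiM {1..n} (\<lambda>_. borel))"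
  show "(\<lambda>((j, y), M). indicator B y :: ennreal) \<in> borel_measurable (((\<Pi>\<^sub>M i\<in>{1..n}. Jumps) \<Otimes>\<^sub>M (\<Pi>\<^sub>M i\<in>{1..n}. borel)) \<Otimes>\<^sub>M R)"
    unfolding split_beta'
    by (rule measurable_compose[OF measurable_compose[OF measurable_fst measurable_snd] borel_measurable_indicator[OF B]])
qed

text \<open>The disintegration over the sample is the same as for the random measure, but now only
  the cell jumps are kept. Integrating out \<open>M\<close> turns \<open>weight\<close> into
  \<open>phi\<close> times the jump powers, the density in \<open>J_law\<close>.\<close>

theorem J_given_sample:
  "conditional_law \<Omega> J (\<Pi>\<^sub>M i\<in>{1..n}. Jumps) Y (\<Pi>\<^sub>M i\<in>{1..n}. borel) (J_law n q L \<rho>)"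
proof -
  let ?T = "sample_kernel n (PiM {1..n} (\<lambda>_. Jumps)) (\<lambda>p y s M. of_cells n p s)"
  have sets_T: "sets (?T y) = sets (PiM {1..n} (\<lambda>_. Jumps))" for y by (rule sets_sample_kernel)
  have T: "(\<integral>\<^sup>+ j. f j \<partial>?T y) = (\<integral>\<^sup>+ s. f (of_cells n (ties n y) s) * (phi q L (ties n y) card s (restrict (on_cells y) (ties n y)) *
      (\<Prod>C\<in>ties n y. ennreal (s C) ^ card C)) \<partial>PiM (ties n y) (\<lambda>C. r (restrict (on_cells y) (ties n y) C)))"
    if y: "y \<in> space (PiM {1..n} (\<lambda>_. borel))" and f: "f \<in> borel_measurable (PiM {1..n} (\<lambda>_. Jumps))" for y f
    using nn_integral_sample_kernel[where h="\<lambda>p y s M. of_cells n p s", OF measurable_of_cells_kernel ties_partition y refl f]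
      nn_integral_weight_phi[OF measurable_space[OF measurable_on_cells[OF ties_partition] y]]
    by (rule trans)
  show ?thesis
  proof (rule conditional_law_bayes[where I="cells_integral n" and T="?T" and G="regular_sample n"])
    show "prob_space \<Omega>" by unfold_locales
    show "J \<in> measurable \<Omega> (PiM {1..n} (\<lambda>_. Jumps))" by (rule J_measurable)
    show "Y \<in> measurable \<Omega> (PiM {1..n} (\<lambda>_. borel))" by (rule Y_measurable)
    show "sets (?T z) = sets (PiM {1..n} (\<lambda>_. Jumps))" for z by (rule sets_T)
    show "(\<lambda>z. emeasure (?T z) B) \<in> borel_measurable (PiM {1..n} (\<lambda>_. borel))" if "B \<in> sets (PiM {1..n} (\<lambda>_. Jumps))" for B
      by (rule measurable_emeasure_sample_kernel[OF measurable_of_cells_kernel that])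
    show "cells_integral n f = cells_integral n g" if "\<And>z. z \<in> space (PiM {1..n} (\<lambda>_. borel)) \<Longrightarrow> f z = g z" for f g
      using that by (rule cells_integral_cong)
    show "(\<integral>\<^sup>+ \<omega>. F (Y \<omega>, J \<omega>) \<partial>\<Omega>) = cells_integral n (\<lambda>z. \<integral>\<^sup>+ x. F (z, x) \<partial>?T z)"
      if F: "F \<in> borel_measurable (PiM {1..n} (\<lambda>_. borel) \<Otimes>\<^sub>M PiM {1..n} (\<lambda>_. Jumps))" for F
    proof -
      have F': "(\<lambda>(y, j). F (y, j)) \<in> borel_measurable (PiM {1..n} (\<lambda>_. borel) \<Otimes>\<^sub>M PiM {1..n} (\<lambda>_. Jumps))" using F by simp
      have "(\<lambda>((j, y), M). F (y, j)) \<in> borel_measurable (((\<Pi>\<^sub>M i\<in>{1..n}. Jumps) \<Otimes>\<^sub>M (\<Pi>\<^sub>M i\<in>{1..n}. borel)) \<Otimes>\<^sub>M R)"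
        using measurable_compose[OF measurable_compose[OF measurable_fst measurable_pair_swap'] F]
        by (simp only: split_beta')
      from jump_sample_joint[OF this] show ?thesis
        unfolding joint_integral_def using sample_kernel_joint[OF measurable_of_cells_kernel F'] by simp
    qed
    show "regular_sample n \<in> sets (PiM {1..n} (\<lambda>_. borel))" by (rule regular_sample_sets)
    show "AE \<omega> in \<Omega>. Y \<omega> \<in> regular_sample n" by (rule AE_latent_regular)
  next
    fix z assume z: "z \<in> regular_sample n"
    then have zs: "z \<in> space (PiM {1..n} (\<lambda>_. borel))" by (simp add: regular_sample_def)
    show "sets (J_law n q L \<rho> z) = sets (PiM {1..n} (\<lambda>_. Jumps))" by (rule sets_J_law[OF zs])
    fix B assume B: "B \<in> sets (PiM {1..n} (\<lambda>_. Jumps))"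
    let ?p = "ties n z" and ?c = "restrict (on_cells z) (ties n z)"
    define D where "D s = phi q L ?p card s ?c * (\<Prod>C\<in>?p. ennreal (s C) ^ card C)" for s
    have Dm: "D \<in> borel_measurable (PiM ?p (\<lambda>C. r (?c C)))"
      unfolding measurable_cong_sets[OF sets_PiM_r refl] D_def
      using c_space[OF zs] by (intro borel_measurable_times_ennreal measurable_phi measurable_jump_power measurable_const measurable_ident_sets refl)
    have Bm: "(\<lambda>s. indicator B (of_cells n ?p s) :: ennreal) \<in> borel_measurable (PiM ?p (\<lambda>C. r (?c C)))"
      unfolding measurable_cong_sets[OF sets_PiM_r refl]
      by (rule measurable_compose[OF measurable_of_cells[OF ties_partition] borel_measurable_indicator[OF B]])
    have TB: "emeasure (?T z) B = (\<integral>\<^sup>+ s. indicator B (of_cells n ?p s) * D s \<partial>PiM ?p (\<lambda>C. r (?c C)))"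
    proof -
      have "emeasure (?T z) B = (\<integral>\<^sup>+ j. indicator B j \<partial>?T z)"
        by (rule nn_integral_indicator[symmetric]) (simp only: sets_T B)
      then show ?thesis unfolding T[OF zs borel_measurable_indicator[OF B]] D_def .
    qed
    have Tt: "emeasure (?T z) (space (PiM {1..n} (\<lambda>_. Jumps))) = (\<integral>\<^sup>+ s. D s \<partial>PiM ?p (\<lambda>C. r (?c C)))"
    proof -
      have "emeasure (?T z) (space (PiM {1..n} (\<lambda>_. Jumps))) = (\<integral>\<^sup>+ j. 1 \<partial>?T z)"
        unfolding sets_eq_imp_space_eq[OF sets_T[of z], symmetric] by simp
      then show ?thesis using T[OF zs, of "\<lambda>_. 1"] unfolding D_def by simp
    qed
    have "emeasure (J_law n q L \<rho> z) B = (\<integral>\<^sup>+ j. indicator B j \<partial>J_law n q L \<rho> z)"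
      using B by (simp add: sets_J_law[OF zs])
    also have "\<dots> = (\<integral>\<^sup>+ s. D s * (1 / (\<integral>\<^sup>+ s. D s \<partial>PiM ?p (\<lambda>C. r (?c C))) * indicator B (of_cells n ?p s)) \<partial>PiM ?p (\<lambda>C. r (?c C)))"
      unfolding D_def by (rule nn_integral_J_law[OF zs z borel_measurable_indicator[OF B]])
    also have "\<dots> = (\<integral>\<^sup>+ s. indicator B (of_cells n ?p s) * D s / (\<integral>\<^sup>+ s. D s \<partial>PiM ?p (\<lambda>C. r (?c C))) \<partial>PiM ?p (\<lambda>C. r (?c C)))"
      by (intro nn_integral_cong) (simp add: divide_ennreal_def ac_simps)
    also have "\<dots> = emeasure (?T z) B / emeasure (?T z) (space (PiM {1..n} (\<lambda>_. Jumps)))"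
      unfolding TB Tt using Bm Dm by (intro nn_integral_divide borel_measurable_times_ennreal)
    finally show "emeasure (J_law n q L \<rho> z) B = emeasure (?T z) B / emeasure (?T z) (space (PiM {1..n} (\<lambda>_. Jumps)))" .
  qed
qed

text \<open>The outer functional for conditioning on jumps and locations. It carries the jump
  powers, while \<open>q_product\<close> is left to the kernel; the kernel then has total mass
  \<open>phi\<close>, the normaliser in \<open>pi_star\<close>.\<close>

definition jump_cells_integral :: "((nat \<Rightarrow> real) \<times> (nat \<Rightarrow> 'y) \<Rightarrow> ennreal) \<Rightarrow> ennreal" where
  "jump_cells_integral f = (\<Sum>p | partition_on {1..n} p. \<integral>\<^sup>+ y. (\<integral>\<^sup>+ s. f (of_cells n p s, of_cells n p y) *
     (\<Prod>C\<in>p. ennreal (s C) ^ card C) \<partial>PiM p (\<lambda>C. r (y C))) \<partial>PiM p (\<lambda>_. \<eta>))"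

text \<open>Given jumps and locations, only the factor \<open>q_product\<close> remains to be
  normalised. The cells are read off the ties of Y, on which the jumps are constant up to null sets.
  As \<rho> does not occur in \<open>N_star_law\<close>, the good set of Bayes' rule is the whole
  space.\<close>

theorem N_given_jumps_sample:
  "conditional_law \<Omega> N R (\<lambda>\<omega>. (J \<omega>, Y \<omega>)) ((\<Pi>\<^sub>M i\<in>{1..n}. Jumps) \<Otimes>\<^sub>M (\<Pi>\<^sub>M i\<in>{1..n}. borel))
    (\<lambda>(j, y). N_star_law n d q L j y)"
proof -
  let ?JY = "(\<Pi>\<^sub>M i\<in>{1..n}. Jumps) \<Otimes>\<^sub>M (\<Pi>\<^sub>M i\<in>{1..n}. (borel :: 'y measure))"
  define T where "T z = distr (density L (\<lambda>M. q_product q (ties n (snd z)) card (restrict (on_cells (fst z)) (ties n (snd z)))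
      (restrict (on_cells (snd z)) (ties n (snd z))) M)) R
      (\<lambda>M. add_atoms (ties n (snd z)) (restrict (on_cells (fst z)) (ties n (snd z))) (restrict (on_cells (snd z)) (ties n (snd z))) M)"
    for z :: "(nat \<Rightarrow> real) \<times> (nat \<Rightarrow> 'y)"
  have sets_T: "sets (T z) = sets R" for z by (simp add: T_def)
  have T: "(\<integral>\<^sup>+ M. f M \<partial>T (j, y)) = (\<integral>\<^sup>+ M. f (add_atoms p s c M) * q_product q p card s c M \<partial>L)"
    if j: "j \<in> space (PiM {1..n} (\<lambda>_. Jumps))" and y: "y \<in> space (PiM {1..n} (\<lambda>_. borel))"
      and f: "f \<in> borel_measurable R" and p: "p = ties n y" and s: "s = restrict (on_cells j) p" and c: "c = restrict (on_cells y) p"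
    for f j y p s c
  proof -
    have p': "partition_on {1..n} p" unfolding p by (rule ties_partition)
    have s': "s \<in> space (PiM p (\<lambda>_. Jumps))" unfolding s by (rule measurable_space[OF measurable_on_cells[OF p'] j])
    have c': "c \<in> space (PiM p (\<lambda>_. borel))" unfolding c by (rule measurable_space[OF measurable_on_cells[OF p'] y])
    have qm: "(\<lambda>M. q_product q p card s c M) \<in> borel_measurable L" using q_product_measurable_M[OF s' c'] by simp
    have am: "(\<lambda>M. add_atoms p s c M) \<in> measurable R R" by (rule add_atoms_measurable_M[OF s' c'])
    have "(\<integral>\<^sup>+ M. f M \<partial>T (j, y)) = (\<integral>\<^sup>+ M. f (add_atoms p s c M) \<partial>density L (\<lambda>M. q_product q p card s c M))"
      unfolding T_def fst_conv snd_conv p[symmetric] s[symmetric] c[symmetric]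
      using am f by (intro nn_integral_distr) (simp_all cong: measurable_cong_sets)
    also have "\<dots> = (\<integral>\<^sup>+ M. q_product q p card s c M * f (add_atoms p s c M) \<partial>L)"
      using qm measurable_compose[OF am f] by (intro nn_integral_density) simp_all
    finally show ?thesis by (simp only: mult.commute)
  qed
  have T_B: "emeasure (T (j, y)) B = (\<integral>\<^sup>+ M. indicator B (add_atoms p s c M) * q_product q p card s c M \<partial>L)"
    if "j \<in> space (PiM {1..n} (\<lambda>_. Jumps))" "y \<in> space (PiM {1..n} (\<lambda>_. borel))" "B \<in> sets R"
      "p = ties n y" "s = restrict (on_cells j) p" "c = restrict (on_cells y) p" for j y p s c B
    using T[OF that(1,2) borel_measurable_indicator[OF that(3)] that(4,5,6)] that(3) by (simp add: sets_T)
  show ?thesis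
  proof (rule conditional_law_bayes[where I="jump_cells_integral" and T="T" and G="space ?JY"])
    show "prob_space \<Omega>" by unfold_locales
    show "N \<in> measurable \<Omega> R" by (rule N)
    show JY: "(\<lambda>\<omega>. (J \<omega>, Y \<omega>)) \<in> measurable \<Omega> ?JY" by (rule measurable_Pair[OF J_measurable Y_measurable])
    show "sets (T z) = sets R" for z by (rule sets_T)
    show "(\<lambda>z. emeasure (T z) B) \<in> borel_measurable ?JY" if B: "B \<in> sets R" for B
    proof -
      define f where "f p z = (\<integral>\<^sup>+ M. indicator B (add_atoms p (restrict (on_cells (fst z)) p) (restrict (on_cells (snd z)) p) M) *
          q_product q p card (restrict (on_cells (fst z)) p) (restrict (on_cells (snd z)) p) M \<partial>L)"
        for p and z :: "(nat \<Rightarrow> real) \<times> (nat \<Rightarrow> 'y)"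
      have "f p \<in> borel_measurable ?JY" if p: "partition_on {1..n} p" for p
      proof -
        have 1: "(\<lambda>z. restrict (on_cells (fst z)) p) \<in> measurable ?JY (PiM p (\<lambda>_. Jumps))"
          by (rule measurable_compose[OF measurable_fst measurable_on_cells[OF p]])
        have 2: "(\<lambda>z. restrict (on_cells (snd z)) p) \<in> measurable ?JY (PiM p (\<lambda>_. borel))"
          by (rule measurable_compose[OF measurable_snd measurable_on_cells[OF p]])
        have "(\<lambda>x. add_atoms p (restrict (on_cells (fst (fst x))) p) (restrict (on_cells (snd (fst x))) p) (snd x)) \<in> measurable (?JY \<Otimes>\<^sub>M R) R"
          by (rule measurable_add_atoms_cells[OF measurable_compose[OF measurable_fst 1] measurable_compose[OF measurable_fst 2] measurable_snd])
        from measurable_compose[OF this borel_measurable_indicator[OF B]]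
        show ?thesis unfolding f_def[abs_def]
          by (intro measurable_q_integral[OF 1 2]) (simp only: split_beta')
      qed
      then have "(\<lambda>z. f (ties n (snd z)) z) \<in> borel_measurable ?JY"
        using measurable_case_ties[where f=f and g=snd and n=n and Z="?JY"] measurable_snd by blast
      then show ?thesis
        by (rule measurable_cong[THEN iffD1, rotated])
           (auto simp: space_pair_measure f_def B intro!: T_B[symmetric])
    qed
    show "jump_cells_integral f = jump_cells_integral g" if eq: "\<And>z. z \<in> space ?JY \<Longrightarrow> f z = g z" for f g
      unfolding jump_cells_integral_def
    proof (intro sum.cong refl nn_integral_cong arg_cong2[where f="(*)"])
      fix p y s assume "p \<in> {p. partition_on {1..n} p}" and y: "y \<in> space (PiM p (\<lambda>_. \<eta>))" and s: "s \<in> space (PiM p (\<lambda>C. r (y C)))"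
      then have p: "partition_on {1..n} p" by simp
      have "y \<in> space (PiM p (\<lambda>_. borel))" "s \<in> space (PiM p (\<lambda>_. Jumps))"
        using y s by (simp_all add: sets_eq_imp_space_eq[OF sets_PiM_\<eta>] sets_eq_imp_space_eq[OF sets_PiM_r])
      from this[THEN measurable_space[OF measurable_of_cells[OF p]]]
      show "f (of_cells n p s, of_cells n p y) = g (of_cells n p s, of_cells n p y)"
        by (intro eq) (simp add: space_pair_measure)
    qed
    show "(\<integral>\<^sup>+ \<omega>. F ((J \<omega>, Y \<omega>), N \<omega>) \<partial>\<Omega>) = jump_cells_integral (\<lambda>z. \<integral>\<^sup>+ x. F (z, x) \<partial>T z)"
      if F: "F \<in> borel_measurable (?JY \<Otimes>\<^sub>M R)" for F
    proof -
      have "(\<lambda>((j, y), M). F ((j, y), M)) \<in> borel_measurable (?JY \<Otimes>\<^sub>M R)" using F by (simp add: split_beta')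
      from jump_sample_joint[OF this]
      have "(\<integral>\<^sup>+ \<omega>. F ((J \<omega>, Y \<omega>), N \<omega>) \<partial>\<Omega>) = joint_integral n (\<lambda>j y M. F ((j, y), M))" .
      also have "\<dots> = jump_cells_integral (\<lambda>z. \<integral>\<^sup>+ x. F (z, x) \<partial>T z)"
        unfolding joint_integral_def jump_cells_integral_def
      proof (intro sum.cong refl nn_integral_cong_AE)
        fix p assume "p \<in> {p. partition_on {1..n} p}"
        then have p: "partition_on {1..n} p" by simp
        have fin: "finite p" using partition_on_finite[OF _ p] by simp
        have "AE y in PiM p (\<lambda>_. \<eta>). y \<in> space (PiM p (\<lambda>_. borel))"
          by (rule AE_I2) (simp add: sets_eq_imp_space_eq[OF sets_PiM_\<eta>])
        with AE_inj_on[OF fin]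
        show "AE y in PiM p (\<lambda>_. \<eta>). (\<integral>\<^sup>+ s. (\<integral>\<^sup>+ M. F ((of_cells n p s, of_cells n p y), add_atoms p s y M) * weight p card s y M \<partial>L)
            \<partial>PiM p (\<lambda>C. r (y C))) = (\<integral>\<^sup>+ s. (\<integral>\<^sup>+ x. F ((of_cells n p s, of_cells n p y), x) \<partial>T (of_cells n p s, of_cells n p y)) *
              (\<Prod>C\<in>p. ennreal (s C) ^ card C) \<partial>PiM p (\<lambda>C. r (y C)))"
        proof eventually_elim
          fix y :: "nat set \<Rightarrow> 'y" assume inj: "inj_on y p" and y: "y \<in> space (PiM p (\<lambda>_. borel))"
          show "(\<integral>\<^sup>+ s. (\<integral>\<^sup>+ M. F ((of_cells n p s, of_cells n p y), add_atoms p s y M) * weight p card s y M \<partial>L)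
            \<partial>PiM p (\<lambda>C. r (y C))) = (\<integral>\<^sup>+ s. (\<integral>\<^sup>+ x. F ((of_cells n p s, of_cells n p y), x) \<partial>T (of_cells n p s, of_cells n p y)) *
              (\<Prod>C\<in>p. ennreal (s C) ^ card C) \<partial>PiM p (\<lambda>C. r (y C)))"
          proof (intro nn_integral_cong)
            fix s assume "s \<in> space (PiM p (\<lambda>C. r (y C)))"
            then have s: "s \<in> space (PiM p (\<lambda>_. Jumps))" by (simp add: sets_eq_imp_space_eq[OF sets_PiM_r])
            have y': "of_cells n p y \<in> space (PiM {1..n} (\<lambda>_. borel))" by (rule measurable_space[OF measurable_of_cells[OF p] y])
            have s': "of_cells n p s \<in> space (PiM {1..n} (\<lambda>_. Jumps))" by (rule measurable_space[OF measurable_of_cells[OF p] s])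
            have c: "y = restrict (on_cells (of_cells n p y)) p"
              using y by (auto simp: fun_eq_iff on_cells_of_cells[OF p] restrict_def space_PiM PiE_iff extensional_def)
            have c2: "s = restrict (on_cells (of_cells n p s)) p"
              using s by (auto simp: fun_eq_iff on_cells_of_cells[OF p] restrict_def space_PiM PiE_iff extensional_def)
            have "(of_cells n p s, of_cells n p y) \<in> space ?JY" using s' y' by (simp add: space_pair_measure)
            from measurable_Pair2[OF F this]
            have Fm: "(\<lambda>x. F ((of_cells n p s, of_cells n p y), x)) \<in> borel_measurable R" .
            have "(\<integral>\<^sup>+ x. F ((of_cells n p s, of_cells n p y), x) \<partial>T (of_cells n p s, of_cells n p y)) =
                (\<integral>\<^sup>+ M. F ((of_cells n p s, of_cells n p y), add_atoms p s y M) * q_product q p card s y M \<partial>L)"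
              by (rule T[OF s' y' Fm ties_of_cells[OF p inj, symmetric] c2 c])
            then show "(\<integral>\<^sup>+ M. F ((of_cells n p s, of_cells n p y), add_atoms p s y M) * weight p card s y M \<partial>L) =
              (\<integral>\<^sup>+ x. F ((of_cells n p s, of_cells n p y), x) \<partial>T (of_cells n p s, of_cells n p y)) * (\<Prod>C\<in>p. ennreal (s C) ^ card C)"
              using nn_integral_weight[OF s y measurable_compose[OF add_atoms_measurable_M[OF s y] Fm]] by simp
          qed
        qed
      qed
      finally show ?thesis .
    qed
    show "space ?JY \<in> sets ?JY" by simp
    show "AE \<omega> in \<Omega>. (J \<omega>, Y \<omega>) \<in> space ?JY" by (rule AE_I2) (rule measurable_space[OF JY])
  next
    fix z assume "z \<in> space ?JY"
    then obtain j y where z: "z = (j, y)" and j: "j \<in> space (PiM {1..n} (\<lambda>_. Jumps))" and y: "y \<in> space (PiM {1..n} (\<lambda>_. borel))"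
      by (auto simp: space_pair_measure)
    show "sets (case z of (j, y) \<Rightarrow> N_star_law n d q L j y) = sets R" by (simp add: z N_star_law_def)
    fix B assume B: "B \<in> sets R"
    have s: "restrict (on_cells j) (ties n y) \<in> space (PiM (ties n y) (\<lambda>_. Jumps))"
      by (rule measurable_space[OF measurable_on_cells[OF ties_partition] j])
    have "emeasure (T z) (space R) = phi q L (ties n y) card (restrict (on_cells j) (ties n y)) (restrict (on_cells y) (ties n y))"
      unfolding z T_B[OF j y sets.top refl refl refl] phi_def
      using measurable_space[OF add_atoms_measurable_M[OF s c_space[OF y]]]
      by (intro nn_integral_cong) simp
    then show "emeasure (case z of (j, y) \<Rightarrow> N_star_law n d q L j y) B = emeasure (T z) B / emeasure (T z) (space R)"
      unfolding z prod.case using emeasure_N_star_law[OF y j B] T_B[OF j y B refl refl refl] by simp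
  qed
qed

end

end

section \<open>The marginal law of the sample\<close>

context species_model begin

lemma marginal_density_regular:
  assumes "\<forall>i\<in>I. r (y i) = \<rho> (y i)"
  shows "marginal_density q L \<rho> I e y = marginal_density q L r I e y"
proof -
  have "PiM I (\<lambda>i. \<rho> (y i)) = PiM I (\<lambda>i. r (y i))"
    using assms by (intro PiM_cong) auto
  then show ?thesis by (simp add: marginal_density_def)
qed

lemma measurable_phi_jump_power:
  assumes "y \<in> space (PiM I (\<lambda>_. borel))"
  shows "(\<lambda>s. phi q L I e s y * (\<Prod>j\<in>I. ennreal (s j) ^ e j)) \<in> borel_measurable (PiM I (\<lambda>_. Jumps))"
  using assms by (intro borel_measurable_times_ennreal measurable_phi measurable_jump_power measurable_const measurable_ident_sets refl)

lemma measurable_marginal_density: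
  assumes I: "finite I"
  shows "marginal_density q L r I e \<in> borel_measurable (PiM I (\<lambda>_. borel))"
  unfolding marginal_density_def
proof (rule measurable_nn_integral_PiM_sigma_kernel[OF I])
  show "sigma_kernel (PiM I (\<lambda>_. borel)) Jumps (\<lambda>y. r (y i))" if "i \<in> I" for i
    using sigma_kernel_compose[OF measurable_component_singleton[OF that, of "\<lambda>_. borel"] r] .
  have "(\<lambda>x. phi q L I e (snd x) (fst x) * (\<Prod>j\<in>I. ennreal (snd x j) ^ e j)) \<in>
      borel_measurable (PiM I (\<lambda>_. borel) \<Otimes>\<^sub>M PiM I (\<lambda>_. Jumps))"
    by (intro borel_measurable_times_ennreal measurable_phi measurable_jump_power measurable_fst measurable_snd)
  then show "(\<lambda>(y, s). phi q L I e s y * (\<Prod>j\<in>I. ennreal (s j) ^ e j)) \<in>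
      borel_measurable (PiM I (\<lambda>_. borel) \<Otimes>\<^sub>M PiM I (\<lambda>_. Jumps))"
    by (simp only: split_beta')
qed

text \<open>Integrating out \<open>M\<close> gives \<open>phi\<close>, integrating out the jumps
  gives the density, and \<open>r\<close> is exchanged for \<rho> at almost all cell values.\<close>

theorem sample_marginal:
  assumes iid: "conditional_law \<Omega> Y (\<Pi>\<^sub>M i\<in>{1..n}. borel) N R (\<lambda>M. \<Pi>\<^sub>M i\<in>{1..n}. P_of q (mean_rm M))"
    and g: "g \<in> borel_measurable (\<Pi>\<^sub>M i\<in>{1..n}. borel)"
  shows "(\<integral>\<^sup>+ y. g y \<partial>distr \<Omega> (\<Pi>\<^sub>M i\<in>{1..n}. borel) Y) =
    (\<Sum>p | partition_on {1..n} p. \<integral>\<^sup>+ y. g (of_cells n p y) * marginal_density q L \<rho> p card y \<partial>(\<Pi>\<^sub>M C\<in>p. \<eta>))"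
proof -
  have Y: "Y \<in> measurable \<Omega> (PiM {1..n} (\<lambda>_. borel))"
    using iid by (auto simp: conditional_law_def regular_conditional_law_def)
  have F: "(\<lambda>(y, M). g y) \<in> borel_measurable ((\<Pi>\<^sub>M i\<in>{1..n}. borel) \<Otimes>\<^sub>M R)"
    unfolding split_beta' by (rule measurable_compose[OF measurable_fst g])
  have "(\<integral>\<^sup>+ y. g y \<partial>distr \<Omega> (\<Pi>\<^sub>M i\<in>{1..n}. borel) Y) = (\<integral>\<^sup>+ \<omega>. g (Y \<omega>) \<partial>\<Omega>)"
    using Y g by (simp add: nn_integral_distr)
  also have "\<dots> = joint_integral n (\<lambda>s y M. g y)"
    by (rule sample_joint[OF iid F])
  also have "\<dots> = (\<Sum>p | partition_on {1..n} p. \<integral>\<^sup>+ y. g (of_cells n p y) * marginal_density q L \<rho> p card y \<partial>(\<Pi>\<^sub>M C\<in>p. \<eta>))"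
    unfolding joint_integral_def
  proof (intro sum.cong refl nn_integral_cong_AE)
    fix p assume "p \<in> {p. partition_on {1..n} p}"
    then have fin: "finite p" using partition_on_finite by blast
    have "AE y in PiM p (\<lambda>_. \<eta>). y \<in> space (PiM p (\<lambda>_. borel))"
      by (rule AE_I2) (simp add: sets_eq_imp_space_eq[OF sets_PiM_\<eta>])
    with AE_r_cells[OF fin]
    show "AE y in PiM p (\<lambda>_. \<eta>). (\<integral>\<^sup>+ s. (\<integral>\<^sup>+ M. g (of_cells n p y) * weight p card s y M \<partial>L) \<partial>PiM p (\<lambda>C. r (y C))) =
        g (of_cells n p y) * marginal_density q L \<rho> p card y"
    proof eventually_elim
      fix y :: "nat set \<Rightarrow> 'y" assume reg: "\<forall>C\<in>p. r (y C) = \<rho> (y C)" and y: "y \<in> space (PiM p (\<lambda>_. borel))"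
      show "(\<integral>\<^sup>+ s. (\<integral>\<^sup>+ M. g (of_cells n p y) * weight p card s y M \<partial>L) \<partial>PiM p (\<lambda>C. r (y C))) =
          g (of_cells n p y) * marginal_density q L \<rho> p card y"
        unfolding nn_integral_weight_phi[OF y] marginal_density_regular[OF reg]
        unfolding marginal_density_def using measurable_phi_jump_power[OF y, of card]
        by (intro nn_integral_cmult) (simp only: measurable_cong_sets[OF sets_PiM_r refl])
    qed
  qed
  finally show ?thesis .
qed

section \<open>Relabelling of cells, the EPPF and exchangeability\<close>

lemma phi_reindex:
  assumes h: "bij_betw h I I'"
  shows "phi q L I (\<lambda>j. e (h j)) (\<lambda>j\<in>I. s (h j)) (\<lambda>j\<in>I. y (h j)) = phi q L I' e s y"
  unfolding phi_def
proof (intro nn_integral_cong)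
  fix M
  have "add_atoms I (\<lambda>j\<in>I. s (h j)) (\<lambda>j\<in>I. y (h j)) M = add_atoms I (\<lambda>j. s (h j)) (\<lambda>j. y (h j)) M"
    by (rule add_atoms_cong) auto
  also have "\<dots> = add_atoms I' s y M" by (rule add_atoms_reindex[OF h])
  finally have "q_product q I (\<lambda>j. e (h j)) (\<lambda>j\<in>I. s (h j)) (\<lambda>j\<in>I. y (h j)) M =
      (\<Prod>j\<in>I. q_at q (y (h j)) (mean_rm (add_atoms I' s y M)) ^ e (h j))"
    by (simp add: q_product_def)
  also have "\<dots> = q_product q I' e s y M"
    unfolding q_product_def by (rule prod.reindex_bij_betw[OF h])
  finally show "q_product q I (\<lambda>j. e (h j)) (\<lambda>j\<in>I. s (h j)) (\<lambda>j\<in>I. y (h j)) M = q_product q I' e s y M" .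
qed

text \<open>Formulated for \<open>r\<close>, because reindexing the product of jump measures calls
  for \<sigma>-finite factors at every location; \<open>eppf_regular\<close> carries the result over
  to \<rho>.\<close>

lemma marginal_density_reindex:
  assumes h: "bij_betw h I I'" and I: "finite I" and y: "y \<in> space (PiM I' (\<lambda>_. borel))"
  shows "marginal_density q L r I (\<lambda>j. e (h j)) (\<lambda>j\<in>I. y (h j)) = marginal_density q L r I' e y"
proof -
  have y': "(\<lambda>j\<in>I. y (h j)) \<in> space (PiM I (\<lambda>_. borel))" by (auto simp: space_PiM)
  have P: "PiM I (\<lambda>j. r ((\<lambda>j\<in>I. y (h j)) j)) = PiM I (\<lambda>j. r (y (h j)))" by (intro PiM_cong) auto
  have m: "(\<lambda>s. phi q L I (\<lambda>j. e (h j)) s (\<lambda>j\<in>I. y (h j)) * (\<Prod>j\<in>I. ennreal (s j) ^ e (h j)))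
      \<in> borel_measurable (PiM I (\<lambda>j. r (y (h j))))"
    using measurable_phi_jump_power[OF y', of "\<lambda>j. e (h j)"]
    unfolding measurable_cong_sets[OF sets_PiM_r[where y="\<lambda>j. y (h j)"] refl] .
  have "marginal_density q L r I (\<lambda>j. e (h j)) (\<lambda>j\<in>I. y (h j)) =
      (\<integral>\<^sup>+ s. phi q L I (\<lambda>j. e (h j)) (\<lambda>j\<in>I. s (h j)) (\<lambda>j\<in>I. y (h j)) *
        (\<Prod>j\<in>I. ennreal ((\<lambda>j\<in>I. s (h j)) j) ^ e (h j)) \<partial>PiM I' (\<lambda>j. r (y j)))"
    unfolding marginal_density_def P
    by (rule nn_integral_PiM_reindex[where M="\<lambda>j. r (y j)", OF r_sigma_finite h I m])
  also have "\<dots> = marginal_density q L r I' e y"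
    unfolding marginal_density_def
  proof (intro nn_integral_cong arg_cong2[where f="(*)"] phi_reindex[OF h])
    fix s
    have "(\<Prod>j\<in>I. ennreal ((\<lambda>j\<in>I. s (h j)) j) ^ e (h j)) = (\<Prod>j\<in>I. ennreal (s (h j)) ^ e (h j))"
      by (intro prod.cong) auto
    also have "\<dots> = (\<Prod>j\<in>I'. ennreal (s j) ^ e j)" by (rule prod.reindex_bij_betw[OF h])
    finally show "(\<Prod>j\<in>I. ennreal ((\<lambda>j\<in>I. s (h j)) j) ^ e (h j)) = (\<Prod>j\<in>I'. ennreal (s j) ^ e j)" .
  qed
  finally show ?thesis .
qed

lemma eppf_regular:
  assumes "finite I"
  shows "eppf q L \<rho> \<eta> I e = (\<integral>\<^sup>+ y. marginal_density q L r I e y \<partial>PiM I (\<lambda>_. \<eta>))"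
  unfolding eppf_def
  using AE_r_cells[OF assms] by (intro nn_integral_cong_AE) (auto elim!: eventually_mono intro: marginal_density_regular)

text \<open>The partition sum indexes coordinates by cells, the EPPF by \<open>{1..k}\<close>. Every
  numbering of the cells gives the same value; in particular the EPPF is symmetric in the cell
  sizes.\<close>

lemma eppf_reindex:
  assumes h: "bij_betw h I I'" and I: "finite I"
  shows "eppf q L \<rho> \<eta> I (\<lambda>j. e (h j)) = eppf q L \<rho> \<eta> I' e"
proof -
  have I': "finite I'" using h I bij_betw_finite by blast
  have m: "marginal_density q L r I (\<lambda>j. e (h j)) \<in> borel_measurable (PiM I (\<lambda>_. \<eta>))"
    unfolding measurable_cong_sets[OF sets_PiM_\<eta> refl] by (rule measurable_marginal_density[OF I])
  have "eppf q L \<rho> \<eta> I (\<lambda>j. e (h j)) = (\<integral>\<^sup>+ y. marginal_density q L r I (\<lambda>j. e (h j)) y \<partial>PiM I (\<lambda>_. \<eta>))"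
    by (rule eppf_regular[OF I])
  also have "\<dots> = (\<integral>\<^sup>+ y. marginal_density q L r I (\<lambda>j. e (h j)) (\<lambda>j\<in>I. y (h j)) \<partial>PiM I' (\<lambda>_. \<eta>))"
    by (rule nn_integral_PiM_reindex[where M="\<lambda>_. \<eta>", OF eta(2) h I m])
  also have "\<dots> = (\<integral>\<^sup>+ y. marginal_density q L r I' e y \<partial>PiM I' (\<lambda>_. \<eta>))"
    by (intro nn_integral_cong marginal_density_reindex[OF h I])
       (simp add: sets_eq_imp_space_eq[OF sets_PiM_\<eta>])
  also have "\<dots> = eppf q L \<rho> \<eta> I' e" by (rule eppf_regular[OF I', symmetric])
  finally show ?thesis .
qed

text \<open>The marginal formula is applied to the indicator of the event. In the term of
  \<open>p'\<close> the cell values are almost everywhere distinct, so the ties are exactly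
  \<open>p'\<close> and only \<open>p' = p\<close> contributes.\<close>

theorem sample_eppf:
  assumes iid: "conditional_law \<Omega> Y (\<Pi>\<^sub>M i\<in>{1..n}. borel) N R (\<lambda>M. \<Pi>\<^sub>M i\<in>{1..n}. P_of q (mean_rm M))"
    and p: "partition_on {1..n} p" and C: "bij_betw C {1..k} p"
  shows "emeasure \<Omega> {\<omega> \<in> space \<Omega>. ties n (Y \<omega>) = p} = eppf q L \<rho> \<eta> {1..k::nat} (\<lambda>j. card (C j))"
proof -
  let ?S = "{y \<in> space (PiM {1..n} (\<lambda>_. borel :: 'y measure)). ties n y = p}"
  have Y: "Y \<in> measurable \<Omega> (PiM {1..n} (\<lambda>_. borel))"
    using iid by (auto simp: conditional_law_def regular_conditional_law_def)
  have S: "?S \<in> sets (PiM {1..n} (\<lambda>_. borel))" by (rule measurable_ties[OF p])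
  have finP: "finite {p. partition_on {1..n} p}" by (rule finitely_many_partition_on) simp
  have "{\<omega> \<in> space \<Omega>. ties n (Y \<omega>) = p} = Y -` ?S \<inter> space \<Omega>"
    using measurable_space[OF Y] by auto
  then have "emeasure \<Omega> {\<omega> \<in> space \<Omega>. ties n (Y \<omega>) = p} = (\<integral>\<^sup>+ y. indicator ?S y \<partial>distr \<Omega> (\<Pi>\<^sub>M i\<in>{1..n}. borel) Y)"
    using S Y by (simp add: emeasure_distr)
  also have "\<dots> = (\<Sum>p' | partition_on {1..n} p'. \<integral>\<^sup>+ y. indicator ?S (of_cells n p' y) * marginal_density q L \<rho> p' card y \<partial>(\<Pi>\<^sub>M C\<in>p'. \<eta>))"
    by (rule sample_marginal[OF iid borel_measurable_indicator[OF S]])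
  also have "\<dots> = (\<Sum>p' | partition_on {1..n} p'. if p' = p then eppf q L \<rho> \<eta> p card else 0)"
  proof (intro sum.cong refl)
    fix p' assume "p' \<in> {p. partition_on {1..n} p}"
    then have p': "partition_on {1..n} p'" by simp
    have fin: "finite p'" using partition_on_finite[OF _ p'] by simp
    have "AE y in PiM p' (\<lambda>_. \<eta>). y \<in> space (PiM p' (\<lambda>_. borel))"
      by (rule AE_I2) (simp add: sets_eq_imp_space_eq[OF sets_PiM_\<eta>])
    with AE_inj_on[OF fin]
    have "AE y in PiM p' (\<lambda>_. \<eta>). indicator ?S (of_cells n p' y) = (if p' = p then 1 else 0 :: ennreal)"
    proof eventually_elim
      fix y :: "nat set \<Rightarrow> 'y" assume inj: "inj_on y p'" and y: "y \<in> space (PiM p' (\<lambda>_. borel))"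
      show "indicator ?S (of_cells n p' y) = (if p' = p then 1 else 0 :: ennreal)"
        using measurable_space[OF measurable_of_cells[OF p'] y] ties_of_cells[OF p' inj]
        by (auto simp: indicator_def)
    qed
    then have "(\<integral>\<^sup>+ y. indicator ?S (of_cells n p' y) * marginal_density q L \<rho> p' card y \<partial>(\<Pi>\<^sub>M C\<in>p'. \<eta>)) =
        (\<integral>\<^sup>+ y. (if p' = p then 1 else 0) * marginal_density q L \<rho> p' card y \<partial>(\<Pi>\<^sub>M C\<in>p'. \<eta>))"
      by (intro nn_integral_cong_AE) (erule eventually_mono, simp only:)
    also have "\<dots> = (if p' = p then eppf q L \<rho> \<eta> p card else 0)"
      by (simp add: eppf_def)
    finally show "(\<integral>\<^sup>+ y. indicator ?S (of_cells n p' y) * marginal_density q L \<rho> p' card y \<partial>(\<Pi>\<^sub>M C\<in>p'. \<eta>)) =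
        (if p' = p then eppf q L \<rho> \<eta> p card else 0)" .
  qed
  also have "\<dots> = eppf q L \<rho> \<eta> p card" using finP p by (simp add: sum.delta')
  also have "\<dots> = eppf q L \<rho> \<eta> {1..k} (\<lambda>j. card (C j))"
    by (rule eppf_reindex[OF C, symmetric]) simp
  finally show ?thesis .
qed

text \<open>A consequence of conditional independence rather than of the marginal formula: given N,
  the sample is distributed as a product with equal factors, which any relabelling of the
  coordinates leaves invariant.\<close>

theorem sample_exchangeable:
  fixes n :: nat
  assumes iid: "conditional_law \<Omega> Y (\<Pi>\<^sub>M i\<in>{1..n}. borel) N R (\<lambda>M. \<Pi>\<^sub>M i\<in>{1..n}. P_of q (mean_rm M))"
    and \<sigma>: "\<sigma> permutes {1..n}"
  shows "distr \<Omega> (\<Pi>\<^sub>M i\<in>{1..n}. borel) (\<lambda>\<omega>. \<lambda>i\<in>{1..n}. Y \<omega> (\<sigma> i)) = distr \<Omega> (\<Pi>\<^sub>M i\<in>{1..n}. borel) Y"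
proof (rule measure_eqI)
  let ?B = "\<Pi>\<^sub>M i\<in>{1..n}. (borel :: 'y measure)"
  fix A assume "A \<in> sets (distr \<Omega> ?B (\<lambda>\<omega>. \<lambda>i\<in>{1..n}. Y \<omega> (\<sigma> i)))"
  then have A: "A \<in> sets ?B" by simp
  have Y: "Y \<in> measurable \<Omega> ?B"
    using iid by (auto simp: conditional_law_def regular_conditional_law_def)
  have S: "(\<lambda>y. \<lambda>i\<in>{1..n}. y (\<sigma> i)) \<in> measurable ?B ?B"
    using permutes_in_image[OF \<sigma>] by (intro measurable_restrict measurable_component_singleton) auto
  have law: "emeasure (distr \<Omega> ?B (\<lambda>\<omega>. T (Y \<omega>))) A = (\<integral>\<^sup>+ M. (\<integral>\<^sup>+ y. indicator A (T y) \<partial>(\<Pi>\<^sub>M i\<in>{1..n}. P_of q (mean_rm M))) \<partial>L)"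
    if T: "T \<in> measurable ?B ?B" for T
  proof -
    have "emeasure (distr \<Omega> ?B (\<lambda>\<omega>. T (Y \<omega>))) A = (\<integral>\<^sup>+ y. indicator A y \<partial>distr \<Omega> ?B (\<lambda>\<omega>. T (Y \<omega>)))"
      using A by simp
    also have "\<dots> = (\<integral>\<^sup>+ \<omega>. indicator A (T (Y \<omega>)) \<partial>\<Omega>)"
      using A by (intro nn_integral_distr[OF measurable_compose[OF Y T]] borel_measurable_indicator) simp
    also have "\<dots> = (\<integral>\<^sup>+ M. (\<integral>\<^sup>+ y. indicator A (T y) \<partial>(\<Pi>\<^sub>M i\<in>{1..n}. P_of q (mean_rm M))) \<partial>L)"
      using conditional_law_nn_integral[OF iid measurable_compose[OF measurable_snd measurable_compose[OF T borel_measurable_indicator[OF A]]]]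
      by simp
    finally show ?thesis .
  qed
  have "emeasure (distr \<Omega> ?B Y) A = (\<integral>\<^sup>+ M. (\<integral>\<^sup>+ y. indicator A y \<partial>(\<Pi>\<^sub>M i\<in>{1..n}. P_of q (mean_rm M))) \<partial>L)"
    using law[of "\<lambda>y. y"] by simp
  also have "\<dots> = (\<integral>\<^sup>+ M. (\<integral>\<^sup>+ y. indicator A (\<lambda>i\<in>{1..n}. y (\<sigma> i)) \<partial>(\<Pi>\<^sub>M i\<in>{1..n}. P_of q (mean_rm M))) \<partial>L)"
  proof (intro nn_integral_cong_AE)
    have "AE M in L. M \<in> space R" by (rule AE_I2) simp
    with AE_P_aug show "AE M in L. (\<integral>\<^sup>+ y. indicator A y \<partial>(\<Pi>\<^sub>M i\<in>{1..n}. P_of q (mean_rm M))) =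
        (\<integral>\<^sup>+ y. indicator A (\<lambda>i\<in>{1..n}. y (\<sigma> i)) \<partial>(\<Pi>\<^sub>M i\<in>{1..n}. P_of q (mean_rm M)))"
    proof eventually_elim
      fix M assume P: "prob_space (P_aug q M)" and M: "M \<in> space R"
      have sets_aug: "sets (P_aug q M) = sets Marked" by (simp add: P_aug_def space_R_D[OF M])
      have snd: "snd \<in> measurable (P_aug q M) borel"
        unfolding measurable_cong_sets[OF sets_aug refl] by (rule measurable_snd)
      have sf: "sigma_finite_measure (P_of q (mean_rm M))"
        unfolding P_of_mean_rm[OF q_meas space_R_D(1)[OF M]]
        by (rule prob_space_imp_sigma_finite[OF prob_space.prob_space_distr[OF P snd]])
      have "sets (\<Pi>\<^sub>M i\<in>{1..n}. P_of q (mean_rm M)) = sets ?B" by (intro sets_PiM_cong) simp_all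
      then have m: "(indicator A :: _ \<Rightarrow> ennreal) \<in> borel_measurable (\<Pi>\<^sub>M i\<in>{1..n}. P_of q (mean_rm M))"
        using A by (intro borel_measurable_indicator) simp
      show "(\<integral>\<^sup>+ y. indicator A y \<partial>(\<Pi>\<^sub>M i\<in>{1..n}. P_of q (mean_rm M))) =
        (\<integral>\<^sup>+ y. indicator A (\<lambda>i\<in>{1..n}. y (\<sigma> i)) \<partial>(\<Pi>\<^sub>M i\<in>{1..n}. P_of q (mean_rm M)))"
        by (rule nn_integral_PiM_reindex[where M="\<lambda>_. P_of q (mean_rm M)", OF sf permutes_imp_bij[OF \<sigma>] _ m]) simp
    qed
  qed
  also have "\<dots> = emeasure (distr \<Omega> ?B (\<lambda>\<omega>. \<lambda>i\<in>{1..n}. Y \<omega> (\<sigma> i))) A"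
    by (rule law[OF S, symmetric])
  finally show "emeasure (distr \<Omega> ?B (\<lambda>\<omega>. \<lambda>i\<in>{1..n}. Y \<omega> (\<sigma> i))) A = emeasure (distr \<Omega> ?B Y) A" by simp
qed simp

end

theorem theorem3p2:
  fixes \<Omega> :: "'o measure"
    and \<eta> :: "'y::polish_space measure"
    and \<rho> :: "'y \<Rightarrow> real measure"
    and d :: "(real \<times> 'y) metric"
    and \<nu> :: "(real \<times> 'y) measure"
    and N :: "'o \<Rightarrow> (real \<times> 'y) measure"
    and L :: "(real \<times> 'y) measure measure"
    and q :: "'y \<Rightarrow> 'y measure \<Rightarrow> real"
    and n :: nat
    and Y :: "nat \<Rightarrow> 'o \<Rightarrow> 'y"
    and J :: "nat \<Rightarrow> 'o \<Rightarrow> real"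
  assumes eta: "sets \<eta> = sets borel" "sigma_finite_measure \<eta>" "nonatomic \<eta>"
    and rho: "\<rho> \<in> measurable borel (measure_algebra Jumps)"
    and rho_eta: "\<And>B. B \<in> sets borel \<Longrightarrow> bounded B \<Longrightarrow>
        (\<integral>\<^sup>+ y. (\<integral>\<^sup>+ s. ennreal (min s 1) \<partial>\<rho> y) * indicator B y \<partial>\<eta>) < \<infinity>"
    and nu: "\<nu> = intensity \<rho> \<eta>"
    and metric: "mspace d = {0<..} \<times> UNIV" "mcomplete_of d"
        "mtopology_of d = top_of_set ({0<..} \<times> UNIV)"
    and nu_bounded: "boundedly_finite Marked (bounded_in d) \<nu>"
    and N: "poisson_random_measure \<Omega> Marked (bounded_in d) \<nu> N"
    and L: "L = distr \<Omega> (RM d) N"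
    and q_meas: "(\<lambda>(y, m). q y m)
        \<in> borel_measurable (borel \<Otimes>\<^sub>M boundedly_finite_measures borel bounded)"
    and q_pos: "\<And>y m. boundedly_finite borel bounded m \<Longrightarrow> 0 < q y m"
    and P_prob: "AE \<omega> in \<Omega>. prob_space (P_of q (mean_rm (N \<omega>)))"
    and n: "1 \<le> n"
    and Y_meas: "\<And>i. i \<in> {1..n} \<Longrightarrow> Y i \<in> measurable \<Omega> borel"
    and Y_iid: "conditional_law \<Omega> (rvec n Y) (\<Pi>\<^sub>M i\<in>{1..n}. borel) N (RM d)
        (\<lambda>M. \<Pi>\<^sub>M i\<in>{1..n}. P_of q (mean_rm M))"
  shows
    \<comment> \<open>(i) posterior of \<open>N\<close>, and the representation through the latent vector\<close>
    "conditional_law \<Omega> N (RM d) (rvec n Y) (\<Pi>\<^sub>M i\<in>{1..n}. borel)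
        (N_star_posterior n d q L \<rho>)
     \<and>
     (conditional_law \<Omega> (rvec n (\<lambda>i \<omega>. (J i \<omega>, Y i \<omega>))) (\<Pi>\<^sub>M i\<in>{1..n}. Marked) N (RM d)
        (\<lambda>M. \<Pi>\<^sub>M i\<in>{1..n}. P_aug q M)
      \<longrightarrow>
        conditional_law \<Omega> N (RM d)
          (\<lambda>\<omega>. (rvec n J \<omega>, rvec n Y \<omega>)) ((\<Pi>\<^sub>M i\<in>{1..n}. Jumps) \<Otimes>\<^sub>M (\<Pi>\<^sub>M i\<in>{1..n}. borel))
          (\<lambda>(j, y). N_star_law n d q L j y)
        \<and>
        conditional_law \<Omega> (rvec n J) (\<Pi>\<^sub>M i\<in>{1..n}. Jumps)
          (rvec n Y) (\<Pi>\<^sub>M i\<in>{1..n}. borel) (J_law n q L \<rho>))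
     \<and>
     conditional_law \<Omega> (\<lambda>\<omega>. mean_rm (N \<omega>)) (measure_algebra borel)
        (rvec n Y) (\<Pi>\<^sub>M i\<in>{1..n}. borel)
        (\<lambda>y. distr (N_star_posterior n d q L \<rho> y) (measure_algebra borel) mean_rm)
     \<and>
     \<comment> \<open>(ii) posterior of \<open>P\<^sub>\<mu>\<close>\<close>
     conditional_law \<Omega> (\<lambda>\<omega>. P_of q (mean_rm (N \<omega>))) (measure_algebra borel)
        (rvec n Y) (\<Pi>\<^sub>M i\<in>{1..n}. borel)
        (\<lambda>y. distr (N_star_posterior n d q L \<rho> y) (measure_algebra borel)
               (\<lambda>M. P_of q (mean_rm M)))
     \<and>
     \<comment> \<open>(iii) exchangeable marginal law of \<open>Y\<close>, and the EPPF\<close>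
     (\<forall>\<sigma>. \<sigma> permutes {1..n} \<longrightarrow>
        distr \<Omega> (\<Pi>\<^sub>M i\<in>{1..n}. borel) (rvec n (\<lambda>i. Y (\<sigma> i))) =
        distr \<Omega> (\<Pi>\<^sub>M i\<in>{1..n}. borel) (rvec n Y))
     \<and>
     (\<forall>g :: (nat \<Rightarrow> 'y) \<Rightarrow> ennreal. g \<in> borel_measurable (\<Pi>\<^sub>M i\<in>{1..n}. borel) \<longrightarrow>
        (\<integral>\<^sup>+ y. g y \<partial>distr \<Omega> (\<Pi>\<^sub>M i\<in>{1..n}. borel) (rvec n Y)) =
        (\<Sum>p | partition_on {1..n} p.
           \<integral>\<^sup>+ y. g (of_cells n p y) * marginal_density q L \<rho> p card y \<partial>(\<Pi>\<^sub>M C\<in>p. \<eta>)))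
     \<and>
     (\<forall>p k (C :: nat \<Rightarrow> nat set). partition_on {1..n} p \<and> bij_betw C {1..k} p \<longrightarrow>
        emeasure \<Omega> {\<omega> \<in> space \<Omega>. ties n (rvec n Y \<omega>) = p} =
        eppf q L \<rho> \<eta> {1..k} (\<lambda>j. card (C j)))"
proof -
  interpret species_model \<Omega> \<eta> \<rho> d \<nu> N q
    using eta rho rho_eta nu metric(1,3) nu_bounded N q_meas P_prob by (intro species_model.intro)
  have mean: "mean_rm \<in> measurable (RM d) (measure_algebra borel)"
    by (rule measurable_compose[OF measurable_ident_boundedly_finite_measures measurable_mean_rm])
  have P: "(\<lambda>M. P_of q (mean_rm M)) \<in> measurable (RM d) (measure_algebra borel)"
    by (rule measurable_compose[OF mean measurable_P_of[OF q_meas]])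
  have post: "conditional_law \<Omega> N (RM d) (rvec n Y) (\<Pi>\<^sub>M i\<in>{1..n}. borel) (N_star_posterior n d q L \<rho>)"
    unfolding L by (rule N_given_sample[OF Y_iid])
  \<comment> \<open>A vector with the augmented law is assumed in this statement only;
    \<open>post\<close> was obtained from the conditional law of Y alone.\<close>
  have latent: "conditional_law \<Omega> N (RM d)
        (\<lambda>\<omega>. (rvec n J \<omega>, rvec n Y \<omega>)) ((\<Pi>\<^sub>M i\<in>{1..n}. Jumps) \<Otimes>\<^sub>M (\<Pi>\<^sub>M i\<in>{1..n}. borel))
        (\<lambda>(j, y). N_star_law n d q L j y) \<and>
      conditional_law \<Omega> (rvec n J) (\<Pi>\<^sub>M i\<in>{1..n}. Jumps)
        (rvec n Y) (\<Pi>\<^sub>M i\<in>{1..n}. borel) (J_law n q L \<rho>)"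
    if aug: "conditional_law \<Omega> (rvec n (\<lambda>i \<omega>. (J i \<omega>, Y i \<omega>))) (\<Pi>\<^sub>M i\<in>{1..n}. Marked) N (RM d)
        (\<lambda>M. \<Pi>\<^sub>M i\<in>{1..n}. P_aug q M)"
  proof -
    have "rvec n J \<omega> = (\<lambda>i\<in>{1..n}. fst (rvec n (\<lambda>i \<omega>. (J i \<omega>, Y i \<omega>)) \<omega> i))"
      "rvec n Y \<omega> = (\<lambda>i\<in>{1..n}. snd (rvec n (\<lambda>i \<omega>. (J i \<omega>, Y i \<omega>)) \<omega> i))" for \<omega>
      unfolding rvec_def by (rule restrict_ext, simp)+
    from N_given_jumps_sample[OF aug this] J_given_sample[OF aug this] show ?thesis
      unfolding L by blast
  qed
  have exch: "distr \<Omega> (\<Pi>\<^sub>M i\<in>{1..n}. borel) (rvec n (\<lambda>i. Y (\<sigma> i))) = distr \<Omega> (\<Pi>\<^sub>M i\<in>{1..n}. borel) (rvec n Y)"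
    if \<sigma>: "\<sigma> permutes {1..n}" for \<sigma>
  proof -
    have "rvec n (\<lambda>i. Y (\<sigma> i)) = (\<lambda>\<omega>. \<lambda>i\<in>{1..n}. rvec n Y \<omega> (\<sigma> i))"
      unfolding rvec_def using permutes_in_image[OF \<sigma>] by (intro ext restrict_ext) (simp del: atLeastAtMost_iff)
    then show ?thesis using sample_exchangeable[OF Y_iid \<sigma>] by simp
  qed
  show ?thesis
  proof (intro conjI allI impI)
    show "conditional_law \<Omega> (\<lambda>\<omega>. mean_rm (N \<omega>)) (measure_algebra borel) (rvec n Y) (\<Pi>\<^sub>M i\<in>{1..n}. borel)
        (\<lambda>y. distr (N_star_posterior n d q L \<rho> y) (measure_algebra borel) mean_rm)"
      by (rule conditional_law_distr[OF post mean])
    show "conditional_law \<Omega> (\<lambda>\<omega>. P_of q (mean_rm (N \<omega>))) (measure_algebra borel) (rvec n Y) (\<Pi>\<^sub>M i\<in>{1..n}. borel)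
        (\<lambda>y. distr (N_star_posterior n d q L \<rho> y) (measure_algebra borel) (\<lambda>M. P_of q (mean_rm M)))"
      by (rule conditional_law_distr[OF post P])
  qed (use post latent exch sample_marginal[OF Y_iid] sample_eppf[OF Y_iid] in \<open>simp_all only: L simp_thms\<close>)
qed

end
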